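(* Let $\mathcal{G}^\nu$ be a $\nu$-graph satisfying the standing assumptions below, with fixed metrizable node set $\mathcal{M}$, and let rad and diam be its radius and diameter. (i) If rad is an ordinal, then $\mathrm{rad}\le\mathrm{diam}\le\mathrm{rad}\cdot 2$. (ii) If rad is an arrow rank, then $\mathrm{rad}\le\mathrm{diam}\le\mathrm{rad}^{+}\cdot 2$, where $\mathrm{rad}^+$ is the limit ordinal immediately following rad.
   Context: Transfinite graphs are in the sense of Zemanian (Transfinite Graphs and Electrical Networks). A $0$-graph is a conventional graph of branches and $0$-nodes; no self-loops, parallel branches allowed. A $0$-path is a finite, one-ended or endless alternating sequence of distinct $0$-nodes and branches; a $0$-tip is an equivalence class of one-ended $0$-paths that eventually coincide. Recursively, a $\mu$-node shorts together tips of ranks $<\mu$ (at least one of rank $\mu-1$) and may embrace one node of lower rank; a $\mu$-path alternates $\mu$-nodes and $\alpha$-paths ($\alpha<\mu$) with no node met twice; $\mu$-tips are classes of one-ended $\mu$-paths; the arrow rank $\vec\omega$ is used for paths/tips built from paths of all finite ranks, and $\omega$-nodes contain $\vec\omega$-tips. "Node" means maximal node (not embraced by a higher-rank node). A singleton node contains only one tip. Two tips are nondisconnectable if representative one-ended paths meet arbitrarily far out. Standing assumptions: $1\le\nu\le\omega$, $\nu\ne\vec\omega$; $\mathcal{G}^\nu$ is $\nu$-connected (any two branches met by a two-ended path of rank $\le\nu$); Condition (C): nondisconnectable tips are either embraced by the same node or at least one is the sole member of a singleton node. Lengths (natural sums of ordinals): two-ended $0$-path: number of branches; one-ended (resp.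 endless) $\mu$-path: $\omega^{\mu+1}$ (resp. $\omega^{\mu+1}\cdot2$), with $\omega^{\omega}$, $\omega^\omega\cdot2$ for $\vec\omega$-paths; two-ended $\mu$-path: natural sum of lengths of its constituent lower-rank paths. $\mathcal{M}$ is a metrizable set: all nonsingleton nodes plus possibly singleton nodes such that appending end branches to all of them simultaneously preserves (C). $d(x,y)$ for $x\ne y$ in $\mathcal{M}$ is the minimum length of a two-ended path terminating at $x,y$; $d(x,x)=0$. Ranks: countable ordinals with an arrow rank $\vec\lambda$ inserted immediately before each nonzero limit ordinal $\lambda$ ($\alpha<\vec\lambda<\lambda$ for all ordinals $\alpha<\lambda$); for a bounded set $A$ of countable ordinals, $\sup A$ is its maximum if attained, otherwise $\vec\lambda$ with $\lambda$ the least ordinal exceeding all members of $A$. Eccentricity $e(x)=\sup\{d(x,y):y\in\mathcal{M}\}$; $\mathrm{rad}=\min\{e(x):x\in\mathcal{M}\}$; $\mathrm{diam}=\sup\{d(x,y):x,y\in\mathcal{M}\}$.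
   Formalization: The products rad·2 and rad⁺·2 are taken as natural sums rad⊕rad and rad⁺⊕rad⁺; with the ordinary ordinal product the bound fails, e.g. rad = ω+1, diam = ω·2+2 > (ω+1)·2 = ω·2+1. *)

theory Defs
  imports Main "HOL-Library.Countable_Set"
begin

unbundle cardinal_syntax

section \<open>Countable ordinals\<close>

text \<open>A countable ordinal is an isomorphism class of well-orders on sets of natural numbers.\<close>

quotient_type cord = "nat rel" / partial: "\<lambda>r s. Well_order r \<and> Well_order s \<and> r =o s"
proof (rule part_equivpI)
  show "\<exists>r :: nat rel. Well_order r \<and> Well_order r \<and> r =o r"
    by (rule exI[of _ "{}"]) (simp add: ordIso_reflexive)
  show "symp (\<lambda>r s :: nat rel. Well_order r \<and> Well_order s \<and> r =o s)"
    by (auto intro!: sympI intro: ordIso_symmetric)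
  show "transp (\<lambda>r s :: nat rel. Well_order r \<and> Well_order s \<and> r =o s)"
    by (auto intro!: transpI intro: ordIso_transitive)
qed

lemma cord_cases: obtains r where "Well_order r" "a = abs_cord r"
  using Quotient_abs_rep[OF Quotient_cord, of a] Quotient_rep_reflp[OF Quotient_cord, of a]
  by metis

instantiation cord :: linorder
begin

lift_definition less_eq_cord :: "cord \<Rightarrow> cord \<Rightarrow> bool" is "\<lambda>r s. r \<le>o s"
  using ordIso_iff_ordLeq ordLeq_transitive by blast

lift_definition less_cord :: "cord \<Rightarrow> cord \<Rightarrow> bool" is "\<lambda>r s. r <o s"
  using ordIso_ordLess_trans ordIso_symmetric ordLess_ordIso_trans by blast

instance
proof
  fix a b c :: cord
  show "a < b \<longleftrightarrow> a \<le> b \<and> \<not> b \<le> a"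
    by transfer (use not_ordLess_ordLeq ordLess_imp_ordLeq ordLess_or_ordLeq in blast)
  show "a \<le> a" by transfer (auto intro: ordLeq_reflexive)
  show "a \<le> b \<Longrightarrow> b \<le> c \<Longrightarrow> a \<le> c" by transfer (auto intro: ordLeq_transitive)
  show "a \<le> b \<Longrightarrow> b \<le> a \<Longrightarrow> a = b" by transfer (auto simp: ordIso_iff_ordLeq)
  show "a \<le> b \<or> b \<le> a" by transfer (auto simp: ordLeq_total)
qed

end

lemma less_abs_iff:
  "Well_order r \<Longrightarrow> Well_order s \<Longrightarrow> abs_cord r < abs_cord s \<longleftrightarrow> r <o s"
  by (rule less_cord.abs_eq) (auto intro: ordIso_reflexive)

lemmas less_abs = less_abs_iff[THEN iffD2, rotated 2]

instance cord :: wellorder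
proof
  fix P :: "cord \<Rightarrow> bool" and a
  assume step: "\<And>x. (\<And>y. y < x \<Longrightarrow> P y) \<Longrightarrow> P x"
  have "Well_order r \<longrightarrow> P (abs_cord r)" for r :: "nat rel"
  proof (induction r rule: wf_induct[OF wf_ordLess])
    case (1 r)
    show ?case
    proof
      assume r: "Well_order r"
      show "P (abs_cord r)"
      proof (rule step)
        fix y assume y: "y < abs_cord r"
        obtain s where s: "Well_order s" "y = abs_cord s"
          by (rule cord_cases)
        with y r have "s <o r" using less_abs_iff by blast
        with 1 s show "P y" by blast
      qed
    qed
  qed
  then show "P a"
    by (metis cord_cases)
qed


lemma countable_below: "countable {b :: cord. b < a}"
proof -
  obtain r where r: "Well_order r" "a = abs_cord r" by (rule cord_cases)
  have "{b. b < a} \<subseteq> (\<lambda>x. abs_cord (Restr r (underS r x))) ` Field r"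
  proof
    fix b assume "b \<in> {b. b < a}"
    moreover obtain s where s: "Well_order s" "b = abs_cord s" by (rule cord_cases)
    ultimately have "s <o r"
      using r less_abs_iff by blast
    then obtain x where x: "x \<in> Field r" "s =o Restr r (underS r x)"
      using ordLess_iff_ordIso_Restr[OF r(1) s(1)] by blast
    then have "b = abs_cord (Restr r (underS r x))"
      using s r Well_order_Restr by (auto intro: Quotient_rel_abs[OF Quotient_cord])
    with x show "b \<in> (\<lambda>x. abs_cord (Restr r (underS r x))) ` Field r" by blast
  qed
  then show ?thesis by (rule countable_subset) simp
qed

lemma uncountable_cord: "\<not> countable (UNIV :: cord set)"
proof
  assume "countable (UNIV :: cord set)"
  then obtain f :: "cord \<Rightarrow> nat" where f: "inj f" by (rule countableE)
  define r where "r = {(f x, f y) | x y :: cord. x \<le> y}"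
  have r_iff: "(f x, f y) \<in> r \<longleftrightarrow> x \<le> y" for x y
    unfolding r_def using f by (auto dest: injD)
  have fld: "Field r = range f" unfolding r_def Field_def by auto
  have r_rng: "u \<in> range f \<and> v \<in> range f" if "(u, v) \<in> r" for u v
    using that unfolding r_def by auto
  have wo: "Well_order r"
  proof -
    have "Refl r" by (auto simp: refl_on_def fld r_iff)
    moreover have "trans r"
    proof (rule transI)
      fix u v w assume "(u, v) \<in> r" "(v, w) \<in> r"
      moreover from this obtain x y z where "u = f x" "v = f y" "w = f z"
        using r_rng by blast
      ultimately show "(u, w) \<in> r" by (simp add: r_iff)
    qed
    moreover have "antisym r"
    proof (rule antisymI)
      fix u v assume "(u, v) \<in> r" "(v, u) \<in> r"
      moreover from this obtain x y where "u = f x" "v = f y"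
        using r_rng by blast
      ultimately show "u = v" by (simp add: r_iff)
    qed
    moreover have "Total r" by (auto simp: total_on_def fld r_iff)
    moreover have "wf (r - Id)"
    proof -
      have "r - Id \<subseteq> inv_image {(x, y). x < y} (inv f)"
        using f by (auto simp: r_def inv_image_def order_less_le)
      then show ?thesis by (rule wf_subset[OF wf_inv_image[OF wf]])
    qed
    moreover have "r \<subseteq> Field r \<times> Field r" by (auto simp: Field_def)
    ultimately show ?thesis
      by (simp add: well_order_on_def linear_order_on_def partial_order_on_def preorder_on_def)
  qed
  define h where "h x = abs_cord (Restr r (underS r (f x)))" for x
  have mono: "h x < h y" if "x < y" for x y
  proof -
    have "underS r (f x) \<subset> underS r (f y)"
    proof
      show "underS r (f x) \<subseteq> underS r (f y)"
      proof
        fix u assume u: "u \<in> underS r (f x)"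
        then obtain z where z: "u = f z" using r_rng by (auto simp: underS_def)
        with u that f show "u \<in> underS r (f y)"
          by (auto simp: underS_def r_iff inj_eq)
      qed
      have "f x \<in> underS r (f y)" "f x \<notin> underS r (f x)"
        using that f by (auto simp: underS_def r_iff dest: injD)
      then show "underS r (f x) \<noteq> underS r (f y)" by blast
    qed
    then have "Restr r (underS r (f x)) <o Restr r (underS r (f y))"
      using ofilter_subset_ordLess[OF wo] wo_rel.underS_ofilter[of r] wo
      unfolding wo_rel_def by blast
    then show ?thesis
      unfolding h_def by (rule less_abs) (use Well_order_Restr[OF wo] in blast)+
  qed
  have le: "x \<le> h x" for x
  proof (induction x rule: less_induct)
    case (less x)
    show ?case
    proof (rule ccontr)
      assume "\<not> x \<le> h x"
      then have "h x < x" by simp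
      then have "h x \<le> h (h x)" "h (h x) < h x" using less mono by blast+
      then show False by simp
    qed
  qed
  have "h x < abs_cord r" for x
    unfolding h_def
  proof (rule less_abs)
    show "Restr r (underS r (f x)) <o r"
      using underS_Restr_ordLess[OF wo] fld by blast
  qed (use Well_order_Restr[OF wo] wo in blast)+
  with le[of "abs_cord r"] show False by (metis leD)
qed

lemma countable_bounded:
  assumes "countable (A :: cord set)"
  shows "\<exists>c. \<forall>a\<in>A. a < c"
proof (rule ccontr)
  assume "\<not> ?thesis"
  then have "UNIV = (\<Union>a\<in>A. insert a {b. b < a})"
    by (auto simp: not_less order_le_less)
  moreover have "countable (\<Union>a\<in>A. insert a {b. b < a})"
    using assms countable_below by (intro countable_UN) auto
  ultimately have "countable (UNIV :: cord set)" by (rule ssubst)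
  then show False using uncountable_cord by simp
qed

text \<open>The natural (Hessenberg) sum, by its usual recursive characterisation.\<close>

function natsum :: "cord \<Rightarrow> cord \<Rightarrow> cord" (infixl \<open>\<oplus>\<close> 65) where
  "a \<oplus> b = (LEAST c. (\<forall>a'<a. a' \<oplus> b < c) \<and> (\<forall>b'<b. a \<oplus> b' < c))"
  by auto
termination
  by (relation "{(x, y). x < y} <*lex*> {(x, y). x < y}") (auto intro: wf)

declare natsum.simps [simp del]

lemma natsum_strict_mono: "a' < a \<Longrightarrow> a' \<oplus> b < a \<oplus> b" "b' < b \<Longrightarrow> a \<oplus> b' < a \<oplus> b"
proof -
  have "countable ((\<lambda>a'. a' \<oplus> b) ` {a'. a' < a} \<union> (\<lambda>b'. a \<oplus> b') ` {b'. b' < b})"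
    by (intro countable_Un countable_image countable_below)
  then obtain c where "\<forall>x\<in>(\<lambda>a'. a' \<oplus> b) ` {a'. a' < a} \<union> (\<lambda>b'. a \<oplus> b') ` {b'. b' < b}. x < c"
    using countable_bounded by blast
  then have "(\<forall>a'<a. a' \<oplus> b < c) \<and> (\<forall>b'<b. a \<oplus> b' < c)" by auto
  then have "(\<forall>a'<a. a' \<oplus> b < a \<oplus> b) \<and> (\<forall>b'<b. a \<oplus> b' < a \<oplus> b)"
    unfolding natsum.simps[of a b] by (rule LeastI)
  then show "a' < a \<Longrightarrow> a' \<oplus> b < a \<oplus> b" "b' < b \<Longrightarrow> a \<oplus> b' < a \<oplus> b" by auto
qed

instantiation cord :: "{zero, one}"
begin

definition zero_cord :: cord where "(0::cord) = (LEAST a. True)"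
definition one_cord :: cord where "(1::cord) = (LEAST a. 0 < a)"

instance ..

end

text \<open>
  The natural multiple $a \oplus \cdots \oplus a$. It agrees with the ordinary product for
  powers of $\omega$, but not in general: $(\omega + 1) \odot 2 = \omega \cdot 2 + 2$. As
  lengths are added by natural sums, all multiples below are natural ones.
\<close>

primrec nattimes :: "cord \<Rightarrow> nat \<Rightarrow> cord" (infixl \<open>\<odot>\<close> 70) where
  "a \<odot> 0 = 0"
| "a \<odot> Suc n = a \<odot> n \<oplus> a"

text \<open>The powers of $\omega$: $\omega^a$ is the least nonzero ordinal above all finite
  multiples of $\omega^b$ with $b < a$.\<close>

function omega_pow :: "cord \<Rightarrow> cord" where
  "omega_pow a = (LEAST c. 0 < c \<and> (\<forall>b<a. \<forall>n. omega_pow b \<odot> n < c))"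
  by auto
termination
  by (relation "{(x, y). x < y}") (auto intro: wf)

declare omega_pow.simps [simp del]

definition omega :: cord where "omega = omega_pow 1"


section \<open>Ranks of distances\<close>

text \<open>
  \<open>Arrow l\<close> is the arrow rank immediately before \<open>Ord l\<close>; it is a genuine rank only for a
  nonzero limit ordinal \<open>l\<close>, and \<open>rank_sup\<close> produces it only then.
\<close>

datatype rank = Ord cord | Arrow cord

instantiation rank :: linorder
begin

fun less_eq_rank :: "rank \<Rightarrow> rank \<Rightarrow> bool" where
  "Ord a \<le> Ord b \<longleftrightarrow> a \<le> b"
| "Arrow a \<le> Arrow b \<longleftrightarrow> a \<le> b"
| "Arrow a \<le> Ord b \<longleftrightarrow> a \<le> b"
| "Ord a \<le> Arrow b \<longleftrightarrow> a < b"

definition less_rank :: "rank \<Rightarrow> rank \<Rightarrow> bool" where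
  "r < s \<longleftrightarrow> r \<le> s \<and> \<not> s \<le> (r :: rank)"

instance
proof
  fix r s t :: rank
  show "r < s \<longleftrightarrow> r \<le> s \<and> \<not> s \<le> r" by (rule less_rank_def)
  show "r \<le> r" by (cases r) auto
  show "r \<le> s \<Longrightarrow> s \<le> t \<Longrightarrow> r \<le> t" by (cases r; cases s; cases t) auto
  show "r \<le> s \<Longrightarrow> s \<le> r \<Longrightarrow> r = s" by (cases r; cases s) auto
  show "r \<le> s \<or> s \<le> r" by (cases r; cases s) auto
qed

end

definition rank_sup :: "cord set \<Rightarrow> rank" where
  "rank_sup A =
    (if \<exists>m\<in>A. \<forall>a\<in>A. a \<le> m then Ord (GREATEST m. m \<in> A)
     else Arrow (LEAST l. \<forall>a\<in>A. a < l))"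


section \<open>Transfinite graphs\<close>

text \<open>The ranks of nodes and paths: $0, 1, 2, \ldots, \vec\omega, \omega$.\<close>

datatype trank = Fin nat | Arrow_Omega | Omega

instantiation trank :: linorder
begin

fun less_eq_trank :: "trank \<Rightarrow> trank \<Rightarrow> bool" where
  "Fin m \<le> Fin n \<longleftrightarrow> m \<le> n"
| "Fin m \<le> Arrow_Omega \<longleftrightarrow> True"
| "Fin m \<le> Omega \<longleftrightarrow> True"
| "Arrow_Omega \<le> Fin n \<longleftrightarrow> False"
| "Arrow_Omega \<le> Arrow_Omega \<longleftrightarrow> True"
| "Arrow_Omega \<le> Omega \<longleftrightarrow> True"
| "Omega \<le> Fin n \<longleftrightarrow> False"
| "Omega \<le> Arrow_Omega \<longleftrightarrow> False"
| "Omega \<le> Omega \<longleftrightarrow> True"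

definition less_trank :: "trank \<Rightarrow> trank \<Rightarrow> bool" where
  "r < s \<longleftrightarrow> r \<le> s \<and> \<not> s \<le> (r :: trank)"

instance
proof
  fix r s t :: trank
  show "r < s \<longleftrightarrow> r \<le> s \<and> \<not> s \<le> r" by (rule less_trank_def)
  show "r \<le> r" by (cases r) auto
  show "r \<le> s \<Longrightarrow> s \<le> t \<Longrightarrow> r \<le> t" by (cases r; cases s; cases t) auto
  show "r \<le> s \<Longrightarrow> s \<le> r \<Longrightarrow> r = s" by (cases r; cases s) auto
  show "r \<le> s \<or> s \<le> r" by (cases r; cases s) auto
qed

end

text \<open>\<open>tip_rank \<alpha> \<mu>\<close>: $\alpha = \mu - 1$, where $\omega - 1$ is $\vec\omega$.\<close>

fun tip_rank :: "trank \<Rightarrow> trank \<Rightarrow> bool" where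
  "tip_rank (Fin m) (Fin n) \<longleftrightarrow> n = Suc m"
| "tip_rank Arrow_Omega Omega \<longleftrightarrow> True"
| "tip_rank _ _ \<longleftrightarrow> False"

text \<open>
  \<open>Path \<mu> e x P\<close> stands for the alternating sequence
  $\ldots, x_i, P_i, x_{i+1}, P_{i+1}, \ldots$ of rank $\mu$, where $i$ ranges over \<open>steps e\<close>;
  values of \<open>x\<close> and \<open>P\<close> at other indices carry no information. The constituents of a
  0-path are branches. A constituent \<open>P i\<close> is always listed in the direction from
  \<open>x i\<close> to \<open>x (i + 1)\<close>, so that a one-ended path is \<open>Outward\<close> or \<open>Inward\<close> according to
  whether it runs towards or away from its infinite extremity.
\<close>

datatype extent = Two_Ended nat | Outward | Inward | Endless

datatype ('n, 'b) tpath =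
  Branch 'b | Path trank extent "int \<Rightarrow> 'n" "int \<Rightarrow> ('n, 'b) tpath"

fun steps :: "extent \<Rightarrow> int set" where
  "steps (Two_Ended k) = {0..<int k}"
| "steps Outward = {0..}"
| "steps Inward = {..<0}"
| "steps Endless = UNIV"

definition posts :: "extent \<Rightarrow> int set" where
  "posts e = steps e \<union> (\<lambda>i. i + 1) ` steps e"

primrec path_nodes :: "('n, 'b) tpath \<Rightarrow> 'n set" where
  "path_nodes (Branch b) = {}"
| "path_nodes (Path \<mu> e x P) = x ` posts e \<union> (\<Union>i\<in>steps e. path_nodes (P i))"

primrec path_branches :: "('n, 'b) tpath \<Rightarrow> 'b set" where
  "path_branches (Branch b) = {b}"
| "path_branches (Path \<mu> e x P) = (\<Union>i\<in>steps e. path_branches (P i))"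

fun path_rank :: "('n, 'b) tpath \<Rightarrow> trank" where
  "path_rank (Path \<mu> e x P) = \<mu>"
| "path_rank (Branch b) = undefined"

fun flip :: "extent \<Rightarrow> extent" where
  "flip Outward = Inward"
| "flip Inward = Outward"
| "flip e = e"

fun last_index :: "extent \<Rightarrow> int" where
  "last_index (Two_Ended k) = int k"
| "last_index e = 0"

primrec reverse :: "('n, 'b) tpath \<Rightarrow> ('n, 'b) tpath" where
  "reverse (Branch b) = Branch b"
| "reverse (Path \<mu> e x P) =
    Path \<mu> (flip e) (\<lambda>i. x (last_index e - i)) (\<lambda>i. reverse (P (last_index e - 1 - i)))"

fun left_tip :: "('n, 'b) tpath \<Rightarrow> bool" where
  "left_tip (Path \<mu> e x P) \<longleftrightarrow> e = Inward \<or> e = Endless"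
| "left_tip (Branch b) \<longleftrightarrow> False"

fun right_tip :: "('n, 'b) tpath \<Rightarrow> bool" where
  "right_tip (Path \<mu> e x P) \<longleftrightarrow> e = Outward \<or> e = Endless"
| "right_tip (Branch b) \<longleftrightarrow> False"

fun tail :: "nat \<Rightarrow> ('n, 'b) tpath \<Rightarrow> ('n, 'b) tpath" where
  "tail k (Path \<mu> e x P) = Path \<mu> e (\<lambda>i. x (i + int k)) (\<lambda>i. P (i + int k))"
| "tail k (Branch b) = Branch b"

text \<open>
  Eventual coincidence of two outward paths: far enough out, each of them traverses only
  branches of the other. As no node is met twice, a path is determined by its branches, so
  that this means having a common one-ended part. Literal agreement of the listed sequences
  would be too narrow: the same endless constituent can be listed with shifted indices, and
  an $\vec\omega$-path may be divided into constituents in different ways.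
\<close>

definition coincide :: "('n, 'b) tpath \<Rightarrow> ('n, 'b) tpath \<Rightarrow> bool" where
  "coincide p q \<longleftrightarrow> path_rank p = path_rank q \<and>
    (\<exists>k. path_branches (tail k p) \<subseteq> path_branches q) \<and>
    (\<exists>k. path_branches (tail k q) \<subseteq> path_branches p)"

text \<open>
  Nodes are abstract points. \<open>embraced G x y\<close> says that the node \<open>x\<close> is embraced by the node
  \<open>y\<close> of higher rank, directly or through intermediate nodes. The tips contained in
  nodes are given by \<open>tip_node G\<close>, which assigns to a one-ended path the node containing its
  tip; as a tip is a class of paths, \<open>tip_node\<close> has to respect \<open>coincide\<close>.
\<close>

record ('n, 'b) tgraph =
  graph_rank :: trank
  nodes :: "'n set"
  branches :: "'b set"
  ends :: "'b \<Rightarrow> 'n set"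
  node_rank :: "'n \<Rightarrow> trank"
  embraced :: "'n \<Rightarrow> 'n \<Rightarrow> bool"
  tip_node :: "('n, 'b) tpath \<Rightarrow> 'n"

definition embraces :: "('n, 'b) tgraph \<Rightarrow> 'n \<Rightarrow> 'n \<Rightarrow> bool" where
  "embraces G x y \<longleftrightarrow> x = y \<or> embraced G y x"

text \<open>
  Nodes one of which embraces the other are shorted together: they are parts of the same
  maximal node.
\<close>

definition shorted :: "('n, 'b) tgraph \<Rightarrow> 'n \<Rightarrow> 'n \<Rightarrow> bool" where
  "shorted G x y \<longleftrightarrow> embraces G x y \<or> embraces G y x"

text \<open>The node at the left and at the right extremity of a path.\<close>

fun start_node :: "('n, 'b) tgraph \<Rightarrow> ('n, 'b) tpath \<Rightarrow> 'n" where
  "start_node G (Path \<mu> e x P) =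
    (if e = Inward \<or> e = Endless then tip_node G (reverse (Path \<mu> Inward x P)) else x 0)"
| "start_node G (Branch b) = undefined"

fun end_node :: "('n, 'b) tgraph \<Rightarrow> ('n, 'b) tpath \<Rightarrow> 'n" where
  "end_node G (Path \<mu> e x P) =
    (if e = Outward \<or> e = Endless then tip_node G (Path \<mu> Outward x P) else x (last_index e))"
| "end_node G (Branch b) = undefined"

text \<open>The node \<open>x i\<close> is reached through a tip of rank $\mu - 1$ from at least one side.\<close>

definition reached_by_tip :: "extent \<Rightarrow> (int \<Rightarrow> ('n, 'b) tpath) \<Rightarrow> trank \<Rightarrow> int \<Rightarrow> bool" where
  "reached_by_tip e P \<mu> i \<longleftrightarrow>
    (i - 1 \<in> steps e \<and> right_tip (P (i - 1)) \<and> tip_rank (path_rank (P (i - 1))) \<mu>) \<or>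
    (i \<in> steps e \<and> left_tip (P i) \<and> tip_rank (path_rank (P i)) \<mu>)"

text \<open>No node is met twice; adjacent elements of the sequence meet only where they adjoin.\<close>

definition no_repetition ::
  "('n, 'b) tgraph \<Rightarrow> extent \<Rightarrow> (int \<Rightarrow> 'n) \<Rightarrow> (int \<Rightarrow> ('n, 'b) tpath) \<Rightarrow> bool" where
  "no_repetition G e x P \<longleftrightarrow>
    (\<forall>i\<in>posts e. \<forall>j\<in>posts e. shorted G (x i) (x j) \<longrightarrow> i = j) \<and>
    (\<forall>i\<in>steps e. \<forall>j\<in>posts e. \<forall>u\<in>path_nodes (P i). shorted G u (x j) \<longrightarrow>
      (j = i \<and> \<not> left_tip (P i)) \<or> (j = i + 1 \<and> \<not> right_tip (P i))) \<and>
    (\<forall>i\<in>steps e. \<forall>j\<in>steps e. i < j \<longrightarrow>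
      (\<forall>u\<in>path_nodes (P i). \<forall>v\<in>path_nodes (P j). shorted G u v \<longrightarrow>
        j = i + 1 \<and> shorted G u (x j)))"

text \<open>
  In a $\mu$-path with $\mu = 1, 2, \ldots, \omega$ (\<open>limit\<close> covers $\vec\omega$), the interior
  nodes of the sequence are $\mu$-nodes, each reached through a $(\mu-1)$-tip; a terminal node
  may have any rank up to $\mu$, as in the 1-path that consists of a 0-node, a one-ended 0-path
  and a 1-node. Without the conditions on tips one could cut a path of lower rank at nodes
  embraced by $\mu$-nodes and pass it off as a $\mu$-path. An $\vec\omega$-path passes through
  nodes of finite ranks that increase strictly towards its infinite extremities.
\<close>

inductive is_path :: "('n, 'b) tgraph \<Rightarrow> ('n, 'b) tpath \<Rightarrow> bool" for G where
  zero: "is_path G (Path (Fin 0) e x P)"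
  if "e \<noteq> Two_Ended 0"
    and "\<forall>i\<in>steps e. \<exists>b\<in>branches G. P i = Branch b \<and> ends G b = {x i, x (i + 1)}"
    and "inj_on x (posts e)"
| succ: "is_path G (Path \<mu> e x P)"
  if "e \<noteq> Two_Ended 0" and "tip_rank \<alpha> \<mu>" and "\<mu> \<le> graph_rank G"
    and "\<forall>i\<in>posts e. x i \<in> nodes G \<and> node_rank G (x i) \<le> \<mu>"
    and "\<forall>i\<in>steps e. is_path G (P i) \<and> path_rank (P i) < \<mu> \<and>
      embraces G (x i) (start_node G (P i)) \<and> embraces G (x (i + 1)) (end_node G (P i))"
    and "\<forall>i\<in>steps e. i - 1 \<in> steps e \<longrightarrow> node_rank G (x i) = \<mu> \<and> reached_by_tip e P \<mu> i"
    and "\<exists>i\<in>posts e. reached_by_tip e P \<mu> i"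
    and "no_repetition G e x P"
| limit: "is_path G (Path Arrow_Omega e x P)"
  if "e \<in> {Outward, Inward, Endless}" and "Arrow_Omega \<le> graph_rank G"
    and "\<forall>i\<in>posts e. x i \<in> nodes G \<and> node_rank G (x i) < Arrow_Omega"
    and "\<forall>i\<in>steps e. if 0 \<le> i then node_rank G (x i) < node_rank G (x (i + 1))
      else node_rank G (x (i + 1)) < node_rank G (x i)"
    and "\<forall>i\<in>steps e. is_path G (P i) \<and>
      path_rank (P i) < max (node_rank G (x i)) (node_rank G (x (i + 1))) \<and>
      embraces G (x i) (start_node G (P i)) \<and> embraces G (x (i + 1)) (end_node G (P i))"
    and "\<forall>i\<in>posts e. i \<noteq> 0 \<longrightarrow> reached_by_tip e P (node_rank G (x i)) i"
    and "no_repetition G e x P"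

text \<open>A ray is a one-ended path, listed towards its tip.\<close>

definition is_ray :: "('n, 'b) tgraph \<Rightarrow> ('n, 'b) tpath \<Rightarrow> bool" where
  "is_ray G p \<longleftrightarrow> is_path G p \<and> (\<exists>\<mu> x P. p = Path \<mu> Outward x P)"

definition tip_of :: "('n, 'b) tgraph \<Rightarrow> ('n, 'b) tpath \<Rightarrow> ('n, 'b) tpath set" where
  "tip_of G p = {q. is_ray G q \<and> coincide p q}"

text \<open>In a $\nu$-graph the tips of rank less than $\nu$ are those contained in nodes.\<close>

definition tips :: "('n, 'b) tgraph \<Rightarrow> ('n, 'b) tpath set set" where
  "tips G = {tip_of G p | p. is_ray G p \<and> path_rank p < graph_rank G}"

definition tips_in :: "('n, 'b) tgraph \<Rightarrow> 'n \<Rightarrow> ('n, 'b) tpath set set" where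
  "tips_in G x = {tip_of G p | p. is_ray G p \<and> path_rank p < graph_rank G \<and> tip_node G p = x}"

definition maximal_node :: "('n, 'b) tgraph \<Rightarrow> 'n \<Rightarrow> bool" where
  "maximal_node G x \<longleftrightarrow> x \<in> nodes G \<and> (\<forall>y\<in>nodes G. \<not> embraced G x y)"

text \<open>
  Besides nodes of rank $0, 1, \ldots, \omega$ the definition admits nodes of rank $\vec\omega$.
  Such a node contains no tips of its own: it gathers an infinite sequence of nodes of
  increasing finite ranks, each embraced by the next, into one node.
\<close>

definition transfinite_graph :: "('n, 'b) tgraph \<Rightarrow> bool" where
  "transfinite_graph G \<longleftrightarrow>
    (\<forall>x\<in>nodes G. node_rank G x \<le> graph_rank G) \<and>
    (\<exists>x\<in>nodes G. node_rank G x = graph_rank G) \<and>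
    (\<forall>b\<in>branches G. \<exists>u\<in>nodes G. \<exists>v\<in>nodes G. ends G b = {u, v} \<and> u \<noteq> v \<and>
      node_rank G u = Fin 0 \<and> node_rank G v = Fin 0) \<and>
    (\<forall>x\<in>nodes G. node_rank G x = Fin 0 \<longrightarrow> (\<exists>b\<in>branches G. x \<in> ends G b)) \<and>
    (\<forall>x y. embraced G x y \<longrightarrow> x \<in> nodes G \<and> y \<in> nodes G \<and> node_rank G x < node_rank G y) \<and>
    (\<forall>x y z. embraced G x y \<and> embraced G y z \<longrightarrow> embraced G x z) \<and>
    (\<forall>x y z. embraced G x z \<and> embraced G y z \<longrightarrow> shorted G x y) \<and>
    (\<forall>x y z. embraced G x y \<and> embraced G x z \<longrightarrow> shorted G y z) \<and>
    (\<forall>x\<in>nodes G. \<exists>y. maximal_node G y \<and> embraces G y x) \<and>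
    (\<forall>p. is_ray G p \<and> path_rank p < graph_rank G \<longrightarrow>
      tip_node G p \<in> nodes G \<and> tip_rank (path_rank p) (node_rank G (tip_node G p))) \<and>
    (\<forall>p q. is_ray G p \<and> is_ray G q \<and> path_rank p < graph_rank G \<and> coincide p q \<longrightarrow>
      tip_node G p = tip_node G q) \<and>
    (\<forall>x\<in>nodes G. node_rank G x \<notin> {Fin 0, Arrow_Omega} \<longrightarrow> tips_in G x \<noteq> {}) \<and>
    (\<forall>x\<in>nodes G. node_rank G x = Arrow_Omega \<longrightarrow> infinite {y. embraced G y x})"

definition connected_branches :: "('n, 'b) tgraph \<Rightarrow> 'b \<Rightarrow> 'b \<Rightarrow> bool" where
  "connected_branches G b c \<longleftrightarrow>
    (\<exists>\<mu> k x P. let p = Path \<mu> (Two_Ended k) x P in is_path G p \<and> \<mu> \<le> graph_rank G \<and>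
      (\<exists>u\<in>path_nodes p. \<exists>v\<in>ends G b. shorted G u v) \<and>
      (\<exists>u\<in>path_nodes p. \<exists>v\<in>ends G c. shorted G u v))"

definition nu_connected :: "('n, 'b) tgraph \<Rightarrow> bool" where
  "nu_connected G \<longleftrightarrow> (\<forall>b\<in>branches G. \<forall>c\<in>branches G. connected_branches G b c)"

text \<open>The tips contained in a 0-node are the ends of its incident branches.\<close>

definition singleton_node :: "('n, 'b) tgraph \<Rightarrow> 'n \<Rightarrow> bool" where
  "singleton_node G x \<longleftrightarrow> maximal_node G x \<and> (\<forall>y. \<not> embraced G y x) \<and>
    (if node_rank G x = Fin 0 then \<exists>!b. b \<in> branches G \<and> x \<in> ends G b
     else \<exists>!t. t \<in> tips_in G x)"

definition meet :: "('n, 'b) tgraph \<Rightarrow> ('n, 'b) tpath \<Rightarrow> ('n, 'b) tpath \<Rightarrow> bool" where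
  "meet G p q \<longleftrightarrow> (\<exists>u\<in>path_nodes p. \<exists>v\<in>path_nodes q. shorted G u v)"

definition nondisconnectable ::
  "('n, 'b) tgraph \<Rightarrow> ('n, 'b) tpath set \<Rightarrow> ('n, 'b) tpath set \<Rightarrow> bool" where
  "nondisconnectable G s t \<longleftrightarrow> (\<forall>p\<in>s. \<forall>q\<in>t. \<forall>i j. meet G (tail i p) (tail j q))"

definition embraces_tip :: "('n, 'b) tgraph \<Rightarrow> 'n \<Rightarrow> ('n, 'b) tpath set \<Rightarrow> bool" where
  "embraces_tip G x t \<longleftrightarrow> (\<exists>y. embraces G x y \<and> t \<in> tips_in G y)"

definition condition_C :: "('n, 'b) tgraph \<Rightarrow> bool" where
  "condition_C G \<longleftrightarrow> (\<forall>s\<in>tips G. \<forall>t\<in>tips G. nondisconnectable G s t \<longrightarrow>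
    (\<exists>x\<in>nodes G. embraces_tip G x s \<and> embraces_tip G x t) \<or>
    (\<exists>x\<in>nodes G. singleton_node G x \<and> (tips_in G x = {s} \<or> tips_in G x = {t})))"


section \<open>Metrizable sets and distances\<close>

text \<open>
  Appending an end branch to every node of \<open>S\<close>: the new branch joins the node \<open>x\<close>
  itself, if that is a 0-node, and otherwise a new 0-node \<open>Inner x\<close>, which becomes embraced
  by \<open>x\<close>, to a new 0-node \<open>Outer x\<close>. A tip of the new graph lies in the same node as the tip
  of the old graph from whose rays it arises.
\<close>

datatype 'n ext_node = Old_Node 'n | Inner 'n | Outer 'n

datatype ('b, 'n) ext_branch = Old_Branch 'b | End_Branch 'n

definition append_end_branches ::
  "('n, 'b) tgraph \<Rightarrow> 'n set \<Rightarrow> ('n ext_node, ('b, 'n) ext_branch) tgraph" where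
  "append_end_branches G S =
    \<lparr>graph_rank = graph_rank G,
     nodes = Old_Node ` nodes G \<union> Inner ` {x \<in> S. node_rank G x \<noteq> Fin 0} \<union> Outer ` S,
     branches = Old_Branch ` branches G \<union> End_Branch ` S,
     ends = (\<lambda>c. case c of
         Old_Branch b \<Rightarrow> Old_Node ` ends G b
       | End_Branch x \<Rightarrow> {if node_rank G x = Fin 0 then Old_Node x else Inner x, Outer x}),
     node_rank = (\<lambda>u. case u of Old_Node x \<Rightarrow> node_rank G x | _ \<Rightarrow> Fin 0),
     embraced = (\<lambda>u v.
       (\<exists>x y. u = Old_Node x \<and> v = Old_Node y \<and> embraced G x y) \<or>
       (\<exists>x\<in>S. node_rank G x \<noteq> Fin 0 \<and> u = Inner x \<and> v = Old_Node x)),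
     tip_node = (\<lambda>q. Old_Node (tip_node G
       (SOME p. is_ray G p \<and> coincide (map_tpath Old_Node Old_Branch p) q)))\<rparr>"

definition metrizable_set :: "('n, 'b) tgraph \<Rightarrow> 'n set \<Rightarrow> bool" where
  "metrizable_set G M \<longleftrightarrow>
    M \<subseteq> Collect (maximal_node G) \<and>
    {x. maximal_node G x \<and> \<not> singleton_node G x} \<subseteq> M \<and>
    condition_C (append_end_branches G {x \<in> M. singleton_node G x})"

text \<open>The length $\omega^{\mu+1}$ of a one-ended $\mu$-path, which is $\omega^\omega$ for
  $\mu = \vec\omega$.\<close>

fun ray_length :: "trank \<Rightarrow> cord" where
  "ray_length (Fin n) = omega_pow (1 \<odot> Suc n)"
| "ray_length Arrow_Omega = omega_pow omega"
| "ray_length Omega = omega_pow (omega \<oplus> 1)"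

primrec path_length :: "('n, 'b) tpath \<Rightarrow> cord" where
  "path_length (Branch b) = 1"
| "path_length (Path \<mu> e x P) = (case e of
      Two_Ended k \<Rightarrow> foldr (\<oplus>) (map (\<lambda>i. path_length (P (int i))) [0..<k]) 0
    | Endless \<Rightarrow> ray_length \<mu> \<odot> 2
    | _ \<Rightarrow> ray_length \<mu>)"

text \<open>A path terminates at a maximal node if that node embraces its terminal node.\<close>

definition two_ended_path_between ::
  "('n, 'b) tgraph \<Rightarrow> 'n \<Rightarrow> 'n \<Rightarrow> ('n, 'b) tpath \<Rightarrow> bool" where
  "two_ended_path_between G x y p \<longleftrightarrow> is_path G p \<and>
    (\<exists>\<mu> k z P. p = Path \<mu> (Two_Ended k) z P \<and> embraces G x (z 0) \<and> embraces G y (z (int k)))"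

definition distance :: "('n, 'b) tgraph \<Rightarrow> 'n \<Rightarrow> 'n \<Rightarrow> cord" where
  "distance G x y =
    (if x = y then 0 else LEAST l. \<exists>p. two_ended_path_between G x y p \<and> path_length p = l)"

definition eccentricity :: "('n, 'b) tgraph \<Rightarrow> 'n set \<Rightarrow> 'n \<Rightarrow> rank" where
  "eccentricity G M x = rank_sup {distance G x y | y. y \<in> M}"

definition radius :: "('n, 'b) tgraph \<Rightarrow> 'n set \<Rightarrow> rank" where
  "radius G M = (LEAST r. r \<in> eccentricity G M ` M)"

definition diameter :: "('n, 'b) tgraph \<Rightarrow> 'n set \<Rightarrow> rank" where
  "diameter G M = rank_sup {distance G x y | x y. x \<in> M \<and> y \<in> M}"

end

theory Submission
  imports Defs
begin

text \<open>
  The inequalities follow from the triangle inequality for the distance by comparing all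
  distances with those from a node of least eccentricity. The triangle inequality needs a path
  from \<open>a\<close> to \<open>c\<close> inside the union of a path \<open>p\<close> from \<open>a\<close> to \<open>b\<close> and a path \<open>q\<close> from \<open>b\<close> to \<open>c\<close>,
  no longer than both together. Condition (C), applied to the graph with the end branches,
  makes the set of nodes of \<open>q\<close> closed under the limits along tips: a ray that meets \<open>q\<close> arbitrarily far out
  has its tip in a node of \<open>q\<close>. Hence there is a first node of \<open>p\<close> that lies on \<open>q\<close>, and the
  part of \<open>p\<close> up to it can be joined to a part of \<open>q\<close>. Both cutting and joining may
  change the rank of a path and its division into constituents; lengths do not increase
  because a finite natural sum of lengths below \<open>ray_length \<mu>\<close> stays below it.
\<close>

section \<open>Natural sums\<close>

text \<open>Rays are identified when, at equal rank, each has a tail whose branches all belong to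
  the other. So statements about tips have to be recovered from sets of branches, and the main
  obstacle is to show that a ray using only branches of a path has its tip at the place that the
  path itself suggests. This is proved by induction on the rank, with a closure operator that turns
  a set of branches into the nodes it determines.

  Condition (C) has an exception for tips that are alone in a singleton node. End branches remove
  the exception at the singleton nodes in \<open>M\<close>, and a path cannot pass through any other
  singleton node that holds a tip; hence the exception never arises for paths that end in
  \<open>M\<close>. The enlarged graph is not shown to be a transfinite graph; its rays are
  translated to and from the old graph instead.

  The minimum in a distance needs a path to exist. Connectedness is given for branches and is
  carried over to nodes by chaining short links with the same triangle construction. The minimum in
  the radius needs a nonempty \<open>M\<close>, and the suprema need a common bound for all
  distances.\<close>

lemma ex_above: "\<exists>c. \<forall>a\<in>A. a < (c::cord)" if "countable A"
  using countable_bounded[OF that] .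

lemma natsum_leI:
  assumes "!!a'. a' < a ==> a' \<oplus> b < c" "!!b'. b' < b ==> a \<oplus> b' < c"
  shows "a \<oplus> b \<le> c"
  unfolding natsum.simps[of a b] by (rule Least_le) (use assms in auto)

lemma less_natsumE:
  assumes "c < a \<oplus> b"
  obtains a' where "a' < a" "c \<le> a' \<oplus> b" | b' where "b' < b" "c \<le> a \<oplus> b'"
  using natsum_leI[of a b c] assms by (meson not_less)

lemma natsum_commute: "a \<oplus> b = b \<oplus> a"
proof (induction a b rule: natsum.induct)
  case (1 a b)
  have "a \<oplus> b \<le> b \<oplus> a"
    by (rule natsum_leI) (simp_all add: 1 natsum_strict_mono)
  moreover have "b \<oplus> a \<le> a \<oplus> b"
    by (rule natsum_leI) (simp_all add: 1[symmetric] natsum_strict_mono)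
  ultimately show ?case by simp
qed

text \<open>The induction hypotheses enter as assumptions so that the inequality can be used for the
  triple and for its reversal; by commutativity the reversed instance is the opposite
  inequality.\<close>

lemma natsum_assoc_le:
  assumes "!!a'. a' < a ==> (a' \<oplus> b) \<oplus> c = a' \<oplus> (b \<oplus> c)"
    and "!!b'. b' < b ==> (a \<oplus> b') \<oplus> c = a \<oplus> (b' \<oplus> c)"
    and "!!c'. c' < c ==> (a \<oplus> b) \<oplus> c' = a \<oplus> (b \<oplus> c')"
  shows "(a \<oplus> b) \<oplus> c \<le> a \<oplus> (b \<oplus> c)"
proof (rule natsum_leI)
  have mono: "x \<oplus> c \<le> y \<oplus> c" if "x \<le> y" for x y
    using that natsum_strict_mono(1)[of x y c] by (cases "x = y") (auto simp: order_le_less)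
  fix d assume "d < a \<oplus> b"
  then show "d \<oplus> c < a \<oplus> (b \<oplus> c)"
  proof (cases rule: less_natsumE)
    case (1 a')
    then have "d \<oplus> c \<le> a' \<oplus> (b \<oplus> c)" using mono assms(1) by fastforce
    also have "\<dots> < a \<oplus> (b \<oplus> c)" using 1 by (simp add: natsum_strict_mono)
    finally show ?thesis .
  next
    case (2 b')
    then have "d \<oplus> c \<le> a \<oplus> (b' \<oplus> c)" using mono assms(2) by fastforce
    also have "\<dots> < a \<oplus> (b \<oplus> c)" using 2 by (simp add: natsum_strict_mono)
    finally show ?thesis .
  qed
next
  fix c' assume "c' < c"
  then show "(a \<oplus> b) \<oplus> c' < a \<oplus> (b \<oplus> c)" by (simp add: assms(3) natsum_strict_mono)
qed

lemma natsum_assoc: "(a \<oplus> b) \<oplus> c = a \<oplus> (b \<oplus> c)"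
proof (induction a arbitrary: b c rule: less_induct)
  case A: (less a)
  show ?case
  proof (induction b arbitrary: c rule: less_induct)
    case B: (less b)
    show ?case
    proof (induction c rule: less_induct)
      case C: (less c)
      have "(a \<oplus> b) \<oplus> c \<le> a \<oplus> (b \<oplus> c)"
        by (rule natsum_assoc_le) (simp_all add: A B C)
      moreover have "(c \<oplus> b) \<oplus> a \<le> c \<oplus> (b \<oplus> a)"
        by (rule natsum_assoc_le)
          (metis A B C natsum_commute)+
      ultimately show ?case by (metis natsum_commute order_antisym)
    qed
  qed
qed

lemma zero_le_cord [simp]: "(0::cord) \<le> a"
  unfolding zero_cord_def by (rule Least_le) simp

lemma not_less_zero_cord [simp]: "~ a < (0::cord)"
  using zero_le_cord[of a] by (simp add: not_less)

lemma natsum_0_left [simp]: "0 \<oplus> b = b"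
proof (induction b rule: less_induct)
  case (less b)
  have "0 \<oplus> b \<le> b" by (rule natsum_leI) (simp_all add: less)
  moreover have "b' < 0 \<oplus> b" if "b' < b" for b'
    using natsum_strict_mono(2)[OF that, of 0] less[OF that] by simp
  ultimately show ?case by (metis less_irrefl order_le_less)
qed

lemma natsum_0_right [simp]: "b \<oplus> 0 = b"
  by (metis natsum_0_left natsum_commute)

text \<open>Provides \<open>natsum.F\<close> for sums over index sets. Its value on an infinite set
  is the default 0, which is why the length bounds for families of constituents are stated for
  finite index sets.\<close>

interpretation natsum: comm_monoid_set natsum 0
  by unfold_locales (simp_all add: natsum_assoc, rule natsum_commute)

lemma natsum_mono: "a \<le> a' ==> b \<le> b' ==> a \<oplus> b \<le> a' \<oplus> b'"
  using natsum_strict_mono(1)[of a a' b] natsum_strict_mono(2)[of b b' a']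
  by (metis order.order_iff_strict order.trans)

lemma natsum_ge1: "a \<le> a \<oplus> b" and natsum_ge2: "b \<le> a \<oplus> b"
  using natsum_mono[of a a 0 b] natsum_mono[of 0 a b b] by auto

lemma natsum_F_mono:
  assumes "finite B" "A <= B" "!!i. i \<in> A ==> f i \<le> g i"
  shows "natsum.F f A \<le> natsum.F g B"
proof -
  have "finite A" using assms finite_subset by blast
  then have "natsum.F f A \<le> natsum.F g A"
    using assms(3) by (induction A rule: finite_induct) (auto intro: natsum_mono)
  also have "\<dots> \<le> natsum.F g A \<oplus> natsum.F g (B - A)" by (rule natsum_ge1)
  also have "\<dots> = natsum.F g B"
    using natsum.subset_diff[OF assms(2,1), of g] natsum_commute by metis
  finally show ?thesis .
qed

lemma nattimes_mono: "a \<le> b ==> m \<le> n ==> a \<odot> m \<le> b \<odot> n"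
proof (induction n arbitrary: m)
  case (Suc n)
  then show ?case
    by (cases m) (auto intro: natsum_mono)
qed auto

lemma nattimes_add: "a \<odot> (m + n) = a \<odot> m \<oplus> a \<odot> n"
  by (induction n) (auto simp: natsum_assoc)

lemma nattimes_1 [simp]: "a \<odot> Suc 0 = a" by simp

section \<open>Powers of omega and the lengths of rays\<close>

text \<open>Only countably many multiples have to be exceeded, so the \<open>LEAST\<close> in the
  recursion ranges over a nonempty set.\<close>

lemma omega_pow_props: "0 < omega_pow a & (\<forall>b<a. \<forall>n. omega_pow b \<odot> n < omega_pow a)"
proof -
  have "countable (insert 0 ((%(b, n). omega_pow b \<odot> n) ` ({b. b < a} \<times> UNIV)))"
    by (intro countable_insert countable_image countable_SIGMA countable_below) auto
  then obtain c where "\<forall>x\<in>insert 0 ((%(b, n). omega_pow b \<odot> n) ` ({b. b < a} \<times> UNIV)). x < c"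
    using ex_above by blast
  then have "0 < c & (\<forall>b<a. \<forall>n. omega_pow b \<odot> n < c)" by auto
  then show ?thesis unfolding omega_pow.simps[of a] by (rule LeastI)
qed

lemma omega_pow_pos [simp]: "0 < omega_pow a" using omega_pow_props by blast

lemma omega_pow_times_less: "b < a ==> omega_pow b \<odot> n < omega_pow a" using omega_pow_props by blast

lemma less_omega_powE:
  assumes "x < omega_pow a"
  shows "x = 0 \<or> (\<exists>b<a. \<exists>n. x \<le> omega_pow b \<odot> n)"
proof (rule ccontr)
  assume "~ ?thesis"
  then have "0 < x & (\<forall>b<a. \<forall>n. omega_pow b \<odot> n < x)"
    using zero_le_cord[of x] by (metis linorder_not_less order_le_less)
  then have "omega_pow a \<le> x" unfolding omega_pow.simps[of a] by (rule Least_le)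
  with assms show False by simp
qed

lemma omega_pow_less: "b < a ==> omega_pow b < omega_pow a"
  using omega_pow_times_less[of b a 1] by simp

text \<open>Powers of omega are indecomposable for the natural sum: both summands are bounded by
  finite multiples of one power with smaller exponent, and these add up to another such multiple.
  This is the arithmetic behind all bounds by a ray length.\<close>

lemma omega_pow_natsum:
  assumes "x < omega_pow a" "y < omega_pow a" shows "x \<oplus> y < omega_pow a"
proof (cases "x = 0 \<or> y = 0")
  case False
  with assms less_omega_powE obtain b m c n where
    *: "b < a" "x \<le> omega_pow b \<odot> m" "c < a" "y \<le> omega_pow c \<odot> n" by metis
  have le: "omega_pow b \<le> omega_pow (max b c)" "omega_pow c \<le> omega_pow (max b c)"
    using omega_pow_less[of b "max b c"] omega_pow_less[of c "max b c"]
    by (auto simp: max_def order_le_less)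
  have "x \<oplus> y \<le> omega_pow (max b c) \<odot> m \<oplus> omega_pow (max b c) \<odot> n"
    using * le by (meson natsum_mono nattimes_mono order.refl order.trans)
  also have "\<dots> = omega_pow (max b c) \<odot> (m + n)" by (simp add: nattimes_add)
  also have "\<dots> < omega_pow a" using * by (intro omega_pow_times_less) auto
  finally show ?thesis .
qed (use assms in auto)

lemma zero_less_one_cord [simp]: "(0::cord) < 1"
proof -
  have "\<exists>a. (0::cord) < a" using ex_above[of "{0}"] by auto
  then show ?thesis unfolding one_cord_def by (rule LeastI_ex)
qed

lemma omega_pow_0: "omega_pow 0 = 1"
  unfolding omega_pow.simps[of 0] one_cord_def by simp

text \<open>The exponents belonging to \<open>Fin n\<close>, \<open>Arrow_Omega\<close> and
  \<open>Omega\<close> are n + 1, \<open>omega\<close> and its successor, so a comparison of ranks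
  becomes one of exponents.\<close>

lemma ray_length_less: "\<alpha> < \<mu> ==> ray_length \<alpha> < ray_length \<mu>"
proof -
  have step: "1 \<odot> n < 1 \<odot> Suc n" for n
    using natsum_strict_mono(2)[of 0 1 "1 \<odot> n"] by simp
  have fin: "1 \<odot> m < 1 \<odot> n" if "m < n" for m n
    using that lift_Suc_mono_less[of "%n. 1 \<odot> n", OF step] by blast
  have om: "1 \<odot> n < omega" for n
    using omega_pow_times_less[of 0 1 n] by (simp add: omega_pow_0 omega_def)
  have om1: "omega < omega \<oplus> 1" using natsum_strict_mono(2)[of 0 1 omega] by simp
  assume "\<alpha> < \<mu>"
  then show ?thesis
    using fin[of "Suc _" "Suc _"] om[of "Suc _"] om1
    by (cases \<alpha>; cases \<mu>)
      (auto simp: less_trank_def simp del: nattimes.simps intro!: omega_pow_less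
        intro: order.strict_trans)
qed

lemma ray_length_mono: "\<alpha> \<le> \<mu> ==> ray_length \<alpha> \<le> ray_length \<mu>"
  using ray_length_less by (metis order.order_iff_strict)

lemma ray_length_natsum:
  "x < ray_length \<mu> ==> y < ray_length \<mu> ==> x \<oplus> y < ray_length \<mu>"
  by (cases \<mu>) (auto intro: omega_pow_natsum)

lemma ray_length_pos [simp]: "0 < ray_length \<mu>"
  by (cases \<mu>) auto

lemma one_less_ray_length: "1 < ray_length \<mu>"
proof -
  have "1 < omega_pow 1" using omega_pow_less[of 0 1] by (simp add: omega_pow_0)
  then have "1 < ray_length (Fin 0)" by simp
  also have "\<dots> \<le> ray_length \<mu>" by (rule ray_length_mono) (cases \<mu>; simp)
  finally show ?thesis .
qed

lemma natsum_F_less_ray_length: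
  "(!!i. i \<in> A ==> f i < ray_length \<mu>) ==> natsum.F f A < ray_length \<mu>"
  by (induction A rule: infinite_finite_induct) (auto intro: ray_length_natsum)

lemma foldr_natsum: "foldr (\<oplus>) (map f [0..<k]) 0 = natsum.F (%i. f (nat i)) {0..<int k}"
proof -
  have "foldr (\<oplus>) (map f [0..<k]) d = natsum.F f {0..<k} \<oplus> d" for d
    by (induction k arbitrary: d) (auto simp: atLeast0_lessThan_Suc natsum_assoc natsum_commute)
  moreover have "natsum.F f {0..<k} = natsum.F (%i. f (nat i)) {0..<int k}"
    by (rule natsum.reindex_bij_witness[of _ nat int]) auto
  ultimately show ?thesis by simp
qed

lemma path_length_Two_Ended:
  "path_length (Path \<mu> (Two_Ended k) x P) = natsum.F (%i. path_length (P i)) {0..<int k}"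
  unfolding path_length.simps foldr_natsum extent.case
  by (rule natsum.cong) auto

lemma path_length_simps [simp]:
  "path_length (Path \<mu> Outward x P) = ray_length \<mu>"
  "path_length (Path \<mu> Inward x P) = ray_length \<mu>"
  "path_length (Path \<mu> Endless x P) = ray_length \<mu> \<odot> 2"
  by simp_all

declare path_length.simps(2) [simp del]

lemma le_nattimes2: "a \<le> a \<odot> 2"
  by (simp add: numeral_2_eq_2 natsum_ge1)

lemma nattimes2_less_ray_length: "a < ray_length \<mu> ==> a \<odot> 2 < ray_length \<mu>"
  using ray_length_natsum[of a \<mu> a] by (simp add: numeral_2_eq_2)

text \<open>A constituent of a \<mu>-path has smaller rank, so by induction it is at most twice as
  long as a ray of that rank; indecomposability keeps a finite sum of such lengths below
  \<open>ray_length \<mu>\<close>.\<close>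

lemma path_length_bound:
  "is_path G p ==> path_length p \<le> ray_length (path_rank p) \<odot> 2 &
    (~ left_tip p & ~ right_tip p --> path_length p < ray_length (path_rank p))"
proof (induction rule: is_path.induct)
    case (zero e P x)
    then show ?case
    proof (cases e)
      case (Two_Ended k)
      have "path_length (P i) < ray_length (Fin 0)" if i: "i \<in> {0..<int k}" for i
      proof -
        obtain b where "P i = Branch b" using zero(2) Two_Ended i by fastforce
        then show ?thesis using one_less_ray_length by (simp del: ray_length.simps)
      qed
      then have "natsum.F (%i. path_length (P i)) {0..<int k} < ray_length (Fin 0)"
        by (rule natsum_F_less_ray_length)
      then show ?thesis using Two_Ended le_nattimes2
        by (auto simp: path_length_Two_Ended simp del: nattimes.simps ray_length.simps
            intro: order.trans[OF order.strict_implies_order])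
    qed (auto simp: le_nattimes2 simp del: nattimes.simps ray_length.simps)
  next
    case (succ e \<alpha> \<mu> x P)
    then show ?case
    proof (cases e)
      case (Two_Ended k)
      have "path_length (P i) < ray_length \<mu>" if i: "i \<in> {0..<int k}" for i
      proof -
        have "i \<in> steps e" using i Two_Ended by simp
        then have "path_length (P i) \<le> ray_length (path_rank (P i)) \<odot> 2" "path_rank (P i) < \<mu>"
          using succ.IH by blast+
        then show ?thesis
          using nattimes2_less_ray_length[OF ray_length_less] order.strict_trans1 by blast
      qed
      then have "natsum.F (%i. path_length (P i)) {0..<int k} < ray_length \<mu>"
        by (rule natsum_F_less_ray_length)
      then show ?thesis using Two_Ended le_nattimes2
        by (auto simp: path_length_Two_Ended simp del: nattimes.simps ray_length.simps
            intro: order.trans[OF order.strict_implies_order])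
    qed (auto simp: le_nattimes2 simp del: nattimes.simps)
  next
    case (limit e x P)
    then show ?case by (auto simp: le_nattimes2 simp del: nattimes.simps ray_length.simps)
qed

section \<open>Ranks, extents and reversal\<close>

text \<open>The relation \<open>tip_rank\<close> as a function: tips of rank \<alpha> lie in nodes
  of rank \<open>tsuc \<alpha>\<close>. The value at \<open>Omega\<close> is a dummy, hence the side
  conditions that exclude this rank.\<close>

fun tsuc :: "trank \<Rightarrow> trank" where
  "tsuc (Fin n) = Fin (Suc n)"
| "tsuc _ = Omega"

lemma tip_rank_iff: "tip_rank \<alpha> \<mu> \<longleftrightarrow> \<alpha> ~= Omega & \<mu> = tsuc \<alpha>"
  by (cases \<alpha>; cases \<mu>) auto

lemma tsuc_le: "\<alpha> < \<mu> ==> tsuc \<alpha> \<le> \<mu>"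
  by (cases \<alpha>; cases \<mu>) (auto simp: less_trank_def)

lemma less_tsuc: "\<alpha> ~= Omega ==> \<alpha> < tsuc \<alpha>"
  by (cases \<alpha>) (auto simp: less_trank_def)

lemma less_tsuc_iff: "\<alpha> ~= Omega ==> \<beta> < tsuc \<alpha> \<longleftrightarrow> \<beta> \<le> \<alpha>"
  by (cases \<alpha>; cases \<beta>) (auto simp: less_trank_def)

lemma tsuc_inj: "tsuc \<alpha> = tsuc \<beta> ==> \<alpha> ~= Omega ==> \<beta> ~= Omega ==> \<alpha> = \<beta>"
  by (cases \<alpha>; cases \<beta>) auto

lemma tsuc_neq [simp]: "tsuc \<alpha> ~= Arrow_Omega" "tsuc \<alpha> ~= Fin 0"
  by (cases \<alpha>; simp)+

lemma Fin_0_le [simp]: "Fin 0 \<le> \<mu>" by (cases \<mu>) auto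

lemma le_Omega [simp]: "\<mu> \<le> Omega" by (cases \<mu>) auto

lemma not_Omega_less [simp]: "~ Omega < \<mu>" by (simp add: not_less)

lemma less_Arrow_iff: "\<mu> < Arrow_Omega \<longleftrightarrow> (\<exists>n. \<mu> = Fin n)"
  by (cases \<mu>) (auto simp: less_trank_def)

lemma Fin_less_iff [simp]: "Fin m < Fin n \<longleftrightarrow> m < n"
  by (auto simp: less_trank_def)

text \<open>The cases correspond to the three introduction rules of \<open>is_path\<close>.\<close>

lemma trank_cases_succ:
  obtains "\<mu> = Fin 0" | "\<mu> = Arrow_Omega" | \<alpha> where "\<alpha> ~= Omega" "\<mu> = tsuc \<alpha>"
proof (cases \<mu>)
  case (Fin n)
  then show ?thesis using that(1) that(3)[of "Fin (n - 1)"] by (cases n) auto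
next
  case Omega
  then show ?thesis using that(3)[of Arrow_Omega] by auto
qed (use that in auto)

lemma wf_trank: "wf {(x :: trank, y). x < y}"
proof (rule wf_subset[OF wf_measures])
  show "{(x :: trank, y). x < y} <= measures [%r. case r of Fin _ \<Rightarrow> 0 | Arrow_Omega \<Rightarrow> 1 | Omega \<Rightarrow> (2::nat),
      %r. case r of Fin n \<Rightarrow> n | _ \<Rightarrow> 0]"
    by (auto split: trank.splits simp: less_trank_def)
qed

instance trank :: wellorder
proof
  fix P :: "trank \<Rightarrow> bool" and a
  assume "!!x. (!!y. y < x ==> P y) ==> P x"
  then show "P a" using wf_induct_rule[OF wf_trank, of P a] by auto
qed

lemma steps_convex: "i \<in> steps e ==> k \<in> steps e ==> i \<le> j ==> j \<le> k ==> j \<in> steps e"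
  by (cases e) auto

lemma mem_posts: "i \<in> posts e \<longleftrightarrow> i \<in> steps e \<or> i - 1 \<in> steps e"
  by (auto simp: posts_def image_iff) (metis add.commute diff_add_cancel)+

lemma steps_posts: "i \<in> steps e ==> i \<in> posts e" "i \<in> steps e ==> i + 1 \<in> posts e"
  by (auto simp: mem_posts)

text \<open>Reversal sends post i to post \<open>L - i\<close>, but the step between posts i and i +
  1 then begins at post \<open>L - 1 - i\<close>; hence two different reflections for posts and for
  steps.\<close>

lemma steps_flip: "i \<in> steps (flip e) \<longleftrightarrow> last_index e - 1 - i \<in> steps e"
  by (cases e) auto

lemma posts_flip: "i \<in> posts (flip e) \<longleftrightarrow> last_index e - i \<in> posts e"
proof -
  have "last_index e - 1 - (i - 1) = last_index e - i" by simp
  moreover have "last_index e - 1 - i = last_index e - i - 1" by simp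
  ultimately show ?thesis unfolding mem_posts steps_flip by metis
qed

lemma flip_flip [simp]: "flip (flip e) = e" by (cases e) auto
lemma last_index_flip [simp]: "last_index (flip e) = last_index e" by (cases e) auto
lemma flip_eq_Two_Ended [simp]: "flip e = Two_Ended k \<longleftrightarrow> e = Two_Ended k" by (cases e) auto
lemma flip_eq [simp]: "flip e = Outward \<longleftrightarrow> e = Inward" "flip e = Inward \<longleftrightarrow> e = Outward"
  "flip e = Endless \<longleftrightarrow> e = Endless" by (cases e; simp)+

lemma steps_flip_image: "steps (flip e) = (%i. last_index e - 1 - i) ` steps e"
proof (intro set_eqI iffI)
  fix i assume "i \<in> steps (flip e)"
  then have "last_index e - 1 - i \<in> steps e" by (simp add: steps_flip)
  then show "i \<in> (%i. last_index e - 1 - i) ` steps e"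
    by (rule rev_image_eqI) simp
qed (auto simp: steps_flip)

lemma posts_flip_image: "posts (flip e) = (%i. last_index e - i) ` posts e"
proof (intro set_eqI iffI)
  fix i assume "i \<in> posts (flip e)"
  then have "last_index e - i \<in> posts e" by (simp add: posts_flip)
  then show "i \<in> (%i. last_index e - i) ` posts e"
    by (rule rev_image_eqI) simp
qed (auto simp: posts_flip)

lemma reverse_reverse [simp]: "reverse (reverse p) = p"
  by (induction p) auto

lemma path_nodes_reverse [simp]: "path_nodes (reverse p) = path_nodes p"
proof (induction p)
  case (Path \<mu> e x P)
  then show ?case
    by (simp add: steps_flip_image posts_flip_image image_image)
qed simp

lemma path_branches_reverse [simp]: "path_branches (reverse p) = path_branches p"
proof (induction p)
  case (Path \<mu> e x P)
  then show ?case by (simp add: steps_flip_image image_image)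
qed simp

lemma tip_reverse [simp]: "left_tip (reverse p) = right_tip p" "right_tip (reverse p) = left_tip p"
  by (cases p; auto)+

lemma path_rank_reverse [simp]: "path_rank (reverse p) = path_rank p"
  by (cases p) auto

lemma start_node_reverse [simp]: "start_node G (reverse p) = end_node G p"
  by (cases p) (auto split: if_splits)

lemma end_node_reverse [simp]: "end_node G (reverse p) = start_node G p"
  using start_node_reverse[of G "reverse p"] by simp

lemma path_length_reverse [simp]: "path_length (reverse p) = path_length p"
proof (induction p)
  case (Path \<mu> e x P)
  show ?case
  proof (cases e)
    case (Two_Ended k)
    have "natsum.F (%i. path_length (reverse (P (int k - 1 - i)))) {0..<int k} =
      natsum.F (%i. path_length (P i)) {0..<int k}"
      by (rule natsum.reindex_bij_witness[of _ "%i. int k - 1 - i" "%i. int k - 1 - i"])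
        (auto simp: Path)
    then show ?thesis using Two_Ended by (simp add: path_length_Two_Ended)
  qed auto
qed simp

lemma is_path_not_Branch [simp]: "~ is_path G (Branch b)"
  by (auto elim: is_path.cases)

lemma is_path_PathE:
  assumes "is_path G p" obtains \<mu> e x P where "p = Path \<mu> e x P"
  using assms by (cases p) auto

section \<open>Maximal nodes\<close>

locale nu_graph =
  fixes G :: "('n, 'b) tgraph"
  assumes tg: "transfinite_graph G"
    and graph_rank_ge1: "Fin 1 \<le> graph_rank G"
    and graph_rank_not_Arrow: "graph_rank G ~= Arrow_Omega"
begin

lemmas tg_axioms = tg[unfolded transfinite_graph_def]

lemma node_rank_le: "x \<in> nodes G ==> node_rank G x \<le> graph_rank G"
  using tg_axioms[THEN conjunct1] by simp

lemma ends_nodes: "b \<in> branches G ==> \<exists>u\<in>nodes G. \<exists>v\<in>nodes G. ends G b = {u, v} & u ~= v &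
      node_rank G u = Fin 0 & node_rank G v = Fin 0"
  using tg_axioms[THEN conjunct2, THEN conjunct2, THEN conjunct1] by simp

lemma node_branch: "x \<in> nodes G ==> node_rank G x = Fin 0 ==> \<exists>b\<in>branches G. x \<in> ends G b"
  using tg_axioms[THEN conjunct2, THEN conjunct2, THEN conjunct2, THEN conjunct1] by simp

lemma embraced_nodes: "embraced G x y ==> x \<in> nodes G & y \<in> nodes G & node_rank G x < node_rank G y"
  using tg_axioms[THEN conjunct2, THEN conjunct2, THEN conjunct2, THEN conjunct2, THEN conjunct1] by simp

lemma embraced_trans: "embraced G x y ==> embraced G y z ==> embraced G x z"
  using tg_axioms[THEN conjunct2, THEN conjunct2, THEN conjunct2, THEN conjunct2, THEN conjunct2, THEN conjunct1] by blast

lemma embraced_join: "embraced G x z ==> embraced G y z ==> shorted G x y"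
  using tg_axioms[THEN conjunct2, THEN conjunct2, THEN conjunct2, THEN conjunct2, THEN conjunct2, THEN conjunct2, THEN conjunct1] by blast

lemma embraced_fork: "embraced G x y ==> embraced G x z ==> shorted G y z"
  using tg_axioms[THEN conjunct2, THEN conjunct2, THEN conjunct2, THEN conjunct2, THEN conjunct2, THEN conjunct2, THEN conjunct2, THEN conjunct1] by blast

lemma ex_maximal: "x \<in> nodes G ==> \<exists>y. maximal_node G y & embraces G y x"
  using tg_axioms[THEN conjunct2, THEN conjunct2, THEN conjunct2, THEN conjunct2, THEN conjunct2, THEN conjunct2, THEN conjunct2, THEN conjunct2, THEN conjunct1] by simp

lemma tip_node_coincide: "is_ray G p ==> is_ray G q ==> path_rank p < graph_rank G ==> coincide p q ==>
      tip_node G p = tip_node G q"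
  using tg_axioms[THEN conjunct2, THEN conjunct2, THEN conjunct2, THEN conjunct2, THEN conjunct2, THEN conjunct2, THEN conjunct2, THEN conjunct2, THEN conjunct2, THEN conjunct2, THEN conjunct1] by blast

lemma tips_in_nonempty: "x \<in> nodes G ==> node_rank G x ~= Fin 0 ==> node_rank G x ~= Arrow_Omega ==> tips_in G x ~= {}"
  using tg_axioms[THEN conjunct2, THEN conjunct2, THEN conjunct2, THEN conjunct2, THEN conjunct2, THEN conjunct2, THEN conjunct2, THEN conjunct2, THEN conjunct2, THEN conjunct2, THEN conjunct2, THEN conjunct1] by simp

lemma arrow_node: "x \<in> nodes G ==> node_rank G x = Arrow_Omega ==> infinite {y. embraced G y x}"
  using tg_axioms[THEN conjunct2, THEN conjunct2, THEN conjunct2, THEN conjunct2, THEN conjunct2, THEN conjunct2, THEN conjunct2, THEN conjunct2, THEN conjunct2, THEN conjunct2, THEN conjunct2, THEN conjunct2] by simp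

lemma ex_top_node: "\<exists>x\<in>nodes G. node_rank G x = graph_rank G"
  using tg_axioms[THEN conjunct2, THEN conjunct1] by simp

lemma tip_node_props:
  assumes "is_ray G p" "path_rank p < graph_rank G"
  shows "tip_node G p \<in> nodes G" "node_rank G (tip_node G p) = tsuc (path_rank p)"
  using tg_axioms[THEN conjunct2, THEN conjunct2, THEN conjunct2, THEN conjunct2, THEN conjunct2, THEN conjunct2, THEN conjunct2, THEN conjunct2, THEN conjunct2, THEN conjunct1] assms
  by (simp_all add: tip_rank_iff)

lemma ends_subset: "b \<in> branches G ==> u \<in> ends G b ==> u \<in> nodes G & node_rank G u = Fin 0"
  using ends_nodes by fastforce

text \<open>Chooses a representative for being shorted: on nodes, \<open>shorted\<close> becomes
  equality of these values, so that disjointness conditions on paths turn into statements about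
  sets.\<close>

definition mx :: "'n \<Rightarrow> 'n" where
  "mx u = (THE y. maximal_node G y & embraces G y u)"

lemma maximal_unique:
  assumes "maximal_node G y" "embraces G y u" "maximal_node G z" "embraces G z u"
  shows "y = z"
proof (rule ccontr)
  assume ne: "y ~= z"
  have "shorted G y z"
    using assms(2,4) embraced_fork[of u y z] by (auto simp: embraces_def shorted_def)
  then show False
    using ne assms(1,3) by (auto simp: shorted_def embraces_def maximal_node_def)
qed

lemma mx: assumes "u \<in> nodes G" shows "maximal_node G (mx u)" "embraces G (mx u) u"
proof -
  have "\<exists>!y. maximal_node G y & embraces G y u"
    using ex_maximal[OF assms] maximal_unique by blast
  from theI'[OF this] show "maximal_node G (mx u)" "embraces G (mx u) u"
    by (auto simp: mx_def)
qed

lemma mx_eqI: "maximal_node G y ==> embraces G y u ==> u \<in> nodes G ==> mx u = y"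
  using maximal_unique mx by blast

lemma mx_maximal [simp]: "maximal_node G y ==> mx y = y"
  by (rule mx_eqI) (auto simp: embraces_def maximal_node_def)

lemma embraces_nodes: "embraces G x y ==> y \<in> nodes G ==> x \<in> nodes G"
  "embraces G x y ==> x \<in> nodes G ==> y \<in> nodes G"
  using embraced_nodes by (auto simp: embraces_def)

lemma embraces_trans: "embraces G x y ==> embraces G y z ==> embraces G x z"
  unfolding embraces_def using embraced_trans by blast

lemma embraces_mx: "embraces G x y ==> x \<in> nodes G ==> mx y = mx x"
  by (rule mx_eqI[OF mx(1) embraces_trans[OF mx(2)] embraces_nodes(2)])

lemma embraces_rank: "embraces G x y ==> node_rank G y \<le> node_rank G x"
  using embraced_nodes[of y x] by (auto simp: embraces_def)

lemma mx_eq_embraces: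
  assumes "u \<in> nodes G" "v \<in> nodes G" "mx u = mx v" "node_rank G u \<le> node_rank G v"
  shows "embraces G v u"
proof -
  have "shorted G u v"
    using mx(2)[OF assms(1)] mx(2)[OF assms(2)] assms(3) embraced_join[of u "mx u" v]
    by (auto simp: embraces_def shorted_def)
  then show ?thesis
    using assms(4) embraced_nodes[of v u] by (auto simp: shorted_def embraces_def)
qed

text \<open>The nodes inside one maximal node form a chain under embracing, along which the rank
  increases strictly. In particular the two ends of a branch, distinct 0-nodes, lie in different
  maximal nodes.\<close>

lemma mx_rank_eq:
  assumes "u \<in> nodes G" "v \<in> nodes G" "mx u = mx v" "node_rank G u = node_rank G v"
  shows "u = v"
  using mx_eq_embraces[OF assms(1,2,3)] assms(4) embraced_nodes[of u v] by (auto simp: embraces_def)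

lemma shorted_iff: "u \<in> nodes G ==> v \<in> nodes G ==> shorted G u v \<longleftrightarrow> mx u = mx v"
  using embraces_mx mx_eq_embraces linear unfolding shorted_def by metis

text \<open>Paths are compared through the maximal nodes they meet. The node that holds the tip at
  an infinite end is not listed among the nodes of the path, so \<open>span\<close> adds both ends
  to \<open>mnodes\<close>.\<close>

definition mnodes :: "('n, 'b) tpath \<Rightarrow> 'n set" where "mnodes p = mx ` path_nodes p"
definition lend :: "('n, 'b) tpath \<Rightarrow> 'n" where "lend p = mx (start_node G p)"
definition rend :: "('n, 'b) tpath \<Rightarrow> 'n" where "rend p = mx (end_node G p)"
definition span :: "('n, 'b) tpath \<Rightarrow> 'n set" where "span p = mnodes p Un {lend p, rend p}"

lemma mnodes_Path: "mnodes (Path \<mu> e x P) = (%i. mx (x i)) ` posts e Un (\<Union>i\<in>steps e. mnodes (P i))"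
  by (auto simp: mnodes_def image_UN image_Un image_image)

lemma reverse_sets [simp]: "mnodes (reverse p) = mnodes p" "lend (reverse p) = rend p"
  "rend (reverse p) = lend p" "span (reverse p) = span p"
  by (auto simp: mnodes_def lend_def rend_def span_def)

lemma path_nodes_subset: "is_path G p ==> path_nodes p <= nodes G"
proof (induction rule: is_path.induct)
  case (zero e P x)
  have "x i \<in> nodes G" if "i \<in> posts e" for i
  proof -
    obtain j where j: "j \<in> steps e" "i = j \<or> i = j + 1" using \<open>i \<in> posts e\<close> by (force simp: mem_posts)
    then obtain b where "b \<in> branches G" "ends G b = {x j, x (j + 1)}" using zero(2) by blast
    then show ?thesis using ends_subset j(2) by auto
  qed
  moreover have "path_nodes (P i) = {}" if "i \<in> steps e" for i
    using zero(2) that by fastforce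
  ultimately show ?case by auto
next
  case (succ e \<alpha> \<mu> x P)
  have "\<forall>i\<in>steps e. path_nodes (P i) <= nodes G" using succ.IH by simp
  then show ?case using succ.hyps(4) by auto
next
  case (limit e x P)
  have "\<forall>i\<in>steps e. path_nodes (P i) <= nodes G" using limit.IH by simp
  then show ?case using limit.hyps(3) by auto
qed

text \<open>A form of \<open>no_repetition\<close> that looks only at single steps and pairs of
  steps, each taken with its two posts. It is easier to check after reversing or gluing, because
  posts need not be compared separately.\<close>

definition linked :: "extent \<Rightarrow> (int \<Rightarrow> 'n) \<Rightarrow> (int \<Rightarrow> ('n, 'b) tpath) \<Rightarrow> bool" where
  "linked e x P \<longleftrightarrow>
    (\<forall>i\<in>steps e. mx (x i) ~= mx (x (i + 1)) & (left_tip (P i) --> mx (x i) ~: mnodes (P i)) &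
      (right_tip (P i) --> mx (x (i + 1)) ~: mnodes (P i))) &
    (\<forall>i\<in>steps e. \<forall>j\<in>steps e. i < j -->
      (mnodes (P i) Un {mx (x i), mx (x (i + 1))}) Int (mnodes (P j) Un {mx (x j), mx (x (j + 1))})
        <= (if j = i + 1 then {mx (x j)} else {}))"

lemma no_repetition_mx:
  assumes "\<forall>i\<in>posts e. x i \<in> nodes G" "\<forall>i\<in>steps e. path_nodes (P i) <= nodes G"
  shows "no_repetition G e x P \<longleftrightarrow>
    (\<forall>i\<in>posts e. \<forall>j\<in>posts e. mx (x i) = mx (x j) --> i = j) &
    (\<forall>i\<in>steps e. \<forall>j\<in>posts e. mx (x j) \<in> mnodes (P i) -->
      (j = i & ~ left_tip (P i)) \<or> (j = i + 1 & ~ right_tip (P i))) &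
    (\<forall>i\<in>steps e. \<forall>j\<in>steps e. i < j --> (\<forall>m\<in>mnodes (P i) Int mnodes (P j). j = i + 1 & m = mx (x j)))"
proof -
  have 1: "shorted G (x i) (x j) \<longleftrightarrow> mx (x i) = mx (x j)" if "i \<in> posts e" "j \<in> posts e" for i j
    using that assms(1) shorted_iff by blast
  have 2: "shorted G u (x j) \<longleftrightarrow> mx u = mx (x j)" if "i \<in> steps e" "u \<in> path_nodes (P i)" "j \<in> posts e" for i j u
    using that assms shorted_iff by blast
  have 3: "shorted G u v \<longleftrightarrow> mx u = mx v"
    if "i \<in> steps e" "u \<in> path_nodes (P i)" "j \<in> steps e" "v \<in> path_nodes (P j)" for i j u v
    using that assms shorted_iff by blast
  have a: "(\<forall>i\<in>posts e. \<forall>j\<in>posts e. shorted G (x i) (x j) --> i = j) \<longleftrightarrow>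
    (\<forall>i\<in>posts e. \<forall>j\<in>posts e. mx (x i) = mx (x j) --> i = j)"
    using 1 by blast
  have b: "(\<forall>i\<in>steps e. \<forall>j\<in>posts e. \<forall>u\<in>path_nodes (P i). shorted G u (x j) -->
      (j = i & ~ left_tip (P i)) \<or> (j = i + 1 & ~ right_tip (P i))) \<longleftrightarrow>
    (\<forall>i\<in>steps e. \<forall>j\<in>posts e. mx (x j) \<in> mnodes (P i) -->
      (j = i & ~ left_tip (P i)) \<or> (j = i + 1 & ~ right_tip (P i)))"
    using 2 unfolding mnodes_def image_iff by metis
  have c: "(\<forall>i\<in>steps e. \<forall>j\<in>steps e. i < j -->
      (\<forall>u\<in>path_nodes (P i). \<forall>v\<in>path_nodes (P j). shorted G u v -->
        j = i + 1 & shorted G u (x j))) \<longleftrightarrow>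
     (\<forall>i\<in>steps e. \<forall>j\<in>steps e. i < j --> (\<forall>m\<in>mnodes (P i) Int mnodes (P j). j = i + 1 & m = mx (x j)))"
  proof (intro iffI ballI impI)
    fix i j m assume *: "\<forall>i\<in>steps e. \<forall>j\<in>steps e. i < j -->
      (\<forall>u\<in>path_nodes (P i). \<forall>v\<in>path_nodes (P j). shorted G u v -->
        j = i + 1 & shorted G u (x j))" "i \<in> steps e" "j \<in> steps e" "i < j" "m \<in> mnodes (P i) Int mnodes (P j)"
    then obtain u v where "u \<in> path_nodes (P i)" "v \<in> path_nodes (P j)" "m = mx u" "m = mx v"
      by (auto simp: mnodes_def)
    then show "j = i + 1 & m = mx (x j)" using * 2[of i u j] 3[of i u j v] steps_posts(1)[of j e] by metis
  next
    fix i j u v assume *: "\<forall>i\<in>steps e. \<forall>j\<in>steps e. i < j -->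
      (\<forall>m\<in>mnodes (P i) Int mnodes (P j). j = i + 1 & m = mx (x j))"
      "i \<in> steps e" "j \<in> steps e" "i < j" "u \<in> path_nodes (P i)" "v \<in> path_nodes (P j)" "shorted G u v"
    then have "mx u = mx v" using 3 by blast
    then have "mx u \<in> mnodes (P i) Int mnodes (P j)"
      using imageI[OF *(5), of mx] imageI[OF *(6), of mx] by (simp add: mnodes_def)
    then have "j = i + 1 & mx u = mx (x j)" using * by blast
    then show "j = i + 1 & shorted G u (x j)" using 2 * steps_posts(1)[of j e] by metis
  qed
  show ?thesis unfolding no_repetition_def a b c by (rule refl)
qed

lemma no_repetition_iff_linked:
  assumes "\<forall>i\<in>posts e. x i \<in> nodes G" "\<forall>i\<in>steps e. path_nodes (P i) <= nodes G"
  shows "no_repetition G e x P \<longleftrightarrow> linked e x P"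
proof -
  let ?S = "%i. mnodes (P i) Un {mx (x i), mx (x (i + 1))}"
  show ?thesis
  proof
    assume "no_repetition G e x P"
    note R = this[unfolded no_repetition_mx[OF assms]]
    note R1 = R[THEN conjunct1, rule_format] and R2 = R[THEN conjunct2, THEN conjunct1, rule_format]
      and R3 = R[THEN conjunct2, THEN conjunct2, rule_format]
    have piece: "mx (x i) ~= mx (x (i + 1))" "left_tip (P i) ==> mx (x i) ~: mnodes (P i)"
      "right_tip (P i) ==> mx (x (i + 1)) ~: mnodes (P i)" if i: "i \<in> steps e" for i
      using R1[of i "i + 1"] R2[of i i] R2[of i "i + 1"] steps_posts[OF i] i by auto
    have "?S i Int ?S j <= (if j = i + 1 then {mx (x j)} else {})"
      if ij: "i \<in> steps e" "j \<in> steps e" "i < j" for i j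
    proof
      note ps = steps_posts[OF ij(1)] steps_posts[OF ij(2)]
      fix m assume m: "m \<in> ?S i Int ?S j"
      have "j = i + 1 & m = mx (x j)"
      proof (cases "m \<in> mnodes (P i)")
        case mi: True
        show ?thesis
        proof (cases "m \<in> mnodes (P j)")
          case True
          then show ?thesis using R3[OF ij, of m] mi by blast
        next
          case False
          then obtain b where b: "b = j \<or> b = j + 1" "m = mx (x b)" using m by blast
          then have "b \<in> posts e" using ps by auto
          then have "b = i \<or> b = i + 1" using R2[of i b] ij(1) mi b(2) by blast
          then have "b = j" "j = i + 1" using b(1) ij(3) by linarith+
          then show ?thesis using b by simp
        qed
      next
        case False
        then obtain a where a: "a = i \<or> a = i + 1" "m = mx (x a)" using m by blast
        then have ap: "a \<in> posts e" using ps by auto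
        have "\<exists>b. (b = j \<or> b = j + 1) & a = b"
        proof (cases "m \<in> mnodes (P j)")
          case True
          then show ?thesis using R2[of j a] ij(2) a(2) ap by blast
        next
          case False
          then obtain b where b: "b = j \<or> b = j + 1" "m = mx (x b)" using m by blast
          then have "b \<in> posts e" using ps by auto
          then show ?thesis using R1[of a b] ap a(2) b by auto
        qed
        then have "a = j" "j = i + 1" using a(1) ij(3) by auto
        then show ?thesis using a by simp
      qed
      then show "m \<in> (if j = i + 1 then {mx (x j)} else {})" by simp
    qed
    then show "linked e x P" unfolding linked_def using piece by blast
  next
    assume "linked e x P"
    note L0 = this[unfolded linked_def, THEN conjunct1, rule_format]
      and M0 = this[unfolded linked_def, THEN conjunct2, rule_format]
    have L: "i \<in> steps e ==> mx (x i) ~= mx (x (i + 1))"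
      "i \<in> steps e ==> left_tip (P i) ==> mx (x i) ~: mnodes (P i)"
      "i \<in> steps e ==> right_tip (P i) ==> mx (x (i + 1)) ~: mnodes (P i)" for i
      using L0 by auto
    have M: "j = i + 1 & m = mx (x j)"
      if "i \<in> steps e" "j \<in> steps e" "i < j" "m \<in> ?S i" "m \<in> ?S j" for i j m
      using M0[OF that(1-3)] that(4,5) by (cases "j = i + 1") auto
    \<comment> \<open>Post j is also the right post of step j - 1, which comes after step i; a
      common node would have to be the left post of step j - 1 as well.\<close>
    have far: "mx (x j) ~: ?S i" if "i \<in> steps e" "j \<in> posts e" "i + 1 < j" for i j
    proof
      assume a: "mx (x j) \<in> ?S i"
      have j: "j - 1 \<in> steps e" using that steps_convex[of i e j "j - 1"] by (auto simp: mem_posts)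
      have "mx (x j) \<in> ?S (j - 1)" by simp
      then have "mx (x j) = mx (x (j - 1))" using M[of i "j - 1" "mx (x j)"] that j a by auto
      then show False using L(1)[OF j] by simp
    qed
    have near: "mx (x j) ~: ?S i" if "i \<in> steps e" "j \<in> posts e" "j < i" for i j
    proof
      assume a: "mx (x j) \<in> ?S i"
      have j: "j \<in> steps e" using that steps_convex[of "j - 1" e i j] by (auto simp: mem_posts)
      have "i = j + 1 & mx (x j) = mx (x i)" using M[of j i "mx (x j)"] that j a by auto
      then show False using L(1)[OF j] by simp
    qed
    show "no_repetition G e x P" unfolding no_repetition_mx[OF assms]
    proof (intro conjI ballI impI)
      have lt: "mx (x i) ~= mx (x j)" if "i \<in> posts e" "j \<in> posts e" "i < j" for i j
      proof (cases "i \<in> steps e")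
        case True
        then show ?thesis using far[of i j] L(1)[of i] that by (cases "j = i + 1") auto
      next
        case False
        then have "i - 1 \<in> steps e" "j - 1 \<in> steps e \<or> j \<in> steps e" using that by (auto simp: mem_posts)
        then have "i \<in> steps e" using that steps_convex[of "i - 1" e j i] steps_convex[of "i - 1" e "j - 1" i] by auto
        with False show ?thesis by simp
      qed
      fix i j assume "i \<in> posts e" "j \<in> posts e" "mx (x i) = mx (x j)"
      then show "i = j" using lt[of i j] lt[of j i] by (cases i j rule: linorder_cases) auto
    next
      fix i j assume *: "i \<in> steps e" "j \<in> posts e" "mx (x j) \<in> mnodes (P i)"
      then have "~ i + 1 < j" "~ j < i" using far near by blast+
      then have "j = i \<or> j = i + 1" by linarith
      then show "(j = i & ~ left_tip (P i)) \<or> (j = i + 1 & ~ right_tip (P i))" using L * by blast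
    next
      fix i j m assume "i \<in> steps e" "j \<in> steps e" "i < j" "m \<in> mnodes (P i) Int mnodes (P j)"
      then show "j = i + 1" "m = mx (x j)" using M[of i j m] by auto
    qed
  qed
qed

end

section \<open>The structure of paths\<close>

text \<open>The sign condition on the shift keeps the part on one side of post 0; this matters for
  arrow paths, whose ranks increase away from post 0 in both directions. The graph is arbitrary here
  because the lemma is also applied to the graph with end branches.\<close>

lemma sub_ray:
  assumes "is_path G (Path \<mu> e x P)" "e' = Outward & 0 \<le> s \<or> e' = Inward & s \<le> 0"
    and sub: "!!i. i \<in> steps e' ==> i + s \<in> steps e"
  shows "is_path G (Path \<mu> e' (%i. x (i + s)) (%i. P (i + s)))"
proof -
  have e': "e' ~= Two_Ended 0" using assms(2) by auto
  have subp: "i + s \<in> posts e" if "i \<in> posts e'" for i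
    using sub[of i] sub[of "i - 1"] that by (auto simp: mem_posts algebra_simps)
  have shift: "i + 1 + s = i + s + 1" for i by simp
  have norep: "no_repetition G e' (%i. x (i + s)) (%i. P (i + s))" if "no_repetition G e x P"
    unfolding no_repetition_def
  proof (intro conjI ballI impI)
    fix i j assume "i \<in> posts e'" "j \<in> posts e'" "shorted G (x (i + s)) (x (j + s))"
    then have "i + s = j + s" using subp[of i] subp[of j] that[unfolded no_repetition_def, THEN conjunct1] by blast
    then show "i = j" by simp
  next
    fix i j u assume *: "i \<in> steps e'" "j \<in> posts e'" "u \<in> path_nodes (P (i + s))" "shorted G u (x (j + s))"
    have "j + s = i + s & ~ left_tip (P (i + s)) \<or> j + s = i + s + 1 & ~ right_tip (P (i + s))"
      using that[unfolded no_repetition_def, THEN conjunct2, THEN conjunct1, rule_format, OF sub[OF *(1)] subp[OF *(2)] *(3,4)] .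
    then show "j = i & ~ left_tip (P (i + s)) \<or> j = i + 1 & ~ right_tip (P (i + s))" by auto
  next
    fix i j u v assume *: "i \<in> steps e'" "j \<in> steps e'" "i < j" "u \<in> path_nodes (P (i + s))"
      "v \<in> path_nodes (P (j + s))" "shorted G u v"
    have "i + s < j + s" using * by simp
    from that[unfolded no_repetition_def, THEN conjunct2, THEN conjunct2, rule_format, OF sub[OF *(1)] sub[OF *(2)] this *(4-6)]
    show "j = i + 1" "shorted G u (x (j + s))" by auto
  qed
  have reach: "reached_by_tip e' (%i. P (i + s)) \<nu> i \<longleftrightarrow> reached_by_tip e P \<nu> (i + s)"
    if "i \<in> steps e'" "i - 1 \<in> steps e'" for \<nu> i
  proof -
    have "i - 1 + s = i + s - 1" by simp
    then show ?thesis using that sub[OF that(1)] sub[OF that(2)] unfolding reached_by_tip_def by metis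
  qed
  have inner: "i \<in> steps e' & i - 1 \<in> steps e'" if "i \<in> posts e'" "i ~= 0" for i
    using that assms(2) by (auto simp: mem_posts)
  have sub2: "i + s \<in> steps e & i + s - 1 \<in> steps e" if "i \<in> steps e'" "i - 1 \<in> steps e'" for i
    using sub[OF that(1)] sub[OF that(2)] by (auto simp: algebra_simps)
  show ?thesis
    using assms(1)
  proof cases
    case zero
    have "inj_on (%i. x (i + s)) (posts e')"
      using zero(4) subp by (intro inj_onI) (metis add_right_cancel inj_onD)
    moreover have "\<forall>i\<in>steps e'. \<exists>b\<in>branches G. P (i + s) = Branch b & ends G b = {x (i + s), x (i + 1 + s)}"
      unfolding shift using zero(3) sub by blast
    ultimately show ?thesis unfolding zero(1) by (intro is_path.zero[OF e'])
  next
    case (succ \<alpha>)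
    show ?thesis
    proof (rule is_path.succ[OF e' succ(2,3)])
      show "\<forall>i\<in>posts e'. x (i + s) \<in> nodes G & node_rank G (x (i + s)) \<le> \<mu>" using succ subp by blast
      show "\<forall>i\<in>steps e'. is_path G (P (i + s)) & path_rank (P (i + s)) < \<mu> &
       embraces G (x (i + s)) (start_node G (P (i + s))) & embraces G (x (i + 1 + s)) (end_node G (P (i + s)))"
        unfolding shift using succ sub by blast
      show r: "\<forall>i\<in>steps e'. i - 1 \<in> steps e' --> node_rank G (x (i + s)) = \<mu> & reached_by_tip e' (%i. P (i + s)) \<mu> i"
        using succ(6) sub2 reach by blast
      \<comment> \<open>A one-ended part has an interior post, and interior posts are reached by
        tips; this supplies the existence clause of the rule.\<close>
      have "\<exists>i\<in>steps e'. i - 1 \<in> steps e'" using assms(2)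
        by (auto intro: bexI[of _ 1] bexI[of _ "-1"])
      then show "\<exists>i\<in>posts e'. reached_by_tip e' (%i. P (i + s)) \<mu> i" using r steps_posts(1) by blast
      show "no_repetition G e' (%i. x (i + s)) (%i. P (i + s))" using norep succ by blast
    qed
  next
    case limit
    show ?thesis unfolding limit(1)
    proof (rule is_path.limit)
      show "e' \<in> {Outward, Inward, Endless}" "Arrow_Omega \<le> graph_rank G" using assms(2) limit by auto
      show "\<forall>i\<in>posts e'. x (i + s) \<in> nodes G & node_rank G (x (i + s)) < Arrow_Omega" using limit subp by blast
      show "\<forall>i\<in>steps e'. if 0 \<le> i then node_rank G (x (i + s)) < node_rank G (x (i + 1 + s))
        else node_rank G (x (i + 1 + s)) < node_rank G (x (i + s))"
      proof
        fix i assume i: "i \<in> steps e'"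
        have "0 \<le> i + s \<longleftrightarrow> 0 \<le> i" using i assms(2) by auto
        then show "if 0 \<le> i then node_rank G (x (i + s)) < node_rank G (x (i + 1 + s))
        else node_rank G (x (i + 1 + s)) < node_rank G (x (i + s))"
          using limit(5)[rule_format, OF sub[OF i]] unfolding shift by simp
      qed
      show "\<forall>i\<in>steps e'. is_path G (P (i + s)) &
        path_rank (P (i + s)) < max (node_rank G (x (i + s))) (node_rank G (x (i + 1 + s))) &
        embraces G (x (i + s)) (start_node G (P (i + s))) & embraces G (x (i + 1 + s)) (end_node G (P (i + s)))"
        unfolding shift using limit(6) sub by blast
      show "\<forall>i\<in>posts e'. i ~= 0 --> reached_by_tip e' (%i. P (i + s)) (node_rank G (x (i + s))) i"
      proof (intro ballI impI)
        fix i assume i: "i \<in> posts e'" "i ~= 0"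
        have "i + s ~= 0" using i assms(2) by (auto simp: mem_posts)
        then show "reached_by_tip e' (%i. P (i + s)) (node_rank G (x (i + s))) i"
          using limit(7) subp[OF i(1)] reach inner[OF i] by blast
      qed
      show "no_repetition G e' (%i. x (i + s)) (%i. P (i + s))" using norep limit by blast
    qed
  qed
qed

context nu_graph
begin

text \<open>What the rules \<open>succ\<close> and \<open>limit\<close> have in common, so that most
  arguments treat them as one case. The exception at index 0 is the post of least rank in an endless
  arrow path, which no tip has to reach.\<close>

definition compound :: "trank \<Rightarrow> extent \<Rightarrow> (int \<Rightarrow> 'n) \<Rightarrow> (int \<Rightarrow> ('n, 'b) tpath) \<Rightarrow> bool" where
  "compound \<mu> e x P \<longleftrightarrow> e ~= Two_Ended 0 & \<mu> ~= Fin 0 & \<mu> \<le> graph_rank G &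
    (\<mu> = Arrow_Omega --> e \<in> {Outward, Inward, Endless}) &
    (\<forall>i\<in>posts e. x i \<in> nodes G & node_rank G (x i) \<le> \<mu> &
      (\<mu> = Arrow_Omega --> node_rank G (x i) < Arrow_Omega)) &
    (\<forall>i\<in>steps e. is_path G (P i) & path_rank (P i) < \<mu> &
      embraces G (x i) (start_node G (P i)) & embraces G (x (i + 1)) (end_node G (P i))) &
    (\<forall>i\<in>steps e. i - 1 \<in> steps e --> \<mu> = Arrow_Omega & i = 0 \<or>
      reached_by_tip e P (node_rank G (x i)) i) &
    (\<mu> ~= Arrow_Omega --> (\<forall>i\<in>steps e. i - 1 \<in> steps e --> node_rank G (x i) = \<mu>)) &
    no_repetition G e x P"

lemma is_path_compound:
  assumes "is_path G (Path \<mu> e x P)" "\<mu> ~= Fin 0"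
  shows "compound \<mu> e x P"
  using assms(1)
proof cases
  case (succ \<alpha>)
  moreover from this have "\<mu> ~= Arrow_Omega" by (auto simp: tip_rank_iff)
  ultimately show ?thesis using assms(2) unfolding compound_def by auto
next
  case limit
  have "node_rank G (x i) \<le> Arrow_Omega" if "i \<in> posts e" for i
    using limit that by (auto simp: less_imp_le)
  moreover have "path_rank (P i) < Arrow_Omega" if "i \<in> steps e" for i
  proof -
    have "max (node_rank G (x i)) (node_rank G (x (i + 1))) < Arrow_Omega"
      using limit(4) that by (simp add: steps_posts)
    then show ?thesis using limit(6) that by (meson order.strict_trans)
  qed
  moreover have "reached_by_tip e P (node_rank G (x i)) i" if "i \<in> steps e" "i ~= 0" for i
    using limit that by (auto simp: steps_posts)
  ultimately show ?thesis using limit unfolding compound_def by blast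
qed (use assms in simp)

lemma Fin_0_neq_tsuc [simp]: "Fin 0 ~= tsuc \<alpha>"
  by (rule not_sym) (rule tsuc_neq(2))

lemma is_path_zeroD:
  assumes "is_path G (Path (Fin 0) e x P)"
  shows "e ~= Two_Ended 0"
    "\<forall>i\<in>steps e. \<exists>b\<in>branches G. P i = Branch b & ends G b = {x i, x (i + 1)}"
    "inj_on x (posts e)"
proof -
  have "e ~= Two_Ended 0 & (\<forall>i\<in>steps e. \<exists>b\<in>branches G. P i = Branch b & ends G b = {x i, x (i + 1)}) &
    inj_on x (posts e)"
    using assms by cases (auto simp: tip_rank_iff)
  then show "e ~= Two_Ended 0"
    "\<forall>i\<in>steps e. \<exists>b\<in>branches G. P i = Branch b & ends G b = {x i, x (i + 1)}"
    "inj_on x (posts e)" by auto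
qed

lemma is_path_induct [consumes 1, case_names zero compound]:
  assumes "is_path G p"
    and zero: "!!e x P. is_path G (Path (Fin 0) e x P) ==> e ~= Two_Ended 0 ==>
      \<forall>i\<in>steps e. \<exists>b\<in>branches G. P i = Branch b & ends G b = {x i, x (i + 1)} ==>
      inj_on x (posts e) ==> Q (Path (Fin 0) e x P)"
    and comp: "!!\<mu> e x P. is_path G (Path \<mu> e x P) ==> compound \<mu> e x P ==>
      (!!i. i \<in> steps e ==> Q (P i)) ==> Q (Path \<mu> e x P)"
  shows "Q p"
  using assms(1)
proof (induction p rule: tpath.induct)
  case (Path \<mu> e x P)
  show ?case
  proof (cases "\<mu> = Fin 0")
    case True
    then show ?thesis using zero[of e x P] is_path_zeroD[of e x P] Path.prems by blast
  next
    case False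
    then have c: "compound \<mu> e x P" using Path.prems is_path_compound by blast
    show ?thesis
    proof (rule comp[OF Path.prems c])
      fix i assume "i \<in> steps e"
      then show "Q (P i)" using c Path.IH[of "P i"] unfolding compound_def by blast
    qed
  qed
qed simp

lemma is_path_extent: "is_path G (Path \<mu> e x P) ==> e ~= Two_Ended 0"
  using is_path_zeroD(1)[of e x P] is_path_compound[of \<mu> e x P] by (cases "\<mu> = Fin 0") (auto simp: compound_def)

lemma path_rank_le: "is_path G p ==> path_rank p \<le> graph_rank G"
  by (induction rule: is_path_induct) (auto simp: compound_def)

lemma compoundD:
  assumes "compound \<mu> e x P"
  shows "e ~= Two_Ended 0" "\<mu> ~= Fin 0" "\<mu> \<le> graph_rank G"
    "i \<in> posts e ==> x i \<in> nodes G" "i \<in> posts e ==> node_rank G (x i) \<le> \<mu>"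
    "i \<in> steps e ==> is_path G (P i)" "i \<in> steps e ==> path_rank (P i) < \<mu>"
    "i \<in> steps e ==> embraces G (x i) (start_node G (P i))"
    "i \<in> steps e ==> embraces G (x (i + 1)) (end_node G (P i))"
    "no_repetition G e x P" "linked e x P"
  using assms path_nodes_subset no_repetition_iff_linked[of e x P] unfolding compound_def by auto

lemma start_node_in: "is_path G p ==> ~ left_tip p ==> start_node G p \<in> path_nodes p"
proof -
  assume a: "is_path G p" "~ left_tip p"
  then obtain \<mu> e x P where *: "is_path G p" "~ left_tip p" "p = Path \<mu> e x P" using is_path_PathE by metis
  then have "e ~= Two_Ended 0" using is_path_extent by blast
  then have "0 \<in> posts e" using * by (cases e) (auto simp: mem_posts)
  then show ?thesis using * by auto
qed

lemma end_node_in: "is_path G p ==> ~ right_tip p ==> end_node G p \<in> path_nodes p"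
proof -
  assume a: "is_path G p" "~ right_tip p"
  then obtain \<mu> e x P where *: "is_path G p" "~ right_tip p" "p = Path \<mu> e x P" using is_path_PathE by metis
  then have "e ~= Two_Ended 0" using is_path_extent by blast
  then have "last_index e \<in> posts e" using * by (cases e) (auto simp: mem_posts)
  then show ?thesis using * by auto
qed

lemma lend_in: "is_path G p ==> ~ left_tip p ==> lend p \<in> mnodes p"
  and rend_in: "is_path G p ==> ~ right_tip p ==> rend p \<in> mnodes p"
  using start_node_in end_node_in by (auto simp: mnodes_def lend_def rend_def)

text \<open>The invariant shared by the constituents of compound paths and by all paths that are cut
  or joined. The rank bound ensures that the tip at an infinite end is contained in a node; the
  remaining clauses make the two ends differ and keep such a node off the path itself.\<close>

definition proper :: "('n, 'b) tpath \<Rightarrow> bool" where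
  "proper p \<longleftrightarrow> is_path G p & (left_tip p \<or> right_tip p --> path_rank p < graph_rank G) &
    (left_tip p --> lend p ~: mnodes p) & (right_tip p --> rend p ~: mnodes p) & lend p ~= rend p"

lemma compound_piece:
  assumes "compound \<mu> e x P" "i \<in> steps e"
  shows "lend (P i) = mx (x i)" "rend (P i) = mx (x (i + 1))" "proper (P i)"
proof -
  show l: "lend (P i) = mx (x i)" and r: "rend (P i) = mx (x (i + 1))"
    using embraces_mx[OF compoundD(8)[OF assms] compoundD(4)[OF assms(1) steps_posts(1)[OF assms(2)]]]
      embraces_mx[OF compoundD(9)[OF assms] compoundD(4)[OF assms(1) steps_posts(2)[OF assms(2)]]]
    by (simp_all add: lend_def rend_def)
  show "proper (P i)"
    using compoundD(3,11)[OF assms(1)] compoundD(6,7)[OF assms] assms(2) order.strict_trans2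
    unfolding proper_def l r linked_def by blast
qed

lemma compound_span:
  assumes "compound \<mu> e x P" "i \<in> steps e" "j \<in> steps e" "i < j"
  shows "span (P i) Int span (P j) <= (if j = i + 1 then {mx (x j)} else {})"
  using compoundD(11)[OF assms(1)] assms(2-)
  unfolding span_def compound_piece[OF assms(1,2)] compound_piece[OF assms(1,3)] linked_def by blast

lemma compound_posts:
  assumes "compound \<mu> e x P" "i \<in> posts e" "j \<in> posts e" "mx (x i) = mx (x j)"
  shows "i = j"
proof -
  have "shorted G (x i) (x j)"
    using shorted_iff[OF compoundD(4)[OF assms(1,2)] compoundD(4)[OF assms(1,3)]] assms(4) by simp
  then show ?thesis using compoundD(10)[OF assms(1), unfolded no_repetition_def] assms(2,3) by blast
qed

lemma compound_mnodes:
  assumes "compound \<mu> e x P"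
  shows "mnodes (Path \<mu> e x P) = (\<Union>i\<in>steps e. span (P i))"
proof
  have "mx (x i) \<in> (\<Union>i\<in>steps e. span (P i))" if i: "i \<in> posts e" for i
  proof -
    consider "i \<in> steps e" | "i - 1 \<in> steps e" using i by (auto simp: mem_posts)
    then show ?thesis
    proof cases
      case 1
      then show ?thesis using compound_piece(1)[OF assms 1] by (force simp: span_def)
    next
      case 2
      then show ?thesis using compound_piece(2)[OF assms 2] by (force simp: span_def)
    qed
  qed
  then show "mnodes (Path \<mu> e x P) <= (\<Union>i\<in>steps e. span (P i))"
    by (auto simp: mnodes_Path span_def)
next
  show "(\<Union>i\<in>steps e. span (P i)) <= mnodes (Path \<mu> e x P)"
    using compound_piece[OF assms] steps_posts unfolding mnodes_Path span_def by force
qed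

lemma linked_flip:
  assumes "linked e x P"
  shows "linked (flip e) (%i. x (last_index e - i)) (%i. reverse (P (last_index e - 1 - i)))"
proof -
  let ?L = "last_index e"
  note A = assms[unfolded linked_def, THEN conjunct1, rule_format]
    and B = assms[unfolded linked_def, THEN conjunct2, rule_format]
  have L: "?L - (i + 1) = ?L - 1 - i" for i by simp
  show ?thesis unfolding linked_def
  proof (intro conjI ballI impI; unfold steps_flip L)
    fix i j assume i: "?L - 1 - i \<in> steps e" and j: "?L - 1 - j \<in> steps e" and ij: "i < j"
    define i' j' where d: "i' = ?L - 1 - i" "j' = ?L - 1 - j"
    have e: "?L - i = i' + 1" "?L - j = j' + 1" by (simp_all add: d)
    show "(mnodes (reverse (P (?L - 1 - i))) Un {mx (x (?L - i)), mx (x (?L - 1 - i))}) Int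
       (mnodes (reverse (P (?L - 1 - j))) Un {mx (x (?L - j)), mx (x (?L - 1 - j))})
       <= (if j = i + 1 then {mx (x (?L - j))} else {})"
    proof -
      have lt: "j' < i'" using ij by (simp add: d)
      have b: "(mnodes (P j') Un {mx (x j'), mx (x (j' + 1))}) Int (mnodes (P i') Un {mx (x i'), mx (x (i' + 1))})
        <= (if i' = j' + 1 then {mx (x i')} else {})"
        using B[OF j i] lt unfolding d[symmetric] by blast
      show ?thesis
      proof (cases "j = i + 1")
        case True
        then have "i' = j' + 1" by (simp add: d)
        then show ?thesis using b True unfolding e d[symmetric] reverse_sets by (simp, blast)
      next
        case False
        then have "i' ~= j' + 1" by (simp add: d)
        then show ?thesis using b False unfolding e d[symmetric] reverse_sets by (simp, blast)
      qed
    qed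
  next
    fix i assume i: "?L - 1 - i \<in> steps e"
    define i' where d: "i' = ?L - 1 - i"
    have e: "?L - i = i' + 1" by (simp_all add: d)
    show "mx (x (?L - i)) ~= mx (x (?L - 1 - i))"
      "left_tip (reverse (P (?L - 1 - i))) ==> mx (x (?L - i)) ~: mnodes (reverse (P (?L - 1 - i)))"
      "right_tip (reverse (P (?L - 1 - i))) ==> mx (x (?L - 1 - i)) ~: mnodes (reverse (P (?L - 1 - i)))"
      using A[OF i] unfolding e d[symmetric] by auto
  qed
qed

lemma no_repetition_flip:
  assumes "no_repetition G e x P" "\<forall>i\<in>posts e. x i \<in> nodes G" "\<forall>i\<in>steps e. path_nodes (P i) <= nodes G"
  shows "no_repetition G (flip e) (%i. x (last_index e - i)) (%i. reverse (P (last_index e - 1 - i)))"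
  using linked_flip[of e x P] assms
  by (subst no_repetition_iff_linked) (auto simp: posts_flip steps_flip no_repetition_iff_linked)

lemma reached_by_tip_flip:
  "reached_by_tip (flip e) (%i. reverse (P (last_index e - 1 - i))) \<mu> i \<longleftrightarrow>
    reached_by_tip e P \<mu> (last_index e - i)"
proof -
  have "last_index e - 1 - (i - 1) = last_index e - i" "last_index e - 1 - i = last_index e - i - 1" by simp_all
  then show ?thesis unfolding reached_by_tip_def steps_flip by (metis tip_reverse path_rank_reverse)
qed

lemma is_path_reverse: "is_path G p ==> is_path G (reverse p)"
proof (induction rule: is_path.induct)
  case (zero e P x)
  let ?L = "last_index e"
  have "\<exists>b\<in>branches G. reverse (P (?L - 1 - i)) = Branch b & ends G b = {x (?L - i), x (?L - (i + 1))}"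
    if i: "i \<in> steps (flip e)" for i
  proof -
    obtain b where b: "b \<in> branches G" "P (?L - 1 - i) = Branch b"
      "ends G b = {x (?L - 1 - i), x (?L - 1 - i + 1)}"
      using zero(2) i unfolding steps_flip by blast
    have "?L - 1 - i + 1 = ?L - i" "?L - (i + 1) = ?L - 1 - i" by simp_all
    then have "ends G b = {x (?L - i), x (?L - (i + 1))}" using b(3) insert_commute by metis
    then show ?thesis using b by (intro bexI[of _ b]) (simp_all only: reverse.simps)
  qed
  moreover have "inj_on (%i. x (?L - i)) (posts (flip e))"
  proof (rule inj_onI)
    fix i j assume "i \<in> posts (flip e)" "j \<in> posts (flip e)" "x (?L - i) = x (?L - j)"
    then have "?L - i = ?L - j" using inj_onD[OF zero(3)] unfolding posts_flip by blast
    then show "i = j" by simp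
  qed
  ultimately show ?case using zero(1) by (auto intro!: is_path.zero)
next
  case (succ e \<alpha> \<mu> x P)
  let ?L = "last_index e"
  have L: "?L - 1 - i + 1 = ?L - i" "?L - (i + 1) = ?L - 1 - i" "?L - 1 - (i - 1) = ?L - i"
    "?L - i - 1 = ?L - 1 - i" for i by simp_all
  have pn: "\<forall>i\<in>steps e. path_nodes (P i) <= nodes G" using succ.IH path_nodes_subset by blast
  show ?case unfolding reverse.simps
  proof (rule is_path.succ)
    show "flip e ~= Two_Ended 0" "tip_rank \<alpha> \<mu>" "\<mu> \<le> graph_rank G" using succ by auto
    show "\<forall>i\<in>posts (flip e). x (?L - i) \<in> nodes G & node_rank G (x (?L - i)) \<le> \<mu>"
      using succ by (auto simp: posts_flip)
    show "\<forall>i\<in>steps (flip e). is_path G (reverse (P (?L - 1 - i))) & path_rank (reverse (P (?L - 1 - i))) < \<mu> &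
       embraces G (x (?L - i)) (start_node G (reverse (P (?L - 1 - i)))) &
       embraces G (x (?L - (i + 1))) (end_node G (reverse (P (?L - 1 - i))))"
    proof
      fix i assume "i \<in> steps (flip e)"
      then have i': "?L - 1 - i \<in> steps e" by (simp add: steps_flip)
      show "is_path G (reverse (P (?L - 1 - i))) & path_rank (reverse (P (?L - 1 - i))) < \<mu> &
       embraces G (x (?L - i)) (start_node G (reverse (P (?L - 1 - i)))) &
       embraces G (x (?L - (i + 1))) (end_node G (reverse (P (?L - 1 - i))))"
        using bspec[OF succ.IH i'] unfolding L(1)[of i] L(2)[of i] by simp
    qed
    show "\<forall>i\<in>steps (flip e). i - 1 \<in> steps (flip e) --> node_rank G (x (?L - i)) = \<mu> &
       reached_by_tip (flip e) (%i. reverse (P (?L - 1 - i))) \<mu> i"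
    proof (intro ballI impI)
      fix i assume "i \<in> steps (flip e)" "i - 1 \<in> steps (flip e)"
      then have "?L - i \<in> steps e" "?L - i - 1 \<in> steps e" unfolding steps_flip by (metis L(3), metis L(4))
      then show "node_rank G (x (?L - i)) = \<mu> & reached_by_tip (flip e) (%i. reverse (P (?L - 1 - i))) \<mu> i"
        unfolding reached_by_tip_flip using succ.hyps by blast
    qed
    show "\<exists>i\<in>posts (flip e). reached_by_tip (flip e) (%i. reverse (P (?L - 1 - i))) \<mu> i"
      unfolding posts_flip_image reached_by_tip_flip using succ.hyps by auto
    show "no_repetition G (flip e) (%i. x (?L - i)) (%i. reverse (P (?L - 1 - i)))"
      using succ.hyps pn by (intro no_repetition_flip) auto
  qed
next
  case (limit e x P)
  let ?L = "last_index e"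
  have L: "?L - 1 - i + 1 = ?L - i" "?L - (i + 1) = ?L - 1 - i" "?L - 1 - (i - 1) = ?L - i"
    "?L - i - 1 = ?L - 1 - i" for i by simp_all
  have L0: "?L = 0" using limit by auto
  have pn: "\<forall>i\<in>steps e. path_nodes (P i) <= nodes G" using limit.IH path_nodes_subset by blast
  show ?case unfolding reverse.simps
  proof (rule is_path.limit)
    show "flip e \<in> {Outward, Inward, Endless}" "Arrow_Omega \<le> graph_rank G" using limit by auto
    show "\<forall>i\<in>posts (flip e). x (?L - i) \<in> nodes G & node_rank G (x (?L - i)) < Arrow_Omega"
      using limit by (auto simp: posts_flip)
    show "\<forall>i\<in>steps (flip e). if 0 \<le> i then node_rank G (x (?L - i)) < node_rank G (x (?L - (i + 1)))
        else node_rank G (x (?L - (i + 1))) < node_rank G (x (?L - i))"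
    proof
      fix i assume "i \<in> steps (flip e)"
      then have "?L - 1 - i \<in> steps e" by (simp add: steps_flip)
      then have "if 0 \<le> ?L - 1 - i then node_rank G (x (?L - 1 - i)) < node_rank G (x (?L - i))
        else node_rank G (x (?L - i)) < node_rank G (x (?L - 1 - i))"
        using limit.hyps(4) L(1)[of i] by metis
      then show "if 0 \<le> i then node_rank G (x (?L - i)) < node_rank G (x (?L - (i + 1)))
        else node_rank G (x (?L - (i + 1))) < node_rank G (x (?L - i))"
        unfolding L(2) using L0 by (auto split: if_splits)
    qed
    show "\<forall>i\<in>steps (flip e). is_path G (reverse (P (?L - 1 - i))) &
       path_rank (reverse (P (?L - 1 - i))) < max (node_rank G (x (?L - i))) (node_rank G (x (?L - (i + 1)))) &
       embraces G (x (?L - i)) (start_node G (reverse (P (?L - 1 - i)))) &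
       embraces G (x (?L - (i + 1))) (end_node G (reverse (P (?L - 1 - i))))"
    proof
      fix i assume "i \<in> steps (flip e)"
      then have i': "?L - 1 - i \<in> steps e" by (simp add: steps_flip)
      show "is_path G (reverse (P (?L - 1 - i))) &
       path_rank (reverse (P (?L - 1 - i))) < max (node_rank G (x (?L - i))) (node_rank G (x (?L - (i + 1)))) &
       embraces G (x (?L - i)) (start_node G (reverse (P (?L - 1 - i)))) &
       embraces G (x (?L - (i + 1))) (end_node G (reverse (P (?L - 1 - i))))"
        using bspec[OF limit.IH i'] unfolding L(1)[of i] L(2)[of i] by (simp add: max.commute)
    qed
    show "\<forall>i\<in>posts (flip e). i ~= 0 -->
      reached_by_tip (flip e) (%i. reverse (P (?L - 1 - i))) (node_rank G (x (?L - i))) i"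
    proof (intro ballI impI)
      fix i assume "i \<in> posts (flip e)" "i ~= 0"
      then have "?L - i \<in> posts e" "?L - i ~= 0" using L0 by (auto simp: posts_flip)
      then show "reached_by_tip (flip e) (%i. reverse (P (?L - 1 - i))) (node_rank G (x (?L - i))) i"
        unfolding reached_by_tip_flip using limit.hyps(5) by blast
    qed
    show "no_repetition G (flip e) (%i. x (?L - i)) (%i. reverse (P (?L - 1 - i)))"
      using limit.hyps pn by (intro no_repetition_flip) auto
  qed
qed

lemma proper_reverse [simp]: "proper (reverse p) \<longleftrightarrow> proper p"
proof -
  have "is_path G (reverse p) \<longleftrightarrow> is_path G p" using is_path_reverse[of p] is_path_reverse[of "reverse p"] by auto
  then show ?thesis unfolding proper_def by auto
qed

end

section \<open>Rays and tips\<close>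

lemma path_rank_tail [simp]: "path_rank (tail k p) = path_rank p"
  by (cases p) auto

lemma tail_tail: "tail j (tail k p) = tail (j + k) p"
  by (cases p) (auto simp: algebra_simps)

lemma tail_0 [simp]: "tail 0 p = p"
  by (cases p) auto

lemma coincide_sym: "coincide p q ==> coincide q p"
  unfolding coincide_def by auto

lemma coincide_refl [simp]: "coincide p p"
  unfolding coincide_def by (metis order.refl tail_0)

lemma atLeast_image: "{int k..} = (%i. i + int k) ` {0..}"
proof (intro set_eqI iffI)
  fix i assume "i \<in> {int k..}"
  then show "i \<in> (%i. i + int k) ` {0..}" by (intro rev_image_eqI[of "i - int k"]) auto
qed auto

context nu_graph
begin

text \<open>One step with its two posts. For a compound path this is the \<open>span\<close> of the
  constituent, for a 0-path the two ends of the branch; lemmas about it cover both kinds of path at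
  once.\<close>

definition seg :: "(int \<Rightarrow> 'n) \<Rightarrow> (int \<Rightarrow> ('n, 'b) tpath) \<Rightarrow> int \<Rightarrow> 'n set" where
  "seg x P i = mnodes (P i) Un {mx (x i), mx (x (i + 1))}"

lemma mnodes_Branch [simp]: "mnodes (Branch b) = {}"
  by (simp add: mnodes_def)

lemma compound_seg: "compound \<mu> e x P ==> i \<in> steps e ==> span (P i) = seg x P i"
  using compound_piece[of \<mu> e x P i] by (auto simp: span_def seg_def)

lemma zero_posts:
  assumes "is_path G (Path (Fin 0) e x P)" "i \<in> posts e"
  shows "x i \<in> nodes G" "node_rank G (x i) = Fin 0"
proof -
  obtain j where j: "j \<in> steps e" "i = j \<or> i = j + 1" using assms(2) by (force simp: mem_posts)
  then obtain b where "b \<in> branches G" "ends G b = {x j, x (j + 1)}" using is_path_zeroD(2)[OF assms(1)] by blast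
  then show "x i \<in> nodes G" "node_rank G (x i) = Fin 0" using ends_subset j(2) by auto
qed

lemma zero_posts_inj:
  assumes "is_path G (Path (Fin 0) e x P)" "i \<in> posts e" "j \<in> posts e" "mx (x i) = mx (x j)"
  shows "i = j"
proof -
  have "x i = x j"
    using mx_rank_eq[OF zero_posts(1)[OF assms(1,2)] zero_posts(1)[OF assms(1,3)]] assms(4)
      zero_posts(2)[OF assms(1,2)] zero_posts(2)[OF assms(1,3)] by simp
  then show ?thesis using is_path_zeroD(3)[OF assms(1)] assms(2,3) by (auto dest: inj_onD)
qed

lemma posts_nodes: "is_path G (Path \<mu> e x P) ==> i \<in> posts e ==> x i \<in> nodes G"
  using path_nodes_subset[of "Path \<mu> e x P"] by auto

lemma posts_inj:
  assumes "is_path G (Path \<mu> e x P)" "i \<in> posts e" "j \<in> posts e" "mx (x i) = mx (x j)"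
  shows "i = j"
  using zero_posts_inj[of e x P i j] compound_posts[of \<mu> e x P i j] is_path_compound[of \<mu> e x P] assms
  by (cases "\<mu> = Fin 0") auto

lemma zero_piece: "is_path G (Path (Fin 0) e x P) ==> i \<in> steps e ==> mnodes (P i) = {}"
  using is_path_zeroD(2)[of e x P] by fastforce

lemma seg_inter:
  assumes "is_path G (Path \<mu> e x P)" "i \<in> steps e" "j \<in> steps e" "i < j" "m \<in> seg x P i" "m \<in> seg x P j"
  shows "j = i + 1" "m = mx (x j)"
proof -
  have "j = i + 1 & m = mx (x j)"
  proof (cases "\<mu> = Fin 0")
    case True
    have e: "mnodes (P i) = {}" "mnodes (P j) = {}" using zero_piece assms True by auto
    obtain a where a: "a = i \<or> a = i + 1" "m = mx (x a)" using assms(5) e by (auto simp: seg_def)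
    obtain b where b: "b = j \<or> b = j + 1" "m = mx (x b)" using assms(6) e by (auto simp: seg_def)
    have "a = b" using posts_inj[OF assms(1), of a b] a b steps_posts assms(2,3) by auto
    then show ?thesis using a b assms(4) by auto
  next
    case False
    then have c: "compound \<mu> e x P" using assms is_path_compound by blast
    have "m \<in> span (P i) Int span (P j)" using compound_seg[OF c] assms by simp
    then show ?thesis using compound_span[OF c assms(2-4)] by (auto split: if_splits)
  qed
  then show "j = i + 1" "m = mx (x j)" by auto
qed

lemma seg_neq: "is_path G (Path \<mu> e x P) ==> i \<in> steps e ==> mx (x i) ~= mx (x (i + 1))"
  using posts_inj[of \<mu> e x P i "i + 1"] by (auto simp: steps_posts)

lemma post_seg:
  assumes "is_path G (Path \<mu> e x P)" "i \<in> steps e" "j \<in> posts e" "mx (x j) \<in> seg x P i"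
  shows "j = i \<or> j = i + 1"
proof (rule ccontr)
  assume ne: "~ ?thesis"
  consider "j < i" | "i + 1 < j" using ne by linarith
  then show False
  proof cases
    case 1
    then have j: "j \<in> steps e" using assms steps_convex[of "j - 1" e i j] by (auto simp: mem_posts)
    then show False using seg_inter[OF assms(1) j assms(2) 1 _ assms(4)] seg_neq[OF assms(1) j]
      by (auto simp: seg_def)
  next
    case 2
    then have j: "j - 1 \<in> steps e" using assms steps_convex[of i e j "j - 1"] by (auto simp: mem_posts)
    have "i < j - 1" "mx (x j) \<in> seg x P (j - 1)" using 2 by (auto simp: seg_def)
    then show False using seg_inter[OF assms(1,2) j _ assms(4)] seg_neq[OF assms(1) j] by auto
  qed
qed

lemma mnodes_seg:
  assumes "is_path G (Path \<mu> e x P)"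
  shows "mnodes (Path \<mu> e x P) = (\<Union>i\<in>steps e. seg x P i)"
proof (intro equalityI subsetI)
  fix m assume "m \<in> mnodes (Path \<mu> e x P)"
  then consider i where "i \<in> posts e" "m = mx (x i)" | i where "i \<in> steps e" "m \<in> mnodes (P i)"
    unfolding mnodes_Path by auto
  then show "m \<in> (\<Union>i\<in>steps e. seg x P i)"
  proof cases
    case (1 i)
    then have "i \<in> steps e \<or> i - 1 \<in> steps e" by (auto simp: mem_posts)
    then show ?thesis using 1(2) by (auto simp: seg_def intro: bexI[of _ "i - 1"])
  next
    case 2
    then show ?thesis by (auto simp: seg_def)
  qed
next
  fix m assume "m \<in> (\<Union>i\<in>steps e. seg x P i)"
  then show "m \<in> mnodes (Path \<mu> e x P)" unfolding mnodes_Path seg_def using steps_posts by force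
qed

lemma is_rayE: assumes "is_ray G w" obtains \<mu> x P where "w = Path \<mu> Outward x P" "is_path G (Path \<mu> Outward x P)"
  using assms unfolding is_ray_def by blast

lemma is_ray_path: "is_ray G w ==> is_path G w" by (simp add: is_ray_def)

lemma is_ray_tail: assumes "is_ray G w" shows "is_ray G (tail k w)"
proof -
  obtain \<mu> x P where w: "w = Path \<mu> Outward x P" "is_path G w" using assms by (auto elim: is_rayE)
  then show ?thesis using sub_ray[of G \<mu> Outward x P Outward "int k"] by (auto simp: is_ray_def)
qed

lemma ray_tips [simp]: "is_ray G w ==> right_tip w" "is_ray G w ==> ~ left_tip w"
  by (auto elim!: is_rayE)

lemma end_node_ray: "is_ray G w ==> end_node G w = tip_node G w"
  by (auto elim!: is_rayE)

lemma branches_tail: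
  "path_branches (tail k (Path \<mu> Outward x P)) = (\<Union>i\<in>{int k..}. path_branches (P i))"
proof -
  note atLeast_image[of k]
  then show ?thesis by simp
qed

lemma mnodes_tail:
  assumes "is_path G (Path \<mu> Outward x P)"
  shows "mnodes (tail k (Path \<mu> Outward x P)) = (\<Union>i\<in>{int k..}. seg x P i)"
proof -
  have "is_ray G (tail k (Path \<mu> Outward x P))" using assms by (intro is_ray_tail) (simp add: is_ray_def)
  then have "is_path G (Path \<mu> Outward (%i. x (i + int k)) (%i. P (i + int k)))" by (simp add: is_ray_def)
  note mnodes_seg[OF this]
  moreover note atLeast_image[of k]
  moreover have "seg (%i. x (i + int k)) (%i. P (i + int k)) i = seg x P (i + int k)" for i
    by (simp add: seg_def algebra_simps)
  ultimately show ?thesis by simp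
qed

lemma branches_tail_mono: "is_ray G w ==> j \<le> k ==> path_branches (tail k w) <= path_branches (tail j w)"
  by (elim is_rayE) (simp only: branches_tail, force)

lemma branches_tail_subset: "is_ray G w ==> path_branches (tail k w) <= path_branches w"
  using branches_tail_mono[of w 0 k] by simp

lemma mnodes_tail_mono: "is_ray G w ==> j \<le> k ==> mnodes (tail k w) <= mnodes (tail j w)"
  by (elim is_rayE) (simp only: mnodes_tail, force)

lemma coincide_tail: "is_ray G w ==> coincide w (tail k w)"
  unfolding coincide_def path_rank_tail using branches_tail_subset[of w k] tail_0[of "tail k w"]
  by (metis order.refl)

lemma tip_node_tail: "is_ray G w ==> path_rank w < graph_rank G ==> tip_node G (tail k w) = tip_node G w"
  using tip_node_coincide[of w "tail k w"] is_ray_tail[of w k] coincide_tail[of w k] by simp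

text \<open>Two steps that share a node are adjacent, so a node on step i is left behind for good
  from step i + 2 on.\<close>

lemma ray_avoid:
  assumes "is_ray G w"
  shows "\<exists>k0. \<forall>k\<ge>k0. m ~: mnodes (tail k w)"
proof -
  obtain \<mu> x P where w: "w = Path \<mu> Outward x P" "is_path G (Path \<mu> Outward x P)" using assms by (elim is_rayE)
  show ?thesis
  proof (cases "\<exists>i\<ge>0. m \<in> seg x P i")
    case True
    then obtain i where i: "0 \<le> i" "m \<in> seg x P i" by blast
    have "m ~: seg x P j" if "i + 2 \<le> j" for j
      using seg_inter(1)[OF w(2), of i j m] i that by auto
    then have "m ~: mnodes (tail k w)" if "nat i + 2 \<le> k" for k
    proof -
      have "i + 2 \<le> int k" using that i(1) by linarith
      then show ?thesis unfolding w(1) mnodes_tail[OF w(2)] using \<open>!!j. i + 2 \<le> j ==> m ~: seg x P j\<close> by auto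
    qed
    then show ?thesis by blast
  next
    case False
    then have "m ~: mnodes (tail k w)" for k unfolding w(1) mnodes_tail[OF w(2)] by auto
    then show ?thesis by blast
  qed
qed

lemma ray_avoid_finite:
  assumes "is_ray G w" "finite Z"
  shows "\<exists>k0. \<forall>k\<ge>k0. mnodes (tail k w) Int Z = {}"
  using assms(2)
proof (induction Z rule: finite_induct)
  case (insert m Z)
  then obtain k0 k1 where "\<forall>k\<ge>k0. mnodes (tail k w) Int Z = {}" "\<forall>k\<ge>k1. m ~: mnodes (tail k w)"
    using ray_avoid[OF assms(1)] by blast
  then have "\<forall>k\<ge>max k0 k1. mnodes (tail k w) Int insert m Z = {}" by auto
  then show ?case by blast
qed auto

lemma right_ray: "is_path G (Path \<mu> e x P) ==> e = Outward \<or> e = Endless ==> is_ray G (Path \<mu> Outward x P)"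
  using sub_ray[of G \<mu> e x P Outward 0] by (auto simp: is_ray_def)

lemma left_ray:
  assumes "is_path G (Path \<mu> e x P)" "e = Inward \<or> e = Endless"
  shows "is_ray G (reverse (Path \<mu> Inward x P))"
proof -
  have "is_path G (Path \<mu> Inward x P)" using sub_ray[of G \<mu> e x P Inward 0] assms by auto
  from is_path_reverse[OF this] show ?thesis by (auto simp: is_ray_def)
qed

lemma right_tipE:
  assumes "is_path G p" "right_tip p"
  obtains w where "is_ray G w" "end_node G p = tip_node G w" "path_rank w = path_rank p"
    "path_branches w <= path_branches p" "mnodes w <= mnodes p"
proof -
  obtain \<mu> e x P where p: "p = Path \<mu> e x P" "e = Outward \<or> e = Endless"
    using assms by (cases p) auto
  have s: "steps Outward <= steps e" using p by auto
  then have "posts Outward <= posts e" by (auto simp: posts_def)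
  with s have "mnodes (Path \<mu> Outward x P) <= mnodes p" unfolding p mnodes_Path by blast
  moreover have "path_branches (Path \<mu> Outward x P) <= path_branches p" using s p by auto
  ultimately show ?thesis using that[of "Path \<mu> Outward x P"] p right_ray[of \<mu> e x P] assms(1) by auto
qed

lemma left_tipE:
  assumes "is_path G p" "left_tip p"
  obtains w where "is_ray G w" "start_node G p = tip_node G w" "path_rank w = path_rank p"
    "path_branches w <= path_branches p" "mnodes w <= mnodes p"
  using right_tipE[OF is_path_reverse[OF assms(1)]] assms by auto

lemma end_node_tip:
  assumes "is_path G p" "right_tip p" "path_rank p < graph_rank G"
  shows "end_node G p \<in> nodes G" "node_rank G (end_node G p) = tsuc (path_rank p)"
  using right_tipE[OF assms(1,2)] tip_node_props assms(3) by metis+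

lemma start_node_tip:
  assumes "is_path G p" "left_tip p" "path_rank p < graph_rank G"
  shows "start_node G p \<in> nodes G" "node_rank G (start_node G p) = tsuc (path_rank p)"
  using left_tipE[OF assms(1,2)] tip_node_props assms(3) by metis+

lemma post_rank_le:
  assumes "is_path G (Path \<mu> e x P)" "i \<in> posts e" shows "node_rank G (x i) \<le> \<mu>"
  using zero_posts(2)[of e x P i] compoundD(5)[OF is_path_compound, of \<mu> e x P i] assms
  by (cases "\<mu> = Fin 0") auto

lemma end_node_nontip:
  assumes "is_path G p" "~ right_tip p"
  shows "end_node G p \<in> nodes G" "node_rank G (end_node G p) \<le> path_rank p"
proof -
  show "end_node G p \<in> nodes G" using end_node_in path_nodes_subset assms by blast
  obtain \<mu> e x P where p: "p = Path \<mu> e x P" using assms(1) is_path_PathE by metis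
  have "last_index e \<in> posts e" using p assms is_path_extent[of \<mu> e x P] by (cases e) (auto simp: mem_posts)
  then show "node_rank G (end_node G p) \<le> path_rank p" using p assms post_rank_le[of \<mu> e x P] by auto
qed

lemma start_node_nontip:
  assumes "is_path G p" "~ left_tip p"
  shows "start_node G p \<in> nodes G" "node_rank G (start_node G p) \<le> path_rank p"
  using end_node_nontip[OF is_path_reverse[OF assms(1)]] assms(2) by auto

lemma proper_nodes:
  assumes "proper p" shows "start_node G p \<in> nodes G" "end_node G p \<in> nodes G"
  using assms start_node_tip(1) start_node_nontip(1) end_node_tip(1) end_node_nontip(1) unfolding proper_def by metis+

lemma proper_path: "proper p ==> is_path G p" by (simp add: proper_def)

lemma path_branches_subset: "is_path G p ==> path_branches p <= branches G"
proof (induction rule: is_path_induct)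
  case (zero e x P)
  then show ?case by fastforce
qed auto

lemma path_steps_nonempty: "is_path G (Path \<mu> e x P) ==> \<exists>i. i \<in> steps e"
  using is_path_extent[of \<mu> e x P] by (cases e) (auto intro: exI[of _ "-1"] exI[of _ 0])

lemma path_branches_nonempty: "is_path G p ==> path_branches p ~= {}"
proof (induction rule: is_path_induct)
  case (zero e x P)
  then obtain i where "i \<in> steps e" using path_steps_nonempty by blast
  then show ?case using zero(3) by fastforce
next
  case (compound \<mu> e x P)
  then show ?case using path_steps_nonempty by fastforce
qed

lemma branch_ends_mnodes: "is_path G p ==> b \<in> path_branches p ==> u \<in> ends G b ==> mx u \<in> mnodes p"
proof (induction rule: is_path_induct)
  case (zero e x P)
  then obtain i where i: "i \<in> steps e" "b \<in> path_branches (P i)" by auto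
  then have "ends G b = {x i, x (i + 1)}" using zero(3) by fastforce
  then show ?case using i zero(6) steps_posts[OF i(1)] by (auto simp: mnodes_Path)
next
  case (compound \<mu> e x P)
  then show ?case by (auto simp: mnodes_Path)
qed

text \<open>A ray may start in, or pass through, the maximal node that contains its own tip; its
  late tails avoid that node and have the same tip.\<close>

lemma proper_tail:
  assumes "is_ray G w" "path_rank w < graph_rank G"
  shows "\<exists>k0. \<forall>k\<ge>k0. proper (tail k w)"
proof -
  obtain k0 where k0: "\<forall>k\<ge>k0. mx (tip_node G w) ~: mnodes (tail k w)" using ray_avoid[OF assms(1)] by blast
  have "proper (tail k w)" if "k \<ge> k0" for k
  proof -
    have r: "is_ray G (tail k w)" using is_ray_tail assms by blast
    have e: "rend (tail k w) = mx (tip_node G w)" using end_node_ray[OF r] tip_node_tail[OF assms] by (simp add: rend_def)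
    have "lend (tail k w) \<in> mnodes (tail k w)" using lend_in r is_ray_path ray_tips by blast
    then show ?thesis using k0 that e r assms is_ray_path by (auto simp: proper_def)
  qed
  then show ?thesis by blast
qed

lemma rend_ray: "is_ray G w ==> rend w = mx (tip_node G w)"
  by (simp add: rend_def end_node_ray)

end

section \<open>Rays contained in paths\<close>

text \<open>Discrete connectedness of the convex index set. It is the reason why a path cannot pass
  from one set of branches to another without meeting a node common to both.\<close>

lemma steps_dichotomy:
  assumes "!!i. i \<in> steps e ==> A i \<or> B i"
    and "!!i. i \<in> steps e ==> i + 1 \<in> steps e ==> ~ (A i & B (i + 1)) & ~ (B i & A (i + 1))"
  shows "(\<forall>i\<in>steps e. A i) \<or> (\<forall>i\<in>steps e. B i)"
proof -
  have all: "\<forall>i\<in>steps e. C i"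
    if C: "!!i. i \<in> steps e ==> i + 1 \<in> steps e ==> C i = C (i + 1)" and i0: "i0 \<in> steps e" "C i0" for C i0
  proof
    fix j assume j: "j \<in> steps e"
    show "C j"
    proof (cases "i0 \<le> j")
      case True
      have "j \<in> steps e --> C j" using True
      proof (induction j rule: int_ge_induct)
        case (step j)
        then show ?case using C[of j] steps_convex[OF i0(1), of "j + 1" j] by auto
      qed (use i0 in simp)
      then show ?thesis using j by simp
    next
      case False
      then have "j \<le> i0" by simp
      then have "j \<in> steps e --> C j"
      proof (induction j rule: int_le_induct)
        case (step j)
        then show ?case using C[of "j - 1"] steps_convex[OF _ i0(1), of "j - 1" j] by auto
      qed (use i0 in simp)
      then show ?thesis using j by simp
    qed
  qed
  show ?thesis
  proof (cases "\<exists>i\<in>steps e. A i")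
    case True
    then obtain i where i: "i \<in> steps e" "A i" by blast
    show ?thesis using all[of A i] assms i by blast
  qed (use assms in blast)
qed

section \<open>Nodes determined by a set of branches\<close>

context nu_graph
begin

text \<open>Since coincidence of rays sees only branches, the nodes of a path have to be recovered
  from its branches: they are branch ends, or nodes holding tips of rays inside the set. The bound
  \<alpha> on the rank of these rays is what makes an induction on ranks possible.\<close>

definition cl :: "trank \<Rightarrow> 'b set \<Rightarrow> 'n set" where
  "cl \<alpha> B = {mx u | u b. b \<in> B & b \<in> branches G & u \<in> ends G b} Un
    {mx (tip_node G r) | r. is_ray G r & path_rank r < \<alpha> & path_rank r < graph_rank G & path_branches r <= B}"

lemma cl_branch: "b \<in> B ==> b \<in> branches G ==> u \<in> ends G b ==> mx u \<in> cl \<alpha> B"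
  unfolding cl_def by blast

lemma cl_ray: "is_ray G r ==> path_rank r < \<alpha> ==> path_rank r < graph_rank G ==> path_branches r <= B ==>
    mx (tip_node G r) \<in> cl \<alpha> B"
  unfolding cl_def by blast

lemma cl_cases:
  assumes "m \<in> cl \<alpha> B"
  obtains u b where "m = mx u" "b \<in> B" "b \<in> branches G" "u \<in> ends G b"
  | r where "m = mx (tip_node G r)" "is_ray G r" "path_rank r < \<alpha>" "path_rank r < graph_rank G" "path_branches r <= B"
  using assms unfolding cl_def by blast

lemma cl_mono: "A <= B ==> cl \<alpha> A <= cl \<alpha> B"
  unfolding cl_def by blast

lemma cl_empty [simp]: "cl \<alpha> {} = {}"
  using path_branches_nonempty is_ray_path unfolding cl_def by blast

lemma span_cl:
  assumes "proper p" "mnodes p <= cl \<alpha> (path_branches p)" "path_rank p < \<alpha>"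
  shows "span p <= cl \<alpha> (path_branches p)"
proof -
  have "lend p \<in> cl \<alpha> (path_branches p)"
  proof (cases "left_tip p")
    case True
    then obtain w where "is_ray G w" "start_node G p = tip_node G w" "path_rank w = path_rank p"
      "path_branches w <= path_branches p" using left_tipE assms(1) proper_path by metis
    then show ?thesis using cl_ray[of w \<alpha>] assms True by (auto simp: lend_def proper_def)
  qed (use lend_in assms proper_path in blast)
  moreover have "rend p \<in> cl \<alpha> (path_branches p)"
  proof (cases "right_tip p")
    case True
    then obtain w where "is_ray G w" "end_node G p = tip_node G w" "path_rank w = path_rank p"
      "path_branches w <= path_branches p" using right_tipE assms(1) proper_path by metis
    then show ?thesis using cl_ray[of w \<alpha>] assms True by (auto simp: rend_def proper_def)
  qed (use rend_in assms proper_path in blast)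
  ultimately show ?thesis using assms(2) by (auto simp: span_def)
qed

text \<open>The constituents have rank below \<alpha>, so the rays at their infinite ends are among
  those that the closure admits.\<close>

lemma mnodes_cl: "is_path G p ==> path_rank p \<le> \<alpha> ==> mnodes p <= cl \<alpha> (path_branches p)"
proof (induction rule: is_path_induct)
  case (zero e x P)
  show ?case
  proof
    fix m assume "m \<in> mnodes (Path (Fin 0) e x P)"
    then obtain i where i: "i \<in> steps e" "m \<in> seg x P i" using mnodes_seg[OF zero(1)] by blast
    then obtain b where b: "b \<in> branches G" "P i = Branch b" "ends G b = {x i, x (i + 1)}" using zero(3) by blast
    then have "b \<in> path_branches (Path (Fin 0) e x P)" using i(1) by force
    moreover obtain u where "u \<in> ends G b" "m = mx u" using i(2) b zero_piece[OF zero(1) i(1)] by (auto simp: seg_def)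
    ultimately show "m \<in> cl \<alpha> (path_branches (Path (Fin 0) e x P))" using cl_branch b(1) by blast
  qed
next
  case (compound \<mu> e x P)
  have "span (P i) <= cl \<alpha> (path_branches (Path \<mu> e x P))" if i: "i \<in> steps e" for i
  proof -
    have lt: "path_rank (P i) < \<alpha>" using compoundD(7)[OF compound(2) i] compound(4) by simp
    then have "span (P i) <= cl \<alpha> (path_branches (P i))"
      using compound(3)[OF i] compound_piece(3)[OF compound(2) i] by (intro span_cl) auto
    also have "\<dots> <= cl \<alpha> (path_branches (Path \<mu> e x P))" using i by (intro cl_mono) auto
    finally show ?thesis .
  qed
  then show ?case unfolding compound_mnodes[OF compound(2)] by blast
qed

text \<open>If two neighbouring steps lay in different sets, their common post would belong to both
  closures. So all steps lie in the same set; inside one constituent the same holds by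
  induction.\<close>

lemma separation:
  "is_path G p ==> path_rank p \<le> \<alpha> ==> path_branches p <= A Un B ==> cl \<alpha> A Int cl \<alpha> B Int mnodes p = {} ==>
    path_branches p <= A \<or> path_branches p <= B"
proof (induction rule: is_path_induct)
  case (zero e x P)
  let ?A = "%i. path_branches (P i) <= A" and ?B = "%i. path_branches (P i) <= B"
  have "(\<forall>i\<in>steps e. ?A i) \<or> (\<forall>i\<in>steps e. ?B i)"
  proof (rule steps_dichotomy)
    fix i assume i: "i \<in> steps e"
    then obtain b where "P i = Branch b" using zero(3) by blast
    then show "?A i \<or> ?B i" using zero(6) i by force
  next
    fix i assume i: "i \<in> steps e" "i + 1 \<in> steps e"
    obtain b c where b: "b \<in> branches G" "P i = Branch b" "ends G b = {x i, x (i + 1)}"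
      and c: "c \<in> branches G" "P (i + 1) = Branch c" "ends G c = {x (i + 1), x (i + 1 + 1)}"
      using zero(3) i by metis
    have "mx (x (i + 1)) \<in> mnodes (Path (Fin 0) e x P)" using i by (auto simp: mnodes_Path steps_posts)
    moreover have "mx (x (i + 1)) \<in> cl \<alpha> X" if "path_branches (P i) <= X" for X
      using that b cl_branch[of b X "x (i + 1)"] by auto
    moreover have "mx (x (i + 1)) \<in> cl \<alpha> X" if "path_branches (P (i + 1)) <= X" for X
      using that c cl_branch[of c X "x (i + 1)"] by auto
    ultimately show "~ (?A i & ?B (i + 1)) & ~ (?B i & ?A (i + 1))" using zero(7) by blast
  qed
  then show ?case by auto
next
  case (compound \<mu> e x P)
  note c = compound(2)
  let ?A = "%i. path_branches (P i) <= A" and ?B = "%i. path_branches (P i) <= B"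
  have sp: "span (P i) <= mnodes (Path \<mu> e x P)" if "i \<in> steps e" for i
    using compound_mnodes[OF c] that by blast
  have scl: "span (P i) <= cl \<alpha> X" if i: "i \<in> steps e" and X: "path_branches (P i) <= X" for i X
  proof -
    have lt: "path_rank (P i) < \<alpha>" using compoundD(7)[OF c i] compound(4) by simp
    then have "span (P i) <= cl \<alpha> (path_branches (P i))"
      using mnodes_cl[OF compoundD(6)[OF c i]] compound_piece(3)[OF c i] by (intro span_cl) auto
    then show ?thesis using cl_mono[OF X] by blast
  qed
  have "(\<forall>i\<in>steps e. ?A i) \<or> (\<forall>i\<in>steps e. ?B i)"
  proof (rule steps_dichotomy)
    fix i assume i: "i \<in> steps e"
    have "mnodes (P i) <= mnodes (Path \<mu> e x P)" using sp[OF i] by (auto simp: span_def)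
    then have "cl \<alpha> A Int cl \<alpha> B Int mnodes (P i) = {}" using compound(6) by blast
    moreover have "path_rank (P i) \<le> \<alpha>" using compoundD(7)[OF c i] compound(4) by simp
    moreover have "path_branches (P i) <= A Un B" using compound(5) i by auto
    ultimately show "?A i \<or> ?B i" using compound(3)[OF i] by blast
  next
    fix i assume i: "i \<in> steps e" "i + 1 \<in> steps e"
    have "mx (x (i + 1)) \<in> span (P i)" "mx (x (i + 1)) \<in> span (P (i + 1))"
      using compound_seg[OF c] i by (auto simp: seg_def)
    then show "~ (?A i & ?B (i + 1)) & ~ (?B i & ?A (i + 1))"
      using scl[OF i(1)] scl[OF i(2)] sp[OF i(1)] compound(6) by blast
  qed
  then show ?case by auto
qed

lemma ray_separation:
  assumes "is_ray G r" "path_rank r \<le> \<alpha>" "path_branches r <= A Un B" "finite (cl \<alpha> A Int cl \<alpha> B)"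
  shows "\<exists>k. path_branches (tail k r) <= A \<or> path_branches (tail k r) <= B"
proof -
  obtain k where "mnodes (tail k r) Int (cl \<alpha> A Int cl \<alpha> B) = {}"
    using ray_avoid_finite[OF assms(1,4)] by blast
  then have "path_branches (tail k r) <= A \<or> path_branches (tail k r) <= B"
    using assms branches_tail_subset[OF assms(1), of k]
    by (intro separation[of _ \<alpha>] is_ray_path is_ray_tail) auto
  then show ?thesis by blast
qed

text \<open>In general a ray could alternate between the two sets forever. If the closures have only
  finitely many common nodes, a tail avoids all of them and stays in one set, and it has the same
  tip.\<close>

lemma cl_union:
  assumes "finite (cl \<alpha> A Int cl \<alpha> B)"
  shows "cl \<alpha> (A Un B) <= cl \<alpha> A Un cl \<alpha> B"
proof
  fix m assume "m \<in> cl \<alpha> (A Un B)"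
  then show "m \<in> cl \<alpha> A Un cl \<alpha> B"
  proof (cases rule: cl_cases)
    case (1 u b)
    then show ?thesis using cl_branch by blast
  next
    case (2 r)
    then obtain k where "path_branches (tail k r) <= A \<or> path_branches (tail k r) <= B"
      using ray_separation[OF 2(2) order.strict_implies_order[OF 2(3)] 2(5) assms] by blast
    moreover have "m = mx (tip_node G (tail k r))" using tip_node_tail 2 by simp
    ultimately show ?thesis using cl_ray[OF is_ray_tail[OF 2(2), of k]] 2 by auto
  qed
qed

lemma branch_seg:
  assumes "is_path G (Path \<mu> e x P)" "i \<in> steps e" "b \<in> path_branches (P i)" "u \<in> ends G b"
  shows "mx u \<in> seg x P i"
proof (cases "\<mu> = Fin 0")
  case True
  then have "ends G b = {x i, x (i + 1)}" using is_path_zeroD(2)[of e x P] assms by fastforce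
  then show ?thesis using assms(4) by (auto simp: seg_def)
next
  case False
  then have "compound \<mu> e x P" using assms is_path_compound by blast
  then show ?thesis using branch_ends_mnodes[OF compoundD(6)] assms by (auto simp: seg_def)
qed

lemma branch_seg_subset:
  assumes "is_path G (Path \<mu> e x P)" "i \<in> steps e"
  shows "path_branches (P i) <= branches G" "path_branches (P i) ~= {}"
proof -
  have "path_branches (P i) <= branches G & path_branches (P i) ~= {}"
  proof (cases "\<mu> = Fin 0")
    case True
    then show ?thesis using is_path_zeroD(2)[of e x P] assms by fastforce
  next
    case False
    then have "compound \<mu> e x P" using assms is_path_compound by blast
    then show ?thesis using path_branches_subset path_branches_nonempty compoundD(6) assms by blast
  qed
  then show "path_branches (P i) <= branches G" "path_branches (P i) ~= {}" by auto
qed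

text \<open>The two ends of a branch lie in different maximal nodes, whereas two distinct steps have
  at most one node in common.\<close>

lemma piece_branches_disjoint:
  assumes "is_path G (Path \<mu> e x P)" "i \<in> steps e" "j \<in> steps e" "b \<in> path_branches (P i)" "b \<in> path_branches (P j)"
  shows "i = j"
proof -
  have False if ij: "i \<in> steps e" "j \<in> steps e" "i < j" "b \<in> path_branches (P i)" "b \<in> path_branches (P j)" for i j
  proof -
    have "b \<in> branches G" using branch_seg_subset assms(1) ij by blast
    then obtain u v where uv: "u \<in> nodes G" "v \<in> nodes G" "ends G b = {u, v}" "u ~= v" "node_rank G u = Fin 0" "node_rank G v = Fin 0"
      using ends_nodes by metis
    then have "mx u = mx (x j)" "mx v = mx (x j)"
      using seg_inter(2)[OF assms(1) ij(1,2,3)] branch_seg[OF assms(1) ij(1,4)] branch_seg[OF assms(1) ij(2,5)] by auto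
    then have "u = v" using mx_rank_eq uv by metis
    then show False using uv by simp
  qed
  then show ?thesis using assms by (metis linorder_neqE)
qed

lemma ray_not_single: assumes "is_ray G r" shows "~ path_branches r <= {b}"
proof
  assume s: "path_branches r <= {b}"
  obtain \<mu> x P where r: "r = Path \<mu> Outward x P" "is_path G (Path \<mu> Outward x P)" using assms by (elim is_rayE)
  have "path_branches (P 0) <= {b}" "path_branches (P 1) <= {b}" using s unfolding r(1) by (auto simp: UN_subset_iff)
  moreover have "path_branches (P 0) ~= {}" "path_branches (P 1) ~= {}" using branch_seg_subset(2)[OF r(2)] by auto
  ultimately have "b \<in> path_branches (P 0)" "b \<in> path_branches (P 1)" by auto
  then show False using piece_branches_disjoint[OF r(2), of 0 1] by simp
qed

text \<open>A ray of rank greater than that of the path satisfies neither alternative, so the claim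
  that rays inside a path are located also says that such rays do not exist.\<close>

definition located :: "('n, 'b) tpath \<Rightarrow> ('n, 'b) tpath \<Rightarrow> bool" where
  "located r p \<longleftrightarrow> path_rank r < path_rank p & mx (tip_node G r) \<in> mnodes p \<or>
    path_rank r = path_rank p & (left_tip p & mx (tip_node G r) = lend p \<or> right_tip p & mx (tip_node G r) = rend p)"

text \<open>The statement for the induction on \<alpha>. Closures at level \<alpha> involve only
  rays of rank below \<alpha>, so they can be computed from it when rays of rank \<alpha> itself are
  treated.\<close>

definition locates :: "trank \<Rightarrow> bool" where
  "locates \<alpha> \<longleftrightarrow> (\<forall>r p. is_ray G r --> path_rank r < graph_rank G --> path_rank r < \<alpha> --> proper p -->
    path_branches r <= path_branches p --> located r p)"

text \<open>The expected bound for \<open>cl \<alpha>\<close> of the branches of a path: the node at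
  an infinite end counts only if its tip has rank below \<alpha>.\<close>

definition ecl :: "trank \<Rightarrow> ('n, 'b) tpath \<Rightarrow> 'n set" where
  "ecl \<alpha> p = mnodes p Un {m. path_rank p < \<alpha> & (left_tip p & m = lend p \<or> right_tip p & m = rend p)}"

lemma cl_path: assumes "locates \<alpha>" "proper p" shows "cl \<alpha> (path_branches p) <= ecl \<alpha> p"
proof
  fix m assume "m \<in> cl \<alpha> (path_branches p)"
  then show "m \<in> ecl \<alpha> p"
  proof (cases rule: cl_cases)
    case (1 u b)
    then show ?thesis using branch_ends_mnodes proper_path[OF assms(2)] by (auto simp: ecl_def)
  next
    case (2 r)
    then have "located r p" using assms unfolding locates_def by blast
    then show ?thesis using 2 by (auto simp: located_def ecl_def)
  qed
qed

lemma ecl_span: "ecl \<alpha> p <= span p"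
  by (auto simp: ecl_def span_def)

lemma cl_piece:
  assumes "locates \<alpha>" "is_path G (Path \<mu> e x P)" "i \<in> steps e"
  shows "cl \<alpha> (path_branches (P i)) <= seg x P i"
proof (cases "\<mu> = Fin 0")
  case True
  then obtain b where b: "P i = Branch b" using is_path_zeroD(2)[of e x P] assms by blast
  show ?thesis
  proof
    fix m assume "m \<in> cl \<alpha> (path_branches (P i))"
    then show "m \<in> seg x P i"
      using branch_seg[OF assms(2,3)] ray_not_single b by (cases rule: cl_cases) auto
  qed
next
  case False
  then have c: "compound \<mu> e x P" using assms is_path_compound by blast
  show ?thesis using cl_path[OF assms(1) compound_piece(3)[OF c assms(3)]] ecl_span compound_seg[OF c assms(3)] by blast
qed

section \<open>The two sides of a post, and cutting a path at a branch\<close>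

definition lpart :: "extent \<Rightarrow> (int \<Rightarrow> ('n, 'b) tpath) \<Rightarrow> int \<Rightarrow> 'b set" where
  "lpart e P j = (\<Union>i\<in>{i \<in> steps e. i < j}. path_branches (P i))"

definition rpart :: "extent \<Rightarrow> (int \<Rightarrow> ('n, 'b) tpath) \<Rightarrow> int \<Rightarrow> 'b set" where
  "rpart e P j = (\<Union>i\<in>{i \<in> steps e. j \<le> i}. path_branches (P i))"

definition lsegs :: "extent \<Rightarrow> (int \<Rightarrow> 'n) \<Rightarrow> (int \<Rightarrow> ('n, 'b) tpath) \<Rightarrow> int \<Rightarrow> 'n set" where
  "lsegs e x P j = (\<Union>i\<in>{i \<in> steps e. i < j}. seg x P i)"

definition rsegs :: "extent \<Rightarrow> (int \<Rightarrow> 'n) \<Rightarrow> (int \<Rightarrow> ('n, 'b) tpath) \<Rightarrow> int \<Rightarrow> 'n set" where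
  "rsegs e x P j = (\<Union>i\<in>{i \<in> steps e. j \<le> i}. seg x P i)"

lemma lpart_Suc: "lpart e P (j + 1) = lpart e P j Un (if j \<in> steps e then path_branches (P j) else {})"
proof -
  have "{i \<in> steps e. i < j + 1} = {i \<in> steps e. i < j} Un (if j \<in> steps e then {j} else {})"
    by (auto simp: order_le_less)
  then show ?thesis by (auto simp: lpart_def split: if_splits)
qed

lemma lsegs_Suc: "lsegs e x P (j + 1) = lsegs e x P j Un (if j \<in> steps e then seg x P j else {})"
proof -
  have "{i \<in> steps e. i < j + 1} = {i \<in> steps e. i < j} Un (if j \<in> steps e then {j} else {})"
    by (auto simp: order_le_less)
  then show ?thesis by (auto simp: lsegs_def split: if_splits)
qed

lemma rpart_Suc: "rpart e P j = (if j \<in> steps e then path_branches (P j) else {}) Un rpart e P (j + 1)"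
proof -
  have "{i \<in> steps e. j \<le> i} = {i \<in> steps e. j + 1 \<le> i} Un (if j \<in> steps e then {j} else {})"
    by (auto simp: order_le_less add1_zle_eq)
  then show ?thesis by (auto simp: rpart_def split: if_splits)
qed

lemma parts_union: "path_branches (Path \<mu> e x P) = lpart e P j Un rpart e P j"
  by (auto simp: lpart_def rpart_def) (meson not_le)

lemma parts_disjoint:
  assumes "is_path G (Path \<mu> e x P)" "b \<in> lpart e P j" "b \<in> rpart e P j"
  shows False
  using assms(2,3) piece_branches_disjoint[OF assms(1)] unfolding lpart_def rpart_def by fastforce

lemma lsegs_post:
  assumes "is_path G (Path \<mu> e x P)" "j \<in> posts e" "mx (x j) \<in> lsegs e x P i" shows "j \<le> i"
  using assms(3) post_seg[OF assms(1) _ assms(2)] unfolding lsegs_def by fastforce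

lemma rsegs_post:
  assumes "is_path G (Path \<mu> e x P)" "j \<in> posts e" "mx (x j) \<in> rsegs e x P i" shows "i \<le> j"
  using assms(3) post_seg[OF assms(1) _ assms(2)] unfolding rsegs_def by fastforce

lemma lsegs_seg:
  assumes "is_path G (Path \<mu> e x P)" "m \<in> lsegs e x P i" "m \<in> seg x P j" "i \<le> j" "j \<in> steps e"
  shows "i = j & m = mx (x j)"
proof -
  obtain a where a: "a \<in> steps e" "a < i" "m \<in> seg x P a" using assms(2) by (auto simp: lsegs_def)
  then show ?thesis using seg_inter[OF assms(1) a(1) assms(5) _ a(3) assms(3)] assms(4) by auto
qed

lemma rsegs_seg:
  assumes "is_path G (Path \<mu> e x P)" "m \<in> rsegs e x P i" "m \<in> seg x P j" "j < i" "j \<in> steps e"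
  shows "i = j + 1 & m = mx (x (j + 1))"
proof -
  obtain a where a: "a \<in> steps e" "i \<le> a" "m \<in> seg x P a" using assms(2) by (auto simp: rsegs_def)
  then show ?thesis using seg_inter[OF assms(1,5) a(1) _ assms(3) a(3)] assms(4) by auto
qed

lemma lsegs_rsegs:
  assumes "is_path G (Path \<mu> e x P)" "m \<in> lsegs e x P i" "m \<in> rsegs e x P j" "i \<le> j"
  shows "i = j & m = mx (x j)"
proof -
  obtain b where b: "b \<in> steps e" "j \<le> b" "m \<in> seg x P b" using assms(3) by (auto simp: rsegs_def)
  then have "i = b & m = mx (x b)" using lsegs_seg[OF assms(1,2) b(3) _ b(1)] assms(4) by auto
  then show ?thesis using b assms(4) by auto
qed

lemma segs_mnodes:
  assumes "is_path G (Path \<mu> e x P)"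
  shows "lsegs e x P j <= mnodes (Path \<mu> e x P)" "rsegs e x P j <= mnodes (Path \<mu> e x P)"
  unfolding mnodes_seg[OF assms] lsegs_def rsegs_def by auto

text \<open>Induction on the post. Far to the left the branches are those of a proper tail of the
  ray at the left end, where \<open>locates\<close> applies; without a left tip there are none. Each
  further step shares at most two closure nodes with what precedes it, so \<open>cl_union\<close>
  adds it.\<close>

lemma cl_lpart:
  assumes T: "locates \<alpha>" and p: "is_path G (Path \<mu> e x P)" and tips: "left_tip (Path \<mu> e x P) ==> \<mu> < graph_rank G"
  shows "cl \<alpha> (lpart e P j) <= lsegs e x P j Un {m. left_tip (Path \<mu> e x P) & m = lend (Path \<mu> e x P)}"
proof -
  let ?E = "{m. left_tip (Path \<mu> e x P) & m = lend (Path \<mu> e x P)}"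
  have "\<exists>j0. \<forall>j\<le>j0. cl \<alpha> (lpart e P j) <= lsegs e x P j Un ?E"
  proof (cases "left_tip (Path \<mu> e x P)")
    case False
    then have "lpart e P j = {}" if "j \<le> 0" for j using that by (cases e) (auto simp: lpart_def)
    then show ?thesis by (intro exI[of _ 0]) auto
  next
    case True
    then have e: "e = Inward \<or> e = Endless" by auto
    define w where "w = reverse (Path \<mu> Inward x P)"
    have w: "is_ray G w" using left_ray[OF p e] by (simp add: w_def)
    have rw: "path_rank w < graph_rank G" using tips[OF True] by (simp add: w_def)
    obtain k0 where k0: "\<forall>k\<ge>k0. proper (tail k w)" using proper_tail[OF w rw] by blast
    have "cl \<alpha> (lpart e P j) <= lsegs e x P j Un ?E" if j: "j \<le> - int k0" for j
    proof -
      define k where "k = nat (- j)"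
      have k: "k \<ge> k0" "j = - int k" using j by (auto simp: k_def)
      \<comment> \<open>Step i of the outward ray is step -1 - i of the path.\<close>
      have ex: "(\<exists>i\<ge>int k. Q (- 1 - i)) \<longleftrightarrow> (\<exists>i\<in>steps e. i < j & Q i)" for Q
      proof
        assume "\<exists>i\<ge>int k. Q (- 1 - i)"
        then obtain i where "i \<ge> int k" "Q (-1 - i)" by blast
        then show "\<exists>i\<in>steps e. i < j & Q i" using e k by (intro bexI[of _ "-1 - i"]) auto
      next
        assume "\<exists>i\<in>steps e. i < j & Q i"
        then obtain i where "i < j" "Q i" by blast
        then show "\<exists>i\<ge>int k. Q (- 1 - i)" using k by (intro exI[of _ "-1 - i"]) auto
      qed
      have wf: "w = Path \<mu> Outward (%i. x (- i)) (%i. reverse (P (- 1 - i)))" by (simp add: w_def)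
      have pw: "is_path G (Path \<mu> Outward (%i. x (- i)) (%i. reverse (P (- 1 - i))))" using w wf is_ray_path by simp
      have br: "path_branches (tail k w) = lpart e P j"
        unfolding wf branches_tail using ex[of "%i. _ \<in> path_branches (P i)"] by (auto simp: lpart_def)
      have sg: "seg (%i. x (- i)) (%i. reverse (P (- 1 - i))) i = seg x P (- 1 - i)" for i
      proof -
        have a: "x (- (i + 1)) = x (- 1 - i)" "x (- 1 - i + 1) = x (- i)"
          by (rule arg_cong[of _ _ x], simp)+
        show ?thesis unfolding seg_def reverse_sets a by blast
      qed
      have mn: "mnodes (tail k w) = lsegs e x P j"
        unfolding wf mnodes_tail[OF pw] sg using ex[of "%i. _ \<in> seg x P i"] by (auto simp: lsegs_def)
      have "rend (tail k w) = lend (Path \<mu> e x P)"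
        using rend_ray[OF is_ray_tail[OF w]] tip_node_tail[OF w rw] e by (auto simp: lend_def w_def)
      then have "ecl \<alpha> (tail k w) <= lsegs e x P j Un ?E"
        using ray_tips(2)[OF is_ray_tail[OF w]] True mn by (auto simp: ecl_def)
      then show ?thesis using cl_path[OF T k0[rule_format, OF k(1)]] unfolding br by blast
    qed
    then show ?thesis by blast
  qed
  then obtain j0 where j0: "\<forall>j\<le>j0. cl \<alpha> (lpart e P j) <= lsegs e x P j Un ?E" by blast
  show ?thesis
  proof (cases "j \<le> j0")
    case False
    then have "j0 \<le> j" by simp
    then show ?thesis
    proof (induction j rule: int_ge_induct)
      case (step j)
      show ?case
      proof (cases "j \<in> steps e")
        case True
        have s: "cl \<alpha> (path_branches (P j)) <= seg x P j" by (rule cl_piece[OF T p True])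
        have "cl \<alpha> (lpart e P j) Int cl \<alpha> (path_branches (P j)) <= {mx (x j), lend (Path \<mu> e x P)}"
          using s step.IH lsegs_seg[OF p _ _ _ True] by blast
        then have "finite (cl \<alpha> (lpart e P j) Int cl \<alpha> (path_branches (P j)))" by (rule finite_subset) simp
        from cl_union[OF this] show ?thesis
          using s step.IH True unfolding lpart_Suc lsegs_Suc by auto
      next
        case False
        then show ?thesis using step.IH unfolding lpart_Suc lsegs_Suc by auto
      qed
    qed (use j0 in blast)
  qed (use j0 in blast)
qed

lemma lpart_flip: "lpart (flip e) (%i. reverse (P (last_index e - 1 - i))) j = rpart e P (last_index e - j)"
proof -
  let ?L = "last_index e"
  have "{i \<in> steps e. ?L - j \<le> i} = (%i. ?L - 1 - i) ` {i \<in> steps (flip e). i < j}"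
  proof (intro set_eqI iffI)
    fix i assume "i \<in> {i \<in> steps e. ?L - j \<le> i}"
    then show "i \<in> (%i. ?L - 1 - i) ` {i \<in> steps (flip e). i < j}"
      by (intro rev_image_eqI[of "?L - 1 - i"]) (auto simp: steps_flip)
  qed (auto simp: steps_flip)
  then show ?thesis unfolding lpart_def rpart_def by simp
qed

lemma seg_flip:
  "seg (%i. x (L - i)) (%i. reverse (P (L - 1 - i))) i = seg x P (L - 1 - i)"
proof -
  have a: "x (L - (i + 1)) = x (L - 1 - i)" "x (L - 1 - i + 1) = x (L - i)"
    by (rule arg_cong[of _ _ x], simp)+
  show ?thesis unfolding seg_def reverse_sets a by blast
qed

lemma lsegs_flip:
  "lsegs (flip e) (%i. x (last_index e - i)) (%i. reverse (P (last_index e - 1 - i))) j = rsegs e x P (last_index e - j)"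
proof -
  let ?L = "last_index e"
  have "{i \<in> steps e. ?L - j \<le> i} = (%i. ?L - 1 - i) ` {i \<in> steps (flip e). i < j}"
  proof (intro set_eqI iffI)
    fix i assume "i \<in> {i \<in> steps e. ?L - j \<le> i}"
    then show "i \<in> (%i. ?L - 1 - i) ` {i \<in> steps (flip e). i < j}"
      by (intro rev_image_eqI[of "?L - 1 - i"]) (auto simp: steps_flip)
  qed (auto simp: steps_flip)
  then show ?thesis unfolding lsegs_def rsegs_def seg_flip by simp
qed

lemma cl_rpart:
  assumes T: "locates \<alpha>" and p: "is_path G (Path \<mu> e x P)" and tips: "right_tip (Path \<mu> e x P) ==> \<mu> < graph_rank G"
  shows "cl \<alpha> (rpart e P j) <= rsegs e x P j Un {m. right_tip (Path \<mu> e x P) & m = rend (Path \<mu> e x P)}"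
proof -
  let ?p = "Path \<mu> e x P"
  have r: "reverse ?p = Path \<mu> (flip e) (%i. x (last_index e - i)) (%i. reverse (P (last_index e - 1 - i)))" by simp
  have "is_path G (Path \<mu> (flip e) (%i. x (last_index e - i)) (%i. reverse (P (last_index e - 1 - i))))"
    using is_path_reverse[OF p] unfolding r .
  from cl_lpart[OF T this, of "last_index e - j"] show ?thesis
    unfolding lpart_flip lsegs_flip r[symmetric] reverse_sets tip_reverse using tips by simp
qed

lemma left_post:
  assumes "is_path G (Path \<mu> e x P)" "~ left_tip (Path \<mu> e x P)"
  shows "0 \<in> steps e" "!!i. i \<in> steps e ==> 0 \<le> i" "lend (Path \<mu> e x P) = mx (x 0)"
proof -
  show "0 \<in> steps e" "lend (Path \<mu> e x P) = mx (x 0)"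
    using assms is_path_extent[OF assms(1)] by (cases e; auto simp: lend_def)+
  fix i assume "i \<in> steps e"
  then show "0 \<le> i" using assms by (cases e) auto
qed

lemma right_post:
  assumes "is_path G (Path \<mu> e x P)" "~ right_tip (Path \<mu> e x P)"
  shows "last_index e - 1 \<in> steps e" "!!i. i \<in> steps e ==> i \<le> last_index e - 1"
    "rend (Path \<mu> e x P) = mx (x (last_index e))"
proof -
  show "last_index e - 1 \<in> steps e" "rend (Path \<mu> e x P) = mx (x (last_index e))"
    using assms is_path_extent[OF assms(1)] by (cases e; auto simp: rend_def)+
  fix i assume "i \<in> steps e"
  then show "i \<le> last_index e - 1" using assms by (cases e) auto
qed

lemma tips_off:
  assumes "proper (Path \<mu> e x P)"
  shows "left_tip (Path \<mu> e x P) ==> lend (Path \<mu> e x P) ~: lsegs e x P i Un rsegs e x P i"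
    "right_tip (Path \<mu> e x P) ==> rend (Path \<mu> e x P) ~: lsegs e x P i Un rsegs e x P i"
    "i \<in> steps e ==> left_tip (Path \<mu> e x P) ==> lend (Path \<mu> e x P) ~: seg x P i"
    "i \<in> steps e ==> right_tip (Path \<mu> e x P) ==> rend (Path \<mu> e x P) ~: seg x P i"
    "lend (Path \<mu> e x P) ~= rend (Path \<mu> e x P)"
  using assms segs_mnodes[OF proper_path[OF assms]] mnodes_seg[OF proper_path[OF assms]]
  unfolding proper_def by blast+

text \<open>Lifts a splitting of one constituent to the whole path: everything before step i joins
  the left part, everything after it the right part. The conditions that the left part avoids the
  right post and the right part avoids the left post are what allows the next level of
  nesting.\<close>

lemma branch_split_step:
  assumes T: "locates \<alpha>" and pr: "proper (Path \<mu> e x P)" and i: "i \<in> steps e"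
    and L: "L <= path_branches (P i)" and R: "R <= path_branches (P i)"
    and LR: "cl \<alpha> L Int cl \<alpha> R = {}" and R0: "mx (x i) ~: cl \<alpha> R" and L0: "mx (x (i + 1)) ~: cl \<alpha> L"
  shows "cl \<alpha> (lpart e P i Un L) Int cl \<alpha> (R Un rpart e P (i + 1)) = {}"
    "lend (Path \<mu> e x P) ~: cl \<alpha> (R Un rpart e P (i + 1))"
    "rend (Path \<mu> e x P) ~: cl \<alpha> (lpart e P i Un L)"
proof -
  let ?p = "Path \<mu> e x P"
  have p: "is_path G ?p" using pr by (rule proper_path)
  define A where "A = lsegs e x P i Un {m. left_tip ?p & m = lend ?p}"
  define B where "B = rsegs e x P (i + 1) Un {m. right_tip ?p & m = rend ?p}"
  have A: "cl \<alpha> (lpart e P i) <= A" unfolding A_def using pr by (intro cl_lpart[OF T p]) (auto simp: proper_def)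
  have B: "cl \<alpha> (rpart e P (i + 1)) <= B" unfolding B_def using pr by (intro cl_rpart[OF T p]) (auto simp: proper_def)
  have S: "cl \<alpha> L <= seg x P i" "cl \<alpha> R <= seg x P i"
    using cl_piece[OF T p i] cl_mono[OF L, of \<alpha>] cl_mono[OF R, of \<alpha>] by blast+
  note off = tips_off[OF pr]
  have AS: "m = mx (x i)" if m: "m \<in> A" "m \<in> seg x P i" for m
  proof -
    have "m \<in> lsegs e x P i" using m off(3)[OF i] by (auto simp: A_def)
    then show ?thesis using lsegs_seg[OF p _ m(2) order.refl i] by blast
  qed
  have BS: "m = mx (x (i + 1))" if m: "m \<in> B" "m \<in> seg x P i" for m
  proof -
    have "m \<in> rsegs e x P (i + 1)" using m off(4)[OF i] by (auto simp: B_def)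
    then show ?thesis using rsegs_seg[OF p _ m(2) less_add_one i] by blast
  qed
  have AB: "A Int B = {}"
  proof -
    have "lsegs e x P i Int rsegs e x P (i + 1) = {}" using lsegs_rsegs[OF p, of _ i "i + 1"] by auto
    then show ?thesis using off(1)[of "i + 1"] off(2)[of i] off(5) unfolding A_def B_def by auto
  qed
  have AR: "A Int cl \<alpha> R = {}" using AS S(2) R0 by blast
  have LB: "cl \<alpha> L Int B = {}" using BS S(1) L0 by blast
  have "cl \<alpha> (lpart e P i) Int cl \<alpha> L <= {mx (x i)}" using A S(1) AS by blast
  then have "finite (cl \<alpha> (lpart e P i) Int cl \<alpha> L)" by (rule finite_subset) simp
  from cl_union[OF this] have UL: "cl \<alpha> (lpart e P i Un L) <= A Un cl \<alpha> L" using A by blast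
  have "cl \<alpha> R Int cl \<alpha> (rpart e P (i + 1)) <= {mx (x (i + 1))}" using B S(2) BS by blast
  then have "finite (cl \<alpha> R Int cl \<alpha> (rpart e P (i + 1)))" by (rule finite_subset) simp
  from cl_union[OF this] have UR: "cl \<alpha> (R Un rpart e P (i + 1)) <= cl \<alpha> R Un B" using B by blast
  show "cl \<alpha> (lpart e P i Un L) Int cl \<alpha> (R Un rpart e P (i + 1)) = {}"
    using UL UR AB AR LB LR by blast
  have "lend ?p ~: cl \<alpha> R Un B"
  proof (cases "left_tip ?p")
    case True
    then have "lend ?p ~: seg x P i" "lend ?p ~: rsegs e x P (i + 1)" using off(1)[of "i + 1"] off(3)[OF i] by auto
    then show ?thesis using off(5) S(2) by (auto simp: B_def)
  next
    case False
    note l = left_post[OF p False]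
    have z: "0 \<in> posts e" using l(1) by (simp add: steps_posts)
    have "lend ?p ~: cl \<alpha> R"
    proof
      assume "lend ?p \<in> cl \<alpha> R"
      then have m: "mx (x 0) \<in> cl \<alpha> R" unfolding l(3) .
      then have "0 = i \<or> 0 = i + 1" using post_seg[OF p i z] S(2) by blast
      then have "i = 0" using l(2)[OF i] by linarith
      then show False using m R0 by simp
    qed
    moreover have "lend ?p ~: rsegs e x P (i + 1)"
    proof
      assume "lend ?p \<in> rsegs e x P (i + 1)"
      then have "i + 1 \<le> 0" using rsegs_post[OF p z] unfolding l(3) by blast
      then show False using l(2)[OF i] by simp
    qed
    ultimately show ?thesis using off(5) unfolding B_def by simp
  qed
  then show "lend ?p ~: cl \<alpha> (R Un rpart e P (i + 1))" using UR by blast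
  have "rend ?p ~: A Un cl \<alpha> L"
  proof (cases "right_tip ?p")
    case True
    then have "rend ?p ~: seg x P i" "rend ?p ~: lsegs e x P i" using off(2)[of i] off(4)[OF i] by auto
    then show ?thesis using off(5) S(1) by (auto simp: A_def)
  next
    case False
    note l = right_post[OF p False]
    have z: "last_index e \<in> posts e" using l(1) by (simp add: mem_posts)
    have "rend ?p ~: cl \<alpha> L"
    proof
      assume "rend ?p \<in> cl \<alpha> L"
      then have m: "mx (x (last_index e)) \<in> cl \<alpha> L" unfolding l(3) .
      then have "last_index e = i \<or> last_index e = i + 1" using post_seg[OF p i z] S(1) by blast
      then have "last_index e = i + 1" using l(2)[OF i] by linarith
      then show False using m L0 by simp
    qed
    moreover have "rend ?p ~: lsegs e x P i"
    proof
      assume "rend ?p \<in> lsegs e x P i"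
      then have "last_index e \<le> i" using lsegs_post[OF p z] unfolding l(3) by blast
      then show False using l(2)[OF i] by simp
    qed
    ultimately show ?thesis using off(5) unfolding A_def by auto
  qed
  then show "rend ?p ~: cl \<alpha> (lpart e P i Un L)" using UL by blast
qed

lemma branches_decompose:
  assumes "i \<in> steps e"
  shows "path_branches (Path \<mu> e x P) = lpart e P i Un path_branches (P i) Un rpart e P (i + 1)"
  unfolding parts_union[of \<mu> e x P i] rpart_Suc[of e P i] using assms by auto

text \<open>Removing a branch cuts a path: a ray inside the path that misses the branch must stay on
  one side of it. At the innermost level both parts of the split step are empty, since the step is
  the branch itself.\<close>

lemma branch_split:
  assumes T: "locates \<alpha>"
  shows "is_path G p ==> proper p ==> b \<in> path_branches p ==> \<exists>L R. path_branches p - {b} <= L Un R &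
    L <= path_branches p & R <= path_branches p & cl \<alpha> L Int cl \<alpha> R = {} & lend p ~: cl \<alpha> R & rend p ~: cl \<alpha> L"
proof (induction rule: is_path_induct)
  case (zero e x P)
  then obtain i where i: "i \<in> steps e" "P i = Branch b" by fastforce
  have "path_branches (Path (Fin 0) e x P) - {b} <= (lpart e P i Un {}) Un ({} Un rpart e P (i + 1))"
    unfolding branches_decompose[OF i(1), of "Fin 0" x P] using i(2) by auto
  moreover have "lpart e P i Un {} <= path_branches (Path (Fin 0) e x P)"
    "{} Un rpart e P (i + 1) <= path_branches (Path (Fin 0) e x P)"
    unfolding branches_decompose[OF i(1), of "Fin 0" x P] by auto
  ultimately show ?case
    using branch_split_step[OF T zero(5) i(1), of "{}" "{}"]
    by (intro exI[of _ "lpart e P i Un {}"] exI[of _ "{} Un rpart e P (i + 1)"]) simp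
next
  case (compound \<mu> e x P)
  then obtain i where i: "i \<in> steps e" "b \<in> path_branches (P i)" by auto
  note c = compound_piece[OF compound(2) i(1)]
  obtain L R where LR: "path_branches (P i) - {b} <= L Un R" "L <= path_branches (P i)" "R <= path_branches (P i)"
    "cl \<alpha> L Int cl \<alpha> R = {}" "mx (x i) ~: cl \<alpha> R" "mx (x (i + 1)) ~: cl \<alpha> L"
    using compound(3)[OF i(1) c(3) i(2)] unfolding c(1,2) by blast
  have "path_branches (Path \<mu> e x P) - {b} <= (lpart e P i Un L) Un (R Un rpart e P (i + 1))"
    unfolding branches_decompose[OF i(1), of \<mu> x P] using LR(1) by auto
  moreover have "lpart e P i Un L <= path_branches (Path \<mu> e x P)"
    "R Un rpart e P (i + 1) <= path_branches (Path \<mu> e x P)"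
    unfolding branches_decompose[OF i(1), of \<mu> x P] using LR by auto
  ultimately show ?case
    using branch_split_step[OF T compound(4) i(1) LR(2-6)]
    by (intro exI[of _ "lpart e P i Un L"] exI[of _ "R Un rpart e P (i + 1)"]) simp
qed

section \<open>The tip of a ray that uses only branches of a path\<close>

lemma Arrow_neq_tsuc [simp]: "Arrow_Omega ~= tsuc \<alpha>"
  by (rule not_sym) (rule tsuc_neq(1))

lemma arrow_rank_ge:
  assumes "is_path G (Path Arrow_Omega e x P)" "e = Outward \<or> e = Endless"
  shows "Fin k \<le> node_rank G (x (int k))"
  using assms(1)
proof cases
  case limit
  show ?thesis
  proof (induction k)
    case (Suc k)
    have "node_rank G (x (int k)) < node_rank G (x (int k + 1))"
      using limit(4) assms(2) by auto
    moreover have "node_rank G (x (int k + 1)) < Arrow_Omega" using limit(3) assms(2) by (auto simp: posts_def)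
    ultimately obtain a b where "node_rank G (x (int k)) = Fin a" "node_rank G (x (int k + 1)) = Fin b"
      using less_Arrow_iff order.strict_trans by metis
    then show ?case
      using Suc \<open>node_rank G (x (int k)) < node_rank G (x (int k + 1))\<close> by (simp add: add.commute)
  qed simp
qed (auto simp: tip_rank_iff)

text \<open>An interior post of rank above \<alpha> is reached by a tip of rank at least \<alpha>.
  In a path of non-arrow rank \<kappa> all interior posts have rank \<kappa>; in an arrow path the
  ranks of the posts exceed every finite rank.\<close>

lemma reach:
  assumes p: "is_path G (Path \<kappa> e x P)" and e: "e = Outward \<or> e = Endless" and \<alpha>: "\<alpha> < \<kappa>"
  shows "\<exists>j0\<ge>1. \<forall>j\<ge>j0. (right_tip (P (j - 1)) & \<alpha> \<le> path_rank (P (j - 1))) \<or> (left_tip (P j) & \<alpha> \<le> path_rank (P j))"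
proof -
  have "\<kappa> ~= Fin 0" using \<alpha> by (auto simp: leD)
  then have c: "compound \<kappa> e x P" using p is_path_compound by blast
  have st: "j \<in> steps e" "j - 1 \<in> steps e" if "j \<ge> 1" for j using e that by auto
  have key: "(right_tip (P (j - 1)) & \<alpha> \<le> path_rank (P (j - 1))) \<or> (left_tip (P j) & \<alpha> \<le> path_rank (P j))"
    if "j \<ge> 1" "\<alpha> < node_rank G (x j)" for j
  proof -
    have "reached_by_tip e P (node_rank G (x j)) j"
      using c st[OF that(1)] that(1) unfolding compound_def by auto
    then show ?thesis using that(2) less_tsuc_iff by (auto simp: reached_by_tip_def tip_rank_iff)
  qed
  show ?thesis
  proof (cases "\<kappa> = Arrow_Omega")
    case False
    then have "\<alpha> < node_rank G (x j)" if "j \<ge> 1" for j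
      using c st[OF that] \<alpha> unfolding compound_def by auto
    then show ?thesis using key by blast
  next
    case True
    then obtain a where a: "\<alpha> = Fin a" using \<alpha> by (auto simp: less_Arrow_iff)
    have "\<alpha> < node_rank G (x j)" if "j \<ge> int a + 1" for j
    proof -
      have "Fin (nat j) \<le> node_rank G (x j)" using arrow_rank_ge[of e x P "nat j"] p e True that by simp
      moreover have "\<alpha> < Fin (nat j)" using a that by simp
      ultimately show ?thesis by (rule order.strict_trans2[rotated])
    qed
    then show ?thesis using key by (intro exI[of _ "int a + 1"]) auto
  qed
qed

text \<open>Treats a ray whose tails pass every post of the path on the way to the right. Such a ray
  can only be another representative of the right tip.\<close>

lemma cofinal_ray:
  assumes T: "locates (path_rank r)" and Q: "proper (Path \<kappa> e x P)"
    and r: "is_ray G r" "path_rank r < graph_rank G" "path_branches r <= path_branches (Path \<kappa> e x P)"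
    and cof: "!!j. \<exists>k. path_branches (tail k r) <= rpart e P j"
  shows "path_rank r = \<kappa> & right_tip (Path \<kappa> e x P) & mx (tip_node G r) = rend (Path \<kappa> e x P) &
    coincide r (Path \<kappa> Outward x P)"
proof -
  let ?Q = "Path \<kappa> e x P" and ?\<alpha> = "path_rank r"
  have p: "is_path G ?Q" using Q by (rule proper_path)
  note off = tips_off[OF Q]
  have ne: "path_branches (tail k r) ~= {}" for k
    using path_branches_nonempty is_ray_path is_ray_tail r(1) by blast
  have rt: "right_tip ?Q"
  proof (rule ccontr)
    assume "~ right_tip ?Q"
    from right_post(2)[OF p this] have "rpart e P (last_index e) = {}" by (force simp: rpart_def)
    then show False using cof[of "last_index e"] ne by auto
  qed
  then have e: "e = Outward \<or> e = Endless" by simp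
  have A: "cl ?\<alpha> (lpart e P j) <= lsegs e x P j Un {m. left_tip ?Q & m = lend ?Q}" for j
    using Q by (intro cl_lpart[OF T p]) (auto simp: proper_def)
  have B: "cl ?\<alpha> (rpart e P j) <= rsegs e x P j Un {m. right_tip ?Q & m = rend ?Q}" for j
    using Q by (intro cl_rpart[OF T p]) (auto simp: proper_def)
  have AB: "cl ?\<alpha> (lpart e P j) Int cl ?\<alpha> (rpart e P j) <= {mx (x j)}" for j
    using A[of j] B[of j] lsegs_rsegs[OF p, of _ j j] off(1)[of j] off(2)[of j] off(5) by blast
  have st: "j \<in> steps e" "j - 1 \<in> steps e" if "j \<ge> 1" for j using e that by auto
  \<comment> \<open>Otherwise far posts are reached by tips of rank at least \<alpha>, which the
    closure at level \<alpha> does not see. Each far post then separates its two sides, so the whole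
    ray lies to the right of all of them; but a branch of the ray has a definite position in the
    path.\<close>
  have "~ ?\<alpha> < \<kappa>"
  proof
    assume lt: "?\<alpha> < \<kappa>"
    then have "\<kappa> ~= Fin 0" by (auto simp: leD)
    then have c: "compound \<kappa> e x P" using p is_path_compound by blast
    from reach[OF p e lt] obtain j0 where j0: "j0 \<ge> 1" "!!j. j \<ge> j0 ==>
      (right_tip (P (j - 1)) & ?\<alpha> \<le> path_rank (P (j - 1))) \<or> (left_tip (P j) & ?\<alpha> \<le> path_rank (P j))" by blast
    have empty: "cl ?\<alpha> (lpart e P j) Int cl ?\<alpha> (rpart e P j) = {}" if j: "j \<ge> j0" for j
    proof -
      have s: "j \<in> steps e" "j - 1 \<in> steps e" using st j j0(1) by auto
      have jp: "j \<in> posts e" using s by (simp add: mem_posts)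
      have mj: "mx (x j) \<in> mnodes ?Q" using jp by (auto simp: mnodes_Path)
      then have ml: "left_tip ?Q ==> mx (x j) ~= lend ?Q" and mr: "mx (x j) ~= rend ?Q"
        using Q rt by (auto simp: proper_def)
      from j0(2)[OF j] have "mx (x j) ~: cl ?\<alpha> (lpart e P j) \<or> mx (x j) ~: cl ?\<alpha> (rpart e P j)"
      proof
        assume tp: "right_tip (P (j - 1)) & ?\<alpha> \<le> path_rank (P (j - 1))"
        note cp = compound_piece[OF c s(2)]
        have "cl ?\<alpha> (path_branches (P (j - 1))) <= mnodes (P (j - 1))"
          using cl_path[OF T cp(3)] tp by (auto simp: ecl_def)
        moreover have "mx (x j) ~: mnodes (P (j - 1))" using cp tp by (auto simp: proper_def)
        ultimately have 1: "mx (x j) ~: cl ?\<alpha> (path_branches (P (j - 1)))" by blast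
        have 2: "mx (x j) ~: cl ?\<alpha> (lpart e P (j - 1))"
          using A[of "j - 1"] lsegs_post[OF p jp, of "j - 1"] ml by auto
        have "cl ?\<alpha> (lpart e P (j - 1)) Int cl ?\<alpha> (path_branches (P (j - 1))) <= {mx (x (j - 1)), lend ?Q}"
          using A[of "j - 1"] cl_piece[OF T p s(2)] lsegs_seg[OF p _ _ _ s(2), of _ "j - 1"] by blast
        then have "finite (cl ?\<alpha> (lpart e P (j - 1)) Int cl ?\<alpha> (path_branches (P (j - 1))))"
          by (rule finite_subset) simp
        from cl_union[OF this] have "mx (x j) ~: cl ?\<alpha> (lpart e P j)"
          using 1 2 lpart_Suc[of e P "j - 1"] s(2) by auto
        then show ?thesis by simp
      next
        assume tp: "left_tip (P j) & ?\<alpha> \<le> path_rank (P j)"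
        note cp = compound_piece[OF c s(1)]
        have "cl ?\<alpha> (path_branches (P j)) <= mnodes (P j)"
          using cl_path[OF T cp(3)] tp by (auto simp: ecl_def)
        moreover have "mx (x j) ~: mnodes (P j)" using cp tp by (auto simp: proper_def)
        ultimately have 1: "mx (x j) ~: cl ?\<alpha> (path_branches (P j))" by blast
        have 2: "mx (x j) ~: cl ?\<alpha> (rpart e P (j + 1))"
          using B[of "j + 1"] rsegs_post[OF p jp, of "j + 1"] mr by auto
        have "cl ?\<alpha> (path_branches (P j)) Int cl ?\<alpha> (rpart e P (j + 1)) <= {mx (x (j + 1)), rend ?Q}"
          using B[of "j + 1"] cl_piece[OF T p s(1)] rsegs_seg[OF p _ _ _ s(1), of _ "j + 1"] by auto
        then have "finite (cl ?\<alpha> (path_branches (P j)) Int cl ?\<alpha> (rpart e P (j + 1)))"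
          by (rule finite_subset) simp
        from cl_union[OF this] have "mx (x j) ~: cl ?\<alpha> (rpart e P j)"
          using 1 2 rpart_Suc[of e P j] s(1) by auto
        then show ?thesis by simp
      qed
      then show ?thesis using AB[of j] by blast
    qed
    have inB: "path_branches r <= rpart e P j" if j: "j \<ge> j0" for j
    proof -
      have "path_branches r <= lpart e P j \<or> path_branches r <= rpart e P j"
        using r(3) empty[OF j] unfolding parts_union[of \<kappa> e x P j]
        by (intro separation[OF is_ray_path[OF r(1)] order.refl]) auto
      moreover have "~ path_branches r <= lpart e P j"
      proof
        assume l: "path_branches r <= lpart e P j"
        obtain k b where "path_branches (tail k r) <= rpart e P j" "b \<in> path_branches (tail k r)"
          using cof[of j] ne by fast
        then show False using l branches_tail_subset[OF r(1)] parts_disjoint[OF p, of b j] by blast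
      qed
      ultimately show ?thesis by blast
    qed
    obtain b where b: "b \<in> path_branches r" using ne[of 0] by auto
    then obtain i where i: "i \<in> steps e" "b \<in> path_branches (P i)" using r(3) by auto
    obtain i' where i': "i' \<in> steps e" "max j0 (i + 1) \<le> i'" "b \<in> path_branches (P i')"
      using inB[of "max j0 (i + 1)"] b by (auto simp: rpart_def)
    then show False using piece_branches_disjoint[OF p i(1) i'(1) i(2) i'(3)] by simp
  qed
  \<comment> \<open>Otherwise far posts of the ray are reached by tips of rank at least \<kappa> of
    rays inside the path. By \<open>locates\<close> these tips lie at the two ends of the path,
    where three different posts have no room.\<close>
  moreover have "~ \<kappa> < ?\<alpha>"
  proof
    assume lt: "\<kappa> < ?\<alpha>"
    obtain y R where ry: "r = Path ?\<alpha> Outward y R" "is_path G (Path ?\<alpha> Outward y R)"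
      using r(1) by (elim is_rayE) auto
    have "?\<alpha> ~= Fin 0" using lt by (auto simp: leD)
    then have c: "compound ?\<alpha> Outward y R" using ry is_path_compound by blast
    from reach[OF ry(2) _ lt] obtain j0 where j0: "j0 \<ge> 1" "!!j. j \<ge> j0 ==>
      (right_tip (R (j - 1)) & \<kappa> \<le> path_rank (R (j - 1))) \<or> (left_tip (R j) & \<kappa> \<le> path_rank (R j))" by blast
    have tipw: "mx (tip_node G w) = lend ?Q \<or> mx (tip_node G w) = rend ?Q"
      if w: "is_ray G w" "path_rank w = path_rank (R i)" "path_branches w <= path_branches (R i)"
        and i: "i \<ge> 0" "\<kappa> \<le> path_rank (R i)" for w i
    proof -
      have is0: "i \<in> steps Outward" using i by simp
      have "path_branches (R i) <= path_branches r" using ry(1) is0 by (metis UN_upper path_branches.simps(2))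
      then have b: "path_branches w <= path_branches ?Q" using w r(3) by blast
      have "path_rank w < ?\<alpha>" using compoundD(7)[OF c is0] w by simp
      moreover from this have "path_rank w < graph_rank G" using r(2) by simp
      ultimately have "located w ?Q" using T Q w(1) b unfolding locates_def by blast
      then show ?thesis using i(2) w(2) by (auto simp: located_def)
    qed
    have "mx (y j) = lend ?Q \<or> mx (y j) = rend ?Q" if j: "j \<ge> j0" for j
    proof -
      have s: "j \<in> steps Outward" "j - 1 \<in> steps Outward" using j j0(1) by auto
      from j0(2)[OF j] show ?thesis
      proof
        assume t: "right_tip (R (j - 1)) & \<kappa> \<le> path_rank (R (j - 1))"
        then obtain w where w: "is_ray G w" "end_node G (R (j - 1)) = tip_node G w"
          "path_rank w = path_rank (R (j - 1))" "path_branches w <= path_branches (R (j - 1))"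
          using right_tipE[OF compoundD(6)[OF c s(2)]] by metis
        have "mx (y j) = mx (tip_node G w)" using compound_piece(2)[OF c s(2)] w(2) by (simp add: rend_def)
        then show ?thesis using tipw[OF w(1,3,4)] t j j0(1) by simp
      next
        assume t: "left_tip (R j) & \<kappa> \<le> path_rank (R j)"
        then obtain w where w: "is_ray G w" "start_node G (R j) = tip_node G w"
          "path_rank w = path_rank (R j)" "path_branches w <= path_branches (R j)"
          using left_tipE[OF compoundD(6)[OF c s(1)]] by metis
        have "mx (y j) = mx (tip_node G w)" using compound_piece(1)[OF c s(1)] w(2) by (simp add: lend_def)
        then show ?thesis using tipw[OF w(1,3,4)] t j j0(1) by simp
      qed
    qed
    from this[of j0] this[of "j0 + 1"] this[of "j0 + 2"]
    have "mx (y j0) = mx (y (j0 + 1)) \<or> mx (y j0) = mx (y (j0 + 2)) \<or> mx (y (j0 + 1)) = mx (y (j0 + 2))" by auto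
    then show False
      using compound_posts[OF c, of j0 "j0 + 1"] compound_posts[OF c, of j0 "j0 + 2"]
        compound_posts[OF c, of "j0 + 1" "j0 + 2"] j0(1) by (auto simp: mem_posts)
  qed
  ultimately have eq: "?\<alpha> = \<kappa>" by simp
  define w where "w = Path \<kappa> Outward x P"
  have w: "is_ray G w" using right_ray[OF p e] by (simp add: w_def)
  have B0: "rpart e P (int j) = path_branches (tail j w)" for j
  proof -
    have "{i \<in> steps e. int j \<le> i} = {int j..}" using e by auto
    then show ?thesis unfolding w_def branches_tail rpart_def by simp
  qed
  obtain b0 i0 where b0: "b0 \<in> path_branches r" "i0 \<in> steps e" "b0 \<in> path_branches (P i0)"
  proof -
    obtain b0 where "b0 \<in> path_branches r" using ne[of 0] by auto
    moreover from this obtain i0 where "i0 \<in> steps e" "b0 \<in> path_branches (P i0)" using r(3) by auto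
    ultimately show ?thesis using that by blast
  qed
  \<comment> \<open>If the ray missed a branch b beyond step i0, splitting the path at b would leave
    it on one side, although it contains b0 before b and has tails after b.\<close>
  have "path_branches (tail (nat (i0 + 1)) w) <= path_branches r"
  proof
    fix b assume "b \<in> path_branches (tail (nat (i0 + 1)) w)"
    then obtain j where j: "j \<in> steps e" "int (nat (i0 + 1)) \<le> j" "b \<in> path_branches (P j)"
      unfolding B0[symmetric] rpart_def by auto
    have ij: "i0 < j" using j(2) by linarith
    show "b \<in> path_branches r"
    proof (rule ccontr)
      assume nb: "b ~: path_branches r"
      have "\<exists>L R. path_branches (P j) - {b} <= L Un R & L <= path_branches (P j) & R <= path_branches (P j) &
        cl ?\<alpha> L Int cl ?\<alpha> R = {} & mx (x j) ~: cl ?\<alpha> R & mx (x (j + 1)) ~: cl ?\<alpha> L"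
      proof (cases "\<kappa> = Fin 0")
        case True
        then obtain c where "P j = Branch c" using is_path_zeroD(2)[of e x P] p j(1) by blast
        then show ?thesis using j(3) by (intro exI[of _ "{}"]) auto
      next
        case False
        then have "compound \<kappa> e x P" using p is_path_compound by blast
        note cp = compound_piece[OF this j(1)]
        show ?thesis using branch_split[OF T proper_path[OF cp(3)] cp(3) j(3)] unfolding cp(1,2) .
      qed
      then obtain L R where LR: "path_branches (P j) - {b} <= L Un R" "L <= path_branches (P j)"
        "R <= path_branches (P j)" "cl ?\<alpha> L Int cl ?\<alpha> R = {}" "mx (x j) ~: cl ?\<alpha> R" "mx (x (j + 1)) ~: cl ?\<alpha> L"
        by blast
      let ?L = "lpart e P j Un L" and ?R = "R Un rpart e P (j + 1)"
      have dis: "cl ?\<alpha> ?L Int cl ?\<alpha> ?R = {}" using branch_split_step(1)[OF T Q j(1) LR(2-6)] .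
      have sub: "?L Un ?R <= branches G"
        using path_branches_subset[OF p] LR(2,3) unfolding branches_decompose[OF j(1), of \<kappa> x P] by blast
      have nodis: False if cL: "c \<in> ?L" and cR: "c \<in> ?R" for c
      proof -
        have cb: "c \<in> branches G" using sub cL by blast
        then obtain u where u: "u \<in> ends G c" using ends_nodes[of c] by blast
        show False using dis cl_branch[OF cL cb u, of ?\<alpha>] cl_branch[OF cR cb u, of ?\<alpha>] by blast
      qed
      have "path_branches r <= ?L \<or> path_branches r <= ?R"
        using r(3) nb dis LR(1) unfolding branches_decompose[OF j(1), of \<kappa> x P]
        by (intro separation[OF is_ray_path[OF r(1)] order.refl]) auto
      moreover have "b0 \<in> ?L" using b0 ij by (auto simp: lpart_def)
      ultimately have rL: "path_branches r <= ?L" using nodis b0(1) by blast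
      obtain k c where "path_branches (tail k r) <= rpart e P (j + 1)" "c \<in> path_branches (tail k r)"
        using cof[of "j + 1"] ne by fast
      then show False using nodis[of c] rL branches_tail_subset[OF r(1)] by blast
    qed
  qed
  moreover have "\<exists>k. path_branches (tail k r) <= path_branches w" using cof[of 0] B0[of 0] by simp
  moreover have "path_rank r = path_rank w" using eq by (simp add: w_def)
  ultimately have co: "coincide r w" unfolding coincide_def by blast
  then have "tip_node G r = tip_node G w" using tip_node_coincide r w by blast
  then have "mx (tip_node G r) = rend ?Q" using e by (auto simp: rend_def w_def)
  then show ?thesis using eq rt co unfolding w_def by blast
qed

lemma rpart_flip: "rpart (flip e) (%i. reverse (P (last_index e - 1 - i))) j = lpart e P (last_index e - j)"
proof -
  let ?L = "last_index e"
  have "{i \<in> steps e. i < ?L - j} = (%i. ?L - 1 - i) ` {i \<in> steps (flip e). j \<le> i}"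
  proof (intro set_eqI iffI)
    fix i assume "i \<in> {i \<in> steps e. i < ?L - j}"
    then show "i \<in> (%i. ?L - 1 - i) ` {i \<in> steps (flip e). j \<le> i}"
      by (intro rev_image_eqI[of "?L - 1 - i"]) (auto simp: steps_flip)
  qed (auto simp: steps_flip)
  then show ?thesis unfolding lpart_def rpart_def by simp
qed

text \<open>A ray that settles in no single constituent must run off to one end of the path; the
  left end is reduced to the right one by reversal.\<close>

lemma localize:
  assumes T: "locates (path_rank r)" and Q: "proper (Path \<kappa> e x P)"
    and r: "is_ray G r" "path_rank r < graph_rank G" "path_branches r <= path_branches (Path \<kappa> e x P)"
    and nowhere: "~ (\<exists>i\<in>steps e. \<exists>k. path_branches (tail k r) <= path_branches (P i))"
  shows "located r (Path \<kappa> e x P)"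
proof -
  let ?Q = "Path \<kappa> e x P" and ?\<alpha> = "path_rank r"
  have p: "is_path G ?Q" using Q by (rule proper_path)
  note off = tips_off[OF Q]
  let ?A = "%j. \<exists>k. path_branches (tail k r) <= lpart e P j"
  let ?B = "%j. \<exists>k. path_branches (tail k r) <= rpart e P j"
  have A: "cl ?\<alpha> (lpart e P j) <= lsegs e x P j Un {m. left_tip ?Q & m = lend ?Q}" for j
    using Q by (intro cl_lpart[OF T p]) (auto simp: proper_def)
  have B: "cl ?\<alpha> (rpart e P j) <= rsegs e x P j Un {m. right_tip ?Q & m = rend ?Q}" for j
    using Q by (intro cl_rpart[OF T p]) (auto simp: proper_def)
  have clash: False if a: "?A (j + 1)" and b: "?B j" for j
  proof -
    obtain k l where kl: "path_branches (tail k r) <= lpart e P (j + 1)" "path_branches (tail l r) <= rpart e P j"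
      using a b by blast
    define m where "m = max k l"
    have m: "path_branches (tail m r) <= lpart e P (j + 1)" "path_branches (tail m r) <= rpart e P j"
      using kl branches_tail_mono[OF r(1), of k m] branches_tail_mono[OF r(1), of l m] by (auto simp: m_def)
    have "path_branches (tail m r) Int lpart e P j = {}" using parts_disjoint[OF p] m(2) by blast
    then have s: "path_branches (tail m r) <= (if j \<in> steps e then path_branches (P j) else {})"
      using m(1) unfolding lpart_Suc by blast
    moreover have "path_branches (tail m r) ~= {}" using path_branches_nonempty is_ray_path is_ray_tail r(1) by blast
    ultimately show False using nowhere by (auto split: if_splits)
  qed
  have lmono: "lpart e P j <= lpart e P (j + 1)" and rmono: "rpart e P (j + 1) <= rpart e P j" for j
    unfolding lpart_def rpart_def by force+
  \<comment> \<open>All integers serve as cut positions, whatever the extent of the path. A change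
    of side between j and j + 1 would confine a tail to step j, which is excluded.\<close>
  have "(\<forall>j\<in>steps Endless. ?A j) \<or> (\<forall>j\<in>steps Endless. ?B j)"
  proof (rule steps_dichotomy)
    fix j
    have "cl ?\<alpha> (lpart e P j) Int cl ?\<alpha> (rpart e P j) <= {mx (x j)}"
      using A[of j] B[of j] lsegs_rsegs[OF p, of _ j j] off(1)[of j] off(2)[of j] off(5) by blast
    then have "finite (cl ?\<alpha> (lpart e P j) Int cl ?\<alpha> (rpart e P j))" by (rule finite_subset) simp
    then show "?A j \<or> ?B j"
      using ray_separation[OF r(1) order.refl, of "lpart e P j" "rpart e P j"] r(3) parts_union[of \<kappa> e x P j] by blast
  next
    fix j
    have "?A j ==> ?A (j + 1)" "?B (j + 1) ==> ?B j" using lmono[of j] rmono[of j] by blast+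
    then show "~ (?A j & ?B (j + 1)) & ~ (?B j & ?A (j + 1))" using clash[of j] by blast
  qed
  then show ?thesis
  proof
    assume b: "\<forall>j\<in>steps Endless. ?B j"
    have "path_rank r = \<kappa> & right_tip ?Q & mx (tip_node G r) = rend ?Q & coincide r (Path \<kappa> Outward x P)"
      by (rule cofinal_ray[OF T Q r]) (use b in simp)
    then show ?thesis by (auto simp: located_def)
  next
    assume a: "\<forall>j\<in>steps Endless. ?A j"
    let ?x = "%i. x (last_index e - i)" and ?P = "%i. reverse (P (last_index e - 1 - i))"
    have rq: "reverse ?Q = Path \<kappa> (flip e) ?x ?P" by simp
    have "proper (Path \<kappa> (flip e) ?x ?P)" using Q unfolding rq[symmetric] proper_reverse .
    moreover have "path_branches r <= path_branches (Path \<kappa> (flip e) ?x ?P)"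
      using r(3) unfolding rq[symmetric] path_branches_reverse .
    moreover have "\<exists>k. path_branches (tail k r) <= rpart (flip e) ?P j" for j
      unfolding rpart_flip using a by simp
    ultimately have "path_rank r = \<kappa> & right_tip (reverse ?Q) & mx (tip_node G r) = rend (reverse ?Q) &
        coincide r (Path \<kappa> Outward ?x ?P)"
      unfolding rq by (intro cofinal_ray[OF T _ r(1,2)])
    then show ?thesis unfolding tip_reverse reverse_sets located_def path_rank.simps by blast
  qed
qed

text \<open>If a tail settles in one constituent, that constituent locates it, and the ends of a
  constituent are nodes of the whole path; otherwise the ray runs off to an end and
  \<open>localize\<close> applies.\<close>

lemma locates_step:
  assumes T: "locates \<alpha>"
  shows "is_path G p ==> proper p ==> is_ray G r ==> path_rank r = \<alpha> ==> path_rank r < graph_rank G ==>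
    path_branches r <= path_branches p ==> located r p"
proof (induction arbitrary: r rule: is_path_induct)
  case (zero e x P)
  have "~ (\<exists>i\<in>steps e. \<exists>k. path_branches (tail k r) <= path_branches (P i))"
    using zero(3) ray_not_single[OF is_ray_tail[OF zero(6)]] by fastforce
  then show ?case using localize[of r "Fin 0" e x P] zero T by blast
next
  case (compound \<mu> e x P)
  show ?case
  proof (cases "\<exists>i\<in>steps e. \<exists>k. path_branches (tail k r) <= path_branches (P i)")
    case True
    then obtain i k where i: "i \<in> steps e" "path_branches (tail k r) <= path_branches (P i)" by blast
    have "located (tail k r) (P i)"
      using compound(3)[OF i(1) compound_piece(3)[OF compound(2) i(1)] is_ray_tail[OF compound(5)]] i(2) compound(6,7)
      by simp
    then have "path_rank r \<le> path_rank (P i)" "mx (tip_node G r) \<in> span (P i)"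
      using tip_node_tail compound(5-7) by (auto simp: located_def span_def)
    then show ?thesis
      using compoundD(7)[OF compound(2) i(1)] compound_mnodes[OF compound(2)] i(1)
      by (auto simp: located_def)
  next
    case False
    then show ?thesis using localize[of r \<mu> e x P] compound T by blast
  qed
qed

lemma locates_all: "locates \<alpha>"
proof (induction \<alpha> rule: less_induct)
  case (less \<alpha>)
  show ?case unfolding locates_def using locates_step less proper_path by blast
qed

section \<open>Consequences for coincident rays\<close>

lemma cl_proper: "proper p ==> cl \<alpha> (path_branches p) <= ecl \<alpha> p"
  using cl_path locates_all by blast

text \<open>A ray inside finitely many constituents would have a tail inside a single one, whose
  rank is smaller than that of the ray.\<close>

lemma ray_not_in_initial:
  assumes p: "is_path G (Path \<mu> Outward x P)"
    and r: "is_ray G r" "path_rank r < graph_rank G" "\<mu> \<le> path_rank r"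
  shows "~ path_branches (tail k r) <= lpart Outward P (int i)"
proof (induction i arbitrary: k)
  case 0
  have "lpart Outward P 0 = {}" by (auto simp: lpart_def)
  then show ?case using path_branches_nonempty is_ray_path is_ray_tail r(1) by fastforce
next
  case (Suc i)
  show ?case
  proof
    let ?\<alpha> = "path_rank r"
    assume "path_branches (tail k r) <= lpart Outward P (int (Suc i))"
    then have s: "path_branches (tail k r) <= lpart Outward P (int i) Un path_branches (P (int i))"
      using lpart_Suc[of Outward P "int i"] by (simp add: add.commute)
    have i: "int i \<in> steps Outward" by simp
    have "cl ?\<alpha> (lpart Outward P (int i)) Int cl ?\<alpha> (path_branches (P (int i))) <= {mx (x (int i))}"
      using cl_lpart[OF locates_all[of ?\<alpha>] p, of "int i"] cl_piece[OF locates_all p i, of ?\<alpha>] lsegs_seg[OF p _ _ order.refl i]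
      by auto
    then have f: "finite (cl ?\<alpha> (lpart Outward P (int i)) Int cl ?\<alpha> (path_branches (P (int i))))" by (rule finite_subset) simp
    obtain j where "path_branches (tail j (tail k r)) <= lpart Outward P (int i) \<or>
      path_branches (tail j (tail k r)) <= path_branches (P (int i))"
      using ray_separation[OF is_ray_tail[OF r(1)] _ s f] by auto
    then have b: "path_branches (tail (j + k) r) <= path_branches (P (int i))" using Suc.IH by (auto simp: tail_tail)
    show False
    proof (cases "\<mu> = Fin 0")
      case True
      then obtain c where "P (int i) = Branch c" using is_path_zeroD(2)[of Outward x P] p i by blast
      then show False using b ray_not_single is_ray_tail r(1) by (metis path_branches.simps(1))
    next
      case False
      then have c: "compound \<mu> Outward x P" using p is_path_compound by blast
      \<comment> \<open>\<open>locates\<close> is used at the successor of the rank of the ray, so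
        that rays of this rank itself are covered.\<close>
      have "located (tail (j + k) r) (P (int i))"
        using locates_all[of "tsuc ?\<alpha>"] compound_piece(3)[OF c i] is_ray_tail[OF r(1)] r(2) b less_tsuc[of ?\<alpha>]
        unfolding locates_def by (metis path_rank_tail not_Omega_less)
      then show False using compoundD(7)[OF c i] r(3) by (auto simp: located_def)
    qed
  qed
qed

text \<open>\<open>coincide\<close> only puts a tail of one ray inside the other ray. No tail can
  remain in an initial part, so a later tail enters any prescribed tail; this is what yields
  transitivity.\<close>

lemma ray_branches_tail:
  assumes "is_ray G p" "is_ray G q" "path_rank p < graph_rank G" "path_rank p = path_rank q"
    and k: "path_branches (tail k p) <= path_branches q"
  shows "\<exists>k. path_branches (tail k p) <= path_branches (tail i q)"
proof -
  let ?\<alpha> = "path_rank p"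
  obtain x P where q: "q = Path ?\<alpha> Outward x P" "is_path G (Path ?\<alpha> Outward x P)"
    using assms(2,4) by (elim is_rayE) auto
  have ri: "rpart Outward P (int i) = path_branches (tail i q)"
  proof -
    have "{j \<in> steps Outward. int i \<le> j} = {int i..}" by auto
    then show ?thesis unfolding q(1) branches_tail rpart_def by simp
  qed
  have "cl ?\<alpha> (lpart Outward P (int i)) Int cl ?\<alpha> (rpart Outward P (int i)) <= {mx (x (int i)), rend q}"
    using cl_lpart[OF locates_all[of ?\<alpha>] q(2), of "int i"] cl_rpart[OF locates_all[of ?\<alpha>] q(2), of "int i"] assms(3)
      lsegs_rsegs[OF q(2), of _ "int i" "int i"] unfolding q(1) by auto
  then have f: "finite (cl ?\<alpha> (lpart Outward P (int i)) Int cl ?\<alpha> (rpart Outward P (int i)))" by (rule finite_subset) simp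
  have s: "path_branches (tail k p) <= lpart Outward P (int i) Un rpart Outward P (int i)"
    using k parts_union[of ?\<alpha> Outward x P "int i"] q(1) by simp
  obtain j where "path_branches (tail j (tail k p)) <= lpart Outward P (int i) \<or>
      path_branches (tail j (tail k p)) <= rpart Outward P (int i)"
    using ray_separation[OF is_ray_tail[OF assms(1)] _ s f] by auto
  then have "path_branches (tail (j + k) p) <= path_branches (tail i q)"
    using ray_not_in_initial[OF q(2) assms(1,3) order.refl] unfolding ri by (auto simp: tail_tail)
  then show ?thesis by blast
qed

lemma coincide_branches:
  assumes "is_ray G p" "is_ray G q" "path_rank p < graph_rank G" "coincide p q"
  shows "\<exists>k. path_branches (tail k p) <= path_branches (tail i q)"
  using ray_branches_tail[OF assms(1-3)] assms(4) unfolding coincide_def by blast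

lemma coincide_trans:
  assumes "is_ray G p" "is_ray G q" "is_ray G r" "path_rank p < graph_rank G" "coincide p q" "coincide q r"
  shows "coincide p r"
proof -
  have half: "\<exists>k. path_branches (tail k p) <= path_branches r"
    if c: "is_ray G p" "is_ray G q" "is_ray G r" "path_rank p < graph_rank G" "coincide p q" "coincide q r" for p q r
  proof -
    obtain k where "path_branches (tail k q) <= path_branches r" using c(6) by (auto simp: coincide_def)
    moreover obtain l where "path_branches (tail l p) <= path_branches (tail k q)"
      using coincide_branches[OF c(1,2,4,5)] by blast
    ultimately show ?thesis by blast
  qed
  have rk: "path_rank p = path_rank q" "path_rank q = path_rank r" using assms by (auto simp: coincide_def)
  show ?thesis
    using half[OF assms] half[OF assms(3,2,1) _ coincide_sym[OF assms(6)] coincide_sym[OF assms(5)]] assms(4) rk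
    unfolding coincide_def by simp
qed

text \<open>The nodes of a tail of p lie in the closure of its branches, hence in the closure of the
  branches of a proper tail of q. At the level of the common rank that closure adds nothing to the
  nodes of the tail.\<close>

lemma coincide_mnodes:
  assumes "is_ray G p" "is_ray G q" "path_rank p < graph_rank G" "coincide p q"
  shows "\<exists>k. mnodes (tail k p) <= mnodes (tail i q)"
proof -
  have rk: "path_rank q = path_rank p" using assms(4) by (simp add: coincide_def)
  then obtain k0 where "\<forall>k\<ge>k0. proper (tail k q)" using proper_tail[OF assms(2)] assms(3) by auto
  then have j: "proper (tail (max i k0) q)" by simp
  obtain k where k: "path_branches (tail k p) <= path_branches (tail (max i k0) q)"
    using coincide_branches[OF assms] by blast
  have "mnodes (tail k p) <= cl (path_rank p) (path_branches (tail k p))"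
    using mnodes_cl[OF is_ray_path[OF is_ray_tail[OF assms(1)]]] by simp
  also have "\<dots> <= cl (path_rank p) (path_branches (tail (max i k0) q))" using k by (rule cl_mono)
  also have "\<dots> <= mnodes (tail (max i k0) q)" using cl_proper[OF j, of "path_rank p"] rk by (auto simp: ecl_def)
  also have "\<dots> <= mnodes (tail i q)" using mnodes_tail_mono[OF assms(2)] by simp
  finally show ?thesis by blast
qed

section \<open>Singleton nodes and accumulation\<close>

text \<open>The singleton nodes to which the exception in condition (C) can refer. Singleton 0-nodes
  are left out, as they contain a branch end in place of a tip.\<close>

definition tip_singleton :: "'n \<Rightarrow> bool" where
  "tip_singleton m \<longleftrightarrow> singleton_node G m & node_rank G m ~= Fin 0"

lemma zero_node_not_tip_singleton:
  assumes "u \<in> nodes G" "node_rank G u = Fin 0" shows "~ tip_singleton (mx u)"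
  using mx[OF assms(1)] assms(2) by (auto simp: tip_singleton_def singleton_node_def embraces_def)

text \<open>The right end of a path may be finite at the outer level. Descending through last
  constituents leads either to a 0-node or to a ray, both inside the maximal node at that
  end.\<close>

lemma nested_end:
  "is_path G p ==> proper p ==> (\<exists>u\<in>nodes G. node_rank G u = Fin 0 & mx u = rend p) \<or>
    (\<exists>w. is_ray G w & path_rank w < graph_rank G & path_branches w <= path_branches p & mx (tip_node G w) = rend p)"
proof (induction rule: is_path_induct)
  case (zero e x P)
  let ?p = "Path (Fin 0) e x P"
  show ?case
  proof (cases "right_tip ?p")
    case True
    then show ?thesis using right_tipE[OF zero(1) True] zero(5) unfolding proper_def rend_def by metis
  next
    case False
    have "last_index e \<in> posts e" using right_post(1)[OF zero(1) False] by (simp add: mem_posts)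
    then show ?thesis using right_post(3)[OF zero(1) False] zero_posts[OF zero(1)] by metis
  qed
next
  case (compound \<mu> e x P)
  let ?p = "Path \<mu> e x P"
  show ?case
  proof (cases "right_tip ?p")
    case True
    then show ?thesis using right_tipE[OF compound(1) True] compound(4) unfolding proper_def rend_def by metis
  next
    case False
    note r = right_post[OF compound(1) False]
    note cp = compound_piece[OF compound(2) r(1)]
    have "path_branches (P (last_index e - 1)) <= path_branches ?p" using r(1) by auto
    then show ?thesis using compound(3)[OF r(1) cp(3)] cp(2) r(3) by auto
  qed
qed

text \<open>If the node where two paths meet held a single tip, both would arrive through that tip
  and share a branch far out. The two ends of this branch would be two common maximal nodes, but
  only one is allowed.\<close>

lemma joint_not_tip_singleton:
  assumes "proper p" "proper q" "rend p = lend q" "span p Int span q <= {rend p}"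
  shows "~ tip_singleton (rend p)"
proof
  assume s: "tip_singleton (rend p)"
  have z: "~ (\<exists>u\<in>nodes G. node_rank G u = Fin 0 & mx u = rend p)" using zero_node_not_tip_singleton s by metis
  then obtain w where w: "is_ray G w" "path_rank w < graph_rank G" "path_branches w <= path_branches p" "mx (tip_node G w) = rend p"
    using nested_end[OF proper_path] assms(1) by blast
  obtain v where v: "is_ray G v" "path_rank v < graph_rank G" "path_branches v <= path_branches q" "mx (tip_node G v) = rend p"
    using nested_end[of "reverse q"] is_path_reverse[OF proper_path[OF assms(2)]] assms(2,3) z by auto
  have eq: "tip_node G u = rend p" if "is_ray G u" "path_rank u < graph_rank G" "mx (tip_node G u) = rend p" for u
    using mx(2)[OF tip_node_props(1)[OF that(1,2)]] that(3) s
    by (auto simp: embraces_def tip_singleton_def singleton_node_def)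
  have "tip_of G w \<in> tips_in G (rend p)" "tip_of G v \<in> tips_in G (rend p)"
    using w v eq unfolding tips_in_def by blast+
  then have "tip_of G w = tip_of G v" using s unfolding tip_singleton_def singleton_node_def by (metis (full_types))
  moreover have "v \<in> tip_of G v" using v(1) by (simp add: tip_of_def)
  ultimately have "v \<in> tip_of G w" by simp
  then have "coincide w v" by (simp add: tip_of_def)
  then obtain k where k: "path_branches (tail k w) <= path_branches v" by (auto simp: coincide_def)
  obtain b where b: "b \<in> path_branches (tail k w)"
    using path_branches_nonempty is_ray_path is_ray_tail w(1) by fast
  have bp: "b \<in> path_branches p" "b \<in> path_branches q" using b k w v branches_tail_subset[OF w(1)] by blast+
  then have "b \<in> branches G" using path_branches_subset proper_path assms by blast
  then obtain u u' where uv: "u \<in> nodes G" "u' \<in> nodes G" "ends G b = {u, u'}" "u ~= u'" "node_rank G u = Fin 0" "node_rank G u' = Fin 0"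
    using ends_nodes by metis
  then have "mx u \<in> mnodes p Int mnodes q" "mx u' \<in> mnodes p Int mnodes q"
    using branch_ends_mnodes[OF proper_path[OF assms(1)] bp(1)] branch_ends_mnodes[OF proper_path[OF assms(2)] bp(2)] by auto
  moreover have "mnodes p Int mnodes q <= {rend p}" using assms(4) unfolding span_def by blast
  ultimately have "mx u \<in> {rend p}" "mx u' \<in> {rend p}" by (auto simp only: subset_iff)
  then have "mx u = mx u'" by simp
  then show False using mx_rank_eq uv by metis
qed

text \<open>At some level of nesting an interior node is either a 0-node of a 0-path or the junction
  of two consecutive constituents.\<close>

lemma interior_not_tip_singleton:
  "is_path G p ==> proper p ==> m \<in> span p ==> m ~= lend p ==> m ~= rend p ==> ~ tip_singleton m"
proof (induction rule: is_path_induct)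
  case (zero e x P)
  then have "m \<in> mnodes (Path (Fin 0) e x P)" by (auto simp: span_def)
  then obtain i where i: "i \<in> posts e" "m = mx (x i)"
    using zero_piece[OF zero(1)] by (auto simp: mnodes_Path)
  then show ?case using zero_node_not_tip_singleton zero_posts[OF zero(1) i(1)] by blast
next
  case (compound \<mu> e x P)
  note c = compound(2)
  have post: "~ tip_singleton (mx (x j))" if j: "j \<in> posts e" "mx (x j) = m" for j
  proof (cases "j \<in> steps e")
    case True
    show ?thesis
    proof (cases "j - 1 \<in> steps e")
      case t: True
      have "span (P (j - 1)) Int span (P j) <= {mx (x j)}"
        using compound_span[OF c t True] by simp
      then show ?thesis
        using joint_not_tip_singleton[OF compound_piece(3)[OF c t] compound_piece(3)[OF c True]]
          compound_piece(2)[OF c t] compound_piece(1)[OF c True] by simp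
    next
      case False
      then have nl: "~ left_tip (Path \<mu> e x P)" using True by auto
      note l = left_post[OF compound(1) nl]
      have "j = 0" using steps_convex[OF l(1) True, of "j - 1"] l(2)[OF True] False by force
      then show ?thesis using l(3) j compound(6) by simp
    qed
  next
    case False
    then have t: "j - 1 \<in> steps e" using j by (auto simp: mem_posts)
    then have nr: "~ right_tip (Path \<mu> e x P)" using False by auto
    note r = right_post[OF compound(1) nr]
    have "j = last_index e" using steps_convex[OF t r(1), of j] r(2)[OF t] False by force
    then show ?thesis using r(3) j compound(7) by simp
  qed
  have "m \<in> mnodes (Path \<mu> e x P)" using compound by (auto simp: span_def)
  then obtain i where i: "i \<in> steps e" "m \<in> span (P i)" using compound_mnodes[OF c] by auto
  note cp = compound_piece[OF c i(1)]
  show ?case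
    using compound(3)[OF i(1) cp(3) i(2)] post[of i] post[of "i + 1"] i(1) cp by (auto simp: steps_posts)
qed

lemma accumulate_right:
  fixes X :: "nat \<Rightarrow> 'n set"
  assumes p: "is_path G (Path \<mu> e x P)" and rk: "right_tip (Path \<mu> e x P) ==> \<mu> < graph_rank G"
    and anti: "!!k l. k \<le> l ==> X l <= X k"
    and none: "!!i. i \<in> steps e ==> \<exists>k. X k Int seg x P i = {}"
    and hit: "!!k. \<exists>i\<in>steps e. 0 \<le> i & X k Int seg x P i ~= {}"
  shows "\<exists>v. is_ray G v & path_rank v < graph_rank G & mx (tip_node G v) = rend (Path \<mu> e x P) &
    (\<forall>k j. X k Int mnodes (tail j v) ~= {})"
proof -
  have later: "\<exists>i\<in>steps e. int j \<le> i & X k Int seg x P i ~= {}" for j k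
  proof (induction j arbitrary: k)
    case (Suc j)
    show ?case
    proof (cases "int j \<in> steps e")
      case True
      then obtain l where l: "X l Int seg x P (int j) = {}" using none by blast
      obtain i where i: "i \<in> steps e" "int j \<le> i" "X (max k l) Int seg x P i ~= {}" using Suc by blast
      then have "i ~= int j" "X k Int seg x P i ~= {}" using l anti[of l "max k l"] anti[of k "max k l"] by auto
      then show ?thesis using i by (intro bexI[of _ i]) auto
    next
      case False
      obtain i where i: "i \<in> steps e" "int j \<le> i" "X k Int seg x P i ~= {}" using Suc by blast
      moreover have "i ~= int j" using i False by auto
      ultimately show ?thesis by (intro bexI[of _ i]) auto
    qed
  qed (use hit in auto)
  have rt: "right_tip (Path \<mu> e x P)"
  proof (rule ccontr)
    assume n: "~ right_tip (Path \<mu> e x P)"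
    obtain i where "i \<in> steps e" "int (nat (last_index e)) \<le> i" using later by blast
    then show False using right_post(2)[OF p n, of i] by linarith
  qed
  then have e: "e = Outward \<or> e = Endless" by simp
  define v where "v = Path \<mu> Outward x P"
  have v: "is_ray G v" using right_ray[OF p e] by (simp add: v_def)
  have pv: "is_path G (Path \<mu> Outward x P)" using v is_ray_path by (simp add: v_def)
  have "X k Int mnodes (tail j v) ~= {}" for k j
  proof -
    obtain i where "int j \<le> i" "X k Int seg x P i ~= {}" using later by blast
    then show ?thesis unfolding v_def mnodes_tail[OF pv] by auto
  qed
  moreover have "mx (tip_node G v) = rend (Path \<mu> e x P)" using e by (auto simp: rend_def v_def)
  moreover have "path_rank v < graph_rank G" using rk[OF rt] by (simp add: v_def)
  ultimately show ?thesis using v by blast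
qed

text \<open>A compactness argument, applied later to the node sets of the tails of a ray. If some
  constituent meets every set, the search descends into it. Otherwise each step is eventually
  avoided, and the sets can meet the path only by moving out to an infinite end, whose ray is the
  one sought.\<close>

lemma accumulate:
  fixes X :: "nat \<Rightarrow> 'n set"
  assumes anti: "!!k l. k \<le> l ==> X l <= X k" and avoid: "!!m. \<exists>k. m ~: X k"
  shows "is_path G p ==> proper p ==> (!!k. X k Int span p ~= {}) ==>
    \<exists>v. is_ray G v & path_rank v < graph_rank G & mx (tip_node G v) \<in> span p & (\<forall>k j. X k Int mnodes (tail j v) ~= {})"
proof -
  have split: "(\<forall>k. X k Int S ~= {}) \<or> (\<forall>k. X k Int T ~= {})" if u: "!!k. X k Int (S Un T) ~= {}" for S T
  proof (rule ccontr)
    assume "~ ?thesis"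
    then obtain k l where "X k Int S = {}" "X l Int T = {}" by blast
    then have "X (max k l) Int (S Un T) = {}" using anti[of k "max k l"] anti[of l "max k l"] by fastforce
    then show False using u by blast
  qed
  have fin: "\<exists>k. X k Int F = {}" if "finite F" for F
    using that
  proof (induction F rule: finite_induct)
    case (insert m F)
    then show ?case using split[of "{m}" F] avoid[of m] by (metis Int_insert_right_if0 Int_empty_right insert_is_Un)
  qed auto
  have main: "\<exists>v. is_ray G v & path_rank v < graph_rank G & mx (tip_node G v) \<in> span (Path \<mu> e x P) &
      (\<forall>k j. X k Int mnodes (tail j v) ~= {})"
    if p: "is_path G (Path \<mu> e x P)" "proper (Path \<mu> e x P)" and hit: "!!k. X k Int span (Path \<mu> e x P) ~= {}"
      and none: "!!i. i \<in> steps e ==> \<exists>k. X k Int seg x P i = {}" for \<mu> e x P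
  proof -
    let ?p = "Path \<mu> e x P"
    let ?S = "\<Union>i\<in>{i \<in> steps e. 0 \<le> i}. seg x P i" and ?T = "\<Union>i\<in>{i \<in> steps e. i < 0}. seg x P i"
    have "mnodes ?p = ?S Un ?T" unfolding mnodes_seg[OF p(1)] by force
    moreover have "\<forall>k. X k Int mnodes ?p ~= {}"
      using split[of "mnodes ?p" "{lend ?p, rend ?p}"] hit fin[of "{lend ?p, rend ?p}"] unfolding span_def by blast
    ultimately have "(\<forall>k. X k Int ?S ~= {}) \<or> (\<forall>k. X k Int ?T ~= {})" using split[of ?S ?T] by simp
    then show ?thesis
    proof
      assume s: "\<forall>k. X k Int ?S ~= {}"
      have "\<exists>v. is_ray G v & path_rank v < graph_rank G & mx (tip_node G v) = rend ?p & (\<forall>k j. X k Int mnodes (tail j v) ~= {})"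
      proof (rule accumulate_right[OF p(1) _ anti none])
        fix k show "\<exists>i\<in>steps e. 0 \<le> i & X k Int seg x P i ~= {}" using s[rule_format, of k] by blast
      qed (use p(2) in \<open>auto simp: proper_def\<close>)
      then show ?thesis by (auto simp: span_def)
    next
      assume t: "\<forall>k. X k Int ?T ~= {}"
      \<comment> \<open>Steps with negative index exist only next to a left tip, where
        \<open>last_index\<close> is 0; reversal then turns step i into step -1 - i.\<close>
      have L: "last_index e = 0"
      proof (cases "left_tip ?p")
        case False
        then show ?thesis using t left_post(2)[OF p(1) False] by force
      qed auto
      let ?x = "%i. x (last_index e - i)" and ?P = "%i. reverse (P (last_index e - 1 - i))"
      have r: "reverse ?p = Path \<mu> (flip e) ?x ?P" by simp
      have "\<exists>v. is_ray G v & path_rank v < graph_rank G & mx (tip_node G v) = rend (Path \<mu> (flip e) ?x ?P) &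
        (\<forall>k j. X k Int mnodes (tail j v) ~= {})"
      proof (rule accumulate_right[OF _ _ anti])
        show "is_path G (Path \<mu> (flip e) ?x ?P)" using is_path_reverse[OF p(1)] unfolding r .
        show "\<mu> < graph_rank G" if "right_tip (Path \<mu> (flip e) ?x ?P)"
          using that p(2) unfolding r[symmetric] tip_reverse by (simp add: proper_def)
        show "\<exists>k. X k Int seg ?x ?P i = {}" if "i \<in> steps (flip e)" for i
          unfolding seg_flip using none that by (simp add: steps_flip)
        show "\<exists>i\<in>steps (flip e). 0 \<le> i & X k Int seg ?x ?P i ~= {}" for k
        proof -
          obtain i where "i \<in> steps e" "i < 0" "X k Int seg x P i ~= {}" using t[rule_format, of k] by blast
          then show ?thesis unfolding seg_flip by (intro bexI[of _ "-1 - i"]) (auto simp: steps_flip L)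
        qed
      qed
      then show ?thesis unfolding r[symmetric] reverse_sets span_def by blast
    qed
  qed
  show "is_path G p ==> proper p ==> (!!k. X k Int span p ~= {}) ==>
    \<exists>v. is_ray G v & path_rank v < graph_rank G & mx (tip_node G v) \<in> span p & (\<forall>k j. X k Int mnodes (tail j v) ~= {})"
  proof (induction rule: is_path_induct)
    case (zero e x P)
    show ?case
    proof (rule main[OF zero(1,5,6)])
      fix i assume "i \<in> steps e"
      then have "finite (seg x P i)" using zero_piece[OF zero(1)] by (simp add: seg_def)
      then show "\<exists>k. X k Int seg x P i = {}" by (rule fin)
    qed
  next
    case (compound \<mu> e x P)
    show ?case
    proof (cases "\<exists>i\<in>steps e. \<forall>k. X k Int seg x P i ~= {}")
      case True
      then obtain i where i: "i \<in> steps e" "!!k. X k Int seg x P i ~= {}" by blast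
      then have "\<exists>v. is_ray G v & path_rank v < graph_rank G & mx (tip_node G v) \<in> span (P i) & (\<forall>k j. X k Int mnodes (tail j v) ~= {})"
        using compound(3)[OF i(1) compound_piece(3)[OF compound(2) i(1)]] compound_seg[OF compound(2) i(1)] by simp
      moreover have "span (P i) <= span (Path \<mu> e x P)" using compound_mnodes[OF compound(2)] i(1) by (auto simp: span_def)
      ultimately show ?thesis by blast
    next
      case False
      then show ?thesis using main[OF compound(1,4,5)] by blast
    qed
  qed
qed

end

section \<open>Joining paths\<close>

text \<open>The rank of the innermost node by which the path attains its left end. A listed terminal
  node may have any rank up to that of the path, so it does not tell which rank a junction at that
  end has to have.\<close>

primrec lrank :: "('n, 'b) tpath \<Rightarrow> trank" where
  "lrank (Branch b) = Fin 0"
| "lrank (Path \<mu> e x P) = (if e = Inward \<or> e = Endless then tsuc \<mu> else if \<mu> = Fin 0 then Fin 0 else lrank (P 0))"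

primrec rrank :: "('n, 'b) tpath \<Rightarrow> trank" where
  "rrank (Branch b) = Fin 0"
| "rrank (Path \<mu> e x P) = (if e = Outward \<or> e = Endless then tsuc \<mu> else if \<mu> = Fin 0 then Fin 0
    else rrank (P (last_index e - 1)))"

lemma rrank_reverse [simp]: "rrank (reverse p) = lrank p"
  by (induction p) auto

lemma lrank_reverse [simp]: "lrank (reverse p) = rrank p"
  using rrank_reverse[of "reverse p"] by simp

lemma right_tip_rrank: "right_tip p ==> rrank p = tsuc (path_rank p)"
  by (cases p) auto

lemma left_tip_lrank: "left_tip p ==> lrank p = tsuc (path_rank p)"
  by (cases p) auto

lemma rrank_not_Arrow [simp]: "rrank p ~= Arrow_Omega"
  by (induction p) auto

lemma lrank_not_Arrow [simp]: "lrank p ~= Arrow_Omega"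
  by (induction p) auto

definition iconvex :: "int set \<Rightarrow> bool" where
  "iconvex I \<longleftrightarrow> (\<forall>i\<in>I. \<forall>k\<in>I. \<forall>j. i \<le> j & j \<le> k --> j \<in> I)"

lemma uminus_mem: "i \<in> uminus ` K \<longleftrightarrow> - i \<in> K" for i :: int
  by (metis image_iff minus_minus)

text \<open>Paths can therefore be assembled over arbitrary convex index sets, with the
  normalisation to \<open>steps\<close> postponed to the very end.\<close>

lemma iconvex_extent:
  assumes "iconvex I" "I ~= {}"
  obtains e s where "e ~= Two_Ended 0" "!!i. i \<in> steps e \<longleftrightarrow> i + s \<in> I"
proof -
  note c = assms(1)[unfolded iconvex_def, rule_format]
  have least: "\<exists>a\<in>I. \<forall>i\<in>I. a \<le> i" if b: "\<forall>i\<in>I. b \<le> i" and jI: "j \<in> I" for b j and I :: "int set"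
  proof -
    have "\<exists>n. b + int n \<in> I" using b jI by (intro exI[of _ "nat (j - b)"]) auto
    then have l: "b + int (LEAST n. b + int n \<in> I) \<in> I" by (rule LeastI_ex)
    have "b + int (LEAST n. b + int n \<in> I) \<le> i" if i: "i \<in> I" for i
    proof -
      have bi: "b \<le> i" using b i by blast
      then have "(LEAST n. b + int n \<in> I) \<le> nat (i - b)" using i by (intro Least_le) auto
      then show ?thesis using bi by linarith
    qed
    then show ?thesis using l by blast
  qed
  obtain j where j: "j \<in> I" using assms(2) by blast
  have lo: "(\<exists>a\<in>I. \<forall>i\<in>I. a \<le> i) \<or> (\<forall>b. \<exists>i\<in>I. i < b)"
    using least[OF _ j] by (meson not_le)
  have hi: "(\<exists>a\<in>I. \<forall>i\<in>I. i \<le> a) \<or> (\<forall>b. \<exists>i\<in>I. b < i)"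
  proof (cases "\<exists>b. \<forall>i\<in>I. i \<le> b")
    case True
    then obtain b where b: "\<forall>i\<in>I. i \<le> b" by blast
    have "\<exists>a\<in>uminus ` I. \<forall>i\<in>uminus ` I. a \<le> i"
      using b j by (intro least[of _ "- b" "- j"]) auto
    then show ?thesis by auto
  next
    case False
    then show ?thesis by (meson not_le)
  qed
  from lo hi show ?thesis
  proof (elim disjE bexE)
    fix a b assume a: "a \<in> I" "\<forall>i\<in>I. a \<le> i" and b: "b \<in> I" "\<forall>i\<in>I. i \<le> b"
    have "i \<in> steps (Two_Ended (nat (b - a + 1))) \<longleftrightarrow> i + a \<in> I" for i
    proof -
      have "a \<le> b" using a b by blast
      then have "i \<in> steps (Two_Ended (nat (b - a + 1))) \<longleftrightarrow> a \<le> i + a & i + a \<le> b" by auto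
      then show ?thesis using a b c[of a b "i + a"] by blast
    qed
    moreover have "a \<le> b" using a b by blast
    ultimately show ?thesis using that[of "Two_Ended (nat (b - a + 1))" a] by auto
  next
    fix a assume a: "a \<in> I" "\<forall>i\<in>I. a \<le> i" and b: "\<forall>b. \<exists>i\<in>I. b < i"
    have "i \<in> steps Outward \<longleftrightarrow> i + a \<in> I" for i
    proof -
      obtain k where "k \<in> I" "i + a < k" using b by blast
      then show ?thesis using a c[of a k "i + a"] by fastforce
    qed
    then show ?thesis using that[of Outward a] by auto
  next
    fix b assume b: "b \<in> I" "\<forall>i\<in>I. i \<le> b" and a: "\<forall>b. \<exists>i\<in>I. i < b"
    have "i \<in> steps Inward \<longleftrightarrow> i + (b + 1) \<in> I" for i
    proof -
      obtain k where "k \<in> I" "k < i + (b + 1)" using a by blast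
      then show ?thesis using b c[of k b "i + (b + 1)"] by fastforce
    qed
    then show ?thesis using that[of Inward "b + 1"] by auto
  next
    assume a: "\<forall>b. \<exists>i\<in>I. i < b" and b: "\<forall>b. \<exists>i\<in>I. b < i"
    have "i \<in> steps Endless \<longleftrightarrow> i + 0 \<in> I" for i
    proof -
      obtain k l where "k \<in> I" "k < i" "l \<in> I" "i < l" using a b by blast
      then show ?thesis using c[of k l i] by simp
    qed
    then show ?thesis using that[of Endless 0] by auto
  qed
qed

context nu_graph
begin

section \<open>Ranks of nodes at the ends of a path\<close>

lemma ray_length_le: "left_tip p \<or> right_tip p ==> ray_length (path_rank p) \<le> path_length p"
  by (cases p) (auto simp: le_nattimes2 simp del: nattimes.simps)

lemma rrank_props:
  "is_path G p ==> proper p ==> (\<exists>u\<in>nodes G. mx u = rend p & node_rank G u = rrank p) &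
    (~ right_tip p --> rrank p \<le> path_rank p)"
proof (induction rule: is_path_induct)
  case (zero e x P)
  let ?p = "Path (Fin 0) e x P"
  show ?case
  proof (cases "right_tip ?p")
    case True
    then show ?thesis using end_node_tip[OF zero(1) True] right_tip_rrank[OF True] zero(5)
      unfolding proper_def rend_def by metis
  next
    case False
    have "last_index e \<in> posts e" using right_post(1)[OF zero(1) False] by (simp add: mem_posts)
    then show ?thesis using right_post(3)[OF zero(1) False] zero_posts[OF zero(1)] False by auto
  qed
next
  case (compound \<mu> e x P)
  let ?p = "Path \<mu> e x P"
  show ?case
  proof (cases "right_tip ?p")
    case True
    then show ?thesis using end_node_tip[OF compound(1) True] right_tip_rrank[OF True] compound(4)
      unfolding proper_def rend_def by metis
  next
    case False
    let ?l = "last_index e - 1"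
    note r = right_post[OF compound(1) False]
    note cp = compound_piece[OF compound(2) r(1)]
    have rr: "rrank ?p = rrank (P ?l)" using False compoundD(2)[OF compound(2)] by auto
    have lt: "path_rank (P ?l) < \<mu>" using compoundD(7)[OF compound(2) r(1)] .
    have "rrank (P ?l) \<le> \<mu>"
      using compound(3)[OF r(1) cp(3)] right_tip_rrank[of "P ?l"] tsuc_le[OF lt] lt by (cases "right_tip (P ?l)") auto
    moreover have "rend ?p = rend (P ?l)" using cp(2) r(3) by simp
    ultimately show ?thesis using compound(3)[OF r(1) cp(3)] rr by auto
  qed
qed

lemma rrank_node: "proper p ==> \<exists>u\<in>nodes G. mx u = rend p & node_rank G u = rrank p"
  and rrank_le: "proper p ==> ~ right_tip p ==> rrank p \<le> path_rank p"
  using rrank_props proper_path by blast+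

lemma lrank_node: "proper p ==> \<exists>u\<in>nodes G. mx u = lend p & node_rank G u = lrank p"
  and lrank_le: "proper p ==> ~ left_tip p ==> lrank p \<le> path_rank p"
  using rrank_node[of "reverse p"] rrank_le[of "reverse p"] by auto

section \<open>Assembling paths from constituents\<close>

lemma end_node_eq:
  assumes p: "is_path G (Path \<mu> e x P)" "right_tip (Path \<mu> e x P)"
    and q: "is_path G (Path \<mu> e' y Q)" "right_tip (Path \<mu> e' y Q)"
    and \<mu>: "\<mu> < graph_rank G" and eq: "!!i. m \<le> i ==> Q i = P (i + s)"
  shows "end_node G (Path \<mu> e x P) = end_node G (Path \<mu> e' y Q)"
proof -
  define v w where "v = Path \<mu> Outward x P" and "w = Path \<mu> Outward y Q"
  have v: "is_ray G v" and w: "is_ray G w" using right_ray[of \<mu> e x P] right_ray[of \<mu> e' y Q] p q by (auto simp: v_def w_def)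
  have brv: "path_branches (tail k v) = (\<Union>i\<in>{int k..}. path_branches (P i))"
    and brw: "path_branches (tail k w) = (\<Union>i\<in>{int k..}. path_branches (Q i))" for k
    unfolding v_def w_def branches_tail by auto
  have "path_branches (tail (nat (max (m + s) s)) v) <= path_branches w"
  proof
    fix b assume "b \<in> path_branches (tail (nat (max (m + s) s)) v)"
    then obtain i where i: "int (nat (max (m + s) s)) \<le> i" "b \<in> path_branches (P i)" unfolding brv by auto
    then have "m \<le> i - s" "0 \<le> i - s" by linarith+
    then have "b \<in> path_branches (Q (i - s))" using eq[of "i - s"] i by simp
    then show "b \<in> path_branches w" using brw[of 0] \<open>0 \<le> i - s\<close> by auto
  qed
  moreover have "path_branches (tail (nat (max m (- s))) w) <= path_branches v"
  proof
    fix b assume "b \<in> path_branches (tail (nat (max m (- s))) w)"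
    then obtain i where i: "int (nat (max m (- s))) \<le> i" "b \<in> path_branches (Q i)" unfolding brw by auto
    then have "m \<le> i" "0 \<le> i + s" by linarith+
    then have "b \<in> path_branches (P (i + s))" using eq[of i] i by simp
    then show "b \<in> path_branches v" using brv[of 0] \<open>0 \<le> i + s\<close> by auto
  qed
  moreover have "path_rank v = path_rank w" by (simp add: v_def w_def)
  ultimately have "coincide v w" unfolding coincide_def by blast
  then have "tip_node G v = tip_node G w" using tip_node_coincide[OF v w] \<mu> by (simp add: v_def)
  then show ?thesis using p q by (auto simp: v_def w_def)
qed

lemma start_node_eq:
  assumes p: "is_path G (Path \<mu> e x P)" "left_tip (Path \<mu> e x P)"
    and q: "is_path G (Path \<mu> e' y Q)" "left_tip (Path \<mu> e' y Q)"
    and \<mu>: "\<mu> < graph_rank G" and eq: "!!i. i < m ==> Q i = P (i + s)"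
  shows "start_node G (Path \<mu> e x P) = start_node G (Path \<mu> e' y Q)"
proof -
  have L: "last_index e = 0" "last_index e' = 0" using p q by auto
  have r: "reverse (Path \<mu> e x P) = Path \<mu> (flip e) (%i. x (- i)) (%i. reverse (P (- 1 - i)))"
    "reverse (Path \<mu> e' y Q) = Path \<mu> (flip e') (%i. y (- i)) (%i. reverse (Q (- 1 - i)))" by (simp_all add: L)
  have "reverse (Q (- 1 - i)) = reverse (P (- 1 - (i + - s)))" if "- m \<le> i" for i
    using eq[of "- 1 - i"] that by (simp add: algebra_simps)
  then have "end_node G (reverse (Path \<mu> e x P)) = end_node G (reverse (Path \<mu> e' y Q))"
    unfolding r using is_path_reverse[OF p(1)] is_path_reverse[OF q(1)] p(2) q(2) \<mu> unfolding r
    by (intro end_node_eq[of _ _ _ _ _ _ _ "- m" "- s"]) auto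
  then show ?thesis unfolding end_node_reverse .
qed

text \<open>A sequence of constituents for a \<mu>-path with the posts left out and over an
  arbitrary index set. In this form sequences can be restricted, shifted, reversed and glued; posts
  are chosen afterwards.\<close>

definition fam :: "trank \<Rightarrow> int set \<Rightarrow> (int \<Rightarrow> ('n, 'b) tpath) \<Rightarrow> bool" where
  "fam \<mu> I P \<longleftrightarrow> (\<forall>i\<in>I. proper (P i) & path_rank (P i) < \<mu>) &
    (\<forall>i\<in>I. i + 1 \<in> I --> rend (P i) = lend (P (i + 1)) &
      (right_tip (P i) & tsuc (path_rank (P i)) = \<mu> \<or> left_tip (P (i + 1)) & tsuc (path_rank (P (i + 1))) = \<mu>)) &
    (\<forall>i\<in>I. \<forall>j\<in>I. i < j --> span (P i) Int span (P j) <= (if j = i + 1 then {lend (P j)} else {}))"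

lemma start_rank_le:
  assumes "proper p" "path_rank p < \<mu>"
  shows "node_rank G (start_node G p) \<le> \<mu>"
proof (cases "left_tip p")
  case True
  then show ?thesis using start_node_tip[OF proper_path[OF assms(1)] True] tsuc_le[OF assms(2)] assms(1)
    by (simp add: proper_def)
next
  case False
  then show ?thesis using start_node_nontip[OF proper_path[OF assms(1)] False] assms(2) by simp
qed

lemma end_rank_le: "proper p ==> path_rank p < \<mu> ==> node_rank G (end_node G p) \<le> \<mu>"
  using start_rank_le[of "reverse p"] by simp

lemma make_path:
  assumes F: "fam \<mu> I P" and I: "iconvex I" "I ~= {}" and \<mu>: "\<mu> \<le> graph_rank G" "\<mu> = tsuc \<alpha>" "\<alpha> ~= Omega"
    and tip: "\<exists>i\<in>I. tsuc (path_rank (P i)) = \<mu> & (left_tip (P i) \<or> right_tip (P i))"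
  obtains e s y where "is_path G (Path \<mu> e y (%i. P (i + s)))" "!!i. i \<in> steps e \<longleftrightarrow> i + s \<in> I"
    "!!i. i \<in> steps e ==> i - 1 ~: steps e ==> y i = start_node G (P (i + s))"
    "!!i. i \<in> steps e ==> i + 1 ~: steps e ==> y (i + 1) = end_node G (P (i + s))"
proof -
  obtain e s where es: "e ~= Two_Ended 0" "!!i. i \<in> steps e \<longleftrightarrow> i + s \<in> I" using iconvex_extent[OF I] by metis
  note F1 = F[unfolded fam_def, THEN conjunct1, rule_format]
    and F2 = F[unfolded fam_def, THEN conjunct2, THEN conjunct1, rule_format]
    and F3 = F[unfolded fam_def, THEN conjunct2, THEN conjunct2, rule_format]
  \<comment> \<open>A post between two constituents must be a \<mu>-node that embraces the end nodes
    on both sides. The side with a tip of rank \<mu> - 1 has an end node of rank exactly \<mu>, so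
    that node is taken; at a terminal post there is only one candidate.\<close>
  define y where "y j = (if j \<in> I & ~ (j - 1 \<in> I & right_tip (P (j - 1)) & tsuc (path_rank (P (j - 1))) = \<mu>)
    then start_node G (P j) else end_node G (P (j - 1)))" for j
  have F2': "rend (P (j - 1)) = lend (P j)" "right_tip (P (j - 1)) & tsuc (path_rank (P (j - 1))) = \<mu> \<or>
      left_tip (P j) & tsuc (path_rank (P j)) = \<mu>" if "j \<in> I" "j - 1 \<in> I" for j
    using F2[of "j - 1"] that by simp_all
  have ml: "mx (y j) = lend (P j)" if "j \<in> I" for j
    using that F2'(1)[OF that] by (auto simp: y_def lend_def rend_def)
  have mr: "mx (y (j + 1)) = rend (P j)" if "j \<in> I" for j
    using that F2'(1)[of "j + 1"] by (auto simp: y_def lend_def rend_def)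
  have nd: "y j \<in> nodes G & node_rank G (y j) \<le> \<mu>" if "j \<in> I \<or> j - 1 \<in> I" for j
    using that proper_nodes F1 start_rank_le end_rank_le by (auto simp: y_def)
  have inner: "node_rank G (y j) = \<mu>" if j: "j \<in> I" "j - 1 \<in> I" for j
  proof (cases "right_tip (P (j - 1)) & tsuc (path_rank (P (j - 1))) = \<mu>")
    case True
    then have "y j = end_node G (P (j - 1))" using j by (simp add: y_def)
    then show ?thesis using end_node_tip[of "P (j - 1)"] F1[OF j(2)] True by (simp add: proper_def)
  next
    case False
    then have "y j = start_node G (P j)" "left_tip (P j) & tsuc (path_rank (P j)) = \<mu>"
      using j F2'(2)[OF j] by (auto simp: y_def)
    then show ?thesis using start_node_tip[of "P j"] F1[OF j(1)] by (simp add: proper_def)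
  qed
  have el: "embraces G (y j) (start_node G (P j))" if j: "j \<in> I" for j
  proof (cases "j - 1 \<in> I")
    case True
    then show ?thesis
      using mx_eq_embraces[of "start_node G (P j)" "y j"] ml[OF j] nd[of j] F1[OF j] proper_nodes start_rank_le inner[OF j True] j
      by (simp add: lend_def)
  next
    case False
    then show ?thesis using j by (simp add: y_def embraces_def)
  qed
  have er: "embraces G (y (j + 1)) (end_node G (P j))" if j: "j \<in> I" for j
  proof (cases "j + 1 \<in> I")
    case True
    then show ?thesis
      using mx_eq_embraces[of "end_node G (P j)" "y (j + 1)"] mr[OF j] nd[of "j + 1"] F1[OF j] proper_nodes end_rank_le inner[of "j + 1"] j
      by (simp add: rend_def)
  next
    case False
    then show ?thesis using j by (simp add: y_def embraces_def)
  qed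
  have po: "i + s \<in> I \<or> i + s - 1 \<in> I" if "i \<in> posts e" for i
    using that es(2)[of i] es(2)[of "i - 1"] by (auto simp: mem_posts algebra_simps)
  have sh: "i + 1 + s = i + s + 1" "i - 1 + s = i + s - 1" for i by simp_all
  have linked: "linked e (%i. y (i + s)) (%i. P (i + s))"
    unfolding linked_def
  proof (intro conjI ballI impI)
    fix i assume "i \<in> steps e"
    then have i: "i + s \<in> I" using es by blast
    show "mx (y (i + s)) ~= mx (y (i + 1 + s))"
      "left_tip (P (i + s)) ==> mx (y (i + s)) ~: mnodes (P (i + s))"
      "right_tip (P (i + s)) ==> mx (y (i + 1 + s)) ~: mnodes (P (i + s))"
      using F1[OF i] unfolding sh ml[OF i] mr[OF i] by (auto simp: proper_def)
  next
    fix i j assume "i \<in> steps e" "j \<in> steps e" "i < j"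
    then have i: "i + s \<in> I" and j: "j + s \<in> I" and ij: "i + s < j + s" using es by auto
    have "span (P (i + s)) Int span (P (j + s)) <= (if j = i + 1 then {lend (P (j + s))} else {})"
      using F3[OF i j ij] by (simp split: if_splits)
    then show "(mnodes (P (i + s)) Un {mx (y (i + s)), mx (y (i + 1 + s))}) Int
       (mnodes (P (j + s)) Un {mx (y (j + s)), mx (y (j + 1 + s))}) <= (if j = i + 1 then {mx (y (j + s))} else {})"
      unfolding sh ml[OF i] mr[OF i] ml[OF j] mr[OF j] span_def .
  qed
  have "is_path G (Path \<mu> e (%i. y (i + s)) (%i. P (i + s)))"
  proof (rule is_path.succ[OF es(1), of \<alpha>])
    show "tip_rank \<alpha> \<mu>" using \<mu> by (simp add: tip_rank_iff)
    show "\<mu> \<le> graph_rank G" by fact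
    show "\<forall>i\<in>posts e. y (i + s) \<in> nodes G & node_rank G (y (i + s)) \<le> \<mu>" using po nd by blast
    show "\<forall>i\<in>steps e. is_path G (P (i + s)) & path_rank (P (i + s)) < \<mu> &
      embraces G (y (i + s)) (start_node G (P (i + s))) & embraces G (y (i + 1 + s)) (end_node G (P (i + s)))"
      unfolding sh using es F1 el er proper_path by blast
    have rk: "path_rank (P i) = \<alpha>" if "i \<in> I" "tsuc (path_rank (P i)) = \<mu>" for i
    proof -
      have "path_rank (P i) ~= Omega" using F1[OF that(1)] by auto
      then show ?thesis using tsuc_inj that(2) \<mu>(2,3) by metis
    qed
    show "\<forall>i\<in>steps e. i - 1 \<in> steps e --> node_rank G (y (i + s)) = \<mu> & reached_by_tip e (%i. P (i + s)) \<mu> i"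
    proof (intro ballI impI conjI)
      fix i assume st: "i \<in> steps e" "i - 1 \<in> steps e"
      then have i: "i + s \<in> I" "i + s - 1 \<in> I" using es(2)[of i] es(2)[of "i - 1"] unfolding sh by blast+
      show "node_rank G (y (i + s)) = \<mu>" using inner i by blast
      show "reached_by_tip e (%i. P (i + s)) \<mu> i"
        using F2'(2)[OF i] st rk[OF i(1)] rk[OF i(2)] \<mu> unfolding reached_by_tip_def sh tip_rank_iff
        by (elim disjE conjE) metis+
    qed
    obtain i where i: "i \<in> I" "tsuc (path_rank (P i)) = \<mu>" "left_tip (P i) \<or> right_tip (P i)" using tip by blast
    have st: "i - s \<in> steps e" using es(2)[of "i - s"] i by simp
    have "reached_by_tip e (%i. P (i + s)) \<mu> (i - s) \<or> reached_by_tip e (%i. P (i + s)) \<mu> (i - s + 1)"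
      using i st rk[OF i(1,2)] \<mu> unfolding reached_by_tip_def tip_rank_iff by auto
    then show "\<exists>i\<in>posts e. reached_by_tip e (%i. P (i + s)) \<mu> i" using steps_posts[OF st] by blast
    show "no_repetition G e (%i. y (i + s)) (%i. P (i + s))"
      using linked po nd es F1 proper_path path_nodes_subset by (subst no_repetition_iff_linked) blast+
  qed
  moreover have "y (i + s) = start_node G (P (i + s))" if "i \<in> steps e" "i - 1 ~: steps e" for i
    using that es(2)[of i] es(2)[of "i - 1"] unfolding sh y_def by simp
  moreover have "y (i + 1 + s) = end_node G (P (i + s))" if "i \<in> steps e" "i + 1 ~: steps e" for i
    using that es(2)[of i] es(2)[of "i + 1"] unfolding sh y_def by simp
  ultimately show ?thesis using that[of e "%i. y (i + s)" s] es(2) by blast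
qed

text \<open>Only the ends and the length matter in the end. The clauses on ranks and tips are needed
  for the induction: the joined path becomes a constituent of a longer path, and they decide whether
  the posts next to it are still reached by tips and still embrace its end nodes. The rank is the
  least possible, namely the maximum of the ranks of both paths and of their junction.\<close>

definition joins :: "('n, 'b) tpath \<Rightarrow> ('n, 'b) tpath \<Rightarrow> ('n, 'b) tpath \<Rightarrow> bool" where
  "joins r p q \<longleftrightarrow> proper r & lend r = lend p & rend r = rend q & mnodes r <= span p Un span q &
    path_length r \<le> path_length p \<oplus> path_length q &
    path_rank r = max (max (path_rank p) (path_rank q)) (max (rrank p) (lrank q)) &
    (left_tip r \<longleftrightarrow> left_tip p & path_rank p = path_rank r) &
    (right_tip r \<longleftrightarrow> right_tip q & path_rank q = path_rank r) &
    lrank r = lrank p & rrank r = rrank q &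
    node_rank G (start_node G r) \<le> node_rank G (start_node G p) &
    node_rank G (end_node G r) \<le> node_rank G (end_node G q)"

definition joinable :: "('n, 'b) tpath \<Rightarrow> ('n, 'b) tpath \<Rightarrow> bool" where
  "joinable p q \<longleftrightarrow> proper p & proper q & rend p = lend q & span p Int span q <= {rend p}"

lemma joins_reverse: "joins (reverse r) (reverse q) (reverse p) \<longleftrightarrow> joins r p q"
proof -
  have m: "max (max (path_rank q) (path_rank p)) (max (lrank q) (rrank p)) =
    max (max (path_rank p) (path_rank q)) (max (rrank p) (lrank q))"
    by (metis max.commute)
  show ?thesis unfolding joins_def proper_reverse reverse_sets tip_reverse path_rank_reverse
      path_length_reverse lrank_reverse rrank_reverse start_node_reverse end_node_reverse Un_commute[of "span q"] m
      natsum_commute[of "path_length q"]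
    by argo
qed

lemma joinable_reverse: "joinable (reverse q) (reverse p) \<longleftrightarrow> joinable p q"
proof -
  have "joinable (reverse q) (reverse p)" if j: "joinable p q" for p q
  proof -
    have "span q Int span p <= {lend q}" using j unfolding joinable_def by (metis Int_commute)
    then show ?thesis using j unfolding joinable_def proper_reverse reverse_sets by simp
  qed
  from this[of p q] this[of "reverse q" "reverse p"] show ?thesis by auto
qed

lemma joinable_neq: "joinable p q ==> lend p ~= rend q"
  unfolding joinable_def proper_def span_def by auto

lemma joinable_ends:
  assumes "joinable p q"
  shows "lend p ~: span q" "rend q ~: span p"
proof -
  note j = assms[unfolded joinable_def]
  have l: "lend p \<in> span p" and r: "rend q \<in> span q" by (simp_all add: span_def)
  have ne: "lend p ~= rend p" "rend q ~= rend p" using j by (auto simp: proper_def)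
  show "lend p ~: span q" using l ne(1) j by blast
  show "rend q ~: span p" using r ne(2) j by blast
qed

lemma ends_in_span: "lend p \<in> span p" "rend p \<in> span p"
  by (simp_all add: span_def)

lemma joins_span:
  assumes "joins r p q" shows "span r <= span p Un span q"
proof -
  note J = assms[unfolded joins_def]
  have e: "lend r = lend p" "rend r = rend q" and m: "mnodes r <= span p Un span q" using J by blast+
  show ?thesis unfolding span_def[of r] e using m ends_in_span(1)[of p] ends_in_span(2)[of q] by blast
qed

text \<open>The sequence has the left end of p, in one of two ways: it has a first constituent that
  begins as p does, or it is unbounded to the left and every path that eventually follows it there
  has the left tip of p.\<close>

definition lcomp :: "trank \<Rightarrow> ('n, 'b) tpath \<Rightarrow> int set \<Rightarrow> (int \<Rightarrow> ('n, 'b) tpath) \<Rightarrow> bool" where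
  "lcomp \<mu> p K Z \<longleftrightarrow>
    (\<exists>a\<in>K. (\<forall>i\<in>K. a \<le> i) & lend (Z a) = lend p & lrank (Z a) = lrank p &
      node_rank G (start_node G (Z a)) \<le> node_rank G (start_node G p) & ~ (left_tip p & path_rank p = \<mu>)) \<or>
    ((\<forall>a\<in>K. \<exists>i\<in>K. i < a) & left_tip p & path_rank p = \<mu> & lend p ~: (\<Union>i\<in>K. span (Z i)) &
      (\<forall>e y R m s. is_path G (Path \<mu> e y R) --> left_tip (Path \<mu> e y R) --> (\<forall>i<m. R i = Z (i + s)) -->
        start_node G (Path \<mu> e y R) = start_node G p))"

lemma lcomp_facts:
  assumes r: "is_path G (Path \<mu> e y R)" and \<mu>: "\<mu> ~= Fin 0"
    and K: "!!i. i \<in> steps e \<longleftrightarrow> i + s \<in> K" and R: "!!i. R i = Z (i + s)" and l: "lcomp \<mu> p K Z"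
    and y: "\<forall>i\<in>steps e. i - 1 ~: steps e --> y i = start_node G (R i)"
  shows "lend (Path \<mu> e y R) = lend p" "lrank (Path \<mu> e y R) = lrank p"
    "left_tip (Path \<mu> e y R) \<longleftrightarrow> left_tip p & path_rank p = \<mu>"
    "left_tip (Path \<mu> e y R) ==> lend p ~: mnodes (Path \<mu> e y R)"
    "node_rank G (start_node G (Path \<mu> e y R)) \<le> node_rank G (start_node G p)"
proof -
  let ?r = "Path \<mu> e y R"
  have c: "compound \<mu> e y R" using is_path_compound[OF r \<mu>] .
  have mn: "mnodes ?r <= (\<Union>i\<in>K. span (Z i))" unfolding compound_mnodes[OF c] using K R by auto
  from l have "lend ?r = lend p & lrank ?r = lrank p & (left_tip ?r \<longleftrightarrow> left_tip p & path_rank p = \<mu>) &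
    (left_tip ?r --> lend p ~: mnodes ?r) & node_rank G (start_node G ?r) \<le> node_rank G (start_node G p)"
    unfolding lcomp_def
  proof (elim disjE bexE conjE)
    fix a assume a: "a \<in> K" "\<forall>i\<in>K. a \<le> i" "lend (Z a) = lend p" "lrank (Z a) = lrank p" "~ (left_tip p & path_rank p = \<mu>)"
      "node_rank G (start_node G (Z a)) \<le> node_rank G (start_node G p)"
    have nl: "~ left_tip ?r"
    proof
      assume lt: "left_tip ?r"
      have "a - s \<in> steps e" using K a by simp
      then have "a - s - 1 \<in> steps e" using lt by auto
      then have "a - 1 \<in> K" using K[of "a - s - 1"] by simp
      then show False using a(2) by fastforce
    qed
    note lp = left_post[OF r nl]
    have "s = a"
    proof -
      have "s \<in> K" using lp(1) K[of 0] by simp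
      moreover have "0 \<le> a - s" using lp(2)[of "a - s"] K[of "a - s"] a(1) by simp
      ultimately show ?thesis using a(2) by fastforce
    qed
    then have "R 0 = Z a" using R by simp
    moreover have "lend ?r = lend (R 0)" using compound_piece(1)[OF c lp(1)] lp(3) by simp
    moreover have "lrank ?r = lrank (R 0)" using nl \<mu> by auto
    moreover have "start_node G ?r = start_node G (R 0)"
    proof -
      have "y 0 = start_node G (R 0)" using bspec[OF y lp(1)] lp(2)[of "-1"] by fastforce
      then show ?thesis using nl by auto
    qed
    ultimately show ?thesis using a nl by simp
  next
    assume u: "\<forall>a\<in>K. \<exists>i\<in>K. i < a" and p: "left_tip p" "path_rank p = \<mu>" "lend p ~: (\<Union>i\<in>K. span (Z i))"
      and st: "\<forall>e y R m s. is_path G (Path \<mu> e y R) --> left_tip (Path \<mu> e y R) --> (\<forall>i<m. R i = Z (i + s)) -->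
        start_node G (Path \<mu> e y R) = start_node G p"
    have lt: "left_tip ?r"
    proof (rule ccontr)
      assume nl: "~ left_tip ?r"
      note lp = left_post[OF r nl]
      obtain i where "i \<in> K" "i < s" using u lp(1) K[of 0] by auto
      then show False using lp(2)[of "i - s"] K[of "i - s"] by simp
    qed
    have "start_node G ?r = start_node G p" using st[rule_format, OF r lt, of 0 s] R by simp
    moreover have "lrank ?r = lrank p" using left_tip_lrank[OF lt] left_tip_lrank[OF p(1)] p(2) by simp
    ultimately show ?thesis using lt p mn by (auto simp: lend_def)
  qed
  then show "lend ?r = lend p" "lrank ?r = lrank p" "left_tip ?r \<longleftrightarrow> left_tip p & path_rank p = \<mu>"
    "left_tip ?r ==> lend p ~: mnodes ?r"
    "node_rank G (start_node G ?r) \<le> node_rank G (start_node G p)" by blast+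
qed

definition rcomp :: "trank \<Rightarrow> ('n, 'b) tpath \<Rightarrow> int set \<Rightarrow> (int \<Rightarrow> ('n, 'b) tpath) \<Rightarrow> bool" where
  "rcomp \<mu> q K Z \<longleftrightarrow> lcomp \<mu> (reverse q) (uminus ` K) (%i. reverse (Z (- i)))"

lemma rcomp_facts:
  assumes r: "is_path G (Path \<mu> e y R)" and \<mu>: "\<mu> ~= Fin 0"
    and K: "!!i. i \<in> steps e \<longleftrightarrow> i + s \<in> K" and R: "!!i. R i = Z (i + s)" and l: "rcomp \<mu> q K Z"
    and y: "\<forall>i\<in>steps e. i + 1 ~: steps e --> y (i + 1) = end_node G (R i)"
  shows "rend (Path \<mu> e y R) = rend q" "rrank (Path \<mu> e y R) = rrank q"
    "right_tip (Path \<mu> e y R) \<longleftrightarrow> right_tip q & path_rank q = \<mu>"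
    "right_tip (Path \<mu> e y R) ==> rend q ~: mnodes (Path \<mu> e y R)"
    "node_rank G (end_node G (Path \<mu> e y R)) \<le> node_rank G (end_node G q)"
proof -
  let ?r = "Path \<mu> e y R" and ?L = "last_index e"
  let ?y = "%i. y (?L - i)" and ?R = "%i. reverse (R (?L - 1 - i))"
  have rr: "Path \<mu> (flip e) ?y ?R = reverse ?r" by simp
  have p: "is_path G (Path \<mu> (flip e) ?y ?R)" unfolding rr by (rule is_path_reverse[OF r])
  have K': "i \<in> steps (flip e) \<longleftrightarrow> i + (1 - ?L - s) \<in> uminus ` K" for i
  proof -
    have "i + (1 - ?L - s) \<in> uminus ` K \<longleftrightarrow> ?L - 1 - i + s \<in> K"
      unfolding uminus_mem by (simp add: algebra_simps)
    then show ?thesis unfolding steps_flip K by simp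
  qed
  have R': "?R i = reverse (Z (- (i + (1 - ?L - s))))" for i
  proof -
    have "- (i + (1 - ?L - s)) = ?L - 1 - i + s" by simp
    then show ?thesis by (simp only: R)
  qed
  have y': "\<forall>i\<in>steps (flip e). i - 1 ~: steps (flip e) --> ?y i = start_node G (?R i)"
  proof (intro ballI impI)
    fix i assume i: "i \<in> steps (flip e)" "i - 1 ~: steps (flip e)"
    have e: "?L - 1 - (i - 1) = ?L - 1 - i + 1" "?L - i = ?L - 1 - i + 1" by simp_all
    show "?y i = start_node G (?R i)" unfolding start_node_reverse e(2) using y i unfolding steps_flip e(1) by blast
  qed
  note f = lcomp_facts[OF p \<mu> K' R' l[unfolded rcomp_def] y', unfolded rr]
  show "rend ?r = rend q" "rrank ?r = rrank q" "right_tip ?r \<longleftrightarrow> right_tip q & path_rank q = \<mu>"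
    "right_tip ?r ==> rend q ~: mnodes ?r" "node_rank G (end_node G ?r) \<le> node_rank G (end_node G q)"
    using f unfolding reverse_sets lrank_reverse tip_reverse path_rank_reverse start_node_reverse by blast+
qed

lemma assemble:
  assumes F: "fam \<mu> K Z" and K: "iconvex K" "K ~= {}" and \<mu>: "\<mu> \<le> graph_rank G" "\<mu> = tsuc \<alpha>" "\<alpha> ~= Omega"
    and tip: "\<exists>i\<in>K. tsuc (path_rank (Z i)) = \<mu> & (left_tip (Z i) \<or> right_tip (Z i))"
    and l: "lcomp \<mu> p K Z" and r: "rcomp \<mu> q K Z" and pq: "proper p" "proper q" "lend p ~= rend q"
    and sp: "(\<Union>i\<in>K. span (Z i)) <= span p Un span q"
    and len: "finite K ==> natsum.F (%i. path_length (Z i)) K \<le> path_length p \<oplus> path_length q"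
    and mu_eq: "\<mu> = max (max (path_rank p) (path_rank q)) (max (rrank p) (lrank q))"
  shows "\<exists>r. joins r p q"
proof -
  obtain e s y where R: "is_path G (Path \<mu> e y (%i. Z (i + s)))" and st: "!!i. i \<in> steps e \<longleftrightarrow> i + s \<in> K"
    and yl: "\<forall>i\<in>steps e. i - 1 ~: steps e --> y i = start_node G (Z (i + s))"
    and yr: "\<forall>i\<in>steps e. i + 1 ~: steps e --> y (i + 1) = end_node G (Z (i + s))"
    by (rule make_path[OF F K \<mu> tip]) (rule that, assumption, assumption, blast, blast)
  let ?r = "Path \<mu> e y (%i. Z (i + s))"
  have \<mu>0: "\<mu> ~= Fin 0" using \<mu> by auto
  note lf = lcomp_facts[OF R \<mu>0 st refl l yl] and rf = rcomp_facts[OF R \<mu>0 st refl r yr]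
  have "mnodes ?r <= span p Un span q"
    unfolding compound_mnodes[OF is_path_compound[OF R \<mu>0]] using sp st by auto
  moreover have "proper ?r" unfolding proper_def path_rank.simps
  proof (intro conjI impI)
    assume "left_tip ?r \<or> right_tip ?r"
    then show "\<mu> < graph_rank G"
    proof
      assume "left_tip ?r"
      then have "left_tip p" "path_rank p = \<mu>" using lf(3) by blast+
      moreover from this(1) have "path_rank p < graph_rank G" using pq(1) unfolding proper_def by blast
      ultimately show ?thesis by simp
    next
      assume "right_tip ?r"
      then have "right_tip q" "path_rank q = \<mu>" using rf(3) by blast+
      moreover from this(1) have "path_rank q < graph_rank G" using pq(2) unfolding proper_def by blast
      ultimately show ?thesis by simp
    qed
  next
    show "is_path G ?r" by (fact R)
    show "lend ?r ~: mnodes ?r" if "left_tip ?r" unfolding lf(1) by (rule lf(4)[OF that])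
    show "rend ?r ~: mnodes ?r" if "right_tip ?r" unfolding rf(1) by (rule rf(4)[OF that])
    show "lend ?r ~= rend ?r" unfolding lf(1) rf(1) by (fact pq(3))
  qed
  \<comment> \<open>An infinite end of the new path is an infinite end of p or q of the same rank,
    and the length of p or q already contains that of a ray. Only a finite sequence needs the sum
    over the constituents.\<close>
  moreover have "path_length ?r \<le> path_length p \<oplus> path_length q"
  proof (cases e)
    case (Two_Ended k)
    have "K = (%i. i + s) ` {0..<int k}"
    proof (intro set_eqI iffI)
      fix i assume "i \<in> K"
      then have "i - s \<in> steps e" using st by simp
      then show "i \<in> (%i. i + s) ` {0..<int k}" using Two_Ended by (intro rev_image_eqI[of "i - s"]) auto
    next
      fix i assume "i \<in> (%i. i + s) ` {0..<int k}"
      then have "i - s \<in> steps e" using Two_Ended by auto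
      then show "i \<in> K" using st[of "i - s"] by simp
    qed
    then have "finite K" "natsum.F (%i. path_length (Z (i + s))) {0..<int k} = natsum.F (%i. path_length (Z i)) K"
      using natsum.reindex[of "%i. i + s" "{0..<int k}" "%i. path_length (Z i)"] by (auto simp: comp_def)
    then show ?thesis using len Two_Ended by (simp add: path_length_Two_Ended)
  next
    case Outward
    then have "ray_length \<mu> \<le> path_length q" using rf(3) ray_length_le[of q] by auto
    then show ?thesis using Outward natsum_ge2 order.trans by (simp, blast)
  next
    case Inward
    then have "ray_length \<mu> \<le> path_length p" using lf(3) ray_length_le[of p] by auto
    then show ?thesis using Inward natsum_ge1 order.trans by (simp, blast)
  next
    case Endless
    then have "ray_length \<mu> \<le> path_length p" "ray_length \<mu> \<le> path_length q"
      using lf(3) rf(3) ray_length_le[of p] ray_length_le[of q] by auto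
    then show ?thesis using Endless natsum_mono by (simp add: numeral_2_eq_2)
  qed
  ultimately have "joins ?r p q" unfolding joins_def using lf rf mu_eq by simp
  then show ?thesis by blast
qed

section \<open>Joining at a successor rank\<close>

abbreviation (input) tip_piece :: "trank \<Rightarrow> ('n, 'b) tpath \<Rightarrow> bool" where
  "tip_piece \<mu> p \<equiv> tsuc (path_rank p) = \<mu> & (left_tip p \<or> right_tip p)"

lemma fam_sub:
  assumes "fam \<mu> I P" "!!i. i \<in> A ==> i + s \<in> I & Z i = P (i + s)"
  shows "fam \<mu> A Z"
proof -
  note F1 = assms(1)[unfolded fam_def, THEN conjunct1, rule_format]
    and F2 = assms(1)[unfolded fam_def, THEN conjunct2, THEN conjunct1, rule_format]
    and F3 = assms(1)[unfolded fam_def, THEN conjunct2, THEN conjunct2, rule_format]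
  have sh: "i + 1 + s = i + s + 1" for i by simp
  have A: "i + s \<in> I" "Z i = P (i + s)" if "i \<in> A" for i using assms(2)[OF that] by auto
  show ?thesis unfolding fam_def
  proof (intro conjI ballI impI)
    fix i assume i: "i \<in> A"
    show "proper (Z i)" "path_rank (Z i) < \<mu>" using F1[OF A(1)[OF i]] A(2)[OF i] by auto
    assume j: "i + 1 \<in> A"
    have "i + s + 1 \<in> I" "Z (i + 1) = P (i + s + 1)" using A[OF j] unfolding sh by auto
    then show "rend (Z i) = lend (Z (i + 1))"
      "right_tip (Z i) & tsuc (path_rank (Z i)) = \<mu> \<or> left_tip (Z (i + 1)) & tsuc (path_rank (Z (i + 1))) = \<mu>"
      using F2[OF A(1)[OF i]] A(2)[OF i] by auto
  next
    fix i j assume i: "i \<in> A" and j: "j \<in> A" and ij: "i < j"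
    have "i + s < j + s" "j = i + 1 \<longleftrightarrow> j + s = i + s + 1" using ij by auto
    then show "span (Z i) Int span (Z j) <= (if j = i + 1 then {lend (Z j)} else {})"
      unfolding A(2)[OF i] A(2)[OF j] using F3[OF A(1)[OF i] A(1)[OF j]] by (simp split: if_splits)
  qed
qed

lemma fam_reverse:
  assumes "fam \<mu> I P"
  shows "fam \<mu> (uminus ` I) (%i. reverse (P (- i)))"
proof -
  note F1 = assms(1)[unfolded fam_def, THEN conjunct1, rule_format]
    and F2 = assms(1)[unfolded fam_def, THEN conjunct2, THEN conjunct1, rule_format]
    and F3 = assms(1)[unfolded fam_def, THEN conjunct2, THEN conjunct2, rule_format]
  show ?thesis unfolding fam_def
  proof (intro conjI ballI impI; unfold uminus_mem)
    fix i assume i: "- i \<in> I"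
    show "proper (reverse (P (- i)))" "path_rank (reverse (P (- i))) < \<mu>" using F1[OF i] by auto
    assume j: "- (i + 1) \<in> I"
    define k where "k = - (i + 1)"
    have k: "- i = k + 1" by (simp add: k_def)
    show "rend (reverse (P (- i))) = lend (reverse (P (- (i + 1))))"
      "right_tip (reverse (P (- i))) & tsuc (path_rank (reverse (P (- i)))) = \<mu> \<or>
       left_tip (reverse (P (- (i + 1)))) & tsuc (path_rank (reverse (P (- (i + 1))))) = \<mu>"
      using F2[of k] i j unfolding k_def[symmetric] k by auto
  next
    fix i j assume i: "- i \<in> I" and j: "- j \<in> I" and ij: "i < j"
    have lt: "- j < - i" using ij by simp
    have s: "span (P (- j)) Int span (P (- i)) <= (if - i = - j + 1 then {lend (P (- i))} else {})"
      using F3[OF j i lt] .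
    show "span (reverse (P (- i))) Int span (reverse (P (- j))) <= (if j = i + 1 then {lend (reverse (P (- j)))} else {})"
    proof (cases "j = i + 1")
      case True
      then have e: "- i = - j + 1" by simp
      have "rend (P (- j)) = lend (P (- i))" using F2[OF j] i unfolding e by blast
      then have "span (P (- i)) Int span (P (- j)) <= {rend (P (- j))}"
        using s[unfolded if_P[OF e]] by (simp only: Int_commute)
      then show ?thesis unfolding reverse_sets if_P[OF True] .
    next
      case False
      then have ne: "- i ~= - j + 1" by auto
      have "span (P (- i)) Int span (P (- j)) <= {}"
        using s[unfolded if_not_P[OF ne]] by (simp only: Int_commute)
      then show ?thesis unfolding reverse_sets if_not_P[OF False] .
    qed
  qed
qed

lemma fam_glue:
  assumes "fam \<mu> A Z" "fam \<mu> B Z" "!!a. a \<in> A ==> a < m" "!!b. b \<in> B ==> m \<le> b"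
    and "m - 1 \<in> A ==> m \<in> B ==> rend (Z (m - 1)) = lend (Z m) &
      (right_tip (Z (m - 1)) & tsuc (path_rank (Z (m - 1))) = \<mu> \<or> left_tip (Z m) & tsuc (path_rank (Z m)) = \<mu>)"
    and cross: "!!a b. a \<in> A ==> b \<in> B ==> span (Z a) Int span (Z b) <= (if b = a + 1 then {lend (Z b)} else {})"
  shows "fam \<mu> (A Un B) Z"
proof -
  have "rend (Z i) = lend (Z (i + 1)) &
      (right_tip (Z i) & tsuc (path_rank (Z i)) = \<mu> \<or> left_tip (Z (i + 1)) & tsuc (path_rank (Z (i + 1))) = \<mu>)"
    if i: "i \<in> A Un B" "i + 1 \<in> A Un B" for i
  proof -
    consider "i \<in> A" "i + 1 \<in> A" | "i \<in> B" "i + 1 \<in> B" | "i \<in> A" "i + 1 \<in> B" | "i \<in> B" "i + 1 \<in> A"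
      using i by blast
    then show ?thesis
    proof cases
      case 1
      then show ?thesis using assms(1) unfolding fam_def by blast
    next
      case 2
      then show ?thesis using assms(2) unfolding fam_def by blast
    next
      case 3
      then have "i = m - 1" using assms(3)[of i] assms(4)[of "i + 1"] by linarith
      then show ?thesis using assms(5) 3 by simp
    next
      case 4
      then have False using assms(3)[of "i + 1"] assms(4)[of i] by linarith
      then show ?thesis ..
    qed
  qed
  moreover have "span (Z i) Int span (Z j) <= (if j = i + 1 then {lend (Z j)} else {})"
    if i: "i \<in> A Un B" "j \<in> A Un B" "i < j" for i j
  proof -
    consider "i \<in> A" "j \<in> A" | "i \<in> B" "j \<in> B" | "i \<in> A" "j \<in> B" | "i \<in> B" "j \<in> A" using i by blast
    then show ?thesis
    proof cases
      case 1
      then show ?thesis using assms(1) i(3) unfolding fam_def by blast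
    next
      case 2
      then show ?thesis using assms(2) i(3) unfolding fam_def by blast
    next
      case 3
      then show ?thesis using cross by blast
    next
      case 4
      then have False using assms(3)[of j] assms(4)[of i] i(3) by linarith
      then show ?thesis ..
    qed
  qed
  ultimately show ?thesis using assms(1,2) unfolding fam_def by blast
qed

text \<open>The path p as a sequence for a \<mu>-path that ends at index 0: its own constituents if
  it has rank \<mu>, and p as the only constituent if its rank is smaller.\<close>

definition seqrep :: "trank \<Rightarrow> ('n, 'b) tpath \<Rightarrow> int set \<Rightarrow> (int \<Rightarrow> ('n, 'b) tpath) \<Rightarrow> bool" where
  "seqrep \<mu> p I P \<longleftrightarrow> I <= {..0} & 0 \<in> I & iconvex I & fam \<mu> I P & rend (P 0) = rend p & rrank (P 0) = rrank p &
    (\<Union>i\<in>I. span (P i)) <= span p & lcomp \<mu> p I P &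
    (finite I --> natsum.F (%i. path_length (P i)) I \<le> path_length p) &
    (path_rank p = \<mu> --> (\<exists>i\<in>I. tip_piece \<mu> (P i)))"

lemma succ_tip:
  assumes "is_path G (Path \<mu> e x Q)" "\<mu> = tsuc \<alpha>"
  shows "\<exists>i\<in>steps e. tip_piece \<mu> (Q i)"
  using assms(1)
proof cases
  case (succ \<beta>)
  then obtain i where "reached_by_tip e Q \<mu> i" by blast
  then show ?thesis unfolding reached_by_tip_def tip_rank_iff by (elim disjE conjE) (rule bexI, auto)+
qed (use assms(2) in auto)

lemma seqrep_exists:
  assumes p: "proper p" "path_rank p \<le> \<mu>" "path_rank p = \<mu> ==> ~ right_tip p" and \<mu>: "\<mu> = tsuc \<alpha>" "\<alpha> ~= Omega"
  shows "\<exists>I P. seqrep \<mu> p I P"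
proof (cases "path_rank p = \<mu>")
  case False
  then have "path_rank p < \<mu>" using p(2) by simp
  then have "seqrep \<mu> p {0} (%_. p)"
    using p(1) by (auto simp: seqrep_def fam_def lcomp_def iconvex_def)
  then show ?thesis by blast
next
  case True
  then obtain e x Q where pQ: "p = Path \<mu> e x Q" using proper_path[OF p(1)] by (cases p) auto
  have ip: "is_path G (Path \<mu> e x Q)" using proper_path[OF p(1)] unfolding pQ .
  have nr: "~ right_tip (Path \<mu> e x Q)" using p(3)[OF True] unfolding pQ .
  have \<mu>0: "\<mu> ~= Fin 0" "\<mu> ~= Arrow_Omega" using \<mu> by auto
  have c: "compound \<mu> e x Q" using is_path_compound[OF ip \<mu>0(1)] .
  note rp = right_post[OF ip nr]
  let ?l = "last_index e - 1"
  let ?I = "{i. i + ?l \<in> steps e}" and ?P = "%i. Q (i + ?l)"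
  have "fam \<mu> (steps e) Q"
    unfolding fam_def
  proof (intro conjI ballI impI)
    fix i assume i: "i \<in> steps e"
    show "proper (Q i)" "path_rank (Q i) < \<mu>" using compound_piece(3)[OF c i] compoundD(7)[OF c i] by auto
    assume j: "i + 1 \<in> steps e"
    show "rend (Q i) = lend (Q (i + 1))" using compound_piece[OF c i] compound_piece[OF c j] by simp
    have "reached_by_tip e Q \<mu> (i + 1)"
    proof -
      have "i + 1 - 1 \<in> steps e" using i by simp
      then show ?thesis using c j \<mu>0(2) unfolding compound_def by metis
    qed
    then show "right_tip (Q i) & tsuc (path_rank (Q i)) = \<mu> \<or> left_tip (Q (i + 1)) & tsuc (path_rank (Q (i + 1))) = \<mu>"
      unfolding reached_by_tip_def tip_rank_iff by auto
  next
    fix i j assume i: "i \<in> steps e" and j: "j \<in> steps e" and ij: "i < j"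
    show "span (Q i) Int span (Q j) <= (if j = i + 1 then {lend (Q j)} else {})"
      using compound_span[OF c i j ij] unfolding compound_piece(1)[OF c j] .
  qed
  then have F: "fam \<mu> ?I ?P" by (rule fam_sub) simp
  have I0: "?I <= {..0}" using rp(2) by fastforce
  have cv: "iconvex ?I"
    unfolding iconvex_def
  proof (intro ballI allI impI)
    fix i k j assume "i \<in> ?I" "k \<in> ?I" "i \<le> j & j \<le> k"
    then show "j \<in> ?I" using steps_convex[of "i + ?l" e "k + ?l" "j + ?l"] by simp
  qed
  have sp: "(\<Union>i\<in>?I. span (?P i)) <= mnodes p" unfolding pQ compound_mnodes[OF c] by auto
  have "rend (Q ?l) = rend p" using compound_piece(2)[OF c rp(1)] rp(3) pQ by simp
  moreover have "rrank (Q ?l) = rrank p" using nr \<mu>0 pQ by auto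
  moreover have "lcomp \<mu> p ?I ?P"
  proof (cases "left_tip p")
    case False
    then have nl: "~ left_tip (Path \<mu> e x Q)" using pQ by simp
    note lp = left_post[OF ip nl]
    have "lend (Q 0) = lend p" using compound_piece(1)[OF c lp(1)] lp(3) pQ by simp
    moreover have "lrank (Q 0) = lrank p" using nl \<mu>0 pQ by auto
    moreover have "node_rank G (start_node G (Q 0)) \<le> node_rank G (start_node G p)"
    proof -
      have "start_node G p = x 0" using nl pQ by auto
      then show ?thesis using embraces_rank[OF compoundD(8)[OF c lp(1)]] by simp
    qed
    ultimately show ?thesis using False lp(1,2) unfolding lcomp_def
      by (intro disjI1 bexI[of _ "- ?l"]) force+
  next
    case True
    have lt\<mu>: "\<mu> < graph_rank G" proof -
      have "path_rank p = \<mu>" using pQ by simp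
      moreover have "path_rank p < graph_rank G" using p(1) True unfolding proper_def by blast
      ultimately show ?thesis by simp
    qed
    have "lend p ~: (\<Union>i\<in>?I. span (?P i))" using sp True p(1) by (auto simp: proper_def)
    moreover have "start_node G (Path \<mu> e' y R) = start_node G p"
      if r: "is_path G (Path \<mu> e' y R)" "left_tip (Path \<mu> e' y R)" "\<forall>i<m. R i = ?P (i + s)" for e' y R m s
    proof -
      have "R i = Q (i + (s + ?l))" if "i < m" for i using r(3) that by (simp add: algebra_simps)
      then have "start_node G (Path \<mu> e x Q) = start_node G (Path \<mu> e' y R)"
        by (rule start_node_eq[OF ip True[unfolded pQ] r(1,2) lt\<mu>])
      then show ?thesis unfolding pQ by (rule sym)
    qed
    moreover have "\<forall>a\<in>?I. \<exists>i\<in>?I. i < a"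
    proof
      fix a assume "a \<in> ?I"
      then have "a - 1 \<in> ?I" using True pQ by auto
      then show "\<exists>i\<in>?I. i < a" by (intro bexI[of _ "a - 1"]) auto
    qed
    ultimately show ?thesis using True pQ unfolding lcomp_def by auto
  qed
  moreover have "natsum.F (%i. path_length (?P i)) ?I \<le> path_length p" if f: "finite ?I"
  proof -
    have im: "steps e = (%i. i + ?l) ` ?I"
    proof (intro set_eqI iffI)
      fix i assume "i \<in> steps e"
      then show "i \<in> (%i. i + ?l) ` ?I" by (intro rev_image_eqI[of "i - ?l"]) auto
    qed auto
    have fs: "finite (steps e)" by (subst im) (rule finite_imageI[OF f])
    have fs2: "natsum.F (%i. path_length (Q i)) (steps e) = natsum.F (%i. path_length (?P i)) ?I"
      using natsum.reindex[of "%i. i + ?l" ?I "%i. path_length (Q i)"] unfolding im[symmetric] comp_def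
      by (simp add: inj_on_def)
    from fs obtain k where "e = Two_Ended k" by (cases e) (auto simp: infinite_Iio infinite_Ici)
    then show ?thesis using fs2 pQ by (simp add: path_length_Two_Ended)
  qed
  moreover have "\<exists>i\<in>?I. tip_piece \<mu> (?P i)"
  proof -
    obtain i where "i \<in> steps e" "tip_piece \<mu> (Q i)" using succ_tip[OF ip \<mu>(1)] by blast
    then show ?thesis by (intro bexI[of _ "i - ?l"]) auto
  qed
  moreover have "0 \<in> ?I" using rp(1) by simp
  moreover have "(\<Union>i\<in>?I. span (?P i)) <= span p" using sp by (auto simp: span_def)
  ultimately have "seqrep \<mu> p ?I ?P" unfolding seqrep_def using F I0 cv by auto
  then show ?thesis by blast
qed

text \<open>The left end depends only on the constituents before index 0 and on how the one at index
  0 begins; the latter may be replaced by a longer piece and followed by others.\<close>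

lemma lcomp_ext:
  assumes l: "lcomp \<mu> p I P" and I: "iconvex I" "0 \<in> I" "I <= {..0}"
    and A: "!!i. i + s \<le> 0 ==> i \<in> K \<longleftrightarrow> i + s \<in> I"
    and C: "!!i. i \<in> K ==> i + s < 0 ==> Z i = P (i + s)"
    and D: "lend (Z (- s)) = lend (P 0)" "lrank (Z (- s)) = lrank (P 0)"
      "node_rank G (start_node G (Z (- s))) \<le> node_rank G (start_node G (P 0))"
    and E: "left_tip p ==> path_rank p = \<mu> ==> lend p ~: (\<Union>i\<in>K. span (Z i))"
  shows "lcomp \<mu> p K Z"
  using l[unfolded lcomp_def]
proof (elim disjE bexE conjE)
  fix a assume a: "a \<in> I" "\<forall>i\<in>I. a \<le> i" "lend (P a) = lend p" "lrank (P a) = lrank p" "~ (left_tip p & path_rank p = \<mu>)"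
    "node_rank G (start_node G (P a)) \<le> node_rank G (start_node G p)"
  have a0: "a \<le> 0" using a(1) I(3) by auto
  have aK: "a - s \<in> K" using A[of "a - s"] a0 a(1) by simp
  have "lend (Z (a - s)) = lend (P a) & lrank (Z (a - s)) = lrank (P a) &
    node_rank G (start_node G (Z (a - s))) \<le> node_rank G (start_node G (P a))"
  proof (cases "a = 0")
    case True
    then show ?thesis using D by simp
  next
    case False
    then have "a - s + s < 0" using a0 by simp
    from C[OF aK this] show ?thesis by simp
  qed
  moreover have "a - s \<le> i" if i: "i \<in> K" for i
  proof (cases "i + s \<le> 0")
    case True
    then show ?thesis using A[OF True] i a(2) by force
  qed (use a0 in simp)
  ultimately show ?thesis unfolding lcomp_def using aK a(3-6) by (intro disjI1 bexI[of _ "a - s"]) auto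
next
  assume u: "\<forall>a\<in>I. \<exists>i\<in>I. i < a" and p: "left_tip p" "path_rank p = \<mu>"
    and st: "\<forall>e y R m s. is_path G (Path \<mu> e y R) --> left_tip (Path \<mu> e y R) --> (\<forall>i<m. R i = P (i + s)) -->
        start_node G (Path \<mu> e y R) = start_node G p"
  have below: "\<exists>i\<in>I. i \<le> - int n" for n
  proof (induction n)
    case (Suc n)
    then obtain i where "i \<in> I" "i \<le> - int n" by blast
    moreover from this obtain i' where "i' \<in> I" "i' < i" using u by blast
    ultimately show ?case by (intro bexI[of _ i']) auto
  qed (use I in auto)
  have all: "i \<in> I" if i: "i \<le> 0" for i
  proof -
    obtain k where "k \<in> I" "k \<le> i" using below[of "nat (- i)"] i by auto
    then show ?thesis using I(1,2) i unfolding iconvex_def by blast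
  qed
  have low: "\<exists>i\<in>K. i < a" if "a \<in> K" for a
  proof -
    have "min (a - 1) (- s) \<in> K" using A[of "min (a - 1) (- s)"] all by auto
    then show ?thesis by (intro bexI[of _ "min (a - 1) (- s)"]) auto
  qed
  have start: "start_node G (Path \<mu> e y R) = start_node G p"
    if r: "is_path G (Path \<mu> e y R)" "left_tip (Path \<mu> e y R)" "\<forall>i<m. R i = Z (i + t)" for e y R m t
  proof -
    have "R i = P (i + (t + s))" if i: "i < min m (- s - t)" for i
    proof -
      have lt: "i + t + s < 0" using i by simp
      then have "i + t \<in> K" using A[of "i + t"] all by simp
      then have "Z (i + t) = P (i + t + s)" using C lt by blast
      then show ?thesis using r(3) i by (simp add: algebra_simps)
    qed
    then show ?thesis using st r(1,2) by blast
  qed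
  have "\<forall>e y R m s. is_path G (Path \<mu> e y R) --> left_tip (Path \<mu> e y R) --> (\<forall>i<m. R i = Z (i + s)) -->
        start_node G (Path \<mu> e y R) = start_node G p"
    by (intro allI impI) (rule start)
  then show ?thesis unfolding lcomp_def using p E[OF p] low by (intro disjI2 conjI ballI) simp_all
qed

lemma seqrep_end:
  assumes "seqrep \<mu> p I P" "i \<in> I" "rend p \<in> span (P i)"
  shows "i = 0"
proof (rule ccontr)
  assume "i ~= 0"
  then have i: "i < 0" using assms(1,2) by (auto simp: seqrep_def)
  have z: "0 \<in> I" "fam \<mu> I P" "rend (P 0) = rend p" using assms(1) by (auto simp: seqrep_def)
  have "rend p \<in> span (P i) Int span (P 0)" using assms(3) z(3) by (simp add: span_def)
  moreover have "span (P i) Int span (P 0) <= (if 0 = i + 1 then {lend (P 0)} else {})"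
    using z(2) assms(2) z(1) i unfolding fam_def by blast
  ultimately have "rend p = lend (P 0)" by (auto split: if_splits)
  moreover have "proper (P 0)" using z unfolding fam_def by blast
  ultimately show False using z(3) by (simp add: proper_def)
qed

lemma seqrep_span: "seqrep \<mu> p I P ==> i \<in> I ==> span (P i) <= span p"
  unfolding seqrep_def by blast

text \<open>If the junction has rank \<mu>, it is reached by a tip of rank \<mu> - 1 from at least
  one side and can be a post of a \<mu>-path. The two sequences are then put side by side
  unchanged.\<close>

lemma join_at_top_rank:
  assumes j: "joinable p q" and \<mu>: "\<mu> = tsuc \<alpha>" "\<alpha> ~= Omega" "\<mu> \<le> graph_rank G"
    and le: "path_rank p \<le> \<mu>" "path_rank q \<le> \<mu>" and jr: "max (rrank p) (lrank q) = \<mu>"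
  shows "\<exists>r. joins r p q"
proof -
  have pq: "proper p" "proper q" "rend p = lend q" "span p Int span q <= {rend p}" using j by (auto simp: joinable_def)
  \<comment> \<open>A \<mu>-path with a right tip would give its end a rank above \<mu>.\<close>
  have "path_rank p ~= \<mu>" if t: "right_tip p"
  proof
    assume e: "path_rank p = \<mu>"
    have "\<mu> ~= Omega" using pq(1) t e by (auto simp: proper_def)
    then have "\<mu> < rrank p" using right_tip_rrank[OF t] e less_tsuc by simp
    then show False using jr by auto
  qed
  then obtain I P where p: "seqrep \<mu> p I P" using seqrep_exists[OF pq(1) le(1) _ \<mu>(1,2)] by metis
  have "path_rank q ~= \<mu>" if t: "left_tip q"
  proof
    assume e: "path_rank q = \<mu>"
    have "\<mu> ~= Omega" using pq(2) t e by (auto simp: proper_def)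
    then have "\<mu> < lrank q" using left_tip_lrank[OF t] e less_tsuc by simp
    then show False using jr by auto
  qed
  then obtain I' P' where q: "seqrep \<mu> (reverse q) I' P'"
    using seqrep_exists[of "reverse q" \<mu> \<alpha>] pq(2) le(2) \<mu> by auto
  note P = p[unfolded seqrep_def] and Q = q[unfolded seqrep_def]
  have fI: "fam \<mu> I P" "fam \<mu> I' P'" and zI: "0 \<in> I" "0 \<in> I'" and cI: "iconvex I" "iconvex I'"
    and I0: "I <= {..0}" "I' <= {..0}" and lc: "lcomp \<mu> p I P" "lcomp \<mu> (reverse q) I' P'"
    and ends: "rend (P 0) = rend p" "rrank (P 0) = rrank p" "rend (P' 0) = lend q" "rrank (P' 0) = lrank q"
    and lens: "finite I ==> natsum.F (%i. path_length (P i)) I \<le> path_length p"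
      "finite I' ==> natsum.F (%i. path_length (P' i)) I' \<le> path_length q"
    using P Q by simp_all
  \<comment> \<open>The last constituent of p is moved to index -1, and the reversed sequence of q
    begins at index 0.\<close>
  define A where "A = (%i. i - 1) ` I"
  define B where "B = uminus ` I'"
  define Z where "Z i = (if i < 0 then P (i + 1) else reverse (P' (- i)))" for i
  have memA: "i \<in> A \<longleftrightarrow> i + 1 \<in> I" for i unfolding A_def by (auto simp: image_iff intro: bexI[of _ "i + 1"])
  have memB: "i \<in> B \<longleftrightarrow> - i \<in> I'" for i unfolding B_def by (rule uminus_mem)
  have A0: "a < 0" if "a \<in> A" for a using that I0 memA by fastforce
  have B0: "0 \<le> b" if "b \<in> B" for b using that I0 memB by fastforce
  have ZA: "Z a = P (a + 1)" if "a \<in> A" for a using A0[OF that] by (simp add: Z_def)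
  have ZB: "Z b = reverse (P' (- b))" if "b \<in> B" for b using B0[OF that] by (simp add: Z_def)
  have FA: "fam \<mu> A Z" by (rule fam_sub[of _ I P _ 1]) (use fI memA ZA in auto)
  have FB: "fam \<mu> B Z"
    by (rule fam_sub[of _ B "%i. reverse (P' (- i))" _ 0]) (use fam_reverse[of \<mu> I' P'] fI ZB in \<open>auto simp: B_def\<close>)
  have pr: "proper (P 0)" "proper (P' 0)" "path_rank (P 0) < \<mu>" "path_rank (P' 0) < \<mu>"
    using fI zI unfolding fam_def by blast+
  have tipj: "right_tip (P 0) & tsuc (path_rank (P 0)) = \<mu> \<or> right_tip (P' 0) & tsuc (path_rank (P' 0)) = \<mu>"
  proof -
    have *: "right_tip w & tsuc (path_rank w) = \<mu>" if w: "proper w" "path_rank w < \<mu>" "rrank w = \<mu>" for w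
    proof -
      have "right_tip w" using rrank_le[OF w(1)] w(2,3) by (metis leD)
      then show ?thesis using right_tip_rrank[of w] w(3) by simp
    qed
    have "rrank p = \<mu> \<or> lrank q = \<mu>" using jr by (auto simp: max_def split: if_splits)
    then have "rrank (P 0) = \<mu> \<or> rrank (P' 0) = \<mu>" using ends by simp
    then show ?thesis using * pr by blast
  qed
  have zA: "-1 \<in> A" and zB: "0 \<in> B" using zI memA memB by auto
  have z: "Z (-1) = P 0" "Z 0 = reverse (P' 0)" by (auto simp: Z_def)
  have lq: "lend (Z 0) = rend p" using ends z(2) pq(3) by simp
  have F: "fam \<mu> (A Un B) Z"
  proof (rule fam_glue[OF FA FB A0 B0])
    show "rend (Z (0 - 1)) = lend (Z 0) &
      (right_tip (Z (0 - 1)) & tsuc (path_rank (Z (0 - 1))) = \<mu> \<or> left_tip (Z 0) & tsuc (path_rank (Z 0)) = \<mu>)"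
      using tipj ends lq z by simp
  next
    fix a b assume a: "a \<in> A" and b: "b \<in> B"
    have sa: "span (Z a) <= span p" using seqrep_span[OF p, of "a + 1"] memA a ZA by simp
    have sb: "span (Z b) <= span q" using seqrep_span[OF q, of "- b"] memB b ZB by simp
    have sub: "span (Z a) Int span (Z b) <= {rend p}" using sa sb pq(4) by blast
    show "span (Z a) Int span (Z b) <= (if b = a + 1 then {lend (Z b)} else {})"
    proof (cases "rend p \<in> span (Z a) Int span (Z b)")
      case True
      then have "a + 1 = 0" using seqrep_end[OF p, of "a + 1"] memA a ZA by simp
      moreover have "- b = 0" using True seqrep_end[OF q, of "- b"] memB b ZB pq(3) by simp
      ultimately have "b = a + 1" "lend (Z b) = rend p" using lq by auto
      then show ?thesis using sub by simp
    next
      case False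
      then show ?thesis using sub by auto
    qed
  qed
  have sp: "(\<Union>i\<in>A Un B. span (Z i)) <= span p Un span q"
    using seqrep_span[OF p] seqrep_span[OF q] memA memB ZA ZB by fastforce
  show ?thesis
  proof (rule assemble[OF F _ _ \<mu>(3,1,2) _ _ _ pq(1,2) joinable_neq[OF j] sp])
    show "iconvex (A Un B)"
      unfolding iconvex_def
    proof (intro ballI allI impI)
      fix i k l assume i: "i \<in> A Un B" and k: "k \<in> A Un B" and l: "i \<le> l & l \<le> k"
      show "l \<in> A Un B"
      proof (cases "l < 0")
        case True
        then have "i \<in> A" using i l B0[of i] by auto
        then have "i + 1 \<in> I" "i + 1 \<le> l + 1" "l + 1 \<le> 0" using True l memA[of i] by auto
        then have "l + 1 \<in> I" using cI(1) zI(1) unfolding iconvex_def by blast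
        then show ?thesis using memA by simp
      next
        case False
        then have "k \<in> B" using k l A0[of k] by auto
        then have "- k \<in> I'" using memB by simp
        moreover have "- k \<le> - l" "- l \<le> 0" using False l by auto
        ultimately have "- l \<in> I'" using cI(2) zI(2) unfolding iconvex_def by blast
        then show ?thesis using memB by simp
      qed
    qed
    show "A Un B ~= {}" using zA by auto
    show "\<exists>i\<in>A Un B. tip_piece \<mu> (Z i)"
      using tipj zA zB z by (metis UnCI path_rank_reverse tip_reverse(1))
    show "lcomp \<mu> p (A Un B) Z"
    proof (rule lcomp_ext[of \<mu> p I P 1])
      show "lend p ~: (\<Union>i\<in>A Un B. span (Z i))" if lt: "left_tip p" "path_rank p = \<mu>"
      proof -
        have "lend p ~: (\<Union>i\<in>I. span (P i))" using lc(1) lt unfolding lcomp_def by blast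
        then have "lend p ~: span (Z i)" if "i \<in> A" for i using memA ZA that by auto
        moreover have "lend p ~: span (Z i)" if "i \<in> B" for i
          using seqrep_span[OF q, of "- i"] memB ZB joinable_ends(1)[OF j] that by auto
        ultimately show ?thesis by blast
      qed
      show "i \<in> A Un B \<longleftrightarrow> i + 1 \<in> I" if "i + 1 \<le> 0" for i using that memA B0[of i] by auto
    qed (use lc cI zI I0 ZA ends in \<open>auto simp: Z_def\<close>)
    show "rcomp \<mu> q (A Un B) Z"
      unfolding rcomp_def
    proof (rule lcomp_ext[of \<mu> "reverse q" I' P' 0])
      show "lend (reverse q) ~: (\<Union>i\<in>uminus ` (A Un B). span (reverse (Z (- i))))"
        if lt: "left_tip (reverse q)" "path_rank (reverse q) = \<mu>"
      proof -
        have "rend q ~: (\<Union>i\<in>I'. span (P' i))" using lc(2) lt unfolding lcomp_def reverse_sets by blast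
        then have "rend q ~: span (Z i)" if "i \<in> B" for i using memB ZB that by auto
        moreover have "rend q ~: span (Z i)" if "i \<in> A" for i
          using seqrep_span[OF p, of "i + 1"] memA ZA joinable_ends(2)[OF j] that by auto
        ultimately show ?thesis by auto
      qed
      show "i \<in> uminus ` (A Un B) \<longleftrightarrow> i + 0 \<in> I'" if "i + 0 \<le> 0" for i
        unfolding uminus_mem using that memB[of "- i"] A0[of "- i"] by auto
    qed (use lc cI zI I0 ends in \<open>auto simp: Z_def uminus_mem\<close>)
    show "\<mu> = max (max (path_rank p) (path_rank q)) (max (rrank p) (lrank q))"
      using le jr by (simp add: max_def)
    assume fin: "finite (A Un B)"
    have fin1: "finite I" using fin finite_imageD[of "%i. i - 1" I] by (auto simp: A_def inj_on_def)
    have fin2: "finite I'" using fin finite_imageD[of uminus I'] by (auto simp: B_def inj_on_def)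
    have "A Int B = {}" using A0 B0 by fastforce
    then have "natsum.F (%i. path_length (Z i)) (A Un B) =
      natsum.F (%i. path_length (Z i)) A \<oplus> natsum.F (%i. path_length (Z i)) B"
      using fin by (intro natsum.union_disjoint) auto
    moreover have "natsum.F (%i. path_length (Z i)) A = natsum.F (%i. path_length (P i)) I"
      by (rule natsum.reindex_bij_witness[of _ "%i. i - 1" "%i. i + 1"]) (auto simp: memA ZA)
    moreover have "natsum.F (%i. path_length (Z i)) B = natsum.F (%i. path_length (P' i)) I'"
      by (rule natsum.reindex_bij_witness[of _ uminus uminus]) (auto simp: memB ZB)
    ultimately show "natsum.F (%i. path_length (Z i)) (A Un B) \<le> path_length p \<oplus> path_length q"
      using lens fin1 fin2 by (auto intro: natsum_mono)
  qed
qed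

lemma natsum_rearrange: "a \<oplus> ((x \<oplus> y) \<oplus> b) = (x \<oplus> a) \<oplus> (y \<oplus> b)"
  by (simp only: natsum.assoc natsum.commute natsum.left_commute)

text \<open>A junction of rank below \<mu> cannot be an interior post of a \<mu>-path. The last
  constituent of p and the first of q are therefore merged into one constituent by the induction
  hypothesis, which applies because both and their junction have rank below \<mu>.\<close>

lemma join_below_top_rank:
  assumes j: "joinable p q" and \<mu>: "\<mu> = tsuc \<alpha>" "\<alpha> ~= Omega" "\<mu> \<le> graph_rank G"
    and mx_pq: "max (path_rank p) (path_rank q) = \<mu>" and jr: "max (rrank p) (lrank q) < \<mu>"
    and IH: "!!p' q'. joinable p' q' ==>
      max (max (path_rank p') (path_rank q')) (max (rrank p') (lrank q')) < \<mu> ==> \<exists>r. joins r p' q'"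
  shows "\<exists>r. joins r p q"
proof -
  have le: "path_rank p \<le> \<mu>" "path_rank q \<le> \<mu>" using mx_pq by auto
  have pq: "proper p" "proper q" "rend p = lend q" "span p Int span q <= {rend p}" using j by (auto simp: joinable_def)
  have "path_rank p ~= \<mu>" if t: "right_tip p"
  proof
    assume e: "path_rank p = \<mu>"
    have "\<mu> ~= Omega" using pq(1) t e by (auto simp: proper_def)
    then have "\<mu> < rrank p" using right_tip_rrank[OF t] e less_tsuc by simp
    then show False using jr by auto
  qed
  then obtain I P where p: "seqrep \<mu> p I P" using seqrep_exists[OF pq(1) le(1) _ \<mu>(1,2)] by metis
  have "path_rank q ~= \<mu>" if t: "left_tip q"
  proof
    assume e: "path_rank q = \<mu>"
    have "\<mu> ~= Omega" using pq(2) t e by (auto simp: proper_def)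
    then have "\<mu> < lrank q" using left_tip_lrank[OF t] e less_tsuc by simp
    then show False using jr by auto
  qed
  then obtain I' P' where q: "seqrep \<mu> (reverse q) I' P'"
    using seqrep_exists[of "reverse q" \<mu> \<alpha>] pq(2) le(2) \<mu> by auto
  note P = p[unfolded seqrep_def] and Q = q[unfolded seqrep_def]
  have fI: "fam \<mu> I P" "fam \<mu> I' P'" and zI: "0 \<in> I" "0 \<in> I'" and cI: "iconvex I" "iconvex I'"
    and I0: "I <= {..0}" "I' <= {..0}" and lc: "lcomp \<mu> p I P" "lcomp \<mu> (reverse q) I' P'"
    and ends: "rend (P 0) = rend p" "rrank (P 0) = rrank p" "rend (P' 0) = lend q" "rrank (P' 0) = lrank q"
    and lens: "finite I ==> natsum.F (%i. path_length (P i)) I \<le> path_length p"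
      "finite I' ==> natsum.F (%i. path_length (P' i)) I' \<le> path_length q"
    using P Q by simp_all
  have pr: "proper (P 0)" "proper (P' 0)" "path_rank (P 0) < \<mu>" "path_rank (P' 0) < \<mu>"
    using fI zI unfolding fam_def by blast+
  define q0 where "q0 = reverse (P' 0)"
  have q0: "proper q0" "path_rank q0 < \<mu>" "lend q0 = rend p" "lrank q0 = lrank q" "span q0 <= span q"
    using pr ends pq(3) seqrep_span[OF q zI(2)] by (auto simp: q0_def)
  have P0: "rend (P 0) = rend p" "rrank (P 0) = rrank p" "span (P 0) <= span p"
    using ends seqrep_span[OF p zI(1)] by auto
  have "joinable (P 0) q0" unfolding joinable_def using pr(1) q0 P0 pq(4) by auto
  moreover have lt0: "max (max (path_rank (P 0)) (path_rank q0)) (max (rrank (P 0)) (lrank q0)) < \<mu>"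
    using pr(3) q0(2,4) P0(2) jr by simp
  ultimately obtain c where c0: "joins c (P 0) q0" using IH by blast
  note J = c0[unfolded joins_def]
  have rk: "path_rank c = max (max (path_rank (P 0)) (path_rank q0)) (max (rrank (P 0)) (lrank q0))" using J by blast
  have c7: "path_rank c < \<mu>" unfolding rk by (rule lt0)
  have c89: "path_rank (P 0) \<le> path_rank c" "path_rank q0 \<le> path_rank c" unfolding rk by (simp_all add: le_max_iff_disj)
  have c: "proper c" "lend c = lend (P 0)" "rend c = rend q0" "lrank c = lrank (P 0)" "rrank c = rrank q0"
    "path_length c \<le> path_length (P 0) \<oplus> path_length q0" "path_rank c < \<mu>"
    "path_rank (P 0) \<le> path_rank c" "path_rank q0 \<le> path_rank c"
    "left_tip c \<longleftrightarrow> left_tip (P 0) & path_rank (P 0) = path_rank c"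
    "right_tip c \<longleftrightarrow> right_tip q0 & path_rank q0 = path_rank c"
    "span c <= span (P 0) Un span q0"
    "node_rank G (start_node G c) \<le> node_rank G (start_node G (P 0))"
    "node_rank G (end_node G c) \<le> node_rank G (end_node G q0)"
    by (use J c7 c89 joins_span[OF c0] in blast)+
  \<comment> \<open>A piece whose tips lie in \<mu>-nodes has the greatest rank below \<mu>. The
    merged constituent cannot exceed it in rank, so it keeps the tip by which a neighbouring post is
    reached.\<close>
  have top: "path_rank w = path_rank c" if w: "path_rank w \<le> path_rank c" "tsuc (path_rank w) = \<mu>" for w :: "('n, 'b) tpath"
  proof -
    have "path_rank w ~= Omega" using w(1) c(7) by (metis le_Omega not_Omega_less order.antisym)
    then have "path_rank c \<le> path_rank w" using c(7) less_tsuc_iff w(2) by blast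
    then show ?thesis using w(1) by simp
  qed
  have cl: "left_tip c & tsuc (path_rank c) = \<mu>" if "left_tip (P 0) & tsuc (path_rank (P 0)) = \<mu>"
    using that top[OF c(8)] c(10) by auto
  have cr: "right_tip c & tsuc (path_rank c) = \<mu>" if "right_tip q0 & tsuc (path_rank q0) = \<mu>"
    using that top[OF c(9)] c(11) by auto
  \<comment> \<open>The ends that disappear in the merging carry no tip of rank \<mu> - 1, as the
    junction has rank below \<mu>. Hence no tip required by the rule \<open>succ\<close> is
    lost.\<close>
  have notr: "~ (right_tip (P 0) & tsuc (path_rank (P 0)) = \<mu>)"
    using right_tip_rrank[of "P 0"] P0(2) jr by auto
  have notl: "~ (left_tip q0 & tsuc (path_rank q0) = \<mu>)"
    using left_tip_lrank[of q0] q0(4) jr by auto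
  define A where "A = I - {0}"
  define B where "B = uminus ` (I' - {0})"
  define Z where "Z i = (if i < 0 then P i else if i = 0 then c else reverse (P' (- i)))" for i
  have memA: "i \<in> A \<longleftrightarrow> i \<in> I & i < 0" for i unfolding A_def using I0 by auto
  have memB: "i \<in> B \<longleftrightarrow> - i \<in> I' & 0 < i" for i unfolding B_def uminus_mem using I0 by auto
  have ZA: "Z a = P a" if "a \<in> A" for a using that memA by (simp add: Z_def)
  have ZB: "Z b = reverse (P' (- b))" if "b \<in> B" for b using that memB by (simp add: Z_def)
  have Z0: "Z 0 = c" by (simp add: Z_def)
  have FA: "fam \<mu> A Z" by (rule fam_sub[of _ I P _ 0]) (use fI memA ZA in auto)
  have FB: "fam \<mu> B Z"
  proof (rule fam_sub[of _ "uminus ` I'" "%i. reverse (P' (- i))" _ 0])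
    fix i assume "i \<in> B"
    then show "i + 0 \<in> uminus ` I' & Z i = reverse (P' (- (i + 0)))" using memB ZB unfolding uminus_mem by simp
  qed (rule fam_reverse[OF fI(2)])
  have F0: "fam \<mu> {0} Z" using c(1,7) Z0 by (simp add: fam_def)
  have sA: "span (Z a) <= span p" "rend p ~: span (Z a)" if a: "a \<in> A" for a
    using seqrep_span[OF p, of a] seqrep_end[OF p, of a] a memA ZA by auto
  have sB: "span (Z b) <= span q" "rend p ~: span (Z b)" if b: "b \<in> B" for b
    using seqrep_span[OF q, of "- b"] seqrep_end[OF q, of "- b"] b memB ZB pq(3) by auto
  have "fam \<mu> (A Un {0}) Z"
  proof (rule fam_glue[OF FA F0])
    assume "0 - 1 \<in> A"
    then have i: "-1 \<in> I" "Z (-1) = P (-1)" using memA ZA by auto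
    have "rend (P (-1)) = lend (P 0) & (right_tip (P (-1)) & tsuc (path_rank (P (-1))) = \<mu> \<or> left_tip (P 0) & tsuc (path_rank (P 0)) = \<mu>)"
      using fI(1)[unfolded fam_def, THEN conjunct2, THEN conjunct1, rule_format, of "-1"] i(1) zI(1) by simp
    then show "rend (Z (0 - 1)) = lend (Z 0) &
      (right_tip (Z (0 - 1)) & tsuc (path_rank (Z (0 - 1))) = \<mu> \<or> left_tip (Z 0) & tsuc (path_rank (Z 0)) = \<mu>)"
      using cl c(2) i Z0 by auto
  next
    fix a b :: int assume a: "a \<in> A" and b: "b \<in> {0}"
    have s1: "span (P a) Int span (P 0) <= (if 0 = a + 1 then {lend (P 0)} else {})"
      using fI(1)[unfolded fam_def, THEN conjunct2, THEN conjunct2, rule_format, of a 0] a memA zI(1) by simp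
    have "span (Z a) Int span q0 = {}" using sA[OF a] q0(5) pq(4) by blast
    then have s2: "span (Z a) Int span (Z 0) <= span (P a) Int span (P 0)"
      unfolding Z0 ZA[OF a] using c(12) by blast
    have b0: "b = 0" using b by simp
    show "span (Z a) Int span (Z b) <= (if b = a + 1 then {lend (Z b)} else {})"
      using subset_trans[OF s2 s1] unfolding b0 Z0 c(2) .
  qed (use memA in auto)
  have F: "fam \<mu> (A Un {0} Un B) Z"
  proof (rule fam_glue[OF \<open>fam \<mu> (A Un {0}) Z\<close> FB, of 1])
    assume "1 \<in> B"
    then have i: "-1 \<in> I'" "Z 1 = reverse (P' (-1))" using memB ZB by auto
    have "rend (P' (-1)) = lend (P' 0) & (right_tip (P' (-1)) & tsuc (path_rank (P' (-1))) = \<mu> \<or> left_tip (P' 0) & tsuc (path_rank (P' 0)) = \<mu>)"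
      using fI(2)[unfolded fam_def, THEN conjunct2, THEN conjunct1, rule_format, of "-1"] i(1) zI(2) by simp
    then show "rend (Z (1 - 1)) = lend (Z 1) &
      (right_tip (Z (1 - 1)) & tsuc (path_rank (Z (1 - 1))) = \<mu> \<or> left_tip (Z 1) & tsuc (path_rank (Z 1)) = \<mu>)"
      using cr c(3) i Z0 by (auto simp: q0_def)
  next
    fix a b :: int assume a: "a \<in> A Un {0}" and b: "b \<in> B"
    show "span (Z a) Int span (Z b) <= (if b = a + 1 then {lend (Z b)} else {})"
    proof (cases "a = 0")
      case False
      then have a: "a \<in> A" using a by simp
      show ?thesis using sA[OF a] sB[OF b] pq(4) by blast
    next
      case True
      have bb: "- b \<in> I'" "- b < 0" using b memB by auto
      have s: "span (P' (- b)) Int span (P' 0) <= (if 0 = - b + 1 then {lend (P' 0)} else {})"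
        using fI(2)[unfolded fam_def, THEN conjunct2, THEN conjunct2, rule_format, of "- b" 0] bb zI(2) by simp
      have e: "rend (P' (- b)) = lend (P' 0)" if "0 = - b + 1"
        using fI(2)[unfolded fam_def, THEN conjunct2, THEN conjunct1, rule_format, of "- b"] bb zI(2) that by simp
      have "span (Z b) Int span (P 0) = {}" using sB[OF b] P0(3) pq(4) by blast
      then have "span (Z a) Int span (Z b) <= span (P' (- b)) Int span (P' 0)"
        using c(12) True Z0 ZB[OF b] by (auto simp: q0_def)
      then show ?thesis using s e True ZB[OF b] by (auto split: if_splits)
    qed
  qed (use memA memB in force)+
  define K where "K = A Un {0} Un B"
  have memK: "i \<in> K \<longleftrightarrow> i \<in> I & i \<le> 0 \<or> - i \<in> I' & 0 \<le> i" for i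
    unfolding K_def using memA memB zI by (cases i "0 :: int" rule: linorder_cases) auto
  have sp: "(\<Union>i\<in>K. span (Z i)) <= span p Un span q"
    unfolding K_def using sA(1) sB(1) c(12) P0(3) q0(5) Z0 by fastforce
  show ?thesis
  proof (rule assemble[OF F[folded K_def] _ _ \<mu>(3,1,2) _ _ _ pq(1,2) joinable_neq[OF j] sp])
    show "iconvex K"
      unfolding iconvex_def
    proof (intro ballI allI impI)
      fix i k l assume i: "i \<in> K" and k: "k \<in> K" and l: "i \<le> l & l \<le> k"
      show "l \<in> K"
      proof (cases "l \<le> 0")
        case True
        then have "i \<in> I" using i l zI memK[of i] by (cases "i = 0") auto
        then have "l \<in> I" using cI(1) zI(1) True l unfolding iconvex_def by blast
        then show ?thesis using memK True by simp
      next
        case False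
        then have "- k \<in> I'" "- k \<le> - l" "- l \<le> 0" using k l memK[of k] by auto
        then have "- l \<in> I'" using cI(2) zI(2) unfolding iconvex_def by blast
        then show ?thesis using memK False by simp
      qed
    qed
    show "K ~= {}" by (auto simp: K_def)
    show "\<exists>i\<in>K. tip_piece \<mu> (Z i)"
    proof -
      have "path_rank p = \<mu> \<or> path_rank q = \<mu>" using mx_pq by (auto simp: max_def split: if_splits)
      then show ?thesis
      proof
        assume "path_rank p = \<mu>"
        then obtain i where i: "i \<in> I" "tip_piece \<mu> (P i)" using P by blast
        show ?thesis
        proof (cases "i = 0")
          case True
          then show ?thesis using i cl notr Z0 by (intro bexI[of _ 0]) (auto simp: K_def)
        next
          case False
          then have "i \<in> A" using i(1) by (simp add: A_def)
          then show ?thesis using i ZA by (intro bexI[of _ i]) (auto simp: K_def)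
        qed
      next
        assume "path_rank q = \<mu>"
        then obtain i where i: "i \<in> I'" "tip_piece \<mu> (P' i)" using Q by auto
        show ?thesis
        proof (cases "i = 0")
          case True
          then show ?thesis using i cr notl Z0 by (intro bexI[of _ 0]) (auto simp: K_def q0_def)
        next
          case False
          then have "- i \<in> B" using i(1) I0(2) memB[of "- i"] by auto
          then show ?thesis using i ZB[of "- i"] by (intro bexI[of _ "- i"]) (auto simp: K_def)
        qed
      qed
    qed
    show "lcomp \<mu> p K Z"
    proof (rule lcomp_ext[of \<mu> p I P 0])
      show "lend p ~: (\<Union>i\<in>K. span (Z i))" if lt: "left_tip p" "path_rank p = \<mu>"
      proof -
        have n: "lend p ~: (\<Union>i\<in>I. span (P i))" using lc(1) lt unfolding lcomp_def by blast
        have "lend p ~: span (Z i)" if "i \<in> A" for i using n memA ZA that by auto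
        moreover have "lend p ~: span (Z i)" if "i \<in> B" for i
          using sB(1)[OF that] joinable_ends(1)[OF j] by auto
        moreover have "lend p ~: span c" using n zI(1) c(12) q0(5) joinable_ends(1)[OF j] by blast
        ultimately show ?thesis using Z0 by (auto simp: K_def)
      qed
      show "i \<in> K \<longleftrightarrow> i + 0 \<in> I" if "i + 0 \<le> 0" for i using that memK[of i] zI by (cases "i = 0") auto
    qed (use lc cI zI I0 c(2,4,13) in \<open>auto simp: Z_def\<close>)
    show "rcomp \<mu> q K Z"
      unfolding rcomp_def
    proof (rule lcomp_ext[of \<mu> "reverse q" I' P' 0])
      show "lend (reverse q) ~: (\<Union>i\<in>uminus ` K. span (reverse (Z (- i))))"
        if lt: "left_tip (reverse q)" "path_rank (reverse q) = \<mu>"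
      proof -
        have n: "rend q ~: (\<Union>i\<in>I'. span (P' i))" using lc(2) lt unfolding lcomp_def reverse_sets by blast
        have "rend q ~: span (Z i)" if "i \<in> B" for i using n memB ZB that by auto
        moreover have "rend q ~: span (Z i)" if "i \<in> A" for i
          using sA(1)[OF that] joinable_ends(2)[OF j] by auto
        moreover have "rend q ~: span c"
          using n zI(2) c(12) P0(3) joinable_ends(2)[OF j] unfolding q0_def reverse_sets by blast
        ultimately show ?thesis using Z0 by (auto simp: K_def)
      qed
      show "i \<in> uminus ` K \<longleftrightarrow> i + 0 \<in> I'" if "i + 0 \<le> 0" for i
        unfolding uminus_mem using that memK[of "- i"] zI by (cases "i = 0") auto
    qed (use lc cI zI I0 c(3,5,14) in \<open>auto simp: Z_def q0_def\<close>)
    show "\<mu> = max (max (path_rank p) (path_rank q)) (max (rrank p) (lrank q))"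
      unfolding mx_pq by (rule sym, rule max_absorb1, rule less_imp_le, rule jr)
    assume fin: "finite K"
    have fA: "finite A" "finite B" using fin by (auto simp: K_def)
    have fII: "finite I" "finite I'"
      using fA finite_imageD[of uminus "I' - {0}"] by (auto simp: A_def B_def inj_on_def)
    have "natsum.F (%i. path_length (Z i)) K =
      natsum.F (%i. path_length (Z i)) A \<oplus> (path_length c \<oplus> natsum.F (%i. path_length (Z i)) B)"
    proof -
      have "natsum.F (%i. path_length (Z i)) K =
        natsum.F (%i. path_length (Z i)) (A Un {0}) \<oplus> natsum.F (%i. path_length (Z i)) B"
        unfolding K_def using fA memA memB by (intro natsum.union_disjoint) auto
      moreover have "natsum.F (%i. path_length (Z i)) (A Un {0}) =
        natsum.F (%i. path_length (Z i)) A \<oplus> natsum.F (%i. path_length (Z i)) {0}"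
        using fA memA by (intro natsum.union_disjoint) auto
      ultimately show ?thesis using Z0 by (simp add: natsum_assoc)
    qed
    also have "natsum.F (%i. path_length (Z i)) A = natsum.F (%i. path_length (P i)) (I - {0})"
      by (rule natsum.cong) (auto simp: A_def ZA[unfolded A_def])
    also have "natsum.F (%i. path_length (Z i)) B = natsum.F (%i. path_length (P' i)) (I' - {0})"
    proof (rule natsum.reindex_bij_witness[of _ uminus uminus])
      fix b assume "b \<in> B"
      then show "- (- b) = b" "- b \<in> I' - {0}" "path_length (P' (- b)) = path_length (Z b)" using memB ZB by auto
    next
      fix i assume "i \<in> I' - {0}"
      then show "- (- i) = i" "- i \<in> B" by (auto simp: B_def)
    qed
    also have "natsum.F (%i. path_length (P i)) (I - {0}) \<oplus> (path_length c \<oplus> natsum.F (%i. path_length (P' i)) (I' - {0})) \<le>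
      natsum.F (%i. path_length (P i)) (I - {0}) \<oplus> ((path_length (P 0) \<oplus> path_length (P' 0)) \<oplus> natsum.F (%i. path_length (P' i)) (I' - {0}))"
      using c(6) by (intro natsum_mono order.refl) (simp add: q0_def)
    also have "\<dots> = natsum.F (%i. path_length (P i)) I \<oplus> natsum.F (%i. path_length (P' i)) I'"
      unfolding natsum.remove[OF fII(1) zI(1)] natsum.remove[OF fII(2) zI(2)] by (rule natsum_rearrange)
    also have "\<dots> \<le> path_length p \<oplus> path_length q" using lens fII by (auto intro: natsum_mono)
    finally show "natsum.F (%i. path_length (Z i)) K \<le> path_length p \<oplus> path_length q" .
  qed
qed

section \<open>Joining 0-paths\<close>

lemma zero_length:
  assumes "is_path G (Path (Fin 0) (Two_Ended k) x P)"
  shows "path_length (Path (Fin 0) (Two_Ended k) x P) = 1 \<odot> k"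
proof -
  have "natsum.F (%i. path_length (P i)) {0..<int k} = natsum.F (%_. 1) {0..<int k}"
  proof (rule natsum.cong)
    fix i assume "i \<in> {0..<int k}"
    then have "i \<in> steps (Two_Ended k)" by simp
    then obtain b where "P i = Branch b" using is_path_zeroD(2)[OF assms] by blast
    then show "path_length (P i) = 1" by simp
  qed simp
  also have "\<dots> = 1 \<odot> k"
  proof (induction k)
    case (Suc k)
    have "{0..<int (Suc k)} = insert (int k) {0..<int k}" by auto
    then show ?case using Suc by (simp add: natsum_commute)
  qed simp
  finally show ?thesis by (simp add: path_length_Two_Ended)
qed

text \<open>Both paths end at the junction in 0-nodes. Shorted 0-nodes are equal, so the branch
  sequences can be concatenated literally, with the junction at index 0.\<close>

lemma join_zero:
  assumes j: "joinable p q" and rk: "path_rank p = Fin 0" "path_rank q = Fin 0" "rrank p = Fin 0" "lrank q = Fin 0"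
  shows "\<exists>r. joins r p q"
proof -
  have pq: "proper p" "proper q" "rend p = lend q" "span p Int span q <= {rend p}" using j by (auto simp: joinable_def)
  obtain e x P where p: "p = Path (Fin 0) e x P" using proper_path[OF pq(1)] rk(1) by (cases p) auto
  obtain e' y Q where q: "q = Path (Fin 0) e' y Q" using proper_path[OF pq(2)] rk(2) by (cases q) auto
  have ip: "is_path G (Path (Fin 0) e x P)" using proper_path[OF pq(1)] unfolding p .
  have iq: "is_path G (Path (Fin 0) e' y Q)" using proper_path[OF pq(2)] unfolding q .
  have nr: "~ right_tip (Path (Fin 0) e x P)" using right_tip_rrank[of p] rk(3) unfolding p by auto
  have nl: "~ left_tip (Path (Fin 0) e' y Q)" using left_tip_lrank[of q] rk(4) unfolding q by auto
  note rp = right_post[OF ip nr] and lq = left_post[OF iq nl]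
  let ?L = "last_index e"
  have Lp: "?L \<in> posts e" using rp(1) by (simp add: mem_posts)
  have zq: "0 \<in> posts e'" using lq(1) by (simp add: steps_posts)
  have junction: "x ?L = y 0"
  proof (rule mx_rank_eq)
    show "mx (x ?L) = mx (y 0)" using pq(3) rp(3) lq(3) p q by simp
    show "x ?L \<in> nodes G" "y 0 \<in> nodes G" "node_rank G (x ?L) = node_rank G (y 0)"
      using zero_posts[OF ip Lp] zero_posts[OF iq zq] by simp_all
  qed
  define K where "K = {i. i < 0 & i + ?L \<in> steps e \<or> 0 \<le> i & i \<in> steps e'}"
  define Z where "Z i = (if i < 0 then P (i + ?L) else Q i)" for i
  define z where "z i = (if i < 0 then x (i + ?L) else y i)" for i
  have memn: "i \<in> K \<longleftrightarrow> i + ?L \<in> steps e" if "i < 0" for i using that by (simp add: K_def)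
  have memp: "i \<in> K \<longleftrightarrow> i \<in> steps e'" if "0 \<le> i" for i using that by (simp add: K_def)
  have zn: "z i = x (i + ?L)" if "i \<le> 0" for i using that junction by (auto simp: z_def)
  have zp: "z i = y i" if "0 \<le> i" for i using that by (simp add: z_def)
  have KZ: "\<exists>b\<in>branches G. Z i = Branch b & ends G b = {z i, z (i + 1)}" if i: "i \<in> K" for i
  proof (cases "i < 0")
    case True
    have "\<exists>b\<in>branches G. P (i + ?L) = Branch b & ends G b = {x (i + ?L), x (i + ?L + 1)}"
      using is_path_zeroD(2)[OF ip] i memn[OF True] by blast
    moreover have "z i = x (i + ?L)" "z (i + 1) = x (i + ?L + 1)"
      using zn[of i] zn[of "i + 1"] True by (simp_all add: algebra_simps)
    ultimately show ?thesis using True by (simp add: Z_def)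
  next
    case False
    then show ?thesis using is_path_zeroD(2)[OF iq] i memp[of i] zp[of i] zp[of "i + 1"] by (auto simp: Z_def)
  qed
  have pn: "i + ?L \<in> posts e" if "i \<in> K \<or> i - 1 \<in> K" "i \<le> 0" for i
  proof (cases "i = 0")
    case True
    then show ?thesis using Lp by simp
  next
    case False
    then have "i + ?L \<in> steps e \<or> i - 1 + ?L \<in> steps e" using that memn[of i] memn[of "i - 1"] by auto
    moreover have "i - 1 + ?L = i + ?L - 1" by simp
    ultimately show ?thesis unfolding mem_posts by metis
  qed
  have pp: "i \<in> posts e'" if "i \<in> K \<or> i - 1 \<in> K" "0 \<le> i" for i
  proof (cases "i = 0")
    case True
    then show ?thesis using zq by simp
  next
    case False
    then show ?thesis using that memp[of i] memp[of "i - 1"] by (auto simp: mem_posts)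
  qed
  have zinj: "i = k" if i: "i \<in> K \<or> i - 1 \<in> K" and k: "k \<in> K \<or> k - 1 \<in> K" and eq: "z i = z k" for i k
  proof -
    have lt: False if i: "i \<in> K \<or> i - 1 \<in> K" and k: "k \<in> K \<or> k - 1 \<in> K" and eq: "z i = z k" and ik: "i < 0" "0 \<le> k" for i k
    proof -
      have a: "i + ?L \<in> posts e" "z i = x (i + ?L)" using pn[OF i] zn[of i] ik by auto
      have b: "k \<in> posts e'" "z k = y k" using pp[OF k] zp[of k] ik by auto
      have "mx (x (i + ?L)) \<in> span p" "mx (y k) \<in> span q"
        using a(1) b(1) unfolding span_def p q mnodes_Path by blast+
      then have m: "mx (x (i + ?L)) = rend p" using pq(4) eq a(2) b(2) by auto
      have "mx (x (i + ?L)) = mx (x ?L)" using m rp(3) p by simp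
      then have "i + ?L = ?L" using zero_posts_inj[OF ip a(1) Lp] by blast
      then show False using ik by simp
    qed
    consider "i < 0" "k < 0" | "0 \<le> i" "0 \<le> k" | "i < 0" "0 \<le> k" | "0 \<le> i" "k < 0" by linarith
    then show ?thesis
    proof cases
      case 1
      have "i + ?L = k + ?L"
        using inj_onD[OF is_path_zeroD(3)[OF ip], of "i + ?L" "k + ?L"] pn[OF i] pn[OF k] zn[of i] zn[of k] eq 1 by auto
      then show ?thesis by simp
    next
      case 2
      then show ?thesis
        using inj_onD[OF is_path_zeroD(3)[OF iq], of i k] pp[OF i] pp[OF k] zp[of i] zp[of k] eq by auto
    next
      case 3
      then show ?thesis using lt[OF i k eq] by blast
    next
      case 4
      then show ?thesis using lt[OF k i eq[symmetric]] by blast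
    qed
  qed
  have cv: "iconvex K"
    unfolding iconvex_def
  proof (intro ballI allI impI)
    fix i k l assume i: "i \<in> K" and k: "k \<in> K" and l: "i \<le> l & l \<le> k"
    show "l \<in> K"
    proof (cases "l < 0")
      case True
      then have "i + ?L \<in> steps e" using i memn[of i] l by simp
      then have "l + ?L \<in> steps e" using steps_convex[OF _ rp(1), of "i + ?L" "l + ?L"] l True by simp
      then show ?thesis using memn[OF True] by simp
    next
      case False
      then have "k \<in> steps e'" using k memp[of k] l by simp
      then have "l \<in> steps e'" using steps_convex[OF lq(1), of k l] l False by simp
      then show ?thesis using memp[of l] False by simp
    qed
  qed
  have "-1 \<in> K" "0 \<in> K" using rp(1) lq(1) memn[of "-1"] memp[of 0] by (simp_all add: algebra_simps)
  then obtain e'' s where es: "e'' ~= Two_Ended 0" "!!i. i \<in> steps e'' \<longleftrightarrow> i + s \<in> K"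
    using iconvex_extent[OF cv] by blast
  define r where "r = Path (Fin 0) e'' (%i. z (i + s)) (%i. Z (i + s))"
  have sh: "i + 1 + s = i + s + 1" "i - 1 + s = i + s - 1" for i by simp_all
  have po: "i + s \<in> K \<or> i + s - 1 \<in> K" if "i \<in> posts e''" for i
    using that es(2)[of i] es(2)[of "i - 1"] unfolding mem_posts sh by blast
  have ir: "is_path G (Path (Fin 0) e'' (%i. z (i + s)) (%i. Z (i + s)))"
  proof (rule is_path.zero[OF es(1)])
    show "\<forall>i\<in>steps e''. \<exists>b\<in>branches G. Z (i + s) = Branch b & ends G b = {z (i + s), z (i + 1 + s)}"
      unfolding sh using KZ es(2) by blast
    show "inj_on (%i. z (i + s)) (posts e'')"
    proof (rule inj_onI)
      fix i k assume "i \<in> posts e''" "k \<in> posts e''" "z (i + s) = z (k + s)"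
      then have "i + s = k + s" using zinj po by blast
      then show "i = k" by simp
    qed
  qed
  have Zb: "mnodes (Z i) = {}" if "i \<in> K" for i using KZ[OF that] by auto
  have mr: "mnodes r <= span p Un span q"
  proof
    fix m assume "m \<in> mnodes r"
    then obtain i where i: "i \<in> posts e''" "m = mx (z (i + s))" using Zb es(2) unfolding r_def mnodes_Path by auto
    show "m \<in> span p Un span q"
    proof (cases "i + s \<le> 0")
      case True
      then have "m \<in> mnodes p" using pn[OF po[OF i(1)]] zn i(2) unfolding p mnodes_Path by auto
      then show ?thesis by (simp add: span_def)
    next
      case False
      then have "m \<in> mnodes q" using pp[OF po[OF i(1)]] zp i(2) unfolding q mnodes_Path by auto
      then show ?thesis by (simp add: span_def)
    qed
  qed
  have tl: "left_tip r \<longleftrightarrow> left_tip p" and sl: "start_node G r = start_node G p" and s0: "~ left_tip p ==> s = - ?L"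
  proof -
    have "(left_tip r \<longleftrightarrow> left_tip p) & start_node G r = start_node G p & (~ left_tip p --> s = - ?L)"
    proof (cases "left_tip p")
      case True
      have lt: "left_tip r"
      proof (rule ccontr)
        assume "~ left_tip r"
        then have n: "~ left_tip (Path (Fin 0) e'' (%i. z (i + s)) (%i. Z (i + s)))" by (simp add: r_def)
        let ?i = "min (- 1) (s - 1)"
        have "?i + ?L \<in> steps e" using True rp(1) nr by (auto simp: p)
        then have "?i \<in> K" using memn[of ?i] by simp
        then have "?i - s \<in> steps e''" using es(2)[of "?i - s"] by simp
        then show False using left_post(2)[OF ir n, of "?i - s"] by simp
      qed
      have "Fin 0 < graph_rank G" using pq(1) True rk(1) by (simp add: proper_def)
      moreover have "Z (i + s) = P (i + (s + ?L))" if "i < - s" for i using that by (simp add: Z_def algebra_simps)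
      ultimately have "start_node G (Path (Fin 0) e x P) = start_node G (Path (Fin 0) e'' (%i. z (i + s)) (%i. Z (i + s)))"
        using start_node_eq[OF ip True[unfolded p] ir lt[unfolded r_def], of "- s" "s + ?L"] by blast
      then show ?thesis using True lt unfolding p r_def by simp
    next
      case False
      then have np: "~ left_tip (Path (Fin 0) e x P)" by (simp add: p)
      note lp = left_post[OF ip np]
      have Lpos: "0 < ?L" using rp(2)[OF lp(1)] by simp
      have lo: "- ?L \<le> i" if "i \<in> K" for i
        using that lp(2)[of "i + ?L"] memn[of i] Lpos by (cases "i < 0") auto
      have mL: "- ?L \<in> K" using memn[of "- ?L"] lp(1) Lpos by simp
      have nt: "~ left_tip r"
      proof
        assume lt: "left_tip r"
        have "- ?L - s \<in> steps e''" using es(2)[of "- ?L - s"] mL by simp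
        then have "- ?L - s - 1 \<in> steps e''" using lt by (auto simp: r_def)
        then show False using es(2)[of "- ?L - s - 1"] lo[of "- ?L - 1"] by simp
      qed
      then have n: "~ left_tip (Path (Fin 0) e'' (%i. z (i + s)) (%i. Z (i + s)))" by (simp add: r_def)
      note lr = left_post[OF ir n]
      have "s = - ?L"
      proof -
        have "s \<in> K" using lr(1) es(2)[of 0] by simp
        moreover have "- ?L - s \<in> steps e''" using es(2)[of "- ?L - s"] mL by simp
        ultimately show ?thesis using lo[of s] lr(2)[of "- ?L - s"] by simp
      qed
      moreover have "start_node G r = z s" using nt by (auto simp: r_def)
      moreover have "start_node G p = x 0" using np by (auto simp: p)
      ultimately show ?thesis using nt False zn[of s] Lpos by simp
    qed
    then show "left_tip r \<longleftrightarrow> left_tip p" "start_node G r = start_node G p" "~ left_tip p ==> s = - ?L" by auto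
  qed
  have tr: "right_tip r \<longleftrightarrow> right_tip q" and sr: "end_node G r = end_node G q"
    and s1: "~ right_tip q ==> last_index e'' + s = last_index e'"
  proof -
    have "(right_tip r \<longleftrightarrow> right_tip q) & end_node G r = end_node G q & (~ right_tip q --> last_index e'' + s = last_index e')"
    proof (cases "right_tip q")
      case True
      have rt: "right_tip r"
      proof (rule ccontr)
        assume "~ right_tip r"
        then have n: "~ right_tip (Path (Fin 0) e'' (%i. z (i + s)) (%i. Z (i + s)))" by (simp add: r_def)
        let ?i = "max 0 (last_index e'' + s)"
        have "?i \<in> steps e'" using True lq(1) nl by (auto simp: q)
        then have "?i \<in> K" using memp[of ?i] by simp
        then have "?i - s \<in> steps e''" using es(2)[of "?i - s"] by simp
        then show False using right_post(2)[OF ir n, of "?i - s"] by simp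
      qed
      have "Fin 0 < graph_rank G" using pq(2) True rk(2) by (simp add: proper_def)
      moreover have "Z (i + s) = Q (i + s)" if "- s \<le> i" for i using that by (simp add: Z_def)
      ultimately have "end_node G (Path (Fin 0) e' y Q) = end_node G (Path (Fin 0) e'' (%i. z (i + s)) (%i. Z (i + s)))"
        using end_node_eq[OF iq True[unfolded q] ir rt[unfolded r_def], of "- s" s] by blast
      then show ?thesis using True rt unfolding q r_def by simp
    next
      case False
      then have np: "~ right_tip (Path (Fin 0) e' y Q)" by (simp add: q)
      note lp = right_post[OF iq np]
      let ?M = "last_index e'"
      have Mpos: "0 < ?M" using lp(2)[OF lq(1)] by simp
      have hi: "i \<le> ?M - 1" if "i \<in> K" for i
        using that lp(2)[of i] memp[of i] Mpos by (cases "i < 0") auto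
      have mL: "?M - 1 \<in> K" using memp[of "?M - 1"] lp(1) Mpos by simp
      have nt: "~ right_tip r"
      proof
        assume lt: "right_tip r"
        have "?M - 1 - s \<in> steps e''" using es(2)[of "?M - 1 - s"] mL by simp
        then have "?M - 1 - s + 1 \<in> steps e''" using lt by (auto simp: r_def)
        then show False using es(2)[of "?M - 1 - s + 1"] hi[of "?M"] by simp
      qed
      then have n: "~ right_tip (Path (Fin 0) e'' (%i. z (i + s)) (%i. Z (i + s)))" by (simp add: r_def)
      note lr = right_post[OF ir n]
      have eq: "last_index e'' + s = ?M"
      proof -
        have "last_index e'' - 1 + s \<in> K" using lr(1) es(2)[of "last_index e'' - 1"] by simp
        moreover have "?M - 1 - s \<in> steps e''" using es(2)[of "?M - 1 - s"] mL by simp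
        ultimately show ?thesis using hi[of "last_index e'' - 1 + s"] lr(2)[of "?M - 1 - s"] by simp
      qed
      moreover have "end_node G r = z (last_index e'' + s)" using nt by (auto simp: r_def)
      moreover have "end_node G q = y ?M" using np by (auto simp: q)
      ultimately show ?thesis using nt False zp[of ?M] Mpos by simp
    qed
    then show "right_tip r \<longleftrightarrow> right_tip q" "end_node G r = end_node G q"
      "~ right_tip q ==> last_index e'' + s = last_index e'" by auto
  qed
  have ends: "lend r = lend p" "rend r = rend q" using sl sr by (simp_all add: lend_def rend_def)
  have pr: "proper r" unfolding proper_def ends
  proof (intro conjI impI)
    show "is_path G r" using ir by (simp add: r_def)
    show "path_rank r < graph_rank G" if "left_tip r \<or> right_tip r"
      using that tl tr pq(1,2) rk(1,2) unfolding proper_def r_def by auto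
    have mm: "mnodes r <= mnodes p Un mnodes q"
      using mr rend_in[OF ip nr] lend_in[OF iq nl] pq(3)
    proof -
      show ?thesis
      proof
        fix m assume "m \<in> mnodes r"
        then obtain i where i: "i \<in> posts e''" "m = mx (z (i + s))" using Zb es(2) unfolding r_def mnodes_Path by auto
        show "m \<in> mnodes p Un mnodes q"
          using pn[OF po[OF i(1)]] pp[OF po[OF i(1)]] zn[of "i + s"] zp[of "i + s"] i(2)
          unfolding p q mnodes_Path by (cases "i + s \<le> 0") auto
      qed
    qed
    show "lend p ~: mnodes r" if "left_tip r"
      using that tl mm joinable_ends(1)[OF j] pq(1) unfolding proper_def span_def by blast
    show "rend q ~: mnodes r" if "right_tip r"
      using that tr mm joinable_ends(2)[OF j] pq(2) unfolding proper_def span_def by blast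
    show "lend p ~= rend q" using joinable_neq[OF j] .
  qed
  have len: "path_length r \<le> path_length p \<oplus> path_length q"
  proof (cases "left_tip p")
    case lp: True
    have l: "ray_length (Fin 0) \<le> path_length p" using ray_length_le[of p] lp rk(1) by simp
    show ?thesis
    proof (cases "right_tip q")
      case True
      have rl: "ray_length (Fin 0) \<le> path_length q" using ray_length_le[of q] True rk(2) by simp
      have "e'' = Endless" using tl tr lp True by (auto simp: r_def)
      then have "path_length r = ray_length (Fin 0) \<oplus> ray_length (Fin 0)"
        by (simp add: r_def numeral_2_eq_2 del: ray_length.simps)
      then show ?thesis by (rule ord_eq_le_trans[OF _ natsum_mono[OF l rl]])
    next
      case False
      have "e'' = Inward" using tl tr lp False by (auto simp: r_def)
      then have "path_length r = ray_length (Fin 0)" by (simp add: r_def del: ray_length.simps)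
      then show ?thesis by (rule ord_eq_le_trans[OF _ order.trans[OF l natsum_ge1]])
    qed
  next
    case lp: False
    show ?thesis
    proof (cases "right_tip q")
      case True
      have rl: "ray_length (Fin 0) \<le> path_length q" using ray_length_le[of q] True rk(2) by simp
      have "e'' = Outward" using tl tr lp True by (auto simp: r_def)
      then have "path_length r = ray_length (Fin 0)" by (simp add: r_def del: ray_length.simps)
      then show ?thesis by (rule ord_eq_le_trans[OF _ order.trans[OF rl natsum_ge2]])
    next
      case False
      obtain k where k: "e = Two_Ended k" using lp nr by (cases e) (auto simp: p)
      obtain l where l: "e' = Two_Ended l" using False nl by (cases e') (auto simp: q)
      obtain m where m: "e'' = Two_Ended m" using tl tr lp False by (cases e'') (auto simp: r_def)
      \<comment> \<open>The shift is determined on the left by the first branch of p and on the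
        right by the last branch of q.\<close>
      have "m = k + l" using s0[OF lp] s1[OF False] k l m by simp
      then have "path_length r = 1 \<odot> k \<oplus> 1 \<odot> l" using zero_length[OF ir[unfolded m]] by (simp add: r_def m nattimes_add)
      then show ?thesis using zero_length[OF ip[unfolded k]] zero_length[OF iq[unfolded l]] p q k l by simp
    qed
  qed
  have "lrank r = lrank p" "rrank r = rrank q" using tl tr by (auto simp: r_def p q)
  moreover have "path_rank r = Fin 0" by (simp add: r_def)
  ultimately have "joins r p q"
    unfolding joins_def using pr ends mr len tl tr sl sr rk by simp
  then show ?thesis by blast
qed

section \<open>Joining at the arrow rank\<close>

lemma arrow_steps:
  assumes "is_path G (Path Arrow_Omega e x P)"
  shows "e \<in> {Outward, Inward, Endless}" "Arrow_Omega \<le> graph_rank G"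
    "\<forall>i\<in>posts e. x i \<in> nodes G & node_rank G (x i) < Arrow_Omega"
    "\<forall>i\<in>steps e. if 0 \<le> i then node_rank G (x i) < node_rank G (x (i + 1))
      else node_rank G (x (i + 1)) < node_rank G (x i)"
    "\<forall>i\<in>steps e. is_path G (P i) & path_rank (P i) < max (node_rank G (x i)) (node_rank G (x (i + 1))) &
      embraces G (x i) (start_node G (P i)) & embraces G (x (i + 1)) (end_node G (P i))"
    "\<forall>i\<in>posts e. i ~= 0 --> reached_by_tip e P (node_rank G (x i)) i"
  using assms by (cases; simp add: tip_rank_iff)+

text \<open>Because the ranks of the posts increase, merging one constituent after another never
  leads to a rank as high as that of the next post. The last clause keeps the tip by which post n is
  reached, so that the merged piece can replace the first n constituents.\<close>

lemma arrow_run: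
  assumes IH: "!!p' q'. joinable p' q' ==>
      max (max (path_rank p') (path_rank q')) (max (rrank p') (lrank q')) < Arrow_Omega ==> \<exists>r. joins r p' q'"
    and q: "is_path G (Path Arrow_Omega e y Q)" "e = Outward \<or> e = Endless" and n: "1 \<le> n"
  shows "\<exists>c. proper c & lend c = mx (y 0) & rend c = mx (y (int n)) & span c <= (\<Union>i\<in>{0..<int n}. span (Q i)) &
    path_rank c < node_rank G (y (int n)) & lrank c = lrank (Q 0) & rrank c \<le> node_rank G (y (int n)) &
    (right_tip (Q (int n - 1)) & tsuc (path_rank (Q (int n - 1))) = node_rank G (y (int n)) -->
      right_tip c & path_rank c = path_rank (Q (int n - 1)))"
  using n
proof (induction n rule: dec_induct)
  have c: "compound Arrow_Omega e y Q" using is_path_compound[OF q(1)] by simp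
  have st: "i \<in> steps e" "i \<in> posts e" if "0 \<le> i" for i using q(2) that by (auto simp: mem_posts)
  note A = arrow_steps[OF q(1)]
  have up: "node_rank G (y i) < node_rank G (y (i + 1))" if "0 \<le> i" for i
    using bspec[OF A(4) st(1)[OF that]] that by simp
  have rk: "path_rank (Q i) < node_rank G (y (i + 1))" if "0 \<le> i" for i
    using bspec[OF A(5) st(1)[OF that]] up[OF that] by (simp add: max_def split: if_splits)
  have rr: "rrank (Q i) \<le> node_rank G (y (i + 1))" if i: "0 \<le> i" for i
  proof (cases "right_tip (Q i)")
    case True
    then show ?thesis using right_tip_rrank[OF True] tsuc_le[OF rk[OF i]] by simp
  next
    case False
    then have "rrank (Q i) \<le> path_rank (Q i)" using rrank_le compound_piece(3)[OF c st(1)[OF i]] by blast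
    then show ?thesis using rk[OF i] by simp
  qed
  have lr: "lrank (Q i) < node_rank G (y (i + 1))" if i: "0 \<le> i" for i
  proof (cases "left_tip (Q i)")
    case True
    have "node_rank G (start_node G (Q i)) = tsuc (path_rank (Q i))"
      using start_node_tip(2)[of "Q i"] compound_piece(3)[OF c st(1)[OF i]] True by (simp add: proper_def)
    moreover have "node_rank G (start_node G (Q i)) \<le> node_rank G (y i)"
      using embraces_rank[OF compoundD(8)[OF c st(1)[OF i]]] .
    ultimately show ?thesis using left_tip_lrank[OF True] up[OF i] by simp
  next
    case False
    then have "lrank (Q i) \<le> path_rank (Q i)" using lrank_le compound_piece(3)[OF c st(1)[OF i]] by blast
    then show ?thesis using rk[OF i] by simp
  qed
  {
    case base
    note cp = compound_piece[OF c st(1)[of 0]]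
    show ?case using cp rk[of 0] rr[of 0] by (intro exI[of _ "Q 0"]) (auto intro!: bexI[of _ 0])
  next
    case (step n)
    let ?n = "int n"
    have n0: "0 \<le> ?n" by simp
    have Sn: "int (Suc n) = ?n + 1" by simp
    obtain c' where c': "proper c'" "lend c' = mx (y 0)" "rend c' = mx (y ?n)" "span c' <= (\<Union>i\<in>{0..<?n}. span (Q i))"
      "path_rank c' < node_rank G (y ?n)" "lrank c' = lrank (Q 0)" "rrank c' \<le> node_rank G (y ?n)"
      using step.IH by blast
    note cp = compound_piece[OF c st(1)[OF n0]]
    have "span c' Int span (Q ?n) <= {mx (y ?n)}"
    proof
      fix m assume m: "m \<in> span c' Int span (Q ?n)"
      then have "m \<in> (\<Union>i\<in>{0..<?n}. span (Q i))" using c'(4) by blast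
      then obtain i where "i \<in> {0..<?n}" "m \<in> span (Q i)" by (rule UN_E)
      then have i: "0 \<le> i" "i < ?n" "m \<in> span (Q i)" by auto
      then have "m \<in> (if ?n = i + 1 then {mx (y ?n)} else {})"
        using compound_span[OF c st(1)[OF i(1)] st(1)[OF n0] i(2)] m by blast
      then show "m \<in> {mx (y ?n)}" by (simp split: if_splits)
    qed
    then have jn: "joinable c' (Q ?n)" unfolding joinable_def using c' cp by simp
    have top: "max (max (path_rank c') (path_rank (Q ?n))) (max (rrank c') (lrank (Q ?n))) < node_rank G (y (?n + 1))"
      using order.strict_trans[OF c'(5) up[OF n0]] order.strict_trans1[OF c'(7) up[OF n0]] rk[OF n0] lr[OF n0] by (simp only: max_less_iff_conj conj_assoc simp_thms)
    have "node_rank G (y (?n + 1)) < Arrow_Omega" using A(3) st(2)[of "?n + 1"] by simp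
    then obtain d where d: "joins d c' (Q ?n)" using IH[OF jn] top order.strict_trans by blast
    note J = d[unfolded joins_def]
    have rd: "path_rank d = max (max (path_rank c') (path_rank (Q ?n))) (max (rrank c') (lrank (Q ?n)))" using J by blast
    have rd': "path_rank d < node_rank G (y (?n + 1))" unfolding rd by (rule top)
    have "span d <= (\<Union>i\<in>{0..<?n + 1}. span (Q i))"
    proof -
      have "span d <= span c' Un span (Q ?n)" by (rule joins_span[OF d])
      moreover have "(\<Union>i\<in>{0..<?n}. span (Q i)) <= (\<Union>i\<in>{0..<?n + 1}. span (Q i))" by (rule UN_mono) auto
      then have "span c' <= (\<Union>i\<in>{0..<?n + 1}. span (Q i))" by (rule subset_trans[OF c'(4)])
      moreover have "span (Q ?n) <= (\<Union>i\<in>{0..<?n + 1}. span (Q i))" by (rule UN_upper) simp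
      ultimately show ?thesis by (rule subset_trans[OF _ Un_least])
    qed
    moreover have "right_tip d & path_rank d = path_rank (Q ?n)"
      if t: "right_tip (Q ?n)" "tsuc (path_rank (Q ?n)) = node_rank G (y (?n + 1))"
    proof -
      have "path_rank (Q ?n) ~= Omega" using rk[OF n0] by auto
      then have "path_rank d \<le> path_rank (Q ?n)" using rd' t(2) less_tsuc_iff by metis
      moreover have "path_rank (Q ?n) \<le> path_rank d" unfolding rd by (simp add: le_max_iff_disj)
      ultimately have e: "path_rank d = path_rank (Q ?n)" by simp
      then show ?thesis using J t(1) by simp
    qed
    moreover have "proper d" "lend d = mx (y 0)" "rend d = mx (y (?n + 1))" "lrank d = lrank (Q 0)" "rrank d = rrank (Q ?n)"
      using J c'(2,6) cp(2) by simp_all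
    ultimately show ?case unfolding Sn using rd' rr[OF n0] by (intro exI[of _ d]) simp
  }
qed

lemma linkedI:
  assumes "!!i. i \<in> steps e ==> proper (R i) & lend (R i) = mx (z i) & rend (R i) = mx (z (i + 1))"
    and "!!i j. i \<in> steps e ==> j \<in> steps e ==> i < j ==> span (R i) Int span (R j) <= (if j = i + 1 then {mx (z j)} else {})"
  shows "linked e z R"
  unfolding linked_def
proof (intro conjI ballI impI)
  fix i assume i: "i \<in> steps e"
  show "mx (z i) ~= mx (z (i + 1))" "left_tip (R i) ==> mx (z i) ~: mnodes (R i)"
    "right_tip (R i) ==> mx (z (i + 1)) ~: mnodes (R i)"
    using assms(1)[OF i] unfolding proper_def by auto
next
  fix i j assume ij: "i \<in> steps e" "j \<in> steps e" "i < j"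
  have e: "mnodes (R k) Un {mx (z k), mx (z (k + 1))} = span (R k)" if "k \<in> steps e" for k
    using assms(1)[OF that] by (simp add: span_def)
  show "(mnodes (R i) Un {mx (z i), mx (z (i + 1))}) Int (mnodes (R j) Un {mx (z j), mx (z (j + 1))})
    <= (if j = i + 1 then {mx (z j)} else {})"
    unfolding e[OF ij(1)] e[OF ij(2)] by (rule assms(2)[OF ij])
qed

text \<open>The piece d becomes step -1, and earlier steps are shifted by 1 - n so that post
  \<open>- n\<close> of the old path becomes post -1. The assumptions on \<open>w 0\<close> make
  post 0 the post of least rank, as the rule \<open>limit\<close> demands.\<close>

lemma arrow_glue:
  fixes n :: int
  assumes p: "is_path G (Path Arrow_Omega Inward x P)" and n: "1 \<le> n"
    and d: "proper d" "lend d = mx (x (- n))" "rend d = mx (w 0)" "path_rank d < node_rank G (x (- n))"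
    and dtip: "left_tip (P (- n)) ==> tsuc (path_rank (P (- n))) = node_rank G (x (- n)) ==>
      left_tip d & path_rank d = path_rank (P (- n))"
    and dspan: "!!a. a < - n ==> span (P a) Int span d <= (if a = - n - 1 then {mx (x (- n))} else {})"
    and w0: "w 0 \<in> nodes G" "node_rank G (w 0) < node_rank G (x (- n))" "node_rank G (end_node G d) \<le> node_rank G (w 0)"
    and e2: "e2 = Inward \<or> e2 = Endless & is_path G (Path Arrow_Omega Outward w W)"
    and Wd: "!!i. e2 = Endless ==> 0 \<le> i ==> span d Int span (W i) <= (if i = 0 then {mx (w 0)} else {})"
    and WP: "!!i a. e2 = Endless ==> 0 \<le> i ==> a < - n ==> span (P a) Int span (W i) = {}"
  shows "is_path G (Path Arrow_Omega e2 (%i. if i < 0 then x (i + (1 - n)) else w i)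
    (%i. if i < - 1 then P (i + (1 - n)) else if i = - 1 then d else W i))"
proof -
  define z where "z i = (if i < 0 then x (i + (1 - n)) else w i)" for i
  define R where "R i = (if i < - 1 then P (i + (1 - n)) else if i = - 1 then d else W i)" for i
  have c: "compound Arrow_Omega Inward x P" using is_path_compound[OF p] by simp
  note A = arrow_steps[OF p]
  have B: "is_path G (Path Arrow_Omega Outward w W)" if "e2 = Endless" using e2 that by auto
  note BA = arrow_steps[OF B]
  have BC: "compound Arrow_Omega Outward w W" if "e2 = Endless" using is_path_compound[OF B[OF that]] by simp
  have shift: "i + 1 + (1 - n) = i + (1 - n) + 1" for i by simp
  have zi: "z i = x (i + (1 - n))" if "i < 0" for i using that by (simp add: z_def)
  have zw: "z i = w i" if "0 \<le> i" for i using that by (simp add: z_def)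
  have zm1: "z (- 1) = x (- n)" by (simp add: z_def)
  have Ri: "R i = P (i + (1 - n))" if "i < - 1" for i using that by (simp add: R_def)
  have Rd: "R (- 1) = d" by (simp add: R_def)
  have Rw: "R i = W i" if "0 \<le> i" for i using that by (simp add: R_def)
  have st: "i + (1 - n) \<in> steps Inward" if "i < 0" for i using that n by simp
  have po: "i + (1 - n) \<in> posts Inward" if "i < 0" for i using st[OF that] by (rule steps_posts(1))
  have cases: "i < - 1 \<or> i = - 1 \<or> 0 \<le> i" for i :: int by linarith
  have e2E: "e2 = Endless" if "i \<in> steps e2 \<or> i \<in> posts e2 & 0 < i" "0 \<le> i" for i using that e2 by (auto simp: mem_posts)
  have piece: "proper (R i) & lend (R i) = mx (z i) & rend (R i) = mx (z (i + 1))" if i: "i \<in> steps e2" for i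
    using cases[of i]
  proof (elim disjE)
    assume l: "i < - 1"
    have "z (i + 1) = x (i + (1 - n) + 1)" using zi[of "i + 1"] l unfolding shift by simp
    then show ?thesis using compound_piece[OF c st, of i] l by (simp add: Ri zi)
  next
    assume "i = - 1"
    then show ?thesis using d zm1 zw[of 0] Rd by simp
  next
    assume l: "0 \<le> i"
    note E = e2E[OF disjI1[OF i] l]
    show ?thesis using compound_piece[OF BC[OF E], of i] l by (simp add: Rw zw)
  qed
  have nd: "z i \<in> nodes G & node_rank G (z i) < Arrow_Omega" if i: "i \<in> posts e2" for i
  proof (cases "i < 0")
    case True
    then show ?thesis using A(3) po zi by simp
  next
    case False
    show ?thesis
    proof (cases "i = 0")
      case True
      have "node_rank G (x (- n)) < Arrow_Omega" using A(3) po[of "- 1"] by simp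
      then show ?thesis using True w0 zw[of 0] by auto
    next
      case f: False
      then have E: "e2 = Endless" using e2E[of i] i False by auto
      have "i \<in> posts Outward" using False by (simp add: mem_posts)
      then show ?thesis using BA(3)[OF E] zw[of i] False by simp
    qed
  qed
  have inc: "if 0 \<le> i then node_rank G (z i) < node_rank G (z (i + 1)) else node_rank G (z (i + 1)) < node_rank G (z i)"
    if i: "i \<in> steps e2" for i
    using cases[of i]
  proof (elim disjE)
    assume l: "i < - 1"
    have "node_rank G (x (i + (1 - n) + 1)) < node_rank G (x (i + (1 - n)))"
      using bspec[OF A(4) st[of i]] l n by (simp split: if_splits)
    then show ?thesis using zi[of i] zi[of "i + 1"] l unfolding shift by simp
  next
    assume "i = - 1"
    then show ?thesis using w0(2) zm1 zw[of 0] by simp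
  next
    assume l: "0 \<le> i"
    note E = e2E[OF disjI1[OF i] l]
    have "node_rank G (w i) < node_rank G (w (i + 1))" using bspec[OF BA(4)[OF E], of i] l by simp
    then show ?thesis using zw[of i] zw[of "i + 1"] l by simp
  qed
  have con: "is_path G (R i) & path_rank (R i) < max (node_rank G (z i)) (node_rank G (z (i + 1))) &
      embraces G (z i) (start_node G (R i)) & embraces G (z (i + 1)) (end_node G (R i))" if i: "i \<in> steps e2" for i
    using cases[of i]
  proof (elim disjE)
    assume l: "i < - 1"
    have "z (i + 1) = x (i + (1 - n) + 1)" using zi[of "i + 1"] l unfolding shift by simp
    then show ?thesis using bspec[OF A(5) st[of i]] l by (simp add: Ri zi)
  next
    assume l: "i = - 1"
    have xn: "x (- n) \<in> nodes G" using A(3) po[of "- 1"] by simp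
    have "embraces G (x (- n)) (start_node G d)"
      using mx_eq_embraces[OF proper_nodes(1)[OF d(1)] xn] d(2) start_rank_le[OF d(1,4)] by (simp add: lend_def)
    moreover have "embraces G (w 0) (end_node G d)"
      using mx_eq_embraces[OF proper_nodes(2)[OF d(1)] w0(1)] d(3) w0(3) by (simp add: rend_def)
    ultimately show ?thesis using l zm1 zw[of 0] Rd proper_path[OF d(1)] d(4) by (simp add: less_max_iff_disj)
  next
    assume l: "0 \<le> i"
    note E = e2E[OF disjI1[OF i] l]
    show ?thesis using bspec[OF BA(5)[OF E], of i] l by (simp add: Rw zw)
  qed
  have rea: "reached_by_tip e2 R (node_rank G (z i)) i" if i: "i \<in> posts e2" "i ~= 0" for i
  proof (cases "i < 0")
    case True
    have se: "i \<in> steps e2" "i - 1 \<in> steps e2" using True e2 by auto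
    have ne: "i + (1 - n) ~= 0" using True n by simp
    have e1: "i - 1 + (1 - n) = i + (1 - n) - 1" by simp
    have "reached_by_tip Inward P (node_rank G (x (i + (1 - n)))) (i + (1 - n))"
      using A(6) po[OF True] ne by blast
    then have "right_tip (P (i + (1 - n) - 1)) & tip_rank (path_rank (P (i + (1 - n) - 1))) (node_rank G (z i)) \<or>
      left_tip (P (i + (1 - n))) & tip_rank (path_rank (P (i + (1 - n)))) (node_rank G (z i))"
      unfolding reached_by_tip_def zi[OF True] by blast
    then show ?thesis
    proof
      assume "right_tip (P (i + (1 - n) - 1)) & tip_rank (path_rank (P (i + (1 - n) - 1))) (node_rank G (z i))"
      moreover have "R (i - 1) = P (i + (1 - n) - 1)" using Ri[of "i - 1"] True unfolding e1 by simp
      ultimately show ?thesis using se unfolding reached_by_tip_def by simp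
    next
      assume t: "left_tip (P (i + (1 - n))) & tip_rank (path_rank (P (i + (1 - n)))) (node_rank G (z i))"
      show ?thesis
      proof (cases "i = - 1")
        case True
        then have "left_tip d & path_rank d = path_rank (P (- n))"
          using dtip t zm1 by (simp add: tip_rank_iff)
        then show ?thesis using t se True Rd unfolding reached_by_tip_def by simp
      next
        case False
        then have "R i = P (i + (1 - n))" using Ri[of i] True by simp
        then show ?thesis using t se unfolding reached_by_tip_def by simp
      qed
    qed
  next
    case False
    then have E: "e2 = Endless" using e2E[of i] i by auto
    have "i \<in> posts Outward" using False by (simp add: mem_posts)
    then have "reached_by_tip Outward W (node_rank G (w i)) i" using BA(6)[OF E] i(2) by blast
    moreover have "R (i - 1) = W (i - 1)" "R i = W i" using Rw[of "i - 1"] Rw[of i] False i(2) by simp_all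
    ultimately show ?thesis using zw[of i] False E unfolding reached_by_tip_def by auto
  qed
  have link: "span (R i) Int span (R j) <= (if j = i + 1 then {mx (z j)} else {})"
    if i: "i \<in> steps e2" and j: "j \<in> steps e2" and ij: "i < j" for i j
    using cases[of j]
  proof (elim disjE)
    assume l: "j < - 1"
    then have li: "i < - 1" using ij by simp
    have "span (P (i + (1 - n))) Int span (P (j + (1 - n))) <= (if j = i + 1 then {mx (x (j + (1 - n)))} else {})"
      using compound_span[OF c st[of i] st[of j]] l li ij by (simp split: if_splits)
    moreover have "z j = x (j + (1 - n))" by (rule zi) (use l in simp)
    ultimately show ?thesis unfolding Ri[OF l] Ri[OF li] by (simp only:)
  next
    assume l: "j = - 1"
    then have li: "i < - 1" using ij by simp
    have "i + (1 - n) < - n" "i + (1 - n) = - n - 1 \<longleftrightarrow> j = i + 1" using li l by auto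
    then have "span (P (i + (1 - n))) Int span d <= (if j = i + 1 then {mx (x (- n))} else {})"
      using dspan[of "i + (1 - n)"] by (simp only: if_True)
    then show ?thesis unfolding Ri[OF li] l Rd zm1 .
  next
    assume l: "0 \<le> j"
    note E = e2E[OF disjI1[OF j] l]
    show ?thesis using cases[of i]
    proof (elim disjE)
      assume li: "i < - 1"
      then show ?thesis using WP[OF E l, of "i + (1 - n)"] Ri[OF li] Rw[OF l] by simp
    next
      assume li: "i = - 1"
      have "j = 0 \<longleftrightarrow> j = i + 1" using li by simp
      moreover have "mx (w 0) = mx (z j)" if "j = 0" using that zw[of 0] by simp
      ultimately show ?thesis using Wd[OF E l] Rd Rw[OF l] li by (simp split: if_splits)
    next
      assume li: "0 \<le> i"
      have "i \<in> steps Outward" "j \<in> steps Outward" using li l by simp_all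
      then show ?thesis unfolding Rw[OF li] Rw[OF l] zw[OF l] by (rule compound_span[OF BC[OF E] _ _ ij])
    qed
  qed
  have lk: "linked e2 z R" using piece link by (rule linkedI)
  have "is_path G (Path Arrow_Omega e2 z R)"
  proof (rule is_path.limit)
    show "e2 \<in> {Outward, Inward, Endless}" using e2 by auto
    show "no_repetition G e2 z R"
      using lk nd con path_nodes_subset by (subst no_repetition_iff_linked) blast+
  qed (use A(2) nd inc con rea in blast)+
  then show ?thesis unfolding z_def R_def .
qed

text \<open>The ranks of the posts of an arrow path must increase away from post 0, so the two paths
  cannot be put side by side at the junction. Enough constituents of p are merged with the beginning
  of q to make the remaining posts of p higher than everything near the junction; by then all ranks
  involved are finite and the induction hypothesis applies.\<close>

lemma join_arrow:
  assumes IH: "!!p' q'. joinable p' q' ==>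
      max (max (path_rank p') (path_rank q')) (max (rrank p') (lrank q')) < Arrow_Omega ==> \<exists>r. joins r p' q'"
    and j: "joinable p q" and rk: "path_rank p = Arrow_Omega" "path_rank q \<le> Arrow_Omega"
    and jr: "max (rrank p) (lrank q) < Arrow_Omega"
  shows "\<exists>r. joins r p q"
proof -
  have pq: "proper p" "proper q" "rend p = lend q" "span p Int span q <= {rend p}" using j by (auto simp: joinable_def)
  obtain e x P where p0: "p = Path Arrow_Omega e x P" using proper_path[OF pq(1)] rk(1) by (cases p) auto
  have ip0: "is_path G (Path Arrow_Omega e x P)" using proper_path[OF pq(1)] unfolding p0 .
  have nr: "~ right_tip p" using right_tip_rrank[of p] jr rk(1) by (auto simp: less_trank_def)
  have "e = Inward" using arrow_steps(1)[OF ip0] nr p0 by auto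
  then have p: "p = Path Arrow_Omega Inward x P" and ip: "is_path G (Path Arrow_Omega Inward x P)" using p0 ip0 by auto
  have c: "compound Arrow_Omega Inward x P" using is_path_compound[OF ip] by simp
  have ltp: "left_tip p" using p by simp
  have rp: "rend p = mx (x 0)" "rrank p = rrank (P (- 1))" using p by (simp_all add: rend_def)
  have spP: "span (P a) <= mnodes p" if "a < 0" for a
    unfolding p compound_mnodes[OF c] using that by auto
  have spP': "span (P a) <= span p" if "a < 0" for a
    using spP[OF that] unfolding span_def[of p] by blast
  have nq: "~ left_tip q" if "path_rank q = Arrow_Omega"
    using left_tip_lrank[of q] jr that by (auto simp: less_trank_def)
  obtain e2 y Q where Q: "path_rank q = Arrow_Omega & q = Path Arrow_Omega Outward y Q & e2 = Endless \<or>
    path_rank q < Arrow_Omega & e2 = Inward"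
  proof (cases "path_rank q = Arrow_Omega")
    case True
    then obtain e' y Q where q: "q = Path Arrow_Omega e' y Q" using proper_path[OF pq(2)] by (cases q) auto
    have "e' = Outward" using arrow_steps(1)[of e' y Q] proper_path[OF pq(2)] q nq[OF True] by auto
    then show ?thesis using that[of y Q Endless] q True by simp
  next
    case False
    then show ?thesis using that[of _ _ Inward] rk(2) by auto
  qed
  have iq: "is_path G (Path Arrow_Omega Outward y Q)" "q = Path Arrow_Omega Outward y Q" "path_rank q = Arrow_Omega" if "e2 = Endless"
    using Q that proper_path[OF pq(2)] by auto
  have cq: "compound Arrow_Omega Outward y Q" if "e2 = Endless" using is_path_compound[OF iq(1)[OF that]] by simp
  have e2: "e2 = Inward \<or> e2 = Endless" using Q by auto
  \<comment> \<open>If q is an arrow path too, only its first constituent is merged and the rest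
    continues the new path; otherwise q is absorbed as a whole.\<close>
  define q0 where "q0 = (if e2 = Endless then Q 0 else q)"
  have q0: "proper q0" "lend q0 = lend q" "lrank q0 = lrank q" "span q0 <= span q" "path_rank q0 < Arrow_Omega"
  proof -
    have "proper q0 & lend q0 = lend q & lrank q0 = lrank q & span q0 <= span q & path_rank q0 < Arrow_Omega"
    proof (cases "e2 = Endless")
      case True
      have z: "0 \<in> steps Outward" by simp
      note cp = compound_piece[OF cq[OF True] z]
      have "lend q = mx (y 0)" "lrank q = lrank (Q 0)" using iq(2)[OF True] by (simp_all add: lend_def)
      moreover have "span (Q 0) <= span q"
        using compound_mnodes[OF cq[OF True]] z unfolding iq(2)[OF True] span_def by blast
      ultimately show ?thesis using True cp compoundD(7)[OF cq[OF True] z] by (simp add: q0_def)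
    next
      case False
      then show ?thesis using Q pq(2) by (auto simp: q0_def)
    qed
    then show "proper q0" "lend q0 = lend q" "lrank q0 = lrank q" "span q0 <= span q" "path_rank q0 < Arrow_Omega" by auto
  qed
  have endq0: "node_rank G (end_node G q0) < Arrow_Omega"
  proof -
    obtain a where a: "path_rank q0 = Fin a" using q0(5) by (auto simp: less_Arrow_iff)
    have "node_rank G (end_node G q0) \<le> Fin (Suc a)" using end_rank_le[OF q0(1), of "Fin (Suc a)"] a by simp
    then show ?thesis by (cases "node_rank G (end_node G q0)") (auto simp: less_trank_def)
  qed
  have y1: "e2 = Endless ==> node_rank G (y 1) < Arrow_Omega"
    using arrow_steps(3)[OF iq(1)] by (simp add: mem_posts)
  obtain b where b: "path_rank q0 < Fin b" "max (rrank p) (lrank q) < Fin b" "node_rank G (end_node G q0) < Fin b"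
    "e2 = Endless ==> node_rank G (y 1) < Fin b"
  proof -
    have "\<exists>b. A < Fin b & B < Fin b & C < Fin b & D < Fin b"
      if "A < Arrow_Omega" "B < Arrow_Omega" "C < Arrow_Omega" "D < Arrow_Omega" for A B C D
    proof -
      obtain a1 a2 a3 a4 where "A = Fin a1" "B = Fin a2" "C = Fin a3" "D = Fin a4"
        using \<open>A < Arrow_Omega\<close> \<open>B < Arrow_Omega\<close> \<open>C < Arrow_Omega\<close> \<open>D < Arrow_Omega\<close> unfolding less_Arrow_iff by blast
      then show ?thesis by (intro exI[of _ "Suc (a1 + a2 + a3 + a4)"]) auto
    qed
    moreover have "(if e2 = Endless then node_rank G (y 1) else Fin 0) < Arrow_Omega" using y1 by (simp add: less_trank_def)
    ultimately obtain b where "path_rank q0 < Fin b" "max (rrank p) (lrank q) < Fin b"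
      "node_rank G (end_node G q0) < Fin b" "(if e2 = Endless then node_rank G (y 1) else Fin 0) < Fin b"
      using q0(5) jr endq0 by meson
    then show ?thesis using that[of b] by presburger
  qed
  \<comment> \<open>Post \<open>- n\<close> has rank at least n, hence above the bound b for the
    rank of \<open>q0\<close>, for the junction and for the node at which the merged piece
    ends.\<close>
  define n where "n = Suc b"
  have n1: "1 \<le> n" "1 \<le> int n" by (auto simp: n_def)
  let ?x = "%i. x (- i)" and ?P = "%i. reverse (P (- 1 - i))"
  have rv: "reverse (Path Arrow_Omega Inward x P) = Path Arrow_Omega Outward ?x ?P" by simp
  have irp: "is_path G (Path Arrow_Omega Outward ?x ?P)" using is_path_reverse[OF ip] unfolding rv .
  have big: "Fin b < node_rank G (x (- int n))"
  proof -
    have "Fin n \<le> node_rank G (x (- int n))" using arrow_rank_ge[OF irp, of n] by simp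
    moreover have "Fin b < Fin n" by (simp add: n_def)
    ultimately show ?thesis by (rule order.strict_trans2[rotated])
  qed
  have xn: "node_rank G (x (- int n)) < Arrow_Omega" using arrow_steps(3)[OF ip] n1 by (simp add: mem_posts)
  obtain c' where c': "proper c'" "lend c' = mx (x 0)" "rend c' = mx (x (- int n))"
    "span c' <= (\<Union>i\<in>{0..<int n}. span (?P i))" "path_rank c' < node_rank G (x (- int n))" "lrank c' = lrank (?P 0)"
    "right_tip (?P (int n - 1)) & tsuc (path_rank (?P (int n - 1))) = node_rank G (x (- int n)) -->
      right_tip c' & path_rank c' = path_rank (?P (int n - 1))"
    using arrow_run[OF IH irp _ n1(1)] by auto
  define cc where "cc = reverse c'"
  have spc: "\<exists>a. - int n \<le> a & a < 0 & m \<in> span (P a)" if m: "m \<in> span cc" for m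
  proof -
    have "m \<in> (\<Union>i\<in>{0..<int n}. span (?P i))" using c'(4) m by (auto simp: cc_def)
    then obtain i where "i \<in> {0..<int n}" "m \<in> span (?P i)" by (rule UN_E)
    then have "0 \<le> i" "i < int n" "m \<in> span (P (- 1 - i))" by simp_all
    then show ?thesis by (intro exI[of _ "- 1 - i"]) auto
  qed
  have cc: "proper cc" "lend cc = mx (x (- int n))" "rend cc = rend p" "path_rank cc < node_rank G (x (- int n))"
    "rrank cc = rrank p" using c' rp by (simp_all add: cc_def)
  have Pn: "- 1 - (int n - 1) = - int n" by simp
  have cctip: "left_tip cc & path_rank cc = path_rank (P (- int n))"
    if "left_tip (P (- int n))" "tsuc (path_rank (P (- int n))) = node_rank G (x (- int n))"
    using c'(7) that unfolding Pn by (simp add: cc_def)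
  have spcp: "span cc <= mnodes p" using spc spP by blast
  then have jn: "joinable cc q0"
    unfolding joinable_def using cc q0 pq(3,4) by (auto simp: span_def)
  have top: "max (max (path_rank cc) (path_rank q0)) (max (rrank cc) (lrank q0)) < node_rank G (x (- int n))"
    unfolding cc(5) q0(3) using cc(4) b(1,2) big by (simp add: order.strict_trans[OF _ big])
  obtain d where d: "joins d cc q0" using IH[OF jn order.strict_trans[OF top xn]] by blast
  note J = d[unfolded joins_def]
  have rd: "path_rank d = max (max (path_rank cc) (path_rank q0)) (max (rrank cc) (lrank q0))" using J by blast
  have dd: "proper d" "lend d = mx (x (- int n))" "rend d = rend q0" "path_rank d < node_rank G (x (- int n))"
    "rrank d = rrank q0" "node_rank G (end_node G d) \<le> node_rank G (end_node G q0)"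
    using J cc(2) top unfolding rd by simp_all
  have dtip: "left_tip d & path_rank d = path_rank (P (- int n))"
    if t: "left_tip (P (- int n))" "tsuc (path_rank (P (- int n))) = node_rank G (x (- int n))"
  proof -
    note ct = cctip[OF t]
    have "path_rank cc ~= Omega" using cc(4) by auto
    then have "path_rank d \<le> path_rank cc" using dd(4) t(2) ct less_tsuc_iff by metis
    moreover have "path_rank cc \<le> path_rank d" unfolding rd by (simp add: le_max_iff_disj)
    ultimately have "path_rank d = path_rank cc" by simp
    then show ?thesis using J ct by simp
  qed
  have spd: "span d <= span cc Un span q0" by (rule joins_span[OF d])
  have far: "rend p ~: span (P a)" if a: "a < - 1" for a
  proof
    assume m: "rend p \<in> span (P a)"
    have s1: "a \<in> steps Inward" "- 1 \<in> steps Inward" using a by auto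
    have "rend p \<in> span (P (- 1))" using compound_piece(2)[OF c s1(2)] rp(1) by (simp add: span_def)
    then have "rend p = mx (x (- 1))" using m compound_span[OF c s1 a] by (auto split: if_splits)
    moreover have "mx (x (- 1)) ~= mx (x (- 1 + 1))" using seg_neq[OF ip s1(2)] .
    ultimately show False using rp(1) by simp
  qed
  have dspan: "span (P a) Int span d <= (if a = - int n - 1 then {mx (x (- int n))} else {})" if a: "a < - int n" for a
  proof
    fix m assume m: "m \<in> span (P a) Int span d"
    have "m ~: span q0"
    proof
      assume "m \<in> span q0"
      moreover have "span (P a) <= span p" by (rule spP') (use a in simp)
      ultimately have "m = rend p" using m q0(4) pq(4) by blast
      then show False using far[of a] m a n1 by simp
    qed
    then obtain a' where a': "- int n \<le> a'" "a' < 0" "m \<in> span (P a')" using spd m spc by blast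
    have s: "a \<in> steps Inward" "a' \<in> steps Inward" "a < a'" using a a' n1 by auto
    have "m \<in> (if a' = a + 1 then {mx (x a')} else {})" using compound_span[OF c s] m a'(3) by blast
    then have "a' = a + 1" "m = mx (x a')" by (simp_all split: if_splits)
    moreover from this(1) have "a = - int n - 1" "a' = - int n" using a a'(1) by auto
    ultimately show "m \<in> (if a = - int n - 1 then {mx (x (- int n))} else {})" by simp
  qed
  define w where "w i = (if e2 = Endless then y (i + 1) else end_node G d)" for i
  define W where "W i = (if e2 = Endless then Q (i + 1) else d)" for i
  have wE: "w = (%i. y (i + 1))" "W = (%i. Q (i + 1))" if "e2 = Endless" using that by (auto simp: w_def W_def)
  have w0: "w 0 \<in> nodes G" "node_rank G (w 0) < node_rank G (x (- int n))" "node_rank G (end_node G d) \<le> node_rank G (w 0)" "rend d = mx (w 0)"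
  proof -
    have "w 0 \<in> nodes G & node_rank G (w 0) < node_rank G (x (- int n)) & node_rank G (end_node G d) \<le> node_rank G (w 0) & rend d = mx (w 0)"
    proof (cases "e2 = Endless")
      case True
      have z: "0 \<in> steps Outward" by simp
      have "node_rank G (end_node G q0) \<le> node_rank G (y 1)"
        using embraces_rank[OF compoundD(9)[OF cq[OF True] z]] True by (simp add: q0_def)
      moreover have "rend q0 = mx (y 1)" using compound_piece(2)[OF cq[OF True] z] True by (simp add: q0_def)
      moreover have "y 1 \<in> nodes G" using posts_nodes[OF iq(1)[OF True], of 1] by (simp add: mem_posts)
      ultimately show ?thesis using order.strict_trans[OF b(4)[OF True] big] dd(3) order.trans[OF dd(6)] True by (simp add: w_def)
    next
      case False
      then show ?thesis using proper_nodes(2)[OF dd(1)] order.strict_trans1[OF dd(6) order.strict_trans[OF b(3) big]] by (simp add: w_def rend_def)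
    qed
    then show "w 0 \<in> nodes G" "node_rank G (w 0) < node_rank G (x (- int n))"
      "node_rank G (end_node G d) \<le> node_rank G (w 0)" "rend d = mx (w 0)" by auto
  qed
  have spQ: "span (Q i) <= mnodes q" if "e2 = Endless" "0 \<le> i" for i
    unfolding iq(2)[OF that(1)] compound_mnodes[OF cq[OF that(1)]] using that by auto
  have spQ': "span (Q i) <= span q" if "e2 = Endless" "0 \<le> i" for i
    using spQ[OF that] unfolding span_def[of q] by blast
  have farQ: "rend p ~: span (Q i)" if E: "e2 = Endless" and i: "1 \<le> i" for i
  proof
    assume m: "rend p \<in> span (Q i)"
    have s1: "0 \<in> steps Outward" "i \<in> steps Outward" "0 < i" using i by auto
    have l: "lend q = mx (y 0)" using iq(2)[OF E] by (simp add: lend_def)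
    have "rend p \<in> span (Q 0)" using compound_piece(1)[OF cq[OF E] s1(1)] l pq(3) by (simp add: span_def)
    then have "rend p \<in> (if i = 0 + 1 then {mx (y i)} else {})" using m compound_span[OF cq[OF E] s1] by blast
    then have "mx (y 0) = mx (y (0 + 1))" using l pq(3) by (simp split: if_splits)
    then show False using seg_neq[OF iq(1)[OF E] s1(1)] by simp
  qed
  define r where "r = Path Arrow_Omega e2 (%i. if i < 0 then x (i + (1 - int n)) else w i)
    (%i. if i < - 1 then P (i + (1 - int n)) else if i = - 1 then d else W i)"
  have ir: "is_path G r"
    unfolding r_def
  proof (rule arrow_glue[where n = "int n" and w = w and W = W and P = P and x = x, OF ip n1(2) dd(1,2) w0(4) dd(4) _ _ w0(1-3)])
    show "left_tip d & path_rank d = path_rank (P (- int n))"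
      if "left_tip (P (- int n))" "tsuc (path_rank (P (- int n))) = node_rank G (x (- int n))"
      by (rule dtip[OF that])
    show "span (P a) Int span d <= (if a = - int n - 1 then {mx (x (- int n))} else {})" if "a < - int n" for a
      by (rule dspan[OF that])
    show "e2 = Inward \<or> e2 = Endless & is_path G (Path Arrow_Omega Outward w W)"
    proof (cases "e2 = Endless")
      case True
      have "is_ray G (Path Arrow_Omega Outward y Q)" using iq(1)[OF True] by (simp add: is_ray_def)
      from is_ray_tail[OF this, of 1] show ?thesis using True by (simp add: is_ray_def wE)
    qed (use e2 in auto)
    show "span d Int span (W i) <= (if i = 0 then {mx (w 0)} else {})" if E: "e2 = Endless" and i: "0 \<le> i" for i
    proof
      fix m assume m: "m \<in> span d Int span (W i)"
      have W: "W i = Q (i + 1)" using E by (simp add: W_def)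
      have "0 \<le> i + 1" using i by simp
      then have mQ: "m \<in> span q" using m spQ'[OF E] unfolding W by blast
      have "m ~: span cc"
      proof
        assume "m \<in> span cc"
        then have "m \<in> span p" using spcp unfolding span_def[of p] by blast
        then have "m = rend p" using mQ pq(4) by blast
        then show False using farQ[OF E, of "i + 1"] i m W by simp
      qed
      then have m0: "m \<in> span (Q 0)" using spd m E by (auto simp: q0_def)
      have s: "0 \<in> steps Outward" "i + 1 \<in> steps Outward" "0 < i + 1" using i by auto
      have "m \<in> span (Q (i + 1))" using m W by (simp only: Int_iff)
      then have "m \<in> (if i + 1 = 0 + 1 then {mx (y (i + 1))} else {})" using compound_span[OF cq[OF E] s] m0 by blast
      then show "m \<in> (if i = 0 then {mx (w 0)} else {})" using E by (simp add: w_def split: if_splits)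
    qed
    show "span (P a) Int span (W i) = {}" if E: "e2 = Endless" and i: "0 \<le> i" and a: "a < - int n" for i a
    proof -
      have W: "W i = Q (i + 1)" using E by (simp add: W_def)
      have "span (P a) <= span p" by (rule spP') (use a in simp)
      moreover have "span (W i) <= span q" unfolding W by (rule spQ'[OF E]) (use i in simp)
      ultimately have "span (P a) Int span (W i) <= {rend p}" using pq(4) by blast
      moreover have "rend p ~: span (W i)" unfolding W by (rule farQ[OF E]) (use i in simp)
      ultimately show ?thesis by blast
    qed
  qed
  have cr: "compound Arrow_Omega e2 (%i. if i < 0 then x (i + (1 - int n)) else w i)
    (%i. if i < - 1 then P (i + (1 - int n)) else if i = - 1 then d else W i)"
    using is_path_compound[OF ir[unfolded r_def]] by simp
  have mr: "m \<in> mnodes p \<or> m \<in> span q0 \<or> (e2 = Endless & m \<in> mnodes q)" if m: "m \<in> mnodes r" for m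
  proof -
    obtain i where i: "i \<in> steps e2" "m \<in> span (if i < - 1 then P (i + (1 - int n)) else if i = - 1 then d else W i)"
      using m unfolding r_def compound_mnodes[OF cr] by blast
    consider "i < - 1" | "i = - 1" | "0 \<le> i" by linarith
    then show ?thesis
    proof cases
      case 1
      then have "i + (1 - int n) < 0" using n1 by simp
      then show ?thesis using i(2) 1 spP[of "i + (1 - int n)"] by auto
    next
      case 2
      then show ?thesis using i(2) spd spcp by auto
    next
      case 3
      then have E: "e2 = Endless" using i(1) e2 by auto
      then show ?thesis using i(2) 3 spQ[OF E, of "i + 1"] by (auto simp: W_def)
    qed
  qed
  have mr': "mnodes r <= span p Un span q" using mr q0(4) unfolding span_def[of p] span_def[of q] by blast
  have ltr: "left_tip r" using e2 by (auto simp: r_def)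
  have gp: "Arrow_Omega < graph_rank G" using pq(1) ltp rk(1) by (simp add: proper_def)
  have str: "start_node G p = start_node G r"
  proof -
    have "(if i < - 1 then P (i + (1 - int n)) else if i = - 1 then d else W i) = P (i + (1 - int n))" if "i < - 1" for i
      using that by simp
    then show ?thesis unfolding p r_def
      by (intro start_node_eq[OF ip ltp[unfolded p] ir[unfolded r_def] ltr[unfolded r_def] gp, of "- 1" "1 - int n"])
  qed
  have right: "end_node G r = end_node G q & right_tip r & right_tip q" if E: "e2 = Endless"
  proof -
    have rq: "right_tip (Path Arrow_Omega Outward y Q)" by simp
    have rr: "right_tip r" using E by (simp add: r_def)
    have "(if i < - 1 then P (i + (1 - int n)) else if i = - 1 then d else W i) = Q (i + 1)" if "0 \<le> i" for i
      using that E by (simp add: W_def)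
    then have "end_node G (Path Arrow_Omega Outward y Q) = end_node G r"
      unfolding r_def by (intro end_node_eq[OF iq(1)[OF E] rq ir[unfolded r_def] rr[unfolded r_def] gp, of 0 1])
    then show ?thesis using iq(2)[OF E] rr by simp
  qed
  have right': "end_node G r = end_node G d & ~ right_tip r & q0 = q & path_rank q ~= Arrow_Omega & rrank r = rrank d" if E: "e2 = Inward"
    using E Q by (auto simp: r_def w_def q0_def)
  have er: "rend r = rend q" "rrank r = rrank q" "node_rank G (end_node G r) \<le> node_rank G (end_node G q)"
    "right_tip r \<longleftrightarrow> right_tip q & path_rank q = Arrow_Omega"
  proof -
    have "rend r = rend q & rrank r = rrank q & node_rank G (end_node G r) \<le> node_rank G (end_node G q) &
      (right_tip r \<longleftrightarrow> right_tip q & path_rank q = Arrow_Omega)"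
      using e2
    proof
      assume E: "e2 = Inward"
      note R = right'[OF E]
      have "rend r = rend d" using R by (simp add: rend_def)
      then show ?thesis using R dd(3,5,6) by simp
    next
      assume E: "e2 = Endless"
      note R = right[OF E]
      have "path_rank r = Arrow_Omega" by (simp add: r_def)
      then show ?thesis using R right_tip_rrank[of r] right_tip_rrank[of q] iq(3)[OF E] by (simp add: rend_def)
    qed
    then show "rend r = rend q" "rrank r = rrank q" "node_rank G (end_node G r) \<le> node_rank G (end_node G q)"
      "right_tip r \<longleftrightarrow> right_tip q & path_rank q = Arrow_Omega" by auto
  qed
  have el: "lend r = lend p" "lrank r = lrank p" using str left_tip_lrank[OF ltr] left_tip_lrank[OF ltp] rk(1)
    by (simp_all add: lend_def r_def)
  have prp: "path_rank r = Arrow_Omega" by (simp add: r_def)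
  have "proper r"
    unfolding proper_def el(1) er(1) prp
  proof (intro conjI impI)
    show "is_path G r" by (rule ir)
    show "Arrow_Omega < graph_rank G" by (rule gp)
    have "lend p ~: mnodes p" using pq(1) ltp by (simp add: proper_def)
    then show "lend p ~: mnodes r" using mr[of "lend p"] joinable_ends(1)[OF j] q0(4) by (auto simp: span_def)
    show "rend q ~: mnodes r" if "right_tip r"
    proof
      assume m: "rend q \<in> mnodes r"
      have E: "e2 = Endless" using that right' e2 by blast
      have nq: "rend q ~: mnodes q" using pq(2) right[OF E] by (simp add: proper_def)
      moreover have "span q0 <= mnodes q" using spQ[OF E, of 0] E by (simp add: q0_def)
      moreover have "rend q ~: mnodes p" using joinable_ends(2)[OF j] by (auto simp: span_def)
      ultimately show False using mr[OF m] by blast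
    qed
    show "lend p ~= rend q" by (rule joinable_neq[OF j])
  qed
  moreover have "path_length r \<le> path_length p \<oplus> path_length q"
  proof -
    have l: "ray_length Arrow_Omega \<le> path_length p" using ray_length_le[of p] ltp rk(1) by simp
    show ?thesis using e2
    proof
      assume "e2 = Inward"
      then have "path_length r = ray_length Arrow_Omega" by (simp add: r_def)
      then show ?thesis by (rule ord_eq_le_trans[OF _ order.trans[OF l natsum_ge1]])
    next
      assume E: "e2 = Endless"
      then have "path_length r = ray_length Arrow_Omega \<oplus> ray_length Arrow_Omega" by (simp add: r_def numeral_2_eq_2)
      moreover have "ray_length Arrow_Omega \<le> path_length q" using ray_length_le[of q] right[OF E] iq(3)[OF E] by simp
      ultimately show ?thesis by (simp only: natsum_mono[OF l])
    qed
  qed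
  moreover have "Arrow_Omega = max (max (path_rank p) (path_rank q)) (max (rrank p) (lrank q))"
  proof -
    have "max (path_rank p) (path_rank q) = Arrow_Omega" using rk by (simp add: max_absorb1)
    then show ?thesis using max_absorb1[OF order.strict_implies_order[OF jr]] by (simp only:)
  qed
  ultimately have "joins r p q"
    unfolding joins_def prp using el er mr' ltr ltp rk(1) str by simp
  then show ?thesis by blast
qed

text \<open>Induction on the rank that the joined path is going to have. The rank of a junction is
  never the arrow rank, so at this rank one of the two paths must attain it; a successor rank may be
  attained by the junction or only by a path.\<close>

theorem join: "joinable p q ==> \<exists>r. joins r p q"
proof (induction "max (max (path_rank p) (path_rank q)) (max (rrank p) (lrank q))" arbitrary: p q rule: less_induct)
  case less
  define \<mu> where "\<mu> = max (max (path_rank p) (path_rank q)) (max (rrank p) (lrank q))"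
  have IH: "\<exists>r. joins r p' q'"
    if "joinable p' q'" "max (max (path_rank p') (path_rank q')) (max (rrank p') (lrank q')) < \<mu>" for p' q'
    using less.hyps[of p' q'] that unfolding \<mu>_def by blast
  have pq: "proper p" "proper q" using less.prems by (auto simp: joinable_def)
  have le: "path_rank p \<le> \<mu>" "path_rank q \<le> \<mu>" "max (rrank p) (lrank q) \<le> \<mu>" "rrank p \<le> \<mu>" "lrank q \<le> \<mu>"
    unfolding \<mu>_def by (simp_all add: le_max_iff_disj)
  have g: "\<mu> \<le> graph_rank G"
  proof -
    have "rrank p \<le> graph_rank G" "lrank q \<le> graph_rank G"
      using rrank_node[OF pq(1)] lrank_node[OF pq(2)] node_rank_le by metis+
    then show ?thesis using path_rank_le[OF proper_path[OF pq(1)]] path_rank_le[OF proper_path[OF pq(2)]]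
      unfolding \<mu>_def by simp
  qed
  show ?case
  proof (cases \<mu> rule: trank_cases_succ)
    case 1
    have z: "\<nu> = Fin 0" if "\<nu> \<le> \<mu>" for \<nu> using that 1 by (metis Fin_0_le order.antisym)
    show ?thesis by (rule join_zero[OF less.prems]) (use z le in blast)+
  next
    case 2
    have "max (rrank p) (lrank q) ~= Arrow_Omega" by (simp add: max_def)
    then have jr: "max (rrank p) (lrank q) < Arrow_Omega" using le(3) 2 by (simp only: order.not_eq_order_implies_strict)
    then have "max (path_rank p) (path_rank q) = Arrow_Omega" using 2 unfolding \<mu>_def by (metis max_def order.irrefl)
    then consider "path_rank p = Arrow_Omega" | "path_rank q = Arrow_Omega" by (metis max_def)
    then show ?thesis
    proof cases
      case 1
      show ?thesis by (rule join_arrow[OF _ less.prems 1 _ jr]) (use IH le 2 in auto)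
    next
      case 2
      have "\<exists>r. joins r (reverse q) (reverse p)"
      proof (rule join_arrow)
        show "joinable (reverse q) (reverse p)" using less.prems joinable_reverse by blast
        show "max (rrank (reverse q)) (lrank (reverse p)) < Arrow_Omega" using jr by (simp add: max.commute)
      qed (use IH le \<open>\<mu> = Arrow_Omega\<close> 2 in auto)
      then show ?thesis using joins_reverse[of "reverse _" q p] by (metis joins_reverse reverse_reverse)
    qed
  next
    case (3 \<alpha>)
    show ?thesis
    proof (cases "max (rrank p) (lrank q) = \<mu>")
      case True
      then show ?thesis using join_at_top_rank[OF less.prems 3(2,1) g le(1,2)] by blast
    next
      case False
      then have jr: "max (rrank p) (lrank q) < \<mu>" using le(3) by (simp only: order.not_eq_order_implies_strict)
      then have "max (path_rank p) (path_rank q) = \<mu>" unfolding \<mu>_def by (metis max_def order.irrefl)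
      then show ?thesis using join_below_top_rank[OF less.prems 3(2,1) g _ jr IH] by blast
    qed
  qed
qed

section \<open>Two-ended paths, and cutting a path where it first meets a set\<close>

lemma proper_left_tip_rank: "proper p ==> left_tip p ==> path_rank p < graph_rank G"
  by (simp add: proper_def)

lemma piece_length: "is_path G q ==> path_rank q < \<mu> ==> path_length q < ray_length \<mu>"
  using path_length_bound[of G q] nattimes2_less_ray_length[OF ray_length_less] by (metis order.strict_trans1)

lemma lrank_le_above: assumes "proper q" "path_rank q < \<mu>" shows "lrank q \<le> \<mu>"
proof (cases "left_tip q")
  case True
  then show ?thesis using left_tip_lrank[OF True] tsuc_le[OF assms(2)] by (simp only:)
next
  case False
  then show ?thesis using order.trans[OF lrank_le[OF assms(1) False]] assms(2) by (simp add: order.strict_implies_order)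
qed

lemma rrank_le_above: "proper q ==> path_rank q < \<mu> ==> rrank q \<le> \<mu>"
  using lrank_le_above[of "reverse q"] by simp

lemma span_node:
  assumes "proper p" "m \<in> span p" shows "maximal_node G m"
proof -
  have "m \<in> mx ` path_nodes p \<or> m = mx (start_node G p) \<or> m = mx (end_node G p)"
    using assms(2) by (auto simp: span_def mnodes_def lend_def rend_def)
  then obtain u where "u \<in> nodes G" "m = mx u"
    using proper_nodes[OF assms(1)] path_nodes_subset[OF proper_path[OF assms(1)]] by blast
  then show ?thesis using mx(1) by blast
qed

text \<open>A path with an infinite end is made the only constituent of a two-ended path of the next
  rank, with the nodes holding its tips as posts. The sum of one length is unchanged, so distances
  may be estimated with arbitrary proper paths.\<close>

lemma two_ended_same_length:
  assumes p: "proper p"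
  obtains p' where "two_ended_path_between G (lend p) (rend p) p'" "path_length p' = path_length p"
proof -
  obtain \<mu> e x P where p': "p = Path \<mu> e x P" using is_path_PathE[OF proper_path[OF p]] .
  note N = proper_nodes[OF p]
  show ?thesis
  proof (cases "left_tip p \<or> right_tip p")
    case False
    then obtain k where e: "e = Two_Ended k" using p' by (cases e) auto
    have "start_node G p = x 0" "end_node G p = x (int k)" using p' e by simp_all
    then have "two_ended_path_between G (lend p) (rend p) p"
      using proper_path[OF p] N mx(2) unfolding two_ended_path_between_def lend_def rend_def p' e by auto
    then show ?thesis using that by blast
  next
    case True
    then have r: "path_rank p < graph_rank G" using p by (simp add: proper_def)
    have O: "path_rank p ~= Omega" using r by auto
    define z where "z i = (if i = 0 then start_node G p else end_node G p)" for i :: int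
    let ?q = "Path (tsuc (path_rank p)) (Two_Ended 1) z (%_. p)"
    have po: "i \<in> posts (Two_Ended 1) ==> i = 0 \<or> i = 1" for i by (auto simp: mem_posts)
    have zn: "z i \<in> nodes G" "node_rank G (z i) \<le> tsuc (path_rank p)" for i
      using N start_rank_le[OF p less_tsuc[OF O]] end_rank_le[OF p less_tsuc[OF O]] by (auto simp: z_def)
    have lk: "linked (Two_Ended 1) z (%_. p)" by (rule linkedI) (auto simp: p z_def lend_def rend_def)
    have "is_path G ?q"
    proof (rule is_path.succ)
      show "tip_rank (path_rank p) (tsuc (path_rank p))" using O by (simp add: tip_rank_iff)
      show "tsuc (path_rank p) \<le> graph_rank G" by (rule tsuc_le[OF r])
      show "\<exists>i\<in>posts (Two_Ended 1). reached_by_tip (Two_Ended 1) (%_. p) (tsuc (path_rank p)) i"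
        using True
      proof
        assume "left_tip p"
        then show ?thesis using O by (intro bexI[of _ 0]) (auto simp: reached_by_tip_def tip_rank_iff mem_posts)
      next
        assume "right_tip p"
        then show ?thesis using O by (intro bexI[of _ 1]) (auto simp: reached_by_tip_def tip_rank_iff mem_posts)
      qed
      show "no_repetition G (Two_Ended 1) z (%_. p)"
        using lk zn path_nodes_subset[OF proper_path[OF p]] by (subst no_repetition_iff_linked) auto
    qed (use zn proper_path[OF p] less_tsuc[OF O] in \<open>auto simp: z_def embraces_def\<close>)
    then have "two_ended_path_between G (lend p) (rend p) ?q"
      using N mx(2) unfolding two_ended_path_between_def lend_def rend_def by (auto simp: z_def)
    moreover have "path_length ?q = path_length p"
    proof -
      have "{0..<int 1} = {0}" by auto
      then show ?thesis unfolding path_length_Two_Ended by simp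
    qed
    ultimately show ?thesis using that by blast
  qed
qed

lemma two_ended_proper:
  assumes p: "is_path G p" "p = Path \<mu> (Two_Ended k) z P"
  shows "proper p" "lend p = mx (z 0)" "rend p = mx (z (int k))"
proof -
  show l: "lend p = mx (z 0)" "rend p = mx (z (int k))" using p(2) by (simp_all add: lend_def rend_def)
  have k: "k ~= 0" using is_path_extent[OF p(1)[unfolded p(2)]] by simp
  have "0 \<in> posts (Two_Ended k)" "int k \<in> posts (Two_Ended k)" using k by (auto simp: mem_posts)
  then have "mx (z 0) ~= mx (z (int k))" using posts_inj[OF p(1)[unfolded p(2)], of 0 "int k"] k by auto
  then show "proper p" unfolding proper_def l using p by simp
qed

lemma two_ended_between_proper:
  assumes p: "two_ended_path_between G a b p" and "maximal_node G a" "maximal_node G b"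
  shows "proper p & lend p = a & rend p = b"
proof -
  obtain \<mu> k z P where q: "p = Path \<mu> (Two_Ended k) z P" "embraces G a (z 0)" "embraces G b (z (int k))" "is_path G p"
    using p by (auto simp: two_ended_path_between_def)
  have "a \<in> nodes G" "b \<in> nodes G" using assms by (auto simp: maximal_node_def)
  then have "mx (z 0) = a" "mx (z (int k)) = b"
    using q assms mx_eqI embraces_nodes(2) by blast+
  then show ?thesis using two_ended_proper[OF q(4,1)] by simp
qed

text \<open>Only tips whose nodes lie in \<open>E\<close> are considered, because condition (C)
  gives no information about singleton nodes outside \<open>M\<close>.\<close>

definition closed_in :: "'n set \<Rightarrow> 'n set \<Rightarrow> bool" where
  "closed_in E Z \<longleftrightarrow> (\<forall>w. is_ray G w & path_rank w < graph_rank G & mx (tip_node G w) \<in> E - Z -->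
    (\<exists>k. mnodes (tail k w) Int Z = {}))"

lemma closed_in_singleton: "closed_in E {m}"
proof -
  have "\<exists>k. mnodes (tail k w) Int {m} = {}" if "is_ray G w" for w using ray_avoid[OF that, of m] by blast
  then show ?thesis unfolding closed_in_def by blast
qed

text \<open>Without a left tip the steps are bounded below. With one, the node of that tip is
  outside \<open>Z\<close>, so by closedness a tail towards it avoids \<open>Z\<close>; this again
  bounds the steps that meet \<open>Z\<close>.\<close>

lemma first_post:
  assumes p: "is_path G (Path \<mu> e x P)" "proper (Path \<mu> e x P)" and Z: "closed_in E Z"
    and l: "lend (Path \<mu> e x P) \<in> E - Z" and ne: "mnodes (Path \<mu> e x P) Int Z ~= {}"
  obtains i where "i \<in> steps e" "seg x P i Int Z ~= {}" "!!j. j \<in> steps e ==> j < i ==> seg x P j Int Z = {}" "mx (x i) ~: Z"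
proof -
  let ?J = "{i \<in> steps e. seg x P i Int Z ~= {}}"
  obtain i0 where i0: "i0 \<in> ?J" using ne mnodes_seg[OF p(1)] by blast
  have "\<exists>b. \<forall>i\<in>?J. b \<le> i"
  proof (cases "left_tip (Path \<mu> e x P)")
    case False
    then show ?thesis using left_post(2)[OF p(1)] by blast
  next
    case True
    then have e: "e = Inward \<or> e = Endless" by simp
    let ?w = "Path \<mu> Outward (%i. x (0 - i)) (%i. reverse (P (0 - 1 - i)))"
    have w: "is_ray G ?w" using left_ray[OF p(1) e] by simp
    have "start_node G (Path \<mu> e x P) = tip_node G ?w" using e by auto
    then have "mx (tip_node G ?w) \<in> E - Z" using l by (simp add: lend_def)
    moreover have "path_rank ?w < graph_rank G" using proper_left_tip_rank[OF p(2) True] by simp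
    ultimately obtain k where k: "mnodes (tail k ?w) Int Z = {}" using Z w unfolding closed_in_def by blast
    have k': "(\<Union>i\<in>{int k..}. seg x P (0 - 1 - i)) Int Z = {}"
      using k unfolding mnodes_tail[OF is_ray_path[OF w]] seg_flip .
    have "- int k \<le> i" if "i \<in> ?J" for i
    proof (rule ccontr)
      assume "~ - int k \<le> i"
      then have "- 1 - i \<in> {int k..}" by simp
      then have "seg x P (0 - 1 - (- 1 - i)) Int Z = {}" using k' by blast
      then show False using that by simp
    qed
    then show ?thesis by blast
  qed
  then obtain b where b: "!!i. i \<in> ?J ==> b \<le> i" by blast
  obtain i where i: "i \<in> ?J" "!!j. j \<in> ?J ==> nat (i - b) \<le> nat (j - b)"
    using ex_has_least_nat[of "%i. i \<in> ?J" i0 "%i. nat (i - b)"] i0 by blast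
  have before: "seg x P j Int Z = {}" if j: "j \<in> steps e" "j < i" for j
  proof (rule ccontr)
    assume "seg x P j Int Z ~= {}"
    then have "j \<in> ?J" using j by blast
    then show False using i(2)[of j] b[of j] j(2) by simp
  qed
  have "mx (x i) ~: Z"
  proof (cases "i - 1 \<in> steps e")
    case True
    have "mx (x i) \<in> seg x P (i - 1)" by (simp add: seg_def)
    then show ?thesis using before[OF True] by auto
  next
    case False
    have nl: "~ left_tip (Path \<mu> e x P)" using False i(1) by auto
    have "i = 0" using left_post(1,2)[OF p(1) nl] i(1) False steps_convex[of 0 e i "i - 1"] by force
    then show ?thesis using left_post(3)[OF p(1) nl] l by simp
  qed
  then show ?thesis using that[of i] i(1) before by blast
qed

lemma inward_part:
  assumes p: "is_path G (Path \<mu> e x P)" "proper (Path \<mu> e x P)" "left_tip (Path \<mu> e x P)"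
    and s: "\<forall>i<0. i + s \<in> steps e"
    and c: "c = Path \<mu> Inward (%i. x (i + s)) (%i. P (i + s))" "is_path G c"
  shows "proper c" "lend c = lend (Path \<mu> e x P)" "rend c = mx (x s)" "mnodes c = (\<Union>i\<in>{i \<in> steps e. i < s}. seg x P i)"
proof -
  have r: "\<mu> < graph_rank G" using proper_left_tip_rank[OF p(2,3)] by simp
  have "start_node G (Path \<mu> e x P) = start_node G c"
    unfolding c(1) by (rule start_node_eq[OF p(1,3) c(2)[unfolded c(1)] _ r, of 0 s]) simp_all
  then show l: "lend c = lend (Path \<mu> e x P)" by (simp add: lend_def)
  show rd: "rend c = mx (x s)" unfolding c(1) by (simp add: rend_def)
  have "seg (%i. x (i + s)) (%i. P (i + s)) i = seg x P (i + s)" for i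
    unfolding seg_def by (simp add: algebra_simps)
  then have "mnodes c = (\<Union>i\<in>{..<0}. seg x P (i + s))" using mnodes_seg[OF c(2)[unfolded c(1)]] unfolding c(1) by simp
  also have "\<dots> = (\<Union>i\<in>{i \<in> steps e. i < s}. seg x P i)"
  proof (intro equalityI subsetI)
    fix m assume "m \<in> (\<Union>i\<in>{..<0}. seg x P (i + s))"
    then obtain i where "i < 0" "m \<in> seg x P (i + s)" by blast
    then show "m \<in> (\<Union>i\<in>{i \<in> steps e. i < s}. seg x P i)" using s by (intro UN_I[of "i + s"]) auto
  next
    fix m assume "m \<in> (\<Union>i\<in>{i \<in> steps e. i < s}. seg x P i)"
    then obtain i where "i < s" "m \<in> seg x P i" by blast
    then show "m \<in> (\<Union>i\<in>{..<0}. seg x P (i + s))" by (intro UN_I[of "i - s"]) auto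
  qed
  finally show M: "mnodes c = (\<Union>i\<in>{i \<in> steps e. i < s}. seg x P i)" .
  have sub: "mnodes c <= mnodes (Path \<mu> e x P)" unfolding M mnodes_seg[OF p(1)] by blast
  have nl: "lend c ~: mnodes c" using sub p(2,3) unfolding l proper_def by blast
  moreover have "rend c \<in> mnodes c" by (rule rend_in[OF c(2)]) (simp add: c(1))
  ultimately have "lend c ~= rend c" by metis
  then show "proper c" unfolding proper_def using nl c r by simp
qed

lemma length_one_ended: "left_tip c ==> ~ right_tip c ==> path_length c = ray_length (path_rank c)"
  by (cases c; cases "case c of Path \<mu> e x P \<Rightarrow> e") auto

text \<open>With a left tip, the part keeps it at rank \<open>\<mu>\<close>, so that its length is that of a ray,
  however many pieces are added on the right; this replaces the bound by partial sums.\<close>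

lemma initial_part:
  assumes p: "proper p" "p = Path \<mu> e x P" and c: "compound \<mu> e x P"
    and i: "i \<in> steps e" "i - 1 \<in> steps e"
  shows "\<exists>c. proper c & lend c = lend p & rend c = mx (x i) &
    span c <= {m. left_tip p & m = lend p} Un (\<Union>j\<in>{j \<in> steps e. j < i}. span (P j)) &
    path_rank c \<le> \<mu> & rrank c \<le> \<mu> & (right_tip c --> path_rank c < \<mu>) &
    (left_tip p --> left_tip c & path_rank c = \<mu>) &
    (~ left_tip p --> path_length c \<le> natsum.F (%j. path_length (P j)) {0..<i})"
proof -
  let ?S = "%k. {m. left_tip p & m = lend p} Un (\<Union>j\<in>{j \<in> steps e. j < k}. span (P j))"
  let ?R = "%k c. proper c & lend c = lend p & rend c = mx (x k) & span c <= ?S k &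
    path_rank c \<le> \<mu> & rrank c \<le> \<mu> & (right_tip c --> path_rank c < \<mu>) &
    (left_tip p --> left_tip c & path_rank c = \<mu>) &
    (~ left_tip p --> path_length c \<le> natsum.F (%j. path_length (P j)) {0..<k})"
  have ip: "is_path G (Path \<mu> e x P)" using proper_path[OF p(1)] p(2) by simp
  have base: "\<exists>k\<le>i. k - 1 \<in> steps e & (\<exists>c. ?R k c)"
  proof (cases "left_tip p")
    case True
    \<comment> \<open>An inward part may not reach beyond post 0, as in \<open>sub_ray\<close>. The
      steps from s to i are joined to it one at a time.\<close>
    define s where "s = min i 0"
    have s: "s \<le> i" "s \<le> 0" by (auto simp: s_def)
    have st: "\<forall>j<0. j + s \<in> steps e" using True p(2) s by auto
    let ?c = "Path \<mu> Inward (%j. x (j + s)) (%j. P (j + s))"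
    have ic: "is_path G ?c" by (rule sub_ray[OF ip]) (use s st in auto)
    note I = inward_part[OF ip p(1)[unfolded p(2)] True[unfolded p(2)] st refl ic]
    have s1: "s - 1 \<in> steps e" using st[rule_format, of "- 1"] by (simp add: add.commute)
    have "rrank ?c = rrank (P (s - 1))" using compoundD(2)[OF c] by (simp add: add.commute)
    then have rr: "rrank ?c \<le> \<mu>" using rrank_le_above[OF compound_piece(3)[OF c s1] compoundD(7)[OF c s1]] by simp
    have ss: "seg x P j <= span (P j)" if "j \<in> steps e" for j using compound_seg[OF c that] by simp
    have "mnodes ?c <= (\<Union>j\<in>{j \<in> steps e. j < s}. span (P j))" using I(4) ss by blast
    moreover have "rend ?c \<in> mnodes ?c" by (rule rend_in[OF ic]) simp
    ultimately have "span ?c <= ?S s" using I(2) True unfolding span_def[of ?c] p(2) by blast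
    moreover have "left_tip ?c" "path_rank ?c = \<mu>" "path_rank ?c \<le> \<mu>" "~ right_tip ?c" by simp_all
    ultimately have "?R s ?c" using I(1-3) rr True unfolding p(2) by blast
    then show ?thesis using s(1) s1 by blast
  next
    case False
    note L = left_post[OF ip False[unfolded p(2)]]
    note cp = compound_piece[OF c L(1)]
    have i1: "1 \<le> i" using L(2)[OF i(2)] by simp
    have "span (P 0) <= ?S 1" using L(1) by auto
    moreover have "path_length (P 0) \<le> natsum.F (%j. path_length (P j)) {0..<1}"
    proof -
      have "{0..<1} = {0 :: int}" by auto
      then show ?thesis by simp
    qed
    ultimately have "?R 1 (P 0)" using cp L(3) False p(2) compoundD(7)[OF c L(1)]
        rrank_le_above[OF cp(3) compoundD(7)[OF c L(1)]] by simp
    then show ?thesis using i1 L(1) by (intro exI[of _ 1]) auto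
  qed
  then obtain k where k: "k \<le> i" "k - 1 \<in> steps e" "\<exists>c. ?R k c" by blast
  have "n \<le> i --> (\<exists>c. ?R n c)" if "k \<le> n" for n
    using that
  proof (induction n rule: int_ge_induct)
    case base
    then show ?case using k(3) by blast
  next
    case (step n)
    show ?case
    proof
      assume n1: "n + 1 \<le> i"
      have n: "n \<in> steps e" by (rule steps_convex[OF k(2) i(1)]) (use step.hyps n1 in auto)
      obtain b where b: "?R n b" using step.IH n1 by auto
      note cp = compound_piece[OF c n]
      have lp: "lend p ~: span (P n)" if "left_tip p"
      proof -
        have "span (P n) <= mnodes p" unfolding p(2) compound_mnodes[OF c] using n by blast
        then show ?thesis using p(1) that unfolding proper_def by blast
      qed
      have "span b Int span (P n) <= {mx (x n)}"
      proof
        fix m assume m: "m \<in> span b Int span (P n)"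
        then have "m \<in> ?S n" using b by blast
        then obtain j where j: "j \<in> steps e" "j < n" "m \<in> span (P j)" using lp m by blast
        then have "m \<in> (if n = j + 1 then {mx (x n)} else {})" using compound_span[OF c j(1) n j(2)] m by blast
        then show "m \<in> {mx (x n)}" by (simp split: if_splits)
      qed
      then have "joinable b (P n)" unfolding joinable_def using b cp by simp
      then obtain d where d: "joins d b (P n)" using join by blast
      note J = d[unfolded joins_def]
      have rd: "path_rank d = max (max (path_rank b) (path_rank (P n))) (max (rrank b) (lrank (P n)))" using J by blast
      have rk: "path_rank d \<le> \<mu>"
        unfolding rd using b compoundD(7)[OF c n] lrank_le_above[OF cp(3) compoundD(7)[OF c n]] by simp
      have rt: "right_tip d --> path_rank d < \<mu>" using J compoundD(7)[OF c n] by auto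
      have lt: "left_tip p --> left_tip d & path_rank d = \<mu>"
      proof
        assume l: "left_tip p"
        have bm: "path_rank b = \<mu>" "left_tip b" using b l by blast+
        have "path_rank b \<le> path_rank d" unfolding rd by (simp add: le_max_iff_disj)
        then have "path_rank d = \<mu>" using rk bm by simp
        then show "left_tip d & path_rank d = \<mu>" using J bm by simp
      qed
      have "span d <= span b Un span (P n)" by (rule joins_span[OF d])
      moreover have "span (P n) <= ?S (n + 1)" using n by auto
      moreover have "?S n <= ?S (n + 1)" by auto
      ultimately have sp: "span d <= ?S (n + 1)" using b by (meson Un_least subset_trans)
      have len: "path_length d \<le> natsum.F (%j. path_length (P j)) {0..<n + 1}" if l: "~ left_tip p"
      proof -
        have "0 \<le> n" using left_post(2)[OF ip] l n p(2) by blast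
        then have e: "{0..<n + 1} = insert n {0..<n}" by auto
        have "path_length d \<le> path_length b \<oplus> path_length (P n)" using J by blast
        also have "\<dots> \<le> natsum.F (%j. path_length (P j)) {0..<n} \<oplus> path_length (P n)"
          by (rule natsum_mono) (use b l in blast)+
        also have "\<dots> = natsum.F (%j. path_length (P j)) {0..<n + 1}" unfolding e by (simp add: natsum_commute)
        finally show ?thesis .
      qed
      have "rrank d \<le> \<mu>" using J rrank_le_above[OF cp(3) compoundD(7)[OF c n]] by simp
      moreover have "proper d" "lend d = lend p" "rend d = mx (x (n + 1))" using J b cp by simp_all
      ultimately have "?R (n + 1) d" using rk rt lt sp len by blast
      then show "\<exists>c. ?R (n + 1) c" by blast
    qed
  qed
  then show ?thesis using k(1) by blast
qed

text \<open>With a right tip the terms are below \<open>ray_length \<mu>\<close>, so a finite sum of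
  them stays below the length of the path; without one the sum is part of that length.\<close>

lemma partial_length:
  assumes p: "is_path G p" "p = Path \<mu> e x P" and c: "compound \<mu> e x P" and l: "~ left_tip p" and i: "i \<in> steps e"
  shows "natsum.F (%j. path_length (P j)) {0..<i + 1} \<le> path_length p"
proof (cases "right_tip p")
  case True
  then have e: "e = Outward" using l p(2) by (cases e) auto
  have "natsum.F (%j. path_length (P j)) {0..<i + 1} \<le> natsum.F (%j. if 0 \<le> j then path_length (P j) else 0) {0..<i + 1}"
    by (rule natsum_F_mono) auto
  also have "\<dots> < ray_length \<mu>"
    by (rule natsum_F_less_ray_length) (use e compoundD(6,7)[OF c] piece_length in auto)
  finally show ?thesis using e p(2) by simp
next
  case False
  then obtain k where e: "e = Two_Ended k" using l p(2) by (cases e) auto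
  show ?thesis unfolding p(2) e path_length_Two_Ended by (rule natsum_F_mono) (use i e in auto)
qed

lemma cut_zero:
  assumes p: "is_path G p" "proper p" "p = Path (Fin 0) e x P" and i: "i \<in> steps e"
  obtains c where "proper c" "lend c = lend p" "rend c = mx (x (i + 1))"
    "span c <= {lend p} Un (\<Union>j\<in>{j \<in> steps e. j \<le> i}. seg x P j)" "span c <= span p" "path_rank c = Fin 0"
    "path_length c \<le> path_length p"
proof (cases "left_tip p")
  case True
  let ?s = "i + 1"
  let ?c = "Path (Fin 0) Inward (%j. x (j + ?s)) (%j. P (j + ?s))"
  have ip: "is_path G (Path (Fin 0) e x P)" using p by simp
  note Zd = is_path_zeroD[OF ip]
  have st: "\<forall>j<0. j + ?s \<in> steps e" using True p(3) i by auto
  have ic: "is_path G ?c"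
  proof (rule is_path.zero)
    have sh: "j + 1 + ?s = j + ?s + 1" for j by simp
    show "\<forall>j\<in>steps Inward. \<exists>b\<in>branches G. P (j + ?s) = Branch b & ends G b = {x (j + ?s), x (j + 1 + ?s)}"
    proof
      fix j assume "j \<in> steps Inward"
      then have "j + ?s \<in> steps e" using st by simp
      then show "\<exists>b\<in>branches G. P (j + ?s) = Branch b & ends G b = {x (j + ?s), x (j + 1 + ?s)}"
        unfolding sh using Zd(2) by blast
    qed
    have "j + ?s \<in> posts e" if "j \<in> posts Inward" for j
      using steps_posts[OF st[rule_format, of "j - 1"]] that by (auto simp: mem_posts algebra_simps)
    then show "inj_on (%j. x (j + ?s)) (posts Inward)"
      using Zd(3) by (intro inj_onI) (metis add_right_cancel inj_onD)
  qed simp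
  note I = inward_part[OF ip p(2)[unfolded p(3)] True[unfolded p(3)] st refl ic]
  have rm: "rend ?c \<in> mnodes ?c" by (rule rend_in[OF ic]) simp
  have ss: "span ?c <= {lend p} Un mnodes ?c" using rm I(2) unfolding span_def[of ?c] p(3) by blast
  have "{j \<in> steps e. j < ?s} = {j \<in> steps e. j \<le> i}" by auto
  then have M: "mnodes ?c = (\<Union>j\<in>{j \<in> steps e. j \<le> i}. seg x P j)" using I(4) by simp
  then have "mnodes ?c <= mnodes p" unfolding p(3) mnodes_seg[OF ip] by blast
  then have "span ?c <= span p" using ss unfolding span_def[of p] by blast
  moreover have "path_length ?c \<le> path_length p" using ray_length_le[OF disjI1[OF True]] unfolding p(3) by simp
  ultimately show ?thesis using that[of ?c] I(1-3) ss M p(3) by simp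
next
  case False
  have ip: "is_path G (Path (Fin 0) e x P)" using p by simp
  note Zd = is_path_zeroD[OF ip]
  note L = left_post[OF ip False[unfolded p(3)]]
  define k where "k = nat (i + 1)"
  have k: "int k = i + 1" "k ~= 0" using L(2)[OF i] by (auto simp: k_def)
  let ?c = "Path (Fin 0) (Two_Ended k) x P"
  have st: "j \<in> steps e" if "j \<in> steps (Two_Ended k)" for j
    by (rule steps_convex[OF L(1) i]) (use that k in auto)
  have po: "posts (Two_Ended k) <= posts e"
  proof
    fix j assume "j \<in> posts (Two_Ended k)"
    then have "j \<in> steps (Two_Ended k) \<or> j - 1 \<in> steps (Two_Ended k)" unfolding mem_posts .
    then show "j \<in> posts e" using st unfolding mem_posts by blast
  qed
  have ic: "is_path G ?c" by (rule is_path.zero) (use k Zd st in \<open>blast intro: inj_on_subset[OF _ po]\<close>)+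
  note T = two_ended_proper[OF ic refl]
  have M: "mnodes ?c = (\<Union>j\<in>steps (Two_Ended k). seg x P j)" by (rule mnodes_seg[OF ic])
  have "j \<le> i" if "j \<in> steps (Two_Ended k)" for j using that k by simp
  then have "steps (Two_Ended k) <= {j \<in> steps e. j \<le> i}" using st by blast
  then have "mnodes ?c <= (\<Union>j\<in>{j \<in> steps e. j \<le> i}. seg x P j)" unfolding M by (rule UN_mono) simp
  moreover have "lend ?c \<in> mnodes ?c" "rend ?c \<in> mnodes ?c" using lend_in[OF ic] rend_in[OF ic] by simp_all
  ultimately have ss: "span ?c <= (\<Union>j\<in>{j \<in> steps e. j \<le> i}. seg x P j)" unfolding span_def[of ?c] by blast
  have "(\<Union>j\<in>{j \<in> steps e. j \<le> i}. seg x P j) <= span p" using mnodes_seg[OF ip] unfolding p(3) span_def[of "Path (Fin 0) e x P"] by blast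
  then have "span ?c <= span p" using ss by blast
  moreover have "path_length ?c \<le> path_length p"
  proof (cases "right_tip p")
    case True
    then have "ray_length (Fin 0) \<le> path_length p" using ray_length_le[OF disjI2[OF True]] unfolding p(3) by simp
    moreover have "path_length ?c < ray_length (Fin 0)" using path_length_bound[OF ic] by simp
    ultimately show ?thesis by simp
  next
    case f: False
    then obtain n where e: "e = Two_Ended n" using False p(3) by (cases e) auto
    show ?thesis unfolding p(3) e path_length_Two_Ended by (rule natsum_F_mono) (use i e k in auto)
  qed
  ultimately show ?thesis using that[of ?c] T L(3) ss k(1) p(3) by auto
qed

text \<open>The first step that meets \<open>Z\<close> exists by \<open>first_post\<close>. Inside
  that step the cut is found by induction, and the result is joined to the part before the step,
  which does not meet \<open>Z\<close> at all. If only the right end lies in \<open>Z\<close>, the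
  path is already as required.\<close>

lemma first_meeting:
  "is_path G p ==> proper p ==> span p <= E ==> closed_in E Z ==> lend p ~: Z ==> span p Int Z ~= {} ==>
    \<exists>q. proper q & lend q = lend p & rend q \<in> Z & span q Int Z <= {rend q} & span q <= span p &
      path_length q \<le> path_length p & path_rank q \<le> path_rank p"
proof (induction p rule: is_path_induct)
  case (zero e x P)
  let ?p = "Path (Fin 0) e x P"
  show ?case
  proof (cases "mnodes ?p Int Z = {}")
    case True
    then have "span ?p Int Z <= {rend ?p}" "rend ?p \<in> Z"
      using zero.prems(4,5) unfolding span_def[of ?p] by blast+
    then show ?thesis using zero.prems(1) by (intro exI[of _ ?p]) blast
  next
    case False
    have "lend ?p \<in> E - Z" using zero.prems(2,4) ends_in_span(1)[of ?p] by blast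
    then obtain i where i: "i \<in> steps e" "seg x P i Int Z ~= {}" "!!j. j \<in> steps e ==> j < i ==> seg x P j Int Z = {}" "mx (x i) ~: Z"
      using first_post[OF zero.hyps(1) zero.prems(1,3) _ False] by blast
    obtain c where c: "proper c" "lend c = lend ?p" "rend c = mx (x (i + 1))"
      "span c <= {lend ?p} Un (\<Union>j\<in>{j \<in> steps e. j \<le> i}. seg x P j)" "span c <= span ?p" "path_rank c = Fin 0"
      "path_length c \<le> path_length ?p"
      using cut_zero[OF zero.hyps(1) zero.prems(1) refl i(1)] by blast
    have si: "seg x P i = {mx (x i), mx (x (i + 1))}" using zero_piece[OF zero.hyps(1) i(1)] by (simp add: seg_def)
    have r: "rend c \<in> Z" using i(2,4) unfolding si c(3) by blast
    have "span c Int Z <= {rend c}"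
    proof
      fix m assume m: "m \<in> span c Int Z"
      then obtain j where j: "j \<in> steps e" "j \<le> i" "m \<in> seg x P j" using c(4) zero.prems(4) by blast
      then have "j = i" using i(3)[of j] m by (metis disjoint_iff Int_iff order.order_iff_strict)
      then have "m \<in> seg x P i" using j(3) by simp
      then show "m \<in> {rend c}" using m i(4) unfolding si c(3) by blast
    qed
    then show ?thesis using c r by (intro exI[of _ c]) simp
  qed
next
  case (compound \<mu> e x P)
  let ?p = "Path \<mu> e x P"
  note co = compound.hyps(2)
  show ?case
  proof (cases "mnodes ?p Int Z = {}")
    case True
    then have "span ?p Int Z <= {rend ?p}" "rend ?p \<in> Z"
      using compound.prems(4,5) unfolding span_def[of ?p] by blast+
    then show ?thesis using compound.prems(1) by (intro exI[of _ ?p]) blast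
  next
    case False
    have "lend ?p \<in> E - Z" using compound.prems(2,4) ends_in_span(1)[of ?p] by blast
    then obtain i where i: "i \<in> steps e" "seg x P i Int Z ~= {}" "!!j. j \<in> steps e ==> j < i ==> seg x P j Int Z = {}" "mx (x i) ~: Z"
      using first_post[OF compound.hyps(1) compound.prems(1,3) _ False] by blast
    have sg: "seg x P j = span (P j)" if "j \<in> steps e" for j using compound_seg[OF co that] by simp
    have spp: "span (P j) <= span ?p" if "j \<in> steps e" for j
      using compound_mnodes[OF co] that unfolding span_def[of ?p] by blast
    note cp = compound_piece[OF co i(1)]
    have "\<exists>q. proper q & lend q = lend (P i) & rend q \<in> Z & span q Int Z <= {rend q} & span q <= span (P i) &
      path_length q \<le> path_length (P i) & path_rank q \<le> path_rank (P i)"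
    proof (rule compound.IH[OF i(1) cp(3) _ compound.prems(3)])
      show "span (P i) <= E" using spp[OF i(1)] compound.prems(2) by blast
      show "lend (P i) ~: Z" "span (P i) Int Z ~= {}" using cp(1) i(2,4) sg[OF i(1)] by simp_all
    qed
    then obtain f where f: "proper f" "lend f = lend (P i)" "rend f \<in> Z" "span f Int Z <= {rend f}" "span f <= span (P i)"
      "path_length f \<le> path_length (P i)" "path_rank f \<le> path_rank (P i)" by blast
    have rf: "path_rank f < \<mu>" by (rule order.strict_trans1[OF f(7) compoundD(7)[OF co i(1)]])
    show ?thesis
    proof (cases "i - 1 \<in> steps e")
      case False
      have nl: "~ left_tip ?p" using False i(1) by auto
      note L = left_post[OF compound.hyps(1) nl]
      have i0: "i = 0" using L(1,2) i(1) False steps_convex[of 0 e i "i - 1"] by force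
      have "{0..<i + 1} = {i}" using i0 by auto
      then have "path_length (P i) \<le> path_length ?p"
        using partial_length[OF compound.hyps(1) refl co nl i(1)] by simp
      then have "path_length f \<le> path_length ?p" using f(6) by simp
      moreover have "lend f = lend ?p" using f(2) cp(1) L(3) i0 by simp
      moreover have "span f <= span ?p" using f(5) spp[OF i(1)] by blast
      ultimately show ?thesis using f rf by (intro exI[of _ f]) simp
    next
      case True
      obtain c where c: "proper c" "lend c = lend ?p" "rend c = mx (x i)"
        "span c <= {m. left_tip ?p & m = lend ?p} Un (\<Union>j\<in>{j \<in> steps e. j < i}. span (P j))"
        "path_rank c \<le> \<mu>" "rrank c \<le> \<mu>" "right_tip c --> path_rank c < \<mu>"
        "left_tip ?p --> left_tip c & path_rank c = \<mu>"
        "~ left_tip ?p --> path_length c \<le> natsum.F (%j. path_length (P j)) {0..<i}"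
        using initial_part[OF compound.prems(1) refl co i(1) True] by blast
      have lp: "lend ?p ~: span (P i)" if "left_tip ?p"
      proof -
        have "span (P i) <= mnodes ?p" unfolding compound_mnodes[OF co] using i(1) by blast
        then show ?thesis using compound.prems(1) that unfolding proper_def by blast
      qed
      have "span c Int span (P i) <= {mx (x i)}"
      proof
        fix m assume m: "m \<in> span c Int span (P i)"
        then obtain j where j: "j \<in> steps e" "j < i" "m \<in> span (P j)" using lp c(4) by blast
        then have "m \<in> (if i = j + 1 then {mx (x i)} else {})" using compound_span[OF co j(1) i(1) j(2)] m by blast
        then show "m \<in> {mx (x i)}" by (simp split: if_splits)
      qed
      then have "span c Int span f <= {rend c}" unfolding c(3) using f(5) by blast
      moreover have "rend c = lend f" using c(3) f(2) cp(1) by (simp only:)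
      ultimately have "joinable c f" unfolding joinable_def using c(1) f(1) by blast
      then obtain d where d: "joins d c f" by (rule exE[OF join])
      note J = d[unfolded joins_def]
      have rd: "path_rank d = max (max (path_rank c) (path_rank f)) (max (rrank c) (lrank f))" using J by blast
      have rk: "path_rank d \<le> \<mu>" unfolding rd using c(5,6) rf lrank_le_above[OF f(1) rf] by simp
      have sd: "span d <= span c Un span f" by (rule joins_span[OF d])
      have cZ: "span c Int Z = {}"
      proof -
        have "span (P j) Int Z = {}" if "j \<in> steps e" "j < i" for j using i(3)[OF that] sg[OF that(1)] by simp
        then show ?thesis using c(4) compound.prems(4) by blast
      qed
      have "span c <= span ?p" using c(4) spp ends_in_span(1)[of ?p] by blast
      then have "span d <= span ?p" using sd f(5) spp[OF i(1)] by blast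
      \<comment> \<open>With a left tip the joined path still has rank \<mu> and its right end is
        finite, so it is exactly as long as a ray of that rank. Without one, the length is bounded
        by a partial sum.\<close>
      moreover have "path_length d \<le> path_length ?p"
      proof (cases "left_tip ?p")
        case l: True
        have cm: "path_rank c = \<mu>" "left_tip c" using c(8) l by blast+
        have "path_rank c \<le> path_rank d" unfolding rd by (simp add: le_max_iff_disj)
        then have dm: "path_rank d = \<mu>" using rk cm by simp
        have "left_tip d" using J cm dm by simp
        moreover have "~ right_tip d" using J rf dm by auto
        ultimately have "path_length d = ray_length \<mu>" using length_one_ended dm by metis
        then show ?thesis using ray_length_le[OF disjI1[OF l]] by simp
      next
        case l: False
        have "0 \<le> i" using left_post(2)[OF compound.hyps(1) l] i(1) by blast
        then have e: "{0..<i + 1} = insert i {0..<i}" by auto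
        have "path_length d \<le> path_length c \<oplus> path_length f" using J by blast
        also have "\<dots> \<le> natsum.F (%j. path_length (P j)) {0..<i} \<oplus> path_length (P i)"
          by (rule natsum_mono) (use c(9) f(6) l in blast)+
        also have "\<dots> = natsum.F (%j. path_length (P j)) {0..<i + 1}" unfolding e by (simp add: natsum_commute)
        also have "\<dots> \<le> path_length ?p" by (rule partial_length[OF compound.hyps(1) refl co l i(1)])
        finally show ?thesis .
      qed
      moreover have "proper d" "lend d = lend ?p" "rend d = rend f" using J c(2) by simp_all
      moreover have "span d Int Z <= {rend f}" using sd cZ f(4) by blast
      ultimately show ?thesis using f(3) rk by (intro exI[of _ d]) simp
    qed
  qed
qed

end

text \<open>\<open>D\<close> stands for the nodes at which condition (C) holds without its
  exception. Only tip-holding singleton nodes may be missing from it, so \<open>D\<close> contains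
  all interior nodes of paths.\<close>

locale cc_graph = nu_graph G for G :: "('n, 'b) tgraph" +
  fixes D :: "'n set"
  assumes D_max: "m \<in> D ==> maximal_node G m"
    and D_inner: "maximal_node G m ==> ~ tip_singleton m ==> m \<in> D"
    and D_cc: "is_ray G w ==> is_ray G v ==> path_rank w < graph_rank G ==> path_rank v < graph_rank G ==>
      mx (tip_node G w) \<in> D ==> mx (tip_node G v) \<in> D ==>
      (!!i j. mnodes (tail i w) Int mnodes (tail j v) ~= {}) ==> mx (tip_node G w) = mx (tip_node G v)"
begin

section \<open>The triangle inequality for lengths of paths\<close>

lemma interior_D:
  assumes "proper p" "m \<in> span p" "m ~= lend p" "m ~= rend p"
  shows "m \<in> D"
  using D_inner[OF span_node[OF assms(1,2)] interior_not_tip_singleton[OF proper_path[OF assms(1)] assms]] .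

lemma span_D: "proper p ==> lend p \<in> D ==> rend p \<in> D ==> span p <= D"
  using interior_D by blast

lemma zero_node_D: "u \<in> nodes G ==> node_rank G u = Fin 0 ==> mx u \<in> D"
  using D_inner mx(1) zero_node_not_tip_singleton by blast

text \<open>If all tails of w met q, they would accumulate at the tip of a ray v located on q. The
  two tips could then not be disconnected, and \<open>D_cc\<close> would put the tip of w on
  q.\<close>

lemma span_closed:
  assumes q: "proper q" "span q <= D" shows "closed_in D (span q)"
proof -
  have "\<exists>k. mnodes (tail k w) Int span q = {}"
    if w: "is_ray G w" "path_rank w < graph_rank G" "mx (tip_node G w) \<in> D - span q" for w
  proof (rule ccontr)
    assume n: "~ ?thesis"
    have "\<exists>v. is_ray G v & path_rank v < graph_rank G & mx (tip_node G v) \<in> span q &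
      (\<forall>k j. mnodes (tail k w) Int mnodes (tail j v) ~= {})"
    proof (rule accumulate[OF _ _ proper_path[OF q(1)] q(1)])
      show "mnodes (tail l w) <= mnodes (tail k w)" if "k \<le> l" for k l by (rule mnodes_tail_mono[OF w(1) that])
      show "\<exists>k. m ~: mnodes (tail k w)" for m using ray_avoid[OF w(1), of m] by blast
      show "mnodes (tail k w) Int span q ~= {}" for k using n by blast
    qed
    then obtain v where v: "is_ray G v" "path_rank v < graph_rank G" "mx (tip_node G v) \<in> span q"
      "!!k j. mnodes (tail k w) Int mnodes (tail j v) ~= {}" by blast
    have "mx (tip_node G w) = mx (tip_node G v)"
      by (rule D_cc[OF w(1) v(1) w(2) v(2)]) (use w(3) v(3,4) q(2) in blast)+
    then show False using w(3) v(3) by simp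
  qed
  then show ?thesis unfolding closed_in_def by blast
qed

text \<open>p is cut at its first node on q, and q, read backwards from its far end, is cut at the
  same node; the two parts have only this node in common. The cases where the start of p lies on q,
  or where p first meets q at the far end of q, need only one part.\<close>

lemma triangle:
  assumes p: "proper p" "lend p \<in> D" "rend p \<in> D" and q: "proper q" "rend q \<in> D"
    and pq: "rend p = lend q" "lend p ~= rend q"
  shows "\<exists>r. proper r & lend r = lend p & rend r = rend q & path_length r \<le> path_length p \<oplus> path_length q"
proof -
  have sp: "span p <= D" by (rule span_D[OF p])
  have sq: "span q <= D" by (rule span_D[OF q(1) _ q(2)]) (use p(3) pq(1) in simp)
  have rq: "proper (reverse q)" "span (reverse q) <= D" using q(1) sq by simp_all
  have meet: "\<exists>g. proper g & lend g = rend q & rend g = n & span g <= span q & path_length g \<le> path_length q"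
    if n: "n \<in> span q" "n ~= rend q" for n
  proof -
    have "\<exists>g. proper g & lend g = lend (reverse q) & rend g \<in> {n} & span g Int {n} <= {rend g} &
      span g <= span (reverse q) & path_length g \<le> path_length (reverse q) & path_rank g \<le> path_rank (reverse q)"
      by (rule first_meeting[OF proper_path[OF rq(1)] rq closed_in_singleton]) (use n in auto)
    then show ?thesis by auto
  qed
  show ?thesis
  proof (cases "lend p \<in> span q")
    case True
    then obtain g where "proper g" "lend g = rend q" "rend g = lend p" "path_length g \<le> path_length q"
      using meet[of "lend p"] pq(2) by blast
    then show ?thesis using order.trans[OF _ natsum_ge2] by (intro exI[of _ "reverse g"]) simp
  next
    case False
    have "rend p \<in> span p Int span q" using ends_in_span[of p] ends_in_span[of q] pq(1) by simp
    then have ne: "span p Int span q ~= {}" by blast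
    obtain f where f: "proper f" "lend f = lend p" "rend f \<in> span q" "span f Int span q <= {rend f}"
      "path_length f \<le> path_length p"
      using first_meeting[OF proper_path[OF p(1)] p(1) sp span_closed[OF q(1) sq] False ne] by blast
    show ?thesis
    proof (cases "rend f = rend q")
      case True
      then show ?thesis using f order.trans[OF f(5) natsum_ge1] by (intro exI[of _ f]) simp
    next
      case ne: False
      obtain g where g: "proper g" "lend g = rend q" "rend g = rend f" "span g <= span q" "path_length g \<le> path_length q"
        using meet[OF f(3) ne] by blast
      have "joinable f (reverse g)" unfolding joinable_def using f g by auto
      then obtain r where "joins r f (reverse g)" by (rule exE[OF join])
      then have r: "proper r" "lend r = lend f" "rend r = lend g" "path_length r \<le> path_length f \<oplus> path_length g"
        by (simp_all add: joins_def)
      have "path_length r \<le> path_length p \<oplus> path_length q"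
        by (rule order.trans[OF r(4) natsum_mono[OF f(5) g(5)]])
      then show ?thesis using r(1-3) f(2) g(2) by (intro exI[of _ r]) simp
    qed
  qed
qed

section \<open>Existence of paths between nodes\<close>

definition reach :: "'n \<Rightarrow> 'n \<Rightarrow> bool" where
  "reach a b \<longleftrightarrow> a \<in> D & b \<in> D & (a = b \<or> (\<exists>r. proper r & lend r = a & rend r = b))"

lemma reach_refl: "a \<in> D ==> reach a a"
  by (simp add: reach_def)

lemma reach_sym: "reach a b ==> reach b a"
  unfolding reach_def by (metis proper_reverse reverse_sets(2,3))

lemma reach_trans:
  assumes "reach a b" "reach b c" shows "reach a c"
proof (cases "a = b \<or> b = c \<or> a = c")
  case True
  then show ?thesis using assms by (auto simp: reach_def)
next
  case False
  then obtain p q where "proper p" "lend p = a" "rend p = b" "proper q" "lend q = b" "rend q = c"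
    using assms unfolding reach_def by blast
  then show ?thesis using triangle[of p q] assms False unfolding reach_def by metis
qed

lemma reachI: "proper r ==> lend r \<in> D ==> rend r \<in> D ==> reach (lend r) (rend r)"
  unfolding reach_def by blast

lemma interior_post_D:
  assumes p: "is_path G (Path \<mu> e x P)" "proper (Path \<mu> e x P)" and i: "i \<in> steps e" "i - 1 \<in> steps e"
  shows "mx (x i) \<in> D" "mx (x i) \<in> mnodes (Path \<mu> e x P)"
proof -
  have po: "i \<in> posts e" using i(1) by (rule steps_posts)
  show m: "mx (x i) \<in> mnodes (Path \<mu> e x P)" unfolding mnodes_seg[OF p(1)] seg_def using i(1) by blast
  have "mx (x i) ~= lend (Path \<mu> e x P)"
  proof (cases "left_tip (Path \<mu> e x P)")
    case True
    then show ?thesis using m p(2) unfolding proper_def by metis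
  next
    case False
    note L = left_post[OF p(1) False]
    have "i ~= 0" using L(2)[OF i(2)] by simp
    then show ?thesis using posts_inj[OF p(1) po steps_posts(1)[OF L(1)]] unfolding L(3) by blast
  qed
  moreover have "mx (x i) ~= rend (Path \<mu> e x P)"
  proof (cases "right_tip (Path \<mu> e x P)")
    case True
    then show ?thesis using m p(2) unfolding proper_def by metis
  next
    case False
    note L = right_post[OF p(1) False]
    have "i ~= last_index e" "last_index e \<in> posts e" using L(2)[OF i(1)] steps_posts(2)[OF L(1)] by simp_all
    then show ?thesis using posts_inj[OF p(1) po] unfolding L(3) by blast
  qed
  ultimately show "mx (x i) \<in> D" using interior_D[OF p(2)] m by (simp add: span_def)
qed

lemma reach_posts:
  assumes p: "is_path G (Path \<mu> e x P)" "proper (Path \<mu> e x P)"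
    and step: "!!i. i \<in> steps e ==> mx (x i) \<in> D ==> mx (x (i + 1)) \<in> D ==> reach (mx (x i)) (mx (x (i + 1)))"
    and i: "i \<in> steps e" "i - 1 \<in> steps e" and j: "j \<in> steps e" "i \<le> j"
  shows "reach (mx (x i)) (mx (x j))"
proof -
  have "n \<le> j --> reach (mx (x i)) (mx (x n))" if "i \<le> n" for n
    using that
  proof (induction n rule: int_ge_induct)
    case base
    then show ?case using reach_refl interior_post_D(1)[OF p i] by blast
  next
    case (step n)
    show ?case
    proof
      assume n: "n + 1 \<le> j"
      have s: "n \<in> steps e" "n - 1 \<in> steps e" "n + 1 \<in> steps e"
        using steps_convex[OF i(2) j(1)] step.hyps n by simp_all
      have "n + 1 - 1 \<in> steps e" using s(1) by simp
      then have "reach (mx (x n)) (mx (x (n + 1)))"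
        using assms(3)[OF s(1)] interior_post_D(1)[OF p s(1,2)] interior_post_D(1)[OF p s(3)] by blast
      then show "reach (mx (x i)) (mx (x (n + 1)))" using step.IH n reach_trans by auto
    qed
  qed
  then show ?thesis using j(2) by blast
qed

text \<open>Interior posts always belong to \<open>D\<close>, even if the ends of the path do not,
  so the links between consecutive posts can be chained by transitivity.\<close>

lemma reach_segs:
  assumes p: "is_path G (Path \<mu> e x P)" "proper (Path \<mu> e x P)"
    and within: "!!i a b. i \<in> steps e ==> a \<in> seg x P i ==> b \<in> seg x P i ==> a \<in> D ==> b \<in> D ==> reach a b"
    and a: "a \<in> mnodes (Path \<mu> e x P)" "a \<in> D" and b: "b \<in> mnodes (Path \<mu> e x P)" "b \<in> D"
  shows "reach a b"
proof -
  have ends: "mx (x i) \<in> seg x P i" "mx (x (i + 1)) \<in> seg x P i" for i by (auto simp: seg_def)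
  have step: "reach (mx (x i)) (mx (x (i + 1)))" if "i \<in> steps e" "mx (x i) \<in> D" "mx (x (i + 1)) \<in> D" for i
    using within[OF that(1) ends that(2,3)] .
  have less: "reach a b" if ab: "i \<in> steps e" "j \<in> steps e" "i < j" "a \<in> seg x P i" "b \<in> seg x P j" "a \<in> D" "b \<in> D" for a b i j
  proof -
    have s: "i + 1 \<in> steps e" "i + 1 - 1 \<in> steps e" "j - 1 \<in> steps e"
      using steps_convex[OF ab(1,2)] ab(1,3) by simp_all
    have "reach a (mx (x (i + 1)))" by (rule within[OF ab(1,4) ends(2) ab(6) interior_post_D(1)[OF p s(1,2)]])
    moreover have "i + 1 \<le> j" using ab(3) by simp
    then have "reach (mx (x (i + 1))) (mx (x j))" using reach_posts[OF p _ s(1,2) ab(2)] step by blast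
    moreover have "reach (mx (x j)) b" by (rule within[OF ab(2) ends(1) ab(5) interior_post_D(1)[OF p ab(2) s(3)] ab(7)])
    ultimately show ?thesis using reach_trans by blast
  qed
  obtain i where i: "i \<in> steps e" "a \<in> seg x P i" using a(1) unfolding mnodes_seg[OF p(1)] by blast
  obtain j where j: "j \<in> steps e" "b \<in> seg x P j" using b(1) unfolding mnodes_seg[OF p(1)] by blast
  consider "i < j" | "i = j" | "j < i" by linarith
  then show ?thesis
  proof cases
    case 1
    show ?thesis by (rule less[OF i(1) j(1) 1 i(2) j(2) a(2) b(2)])
  next
    case 2
    show ?thesis by (rule within[OF i(1,2) _ a(2) b(2)]) (use j(2) 2 in simp)
  next
    case 3
    show ?thesis by (rule reach_sym[OF less[OF j(1) i(1) 3 j(2) i(2) b(2) a(2)]])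
  qed
qed

text \<open>At an infinite end, the part of the path from the tip to an interior post is itself a
  proper path.\<close>

lemma reach_lend:
  assumes p: "proper p" "lend p \<in> D"
  shows "\<exists>m\<in>mnodes p Int D. reach (lend p) m"
proof (cases "left_tip p")
  case False
  then show ?thesis using lend_in[OF proper_path[OF p(1)]] reach_refl p(2) by blast
next
  case True
  obtain \<mu> e x P where q: "p = Path \<mu> e x P" using is_path_PathE[OF proper_path[OF p(1)]] .
  have ip: "is_path G (Path \<mu> e x P)" using proper_path[OF p(1)] q by simp
  have e: "e = Inward \<or> e = Endless" using True q by simp
  then have st: "\<forall>j<0. j + - 1 \<in> steps e" "- 1 \<in> steps e" "- 1 - 1 \<in> steps e" by auto
  let ?c = "Path \<mu> Inward (%j. x (j + - 1)) (%j. P (j + - 1))"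
  have ic: "is_path G ?c" by (rule sub_ray[OF ip]) (use e in auto)
  note I = inward_part[OF ip p(1)[unfolded q] True[unfolded q] st(1) refl ic]
  note N = interior_post_D[OF ip p(1)[unfolded q] st(2,3)]
  have "reach (lend ?c) (rend ?c)"
    by (rule reachI[OF I(1)]) (use I(2,3) N p(2) q in simp_all)
  then show ?thesis using N unfolding q I(2,3) by blast
qed

text \<open>No part of the path between the two nodes is cut out. Links are chained instead: inside
  a constituent by induction, from one constituent to another through interior posts, and from an
  infinite end to the interior.\<close>

lemma reach_in_path:
  "is_path G p ==> proper p ==> a \<in> span p Int D ==> b \<in> span p Int D ==> reach a b"
proof (induction p arbitrary: a b rule: is_path_induct)
  case (zero e x P)
  let ?p = "Path (Fin 0) e x P"
  have branch: "reach (mx (x i)) (mx (x (i + 1)))" if i: "i \<in> steps e" "mx (x i) \<in> D" "mx (x (i + 1)) \<in> D" for i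
  proof -
    let ?c = "Path (Fin 0) (Two_Ended 1) (%j. x (j + i)) (%j. P (j + i))"
    have "is_path G ?c"
    proof (rule is_path.zero)
      have s0: "steps (Two_Ended 1) = {0}" by auto
      show "\<forall>j\<in>steps (Two_Ended 1). \<exists>b\<in>branches G. P (j + i) = Branch b & ends G b = {x (j + i), x (j + 1 + i)}"
      proof
        fix j assume "j \<in> steps (Two_Ended 1)"
        then have e: "j + i = i" "j + 1 + i = i + 1" unfolding s0 by auto
        show "\<exists>b\<in>branches G. P (j + i) = Branch b & ends G b = {x (j + i), x (j + 1 + i)}"
          unfolding e using bspec[OF zero.hyps(3) i(1)] .
      qed
      have "j + i \<in> posts e" if "j \<in> posts (Two_Ended 1)" for j
      proof -
        have "j = 0 \<or> j = 1" using that by (auto simp: mem_posts)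
        then show ?thesis using steps_posts[OF i(1)] by (auto simp: add.commute)
      qed
      then show "inj_on (%j. x (j + i)) (posts (Two_Ended 1))"
        using zero.hyps(4) by (intro inj_onI) (metis add_right_cancel inj_onD)
    qed simp
    note T = two_ended_proper[OF this refl]
    have "reach (lend ?c) (rend ?c)" by (rule reachI[OF T(1)]) (use T(2,3) i in \<open>simp_all add: add.commute\<close>)
    then show ?thesis unfolding T(2,3) by (simp add: add.commute)
  qed
  have within: "reach a b" if i: "i \<in> steps e" "a \<in> seg x P i" "b \<in> seg x P i" "a \<in> D" "b \<in> D" for i a b
  proof -
    have si: "seg x P i = {mx (x i), mx (x (i + 1))}" using zero_piece[OF zero.hyps(1) i(1)] by (simp add: seg_def)
    have "a = b \<or> a = mx (x i) & b = mx (x (i + 1)) \<or> b = mx (x i) & a = mx (x (i + 1))"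
      using i(2,3) unfolding si by blast
    then show ?thesis using reach_refl[OF i(4)] branch[OF i(1)] reach_sym i(4,5) by metis
  qed
  have inner: "reach a b" if "a \<in> mnodes ?p Int D" "b \<in> mnodes ?p Int D" for a b
    by (rule reach_segs[OF zero.hyps(1) zero.prems(1)]) (use within that in blast)+
  have out: "\<exists>m\<in>mnodes ?p Int D. reach a m" if a: "a \<in> span ?p Int D" for a
  proof -
    have "a \<in> mnodes ?p \<or> a = lend ?p \<or> a = rend ?p" using a unfolding span_def by blast
    then show ?thesis
      using a reach_refl reach_lend[OF zero.prems(1)] reach_lend[of "reverse ?p"] zero.prems(1)
      unfolding reverse_sets proper_reverse by blast
  qed
  then show ?case using zero.prems(2,3) inner reach_trans reach_sym by meson
next
  case (compound \<mu> e x P)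
  let ?p = "Path \<mu> e x P"
  note co = compound.hyps(2)
  have within: "reach a b" if i: "i \<in> steps e" "a \<in> seg x P i" "b \<in> seg x P i" "a \<in> D" "b \<in> D" for i a b
    using compound.IH[OF i(1) compound_piece(3)[OF co i(1)]] compound_seg[OF co i(1)] i by blast
  have inner: "reach a b" if "a \<in> mnodes ?p Int D" "b \<in> mnodes ?p Int D" for a b
    by (rule reach_segs[OF compound.hyps(1) compound.prems(1)]) (use within that in blast)+
  have out: "\<exists>m\<in>mnodes ?p Int D. reach a m" if a: "a \<in> span ?p Int D" for a
  proof -
    have "a \<in> mnodes ?p \<or> a = lend ?p \<or> a = rend ?p" using a unfolding span_def by blast
    then show ?thesis
      using a reach_refl reach_lend[OF compound.prems(1)] reach_lend[of "reverse ?p"] compound.prems(1)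
      unfolding reverse_sets proper_reverse by blast
  qed
  then show ?case using compound.prems(2,3) inner reach_trans reach_sym by meson
qed

text \<open>A node of rank other than 0 and arrow holds a tip, and the branches of a ray to that tip
  end in 0-nodes. A node of arrow rank holds no tips of its own but embraces nodes of lower rank, to
  which this applies.\<close>

lemma reach_zero_node:
  assumes m: "m \<in> D" shows "\<exists>u\<in>nodes G. node_rank G u = Fin 0 & reach m (mx u)"
proof -
  have tip: "\<exists>u\<in>nodes G. node_rank G u = Fin 0 & reach m (mx u)"
    if w: "is_ray G w" "path_rank w < graph_rank G" "mx (tip_node G w) = m" for w
  proof -
    obtain k where k: "proper (tail k w)" using proper_tail[OF w(1,2)] by blast
    have r: "is_ray G (tail k w)" by (rule is_ray_tail[OF w(1)])
    obtain b where b: "b \<in> path_branches (tail k w)" using path_branches_nonempty[OF is_ray_path[OF r]] by blast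
    then have "b \<in> branches G" using path_branches_subset[OF is_ray_path[OF r]] by blast
    then obtain u where u: "u \<in> ends G b" "u \<in> nodes G" "node_rank G u = Fin 0" using ends_nodes by blast
    have "mx u \<in> span (tail k w) Int D"
      using branch_ends_mnodes[OF is_ray_path[OF r] b u(1)] zero_node_D[OF u(2,3)] by (simp add: span_def)
    moreover have "rend (tail k w) = m" using rend_ray[OF r] tip_node_tail[OF w(1,2)] w(3) by simp
    then have "m \<in> span (tail k w) Int D" using ends_in_span(2)[of "tail k w"] m by simp
    ultimately show ?thesis using reach_in_path[OF is_ray_path[OF r] k] u by blast
  qed
  have node: "\<exists>u\<in>nodes G. node_rank G u = Fin 0 & reach m (mx u)"
    if y: "y \<in> nodes G" "mx y = m" "node_rank G y ~= Arrow_Omega" for y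
  proof (cases "node_rank G y = Fin 0")
    case True
    then show ?thesis using y reach_refl[OF m] by blast
  next
    case False
    then obtain w where "is_ray G w" "path_rank w < graph_rank G" "tip_node G w = y"
      using tips_in_nonempty[OF y(1) _ y(3)] unfolding tips_in_def by blast
    then show ?thesis using tip y(2) by blast
  qed
  have mm: "m \<in> nodes G" "mx m = m" using D_max[OF m] by (simp_all add: maximal_node_def)
  show ?thesis
  proof (cases "node_rank G m = Arrow_Omega")
    case True
    then obtain y where y: "embraced G y m" using arrow_node[OF mm(1)] not_finite_existsD by blast
    then have "y \<in> nodes G" "node_rank G y < node_rank G m" using embraced_nodes by blast+
    moreover have "mx y = m" using embraces_mx[of m y] mm y by (simp add: embraces_def)
    ultimately show ?thesis using node[of y] True by auto
  next
    case False
    then show ?thesis using node[OF mm] by blast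
  qed
qed

text \<open>Connectedness speaks of branches. It is transferred along the chain node, 0-node,
  branch, connecting path, branch, 0-node, node.\<close>

lemma reach_all:
  assumes con: "nu_connected G" and m: "m \<in> D" "n \<in> D"
  shows "reach m n"
proof -
  have ends: "reach (mx u) (mx v)" if b: "b \<in> branches G" "u \<in> ends G b" "v \<in> ends G b" for b u v
  proof (cases "u = v")
    case True
    then show ?thesis using zero_node_D ends_subset[OF b(1,2)] reach_refl by blast
  next
    case False
    let ?c = "Path (Fin 0) (Two_Ended 1) (%i. if i = 0 then u else v) (%_. Branch b)"
    have e: "ends G b = {u, v}" using ends_nodes[OF b(1)] b(2,3) False by auto
    have "i = 0 \<or> i = 1" if "i \<in> posts (Two_Ended 1)" for i using that by (auto simp: mem_posts)
    then have "inj_on (%i. if i = 0 then u else v) (posts (Two_Ended 1))" using False by (intro inj_onI) (metis)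
    then have "is_path G ?c" by (intro is_path.zero) (use b(1) e in auto)
    note T = two_ended_proper[OF this refl]
    have "reach (lend ?c) (rend ?c)"
      by (rule reachI[OF T(1)]) (use T(2,3) zero_node_D ends_subset[OF b(1)] b(2,3) in simp_all)
    then show ?thesis unfolding T(2,3) by simp
  qed
  have zero: "reach (mx u) (mx v)"
    if u: "u \<in> nodes G" "node_rank G u = Fin 0" and v: "v \<in> nodes G" "node_rank G v = Fin 0" for u v
  proof -
    obtain b where b: "b \<in> branches G" "u \<in> ends G b" using node_branch[OF u] by blast
    obtain c where c: "c \<in> branches G" "v \<in> ends G c" using node_branch[OF v] by blast
    obtain \<mu> k x P where p: "is_path G (Path \<mu> (Two_Ended k) x P)"
      and pb: "\<exists>u'\<in>path_nodes (Path \<mu> (Two_Ended k) x P). \<exists>v'\<in>ends G b. shorted G u' v'"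
      and pc: "\<exists>u'\<in>path_nodes (Path \<mu> (Two_Ended k) x P). \<exists>v'\<in>ends G c. shorted G u' v'"
      using con b(1) c(1) unfolding nu_connected_def connected_branches_def Let_def by blast
    let ?p = "Path \<mu> (Two_Ended k) x P"
    have on: "\<exists>v'\<in>ends G d. mx v' \<in> span ?p Int D"
      if d: "d \<in> branches G" "\<exists>u'\<in>path_nodes ?p. \<exists>v'\<in>ends G d. shorted G u' v'" for d
    proof -
      obtain u' v' where *: "u' \<in> path_nodes ?p" "v' \<in> ends G d" "shorted G u' v'" using d(2) by blast
      note E = ends_subset[OF d(1) *(2)]
      have "mx u' = mx v'" using *(3) shorted_iff path_nodes_subset[OF p] *(1) E by blast
      then have "mx v' \<in> mnodes ?p" unfolding mnodes_def using *(1) by (metis imageI)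
      then show ?thesis using *(2) zero_node_D E by (auto simp: span_def)
    qed
    obtain u' where u': "u' \<in> ends G b" "mx u' \<in> span ?p Int D" using on[OF b(1) pb] by blast
    obtain v' where v': "v' \<in> ends G c" "mx v' \<in> span ?p Int D" using on[OF c(1) pc] by blast
    have "reach (mx u') (mx v')" by (rule reach_in_path[OF p two_ended_proper(1)[OF p refl] u'(2) v'(2)])
    then show ?thesis using ends[OF b u'(1)] ends[OF c(1) v'(1) c(2)] reach_trans by blast
  qed
  show ?thesis using reach_zero_node[OF m(1)] reach_zero_node[OF m(2)] zero reach_trans reach_sym by meson
qed

end

section \<open>Transport of paths along maps of nodes and branches\<close>

lemma path_nodes_map [simp]: "path_nodes (map_tpath f g p) = f ` path_nodes p"
  by (induction p) (auto simp: image_Un image_UN image_image)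

lemma path_branches_map [simp]: "path_branches (map_tpath f g p) = g ` path_branches p"
  by (induction p) (auto simp: image_UN)

lemma map_tpath_simps [simp]:
  "path_rank (map_tpath f g p) = path_rank p"
  "left_tip (map_tpath f g p) = left_tip p"
  "right_tip (map_tpath f g p) = right_tip p"
  "tail k (map_tpath f g p) = map_tpath f g (tail k p)"
  by (cases p; simp add: comp_def)+

lemma reverse_map [simp]: "reverse (map_tpath f g p) = map_tpath f g (reverse p)"
  by (induction p) (simp_all add: comp_def)

lemma reached_by_tip_map [simp]: "reached_by_tip e (map_tpath f g \<circ> P) \<mu> i \<longleftrightarrow> reached_by_tip e P \<mu> i"
  by (simp add: reached_by_tip_def)

lemma no_repetition_map:
  assumes n: "no_repetition A e x P" and x: "\<forall>i\<in>posts e. x i \<in> N" and P: "\<forall>i\<in>steps e. path_nodes (P i) <= N"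
    and s: "!!u v. u \<in> N ==> v \<in> N ==> shorted B (f u) (f v) \<longleftrightarrow> shorted A u v"
  shows "no_repetition B e (f \<circ> x) (map_tpath f g \<circ> P)"
proof -
  note n' = n[unfolded no_repetition_def]
  note n1 = n'[THEN conjunct1, rule_format] and n2 = n'[THEN conjunct2, THEN conjunct1, rule_format]
    and n3 = n'[THEN conjunct2, THEN conjunct2, rule_format]
  show ?thesis
    unfolding no_repetition_def comp_apply path_nodes_map map_tpath_simps
  proof (intro conjI ballI impI)
    fix i j assume *: "i \<in> posts e" "j \<in> posts e" "shorted B (f (x i)) (f (x j))"
    have "x i \<in> N" "x j \<in> N" using x *(1,2) by blast+
    then have "shorted A (x i) (x j)" using s *(3) by blast
    then show "i = j" by (rule n1[OF *(1,2)])
  next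
    fix i j u assume *: "i \<in> steps e" "j \<in> posts e" "u \<in> f ` path_nodes (P i)" "shorted B u (f (x j))"
    obtain u' where u': "u' \<in> path_nodes (P i)" "u = f u'" using *(3) by blast
    have "u' \<in> N" "x j \<in> N" using x P *(1,2) u'(1) by blast+
    then have "shorted A u' (x j)" using s *(4) unfolding u'(2) by blast
    then show "j = i & ~ left_tip (P i) \<or> j = i + 1 & ~ right_tip (P i)" by (rule n2[OF *(1,2) u'(1)])
  next
    fix i j u v assume *: "i \<in> steps e" "j \<in> steps e" "i < j" "u \<in> f ` path_nodes (P i)" "v \<in> f ` path_nodes (P j)" "shorted B u v"
    obtain u' where u': "u' \<in> path_nodes (P i)" "u = f u'" using *(4) by blast
    obtain v' where v': "v' \<in> path_nodes (P j)" "v = f v'" using *(5) by blast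
    have N: "u' \<in> N" "v' \<in> N" "x j \<in> N" using x P *(1,2) u'(1) v'(1) steps_posts(1)[OF *(2)] by blast+
    then have "shorted A u' v'" using s *(6) unfolding u'(2) v'(2) by blast
    note sh' = n3[OF *(1-3) u'(1) v'(1) this]
    note sh = conjunct1[OF sh'] conjunct2[OF sh']
    show "j = i + 1" by (rule sh(1))
    show "shorted B u (f (x j))" unfolding u'(2) using sh(2) s[OF N(1,3)] by blast
  qed
qed

text \<open>Used in both directions between a graph and its enlargement by end branches. The sets
  \<open>N\<close> and \<open>C\<close> restrict the map to old nodes and branches. The assumption
  on end nodes is limited to paths of rank below the graph rank, the only ones whose tips are
  assigned to nodes.\<close>

lemma path_map:
  assumes gr: "graph_rank B = graph_rank A"
    and nd: "!!u. u \<in> N ==> u \<in> nodes A ==> f u \<in> nodes B & node_rank B (f u) = node_rank A u"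
    and sh: "!!u v. u \<in> N ==> v \<in> N ==> shorted B (f u) (f v) \<longleftrightarrow> shorted A u v"
    and em: "!!X u. u \<in> N ==> embraces A X u ==> X \<in> N & embraces B (f X) (f u)"
    and br: "!!b. b \<in> C ==> b \<in> branches A ==> g b \<in> branches B & ends A b <= N & ends B (g b) = f ` ends A b"
    and f: "inj_on f N"
    and se: "!!p. is_path A p ==> is_path B (map_tpath f g p) ==> path_branches p <= C ==> path_nodes p <= N ==>
      path_rank p < graph_rank A ==> start_node B (map_tpath f g p) = f (start_node A p) & start_node A p \<in> N &
      end_node B (map_tpath f g p) = f (end_node A p) & end_node A p \<in> N"
  shows "is_path A p ==> path_branches p <= C --> is_path B (map_tpath f g p) & path_nodes p <= N"
proof (induction rule: is_path.induct)
  case (zero e P x)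
  show ?case
  proof
    assume C: "path_branches (Path (Fin 0) e x P) <= C"
    have st: "x i \<in> N & x (i + 1) \<in> N & path_nodes (P i) = {} &
      (\<exists>c\<in>branches B. map_tpath f g (P i) = Branch c & ends B c = {f (x i), f (x (i + 1))})" if i: "i \<in> steps e" for i
    proof -
      obtain b where b: "b \<in> branches A" "P i = Branch b" "ends A b = {x i, x (i + 1)}" using zero(2) i by blast
      have "b \<in> C" using C i b(2) by force
      then show ?thesis using br[of b] b by auto
    qed
    have N: "x i \<in> N" if "i \<in> posts e" for i
    proof (cases "i \<in> steps e")
      case True
      then show ?thesis using st by blast
    next
      case False
      then have "i - 1 \<in> steps e" using that by (simp add: mem_posts)
      from st[OF this] show ?thesis by simp
    qed
    have "inj_on (f \<circ> x) (posts e)" using zero(3) f N by (intro comp_inj_on) (auto intro: inj_on_subset)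
    then have "is_path B (Path (Fin 0) e (f \<circ> x) (map_tpath f g \<circ> P))"
      using zero(1) st by (intro is_path.zero) auto
    moreover have "path_nodes (Path (Fin 0) e x P) <= N" using N st by auto
    ultimately show "is_path B (map_tpath f g (Path (Fin 0) e x P)) & path_nodes (Path (Fin 0) e x P) <= N" by simp
  qed
next
  case (succ e \<alpha> \<mu> x P)
  show ?case
  proof
    assume C: "path_branches (Path \<mu> e x P) <= C"
    have pc: "is_path B (map_tpath f g (P i)) & path_nodes (P i) <= N & x i \<in> N & x (i + 1) \<in> N &
      embraces B (f (x i)) (start_node B (map_tpath f g (P i))) &
      embraces B (f (x (i + 1))) (end_node B (map_tpath f g (P i)))" if i: "i \<in> steps e" for i
    proof -
      have Ci: "path_branches (P i) <= C" using C i by auto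
      then have p: "is_path A (P i)" "is_path B (map_tpath f g (P i))" "path_nodes (P i) <= N" "path_rank (P i) < \<mu>"
        "embraces A (x i) (start_node A (P i))" "embraces A (x (i + 1)) (end_node A (P i))" using succ.IH i by blast+
      have "path_rank (P i) < graph_rank A" using p(4) succ(3) by (rule order.strict_trans2)
      note s = se[OF p(1,2) Ci p(3) this]
      show ?thesis using em[OF _ p(5)] em[OF _ p(6)] s p(2,3) by simp
    qed
    have N: "x i \<in> N" if "i \<in> posts e" for i
    proof (cases "i \<in> steps e")
      case True
      then show ?thesis using pc by blast
    next
      case False
      then have "i - 1 \<in> steps e" using that by (simp add: mem_posts)
      from pc[OF this] show ?thesis by simp
    qed
    have "is_path B (Path \<mu> e (f \<circ> x) (map_tpath f g \<circ> P))"
    proof (rule is_path.succ[OF succ(1,2)])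
      show "\<mu> \<le> graph_rank B" using succ(3) gr by simp
      show "\<forall>i\<in>posts e. (f \<circ> x) i \<in> nodes B & node_rank B ((f \<circ> x) i) \<le> \<mu>" using succ(4) N nd by simp
      show "\<forall>i\<in>steps e. i - 1 \<in> steps e --> node_rank B ((f \<circ> x) i) = \<mu> & reached_by_tip e (map_tpath f g \<circ> P) \<mu> i"
        using succ(4,5) N nd steps_posts(1) by simp
      show "\<exists>i\<in>posts e. reached_by_tip e (map_tpath f g \<circ> P) \<mu> i" using succ(6) by simp
      show "no_repetition B e (f \<circ> x) (map_tpath f g \<circ> P)"
        by (rule no_repetition_map[where N = N, OF succ(7)], use N in blast, use pc in blast, rule sh)
    qed (use pc succ.IH in simp)
    moreover have "path_nodes (Path \<mu> e x P) <= N" using N pc by auto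
    ultimately show "is_path B (map_tpath f g (Path \<mu> e x P)) & path_nodes (Path \<mu> e x P) <= N" by simp
  qed
next
  case (limit e x P)
  show ?case
  proof
    assume C: "path_branches (Path Arrow_Omega e x P) <= C"
    have pc: "is_path B (map_tpath f g (P i)) & path_nodes (P i) <= N & x i \<in> N & x (i + 1) \<in> N &
      embraces B (f (x i)) (start_node B (map_tpath f g (P i))) &
      embraces B (f (x (i + 1))) (end_node B (map_tpath f g (P i)))" if i: "i \<in> steps e" for i
    proof -
      have Ci: "path_branches (P i) <= C" using C i by auto
      then have p: "is_path A (P i)" "is_path B (map_tpath f g (P i))" "path_nodes (P i) <= N"
        "path_rank (P i) < max (node_rank A (x i)) (node_rank A (x (i + 1)))"
        "embraces A (x i) (start_node A (P i))" "embraces A (x (i + 1)) (end_node A (P i))" using limit.IH i by blast+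
      have "max (node_rank A (x i)) (node_rank A (x (i + 1))) < Arrow_Omega"
        using limit(3) steps_posts[OF i] by simp
      then have "path_rank (P i) < graph_rank A" using p(4) limit(2) order.strict_trans order.strict_trans2 by blast
      note s = se[OF p(1,2) Ci p(3) this]
      show ?thesis using em[OF _ p(5)] em[OF _ p(6)] s p(2,3) by simp
    qed
    have N: "x i \<in> N" if "i \<in> posts e" for i
    proof (cases "i \<in> steps e")
      case True
      then show ?thesis using pc by blast
    next
      case False
      then have "i - 1 \<in> steps e" using that by (simp add: mem_posts)
      from pc[OF this] show ?thesis by simp
    qed
    have rk: "node_rank B ((f \<circ> x) i) = node_rank A (x i)" if "i \<in> posts e" for i
      using nd[OF N[OF that]] limit(3) that by simp
    have "is_path B (Path Arrow_Omega e (f \<circ> x) (map_tpath f g \<circ> P))"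
    proof (rule is_path.limit[OF limit(1)])
      show "Arrow_Omega \<le> graph_rank B" using limit(2) gr by simp
      show "\<forall>i\<in>posts e. (f \<circ> x) i \<in> nodes B & node_rank B ((f \<circ> x) i) < Arrow_Omega" using limit(3) N nd by simp
      show "\<forall>i\<in>steps e. if 0 \<le> i then node_rank B ((f \<circ> x) i) < node_rank B ((f \<circ> x) (i + 1))
        else node_rank B ((f \<circ> x) (i + 1)) < node_rank B ((f \<circ> x) i)"
        using limit(4) rk steps_posts by metis
      show "\<forall>i\<in>posts e. i ~= 0 --> reached_by_tip e (map_tpath f g \<circ> P) (node_rank B ((f \<circ> x) i)) i"
        unfolding reached_by_tip_map using limit(5) rk by metis
      show "no_repetition B e (f \<circ> x) (map_tpath f g \<circ> P)"
        by (rule no_repetition_map[where N = N, OF limit(6)], use N in blast, use pc in blast, rule sh)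
      show "\<forall>i\<in>steps e. is_path B ((map_tpath f g \<circ> P) i) &
        path_rank ((map_tpath f g \<circ> P) i) < max (node_rank B ((f \<circ> x) i)) (node_rank B ((f \<circ> x) (i + 1))) &
        embraces B ((f \<circ> x) i) (start_node B ((map_tpath f g \<circ> P) i)) &
        embraces B ((f \<circ> x) (i + 1)) (end_node B ((map_tpath f g \<circ> P) i))"
      proof
        fix i assume i: "i \<in> steps e"
        show "is_path B ((map_tpath f g \<circ> P) i) &
          path_rank ((map_tpath f g \<circ> P) i) < max (node_rank B ((f \<circ> x) i)) (node_rank B ((f \<circ> x) (i + 1))) &
          embraces B ((f \<circ> x) i) (start_node B ((map_tpath f g \<circ> P) i)) &
          embraces B ((f \<circ> x) (i + 1)) (end_node B ((map_tpath f g \<circ> P) i))"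
          unfolding rk[OF steps_posts(1)[OF i]] rk[OF steps_posts(2)[OF i]]
          unfolding comp_apply map_tpath_simps
          using pc[OF i] limit.IH i by blast
      qed
    qed
    moreover have "path_nodes (Path Arrow_Omega e x P) <= N" using N pc by auto
    ultimately show "is_path B (map_tpath f g (Path Arrow_Omega e x P)) & path_nodes (Path Arrow_Omega e x P) <= N" by simp
  qed
qed

lemma tail_sets:
  "path_branches (tail k (Path \<mu> Outward x P)) = (\<Union>i\<in>{int k..}. path_branches (P i))"
  "path_nodes (tail k (Path \<mu> Outward x P)) = x ` {int k..} Un (\<Union>i\<in>{int k..}. path_nodes (P i))"
proof -
  have e: "{int k..} = (%i. i + int k) ` {0..}"
  proof (intro equalityI subsetI)
    fix i assume "i \<in> {int k..}"
    then show "i \<in> (%i. i + int k) ` {0..}" by (intro image_eqI[of _ _ "i - int k"]) auto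
  qed auto
  have "posts Outward = {0..}" by (auto simp: mem_posts)
  then show "path_branches (tail k (Path \<mu> Outward x P)) = (\<Union>i\<in>{int k..}. path_branches (P i))"
    "path_nodes (tail k (Path \<mu> Outward x P)) = x ` {int k..} Un (\<Union>i\<in>{int k..}. path_nodes (P i))"
    unfolding e by (simp_all add: image_image)
qed

lemma ray_tail_mono:
  assumes "is_ray A p" "j \<le> k"
  shows "path_branches (tail k p) <= path_branches (tail j p)" "path_nodes (tail k p) <= path_nodes (tail j p)"
proof -
  obtain \<mu> x P where p: "p = Path \<mu> Outward x P" using assms(1) by (auto simp: is_ray_def)
  have sub: "{int k..} <= {int j..}" using assms(2) by auto
  show "path_branches (tail k p) <= path_branches (tail j p)"
    unfolding p tail_sets by (rule UN_mono[OF sub order.refl])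
  show "path_nodes (tail k p) <= path_nodes (tail j p)"
    unfolding p tail_sets by (rule Un_mono[OF image_mono[OF sub] UN_mono[OF sub order.refl]])
qed

lemma is_ray_tail_raw: "is_ray A p ==> is_ray A (tail k p)"
proof -
  assume r: "is_ray A p"
  then obtain \<mu> x P where p: "p = Path \<mu> Outward x P" "is_path A (Path \<mu> Outward x P)" by (auto simp: is_ray_def)
  have "is_path A (Path \<mu> Outward (%i. x (i + int k)) (%i. P (i + int k)))" by (rule sub_ray[OF p(2)]) auto
  then show ?thesis unfolding p(1) is_ray_def by simp
qed

section \<open>Old paths in the graph with end branches\<close>

fun un_node :: "'n ext_node \<Rightarrow> 'n" where
  "un_node (Old_Node a) = a" | "un_node (Inner a) = a" | "un_node (Outer a) = a"

fun un_branch :: "('b, 'n) ext_branch \<Rightarrow> 'b" where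
  "un_branch (Old_Branch b) = b" | "un_branch (End_Branch a) = undefined"

abbreviation emb :: "('n, 'b) tpath \<Rightarrow> ('n ext_node, ('b, 'n) ext_branch) tpath" where
  "emb \<equiv> map_tpath Old_Node Old_Branch"

abbreviation un :: "('n ext_node, ('b, 'n) ext_branch) tpath \<Rightarrow> ('n, 'b) tpath" where
  "un \<equiv> map_tpath un_node un_branch"

lemma un_emb [simp]: "un (emb p) = p"
  by (simp add: tpath.map_comp comp_def tpath.map_ident)

lemma Old_un: "u \<in> range Old_Node ==> Old_Node (un_node u) = u" "b \<in> range Old_Branch ==> Old_Branch (un_branch b) = b"
  by auto

lemma Old_un_image: "B <= range Old_Branch ==> Old_Branch ` un_branch ` B = B"
  using Old_un(2) by (force simp: image_image)

lemma coincide_self: "coincide p p"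
proof -
  have "tail 0 p = p" by (cases p) simp_all
  then show ?thesis unfolding coincide_def by (metis order.refl)
qed

text \<open>\<open>coincide\<close> compares only ranks and sets of branches, and the embedding is
  injective on branches.\<close>

lemma coincide_emb:
  assumes q: "is_ray A q \<or> q = Path \<mu> Outward y Q" "path_branches q <= range Old_Branch"
  shows "coincide (emb p) q \<longleftrightarrow> coincide p (un q)"
proof -
  obtain \<mu> y Q where q': "q = Path \<mu> Outward y Q" using q(1) by (auto simp: is_ray_def)
  have inj: "inj Old_Branch" by (simp add: inj_def)
  have sub: "path_branches (tail k q) <= path_branches q" for k
    unfolding q' tail_sets(1) path_branches.simps steps.simps by (rule UN_mono) auto
  have t: "Old_Branch ` path_branches (tail k (un q)) = path_branches (tail k q)" for k
    using Old_un_image[OF subset_trans[OF sub q(2)]] by simp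
  have u: "Old_Branch ` path_branches (un q) = path_branches q" using Old_un_image[OF q(2)] by simp
  have "path_branches (tail k (emb p)) <= path_branches q \<longleftrightarrow> path_branches (tail k p) <= path_branches (un q)" for k
    unfolding u[symmetric] map_tpath_simps(4) path_branches_map[of Old_Node] by (rule inj_image_subset_iff[OF inj])
  moreover have "path_branches (tail k q) <= path_branches (emb p) \<longleftrightarrow> path_branches (tail k (un q)) <= path_branches p" for k
    unfolding t[symmetric] path_branches_map[of Old_Node] by (rule inj_image_subset_iff[OF inj])
  ultimately show ?thesis unfolding coincide_def by simp
qed

context nu_graph
begin

text \<open>One inclusion suffices at equal rank: the tails of p pass every post of w, and
  \<open>cofinal_ray\<close> supplies the other inclusion.\<close>

lemma ray_in_ray:
  assumes w: "is_ray G w" and p: "is_ray G p" "path_rank p < graph_rank G" "path_rank p = path_rank w"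
    and k: "path_branches (tail k p) <= path_branches w"
  shows "coincide p w"
proof -
  obtain k0 where k0: "proper (tail k0 w)" using proper_tail[OF w] p(2,3) by auto
  have rw: "is_ray G (tail k0 w)" by (rule is_ray_tail[OF w])
  obtain \<mu> x P where Q: "tail k0 w = Path \<mu> Outward x P" by (rule is_rayE[OF rw])
  have \<mu>: "path_rank (tail k0 w) = path_rank p" using p(3) by simp
  obtain l where l: "path_branches (tail l p) <= path_branches (tail k0 w)"
    using ray_branches_tail[OF p(1) w p(2,3) k] by blast
  have rl: "is_ray G (tail l p)" by (rule is_ray_tail[OF p(1)])
  have cof: "\<exists>k. path_branches (tail k (tail l p)) <= rpart Outward P j" for j
  proof -
    have "rpart Outward P (int (nat j)) = path_branches (tail (nat j) (tail k0 w))"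
    proof -
      have "{i \<in> steps Outward. int (nat j) \<le> i} = {int (nat j)..}" by auto
      then show ?thesis unfolding Q branches_tail rpart_def by simp
    qed
    moreover have "rpart Outward P (int (nat j)) <= rpart Outward P j" by (auto simp: rpart_def)
    moreover have "\<exists>k. path_branches (tail k (tail l p)) <= path_branches (tail (nat j) (tail k0 w))"
      by (rule ray_branches_tail[OF rl rw, of 0]) (use p(2) \<mu> l in simp_all)
    ultimately show ?thesis by auto
  qed
  have "coincide (tail l p) (Path \<mu> Outward x P)"
    using cofinal_ray[OF locates_all k0[unfolded Q] rl _ l[unfolded Q] cof] p(2) by simp
  then obtain m where "path_branches (tail m (tail k0 w)) <= path_branches (tail l p)"
    unfolding coincide_def Q by blast
  then have "path_branches (tail (m + k0) w) <= path_branches p"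
    using branches_tail_subset[OF p(1), of l] unfolding tail_tail by blast
  then show ?thesis unfolding coincide_def using p(3) k by blast
qed

end

section \<open>Transfer of condition (C) back to the old graph\<close>

locale append_graph = nu_graph G for G :: "('n, 'b) tgraph" +
  fixes S :: "'n set"
begin

abbreviation H :: "('n ext_node, ('b, 'n) ext_branch) tgraph" where
  "H \<equiv> append_end_branches G S"

lemma H_simps [simp]:
  "graph_rank H = graph_rank G"
  "Old_Node a \<in> nodes H \<longleftrightarrow> a \<in> nodes G"
  "Old_Branch b \<in> branches H \<longleftrightarrow> b \<in> branches G"
  "ends H (Old_Branch b) = Old_Node ` ends G b"
  "node_rank H (Old_Node a) = node_rank G a"
  by (auto simp: append_end_branches_def)

lemma H_embraced: "embraced H (Old_Node a) X \<longleftrightarrow> (\<exists>z. X = Old_Node z & embraced G a z)"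
  by (auto simp: append_end_branches_def)

lemma H_embraces: "embraces H X (Old_Node a) \<longleftrightarrow> (\<exists>z. X = Old_Node z & embraces G z a)"
  unfolding embraces_def H_embraced by blast

lemma H_shorted: "shorted H (Old_Node a) (Old_Node b) \<longleftrightarrow> shorted G a b"
  unfolding shorted_def H_embraces by blast

text \<open>The ray picked by \<open>SOME\<close> in the enlarged graph coincides with the
  translated ray, and \<open>tip_node G\<close> respects coincidence, so the choice does not affect
  the node.\<close>

lemma H_tip_node:
  assumes q: "q = Path \<mu> Outward y Q" "path_branches q <= range Old_Branch"
    and r: "is_ray G (un q)" "path_rank q < graph_rank G"
  shows "tip_node H q = Old_Node (tip_node G (un q))"
proof -
  note c = coincide_emb[OF disjI2[OF q(1)] q(2)]
  let ?p = "SOME p. is_ray G p & coincide (emb p) q"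
  have "is_ray G ?p & coincide (emb ?p) q" by (rule someI[of _ "un q"]) (use r c in simp)
  then have p: "is_ray G ?p" "coincide ?p (un q)" using c by simp_all
  then have "path_rank ?p < graph_rank G" using r(2) by (simp add: coincide_def)
  then have "tip_node G ?p = tip_node G (un q)" using tip_node_coincide[OF p(1) r(1) _ p(2)] by blast
  moreover have "tip_node H q = Old_Node (tip_node G ?p)" by (simp add: append_end_branches_def)
  ultimately show ?thesis by simp
qed

lemma H_start_node:
  assumes p: "is_path G (un q)" and q: "path_branches q <= range Old_Branch" "path_nodes q <= range Old_Node"
    and r: "path_rank q < graph_rank G"
  shows "start_node H q = Old_Node (start_node G (un q))"
proof -
  obtain \<mu> e y Q where q': "q = Path \<mu> e y Q" using p by (cases q) auto
  have ip: "is_path G (Path \<mu> e (un_node \<circ> y) (un \<circ> Q))" using p q' by simp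
  show ?thesis
  proof (cases "left_tip q")
    case True
    then have e: "e = Inward \<or> e = Endless" using q' by simp
    define s where "s = reverse (Path \<mu> Inward y Q)"
    have s: "s = Path \<mu> Outward (%i. y (0 - i)) (%i. reverse (Q (0 - 1 - i)))" by (simp add: s_def)
    have us: "un s = reverse (Path \<mu> Inward (un_node \<circ> y) (un \<circ> Q))" unfolding s_def by (simp add: comp_def)
    have rs: "is_ray G (un s)" unfolding us by (rule left_ray[OF ip e])
    have "path_branches s <= path_branches q" unfolding s_def path_branches_reverse q' using e by auto
    then have b: "path_branches s <= range Old_Branch" using q(1) by blast
    have "tip_node H s = Old_Node (tip_node G (un s))"
      by (rule H_tip_node[OF s b rs]) (use r q' s in simp)
    moreover have "start_node H q = tip_node H s" unfolding q' s_def using e by simp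
    moreover have "start_node G (un q) = tip_node G (un s)" unfolding q' us using e by simp
    ultimately show ?thesis by simp
  next
    case False
    then have "0 \<in> steps e" using left_post(1)[OF ip] q' by simp
    then have "y 0 \<in> path_nodes q" using steps_posts(1) q' by auto
    then have "y 0 \<in> range Old_Node" using q(2) by blast
    then show ?thesis using Old_un(1)[of "y 0"] False q' by auto
  qed
qed

lemma H_end_node:
  assumes p: "is_path G (un q)" and q: "path_branches q <= range Old_Branch" "path_nodes q <= range Old_Node"
    and r: "path_rank q < graph_rank G"
  shows "end_node H q = Old_Node (end_node G (un q))"
proof -
  have "is_path G (un (reverse q))" using is_path_reverse[OF p] by simp
  from H_start_node[OF this] q r have "start_node H (reverse q) = Old_Node (start_node G (un (reverse q)))" by simp
  then show ?thesis by (simp flip: reverse_map)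
qed

lemma emb_path: "is_path G p ==> is_path H (emb p)"
proof -
  assume p: "is_path G p"
  have "path_branches p <= UNIV --> is_path H (emb p) & path_nodes p <= UNIV"
  proof (rule path_map[OF _ _ _ _ _ _ _ p])
    show "start_node H (emb p) = Old_Node (start_node G p) & start_node G p \<in> UNIV &
      end_node H (emb p) = Old_Node (end_node G p) & end_node G p \<in> UNIV"
      if "is_path G p" "path_rank p < graph_rank G" for p
      using H_start_node[of "emb p"] H_end_node[of "emb p"] that by auto
  qed (auto simp: H_shorted H_embraces inj_on_def)
  then show ?thesis by simp
qed

lemma un_path:
  assumes p: "is_path H q" "path_branches q <= range Old_Branch"
  shows "is_path G (un q) & path_nodes q <= range Old_Node"
proof -
  have "path_branches q <= range Old_Branch --> is_path G (un q) & path_nodes q <= range Old_Node"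
  proof (rule path_map[OF _ _ _ _ _ _ _ p(1)])
    show "start_node G (un p) = un_node (start_node H p) & start_node H p \<in> range Old_Node &
      end_node G (un p) = un_node (end_node H p) & end_node H p \<in> range Old_Node"
      if "is_path G (un p)" "path_branches p <= range Old_Branch" "path_nodes p <= range Old_Node"
        "path_rank p < graph_rank H" for p
      using H_start_node[OF that(1-3)] H_end_node[OF that(1-3)] that(4) by simp
  qed (auto simp: H_shorted H_embraces inj_on_def image_image)
  then show ?thesis using p(2) by blast
qed

lemma emb_ray: "is_ray G p ==> is_ray H (emb p)"
  using emb_path by (auto simp: is_ray_def)

lemma coincide_emb_emb: "is_ray G q ==> coincide (emb p) (emb q) \<longleftrightarrow> coincide p q"
  using coincide_emb[of H "emb q"] emb_ray by auto

text \<open>A ray of the enlarged graph that coincides with an old ray uses only old branches from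
  some point on. Its late tails are therefore old rays, and by \<open>ray_in_ray\<close> they lie in
  the same class.\<close>

lemma pull_back:
  assumes w: "is_ray G w" "path_rank w < graph_rank G" and p: "is_ray H p" "coincide (emb w) p"
  obtains k0 where "!!k. k0 \<le> k ==> is_ray G (un (tail k p)) & coincide w (un (tail k p)) &
    path_nodes (tail k p) <= range Old_Node"
proof -
  obtain k0 where k0: "path_branches (tail k0 p) <= path_branches (emb w)" using p(2) by (auto simp: coincide_def)
  have "is_ray G (un (tail k p)) & coincide w (un (tail k p)) & path_nodes (tail k p) <= range Old_Node" if k: "k0 \<le> k" for k
  proof -
    have b: "path_branches (tail k p) <= Old_Branch ` path_branches w"
      using ray_tail_mono(1)[OF p(1) k] k0 by simp
    have r: "is_ray H (tail k p)" by (rule is_ray_tail_raw[OF p(1)])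
    have "path_branches (tail k p) <= range Old_Branch" using b by blast
    then have u: "is_path G (un (tail k p))" "path_nodes (tail k p) <= range Old_Node"
      using un_path[of "tail k p"] r by (auto simp: is_ray_def)
    have ru: "is_ray G (un (tail k p))" using u(1) r by (auto simp: is_ray_def)
    have "path_branches (un (tail k p)) <= path_branches w" using b by (auto simp: image_subset_iff)
    then have "path_branches (tail 0 (un (tail k p))) <= path_branches w" by simp
    moreover have "path_rank (un (tail k p)) = path_rank w" using p(2) by (simp add: coincide_def)
    ultimately have "coincide (un (tail k p)) w" using ray_in_ray[OF w(1) ru, of 0] w(2) by simp
    then show ?thesis using ru u(2) coincide_sym by blast
  qed
  then show ?thesis using that by blast
qed

lemma emb_coincide:
  assumes w: "is_ray G w" "path_rank w < graph_rank G" and v: "is_ray G v"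
    and p: "is_ray H p" "coincide (emb w) p" "coincide (emb v) p"
  shows "coincide w v"
proof -
  have rv: "path_rank v < graph_rank G" using p(2,3) w(2) by (simp add: coincide_def)
  obtain k0 where k0: "!!k. k0 \<le> k ==> is_ray G (un (tail k p)) & coincide w (un (tail k p)) & path_nodes (tail k p) <= range Old_Node"
    using pull_back[OF w p(1,2)] by blast
  obtain k1 where k1: "!!k. k1 \<le> k ==> is_ray G (un (tail k p)) & coincide v (un (tail k p)) & path_nodes (tail k p) <= range Old_Node"
    using pull_back[OF v rv p(1,3)] by blast
  let ?k = "max k0 k1"
  show ?thesis
    by (rule coincide_trans[OF w(1) _ v w(2), of "un (tail ?k p)"]) (use k0[of ?k] k1[of ?k] coincide_sym in auto)
qed

lemma H_tip_node_class:
  assumes w: "is_ray G w" "path_rank w < graph_rank G" and p: "is_ray H p" "coincide (emb w) p"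
  shows "tip_node H p = Old_Node (tip_node G w)"
proof -
  let ?p = "SOME r. is_ray G r & coincide (emb r) p"
  have "is_ray G ?p & coincide (emb ?p) p" by (rule someI[of _ w]) (use w p in simp)
  then have "is_ray G ?p" "coincide w ?p" using emb_coincide[OF w _ p] by blast+
  then have "tip_node G w = tip_node G ?p" using tip_node_coincide[OF w(1) _ w(2)] by blast
  moreover have "tip_node H p = Old_Node (tip_node G ?p)" by (simp add: append_end_branches_def)
  ultimately show ?thesis by simp
qed

lemma H_tips_in:
  assumes w: "is_ray G w" "path_rank w < graph_rank G"
  shows "tip_of H (emb w) \<in> tips_in H X \<longleftrightarrow> X = Old_Node (tip_node G w)"
proof
  assume "tip_of H (emb w) \<in> tips_in H X"
  then obtain p where p: "is_ray H p" "tip_node H p = X" "tip_of H (emb w) = tip_of H p" by (auto simp: tips_in_def)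
  have "p \<in> tip_of H p" using p(1) coincide_self by (auto simp: tip_of_def)
  then have "p \<in> tip_of H (emb w)" unfolding p(3) .
  then have "coincide (emb w) p" by (simp add: tip_of_def)
  then show "X = Old_Node (tip_node G w)" using H_tip_node_class[OF w p(1)] p(2) by simp
next
  assume X: "X = Old_Node (tip_node G w)"
  have c: "coincide (emb w) (emb w)" by (rule coincide_self)
  have "tip_node H (emb w) = X" unfolding X by (rule H_tip_node_class[OF w emb_ray[OF w(1)] c])
  then show "tip_of H (emb w) \<in> tips_in H X" unfolding tips_in_def using emb_ray[OF w(1)] w(2) by fastforce
qed

text \<open>The classes in the enlarged graph contain rays that are not images of old rays. Late
  tails are pulled back to rays coinciding with w and v, whose nodes are comparable by
  \<open>coincide_mnodes\<close>.\<close>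

lemma nondisconnectable_emb:
  assumes w: "is_ray G w" "path_rank w < graph_rank G" and v: "is_ray G v" "path_rank v < graph_rank G"
    and wv: "!!i j. mnodes (tail i w) Int mnodes (tail j v) ~= {}"
  shows "nondisconnectable H (tip_of H (emb w)) (tip_of H (emb v))"
  unfolding nondisconnectable_def
proof (intro ballI allI)
  fix p q i j assume "p \<in> tip_of H (emb w)" "q \<in> tip_of H (emb v)"
  then have p: "is_ray H p" "coincide (emb w) p" and q: "is_ray H q" "coincide (emb v) q" by (auto simp: tip_of_def)
  obtain k0 where k0: "!!k. k0 \<le> k ==> is_ray G (un (tail k p)) & coincide w (un (tail k p)) & path_nodes (tail k p) <= range Old_Node"
    using pull_back[OF w p] by blast
  obtain l0 where l0: "!!k. l0 \<le> k ==> is_ray G (un (tail k q)) & coincide v (un (tail k q)) & path_nodes (tail k q) <= range Old_Node"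
    using pull_back[OF v q] by blast
  let ?k = "max k0 i" and ?l = "max l0 j"
  have P: "is_ray G (un (tail ?k p))" "coincide w (un (tail ?k p))" "path_nodes (tail ?k p) <= range Old_Node"
    using k0[of ?k] by auto
  have Q: "is_ray G (un (tail ?l q))" "coincide v (un (tail ?l q))" "path_nodes (tail ?l q) <= range Old_Node"
    using l0[of ?l] by auto
  obtain a where a: "mnodes (tail a w) <= mnodes (tail 0 (un (tail ?k p)))" using coincide_mnodes[OF w(1) P(1) w(2) P(2)] by blast
  obtain b where b: "mnodes (tail b v) <= mnodes (tail 0 (un (tail ?l q)))" using coincide_mnodes[OF v(1) Q(1) v(2) Q(2)] by blast
  obtain m where m: "m \<in> mnodes (un (tail ?k p))" "m \<in> mnodes (un (tail ?l q))" using a b wv[of a b] unfolding tail_0 by blast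
  obtain u where u: "u \<in> path_nodes (tail ?k p)" "m = mx (un_node u)" using m(1) unfolding mnodes_def path_nodes_map by blast
  obtain u' where u': "u' \<in> path_nodes (tail ?l q)" "m = mx (un_node u')" using m(2) unfolding mnodes_def path_nodes_map by blast
  have un: "un_node u \<in> nodes G" "un_node u' \<in> nodes G"
    using path_nodes_subset[OF is_ray_path[OF P(1)]] path_nodes_subset[OF is_ray_path[OF Q(1)]] u(1) u'(1)
    unfolding path_nodes_map by blast+
  have "mx (un_node u) = mx (un_node u')" by (rule trans[OF u(2)[symmetric] u'(2)])
  then have "shorted G (un_node u) (un_node u')" using shorted_iff[OF un] by blast
  then have sh: "shorted H (Old_Node (un_node u)) (Old_Node (un_node u'))" unfolding H_shorted .
  have "shorted H u u'"
    using sh unfolding Old_un(1)[OF subsetD[OF P(3) u(1)]] Old_un(1)[OF subsetD[OF Q(3) u'(1)]] .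
  moreover have "u \<in> path_nodes (tail i p)" "u' \<in> path_nodes (tail j q)"
    by (rule subsetD[OF ray_tail_mono(2)[OF p(1)] u(1)], simp, rule subsetD[OF ray_tail_mono(2)[OF q(1)] u'(1)], simp)
  ultimately show "meet H (tail i p) (tail j q)" unfolding meet_def by blast
qed

text \<open>The end branch at a node that holds a tip adds an embraced 0-node \<open>Inner\<close>,
  so a node of \<open>S\<close> is no longer a singleton. For nodes outside \<open>S\<close> nothing
  changes, and distinct old tips remain distinct.\<close>

lemma singleton_emb:
  assumes w: "is_ray G w" "path_rank w < graph_rank G" and s: "singleton_node H (Old_Node (tip_node G w))"
  shows "tip_singleton (tip_node G w)" "tip_node G w ~: S"
proof -
  let ?z = "tip_node G w"
  have z: "?z \<in> nodes G" "node_rank G ?z ~= Fin 0" using tip_node_props[OF w] by simp_all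
  have mH: "maximal_node H (Old_Node ?z)" using s by (simp add: singleton_node_def)
  have "~ embraced G ?z y" if "y \<in> nodes G" for y
  proof -
    have "Old_Node y \<in> nodes H" using that by simp
    then have "~ embraced H (Old_Node ?z) (Old_Node y)" using mH unfolding maximal_node_def by blast
    then show ?thesis unfolding H_embraced by blast
  qed
  then have mxl: "maximal_node G ?z" unfolding maximal_node_def using z(1) by blast
  have ne: "~ embraced H X (Old_Node ?z)" for X using s unfolding singleton_node_def by blast
  have noin: "~ embraced G y ?z" for y using ne[of "Old_Node y"] H_embraced by blast
  have "\<exists>!t. t \<in> tips_in H (Old_Node ?z)" using s z(2) unfolding singleton_node_def by simp
  then have one: "t = t'" if "t \<in> tips_in H (Old_Node ?z)" "t' \<in> tips_in H (Old_Node ?z)" for t t' using that by blast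
  have uniq: "t = tip_of G w" if t: "t \<in> tips_in G ?z" for t
  proof -
    obtain v where v: "is_ray G v" "path_rank v < graph_rank G" "tip_node G v = ?z" "t = tip_of G v"
      using t by (auto simp: tips_in_def)
    have eq: "tip_of H (emb v) = tip_of H (emb w)"
      by (rule one) (use H_tips_in[OF w] H_tips_in[OF v(1,2)] v(3) in simp_all)
    have "emb v \<in> tip_of H (emb v)" using emb_ray[OF v(1)] coincide_self by (simp add: tip_of_def)
    then have "emb v \<in> tip_of H (emb w)" unfolding eq .
    then have "coincide (emb w) (emb v)" by (simp add: tip_of_def)
    then have c: "coincide w v" using coincide_emb_emb[OF v(1)] by simp
    then show ?thesis unfolding v(4) tip_of_def
      using coincide_trans[OF w(1) v(1) _ w(2) c] coincide_trans[OF v(1) w(1) _ v(2) coincide_sym[OF c]] by blast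
  qed
  have "tip_of G w \<in> tips_in G ?z" using w unfolding tips_in_def by blast
  then have "\<exists>!t. t \<in> tips_in G ?z" using uniq by blast
  then show "tip_singleton ?z" unfolding tip_singleton_def singleton_node_def using mxl noin z(2) by simp
  show "?z ~: S" using ne[of "Inner ?z"] z(2) by (auto simp: append_end_branches_def)
qed

text \<open>Condition (C) of the enlarged graph without its exception: a singleton node there
  holding one of the two tips would be a tip-holding singleton node of the old graph outside
  \<open>S\<close>.\<close>

lemma append_same_node:
  assumes C: "condition_C H" and w: "is_ray G w" "path_rank w < graph_rank G" and v: "is_ray G v" "path_rank v < graph_rank G"
    and good: "tip_singleton (tip_node G w) ==> tip_node G w \<in> S" "tip_singleton (tip_node G v) ==> tip_node G v \<in> S"
    and wv: "!!i j. mnodes (tail i w) Int mnodes (tail j v) ~= {}"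
  shows "mx (tip_node G w) = mx (tip_node G v)"
proof -
  let ?s = "tip_of H (emb w)" and ?t = "tip_of H (emb v)"
  have tips: "?s \<in> tips H" "?t \<in> tips H" unfolding tips_def using emb_ray w v by auto
  have cases: "(\<exists>x\<in>nodes H. embraces_tip H x ?s & embraces_tip H x ?t) \<or>
    (\<exists>x\<in>nodes H. singleton_node H x & (tips_in H x = {?s} \<or> tips_in H x = {?t}))"
    using C[unfolded condition_C_def, rule_format, OF tips nondisconnectable_emb[OF w v wv]] .
  then show ?thesis
  proof
    assume "\<exists>x\<in>nodes H. embraces_tip H x ?s & embraces_tip H x ?t"
    then obtain X where X: "X \<in> nodes H" "embraces_tip H X ?s" "embraces_tip H X ?t" by blast
    have over: "\<exists>z. X = Old_Node z & embraces G z (tip_node G w)"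
      if w: "is_ray G w" "path_rank w < graph_rank G" and e: "embraces_tip H X (tip_of H (emb w))" for w
    proof -
      obtain Y where Y: "embraces H X Y & tip_of H (emb w) \<in> tips_in H Y" using e[unfolded embraces_tip_def] by (rule exE)
      have "Y = Old_Node (tip_node G w)" by (rule iffD1[OF H_tips_in[OF w] conjunct2[OF Y]])
      then show ?thesis using conjunct1[OF Y] by (simp only: H_embraces)
    qed
    obtain z where z: "X = Old_Node z" "embraces G z (tip_node G w)" using over[OF w X(2)] by blast
    obtain z' where "X = Old_Node z'" "embraces G z' (tip_node G v)" using over[OF v X(3)] by blast
    then have z3: "embraces G z (tip_node G v)" using z(1) by simp
    have "z \<in> nodes G" using X(1) z(1) by simp
    then show ?thesis using embraces_mx[OF z(2)] embraces_mx[OF z3] by metis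
  next
    assume "\<exists>x\<in>nodes H. singleton_node H x & (tips_in H x = {?s} \<or> tips_in H x = {?t})"
    then obtain X where X: "singleton_node H X" "?s \<in> tips_in H X \<or> ?t \<in> tips_in H X" by (metis insertI1)
    have "X = Old_Node (tip_node G w) \<or> X = Old_Node (tip_node G v)"
      using X(2) unfolding H_tips_in[OF w] H_tips_in[OF v] .
    then have False
    proof
      assume "X = Old_Node (tip_node G w)"
      with X(1) have "singleton_node H (Old_Node (tip_node G w))" by simp
      from singleton_emb[OF w this] good(1) show False by blast
    next
      assume "X = Old_Node (tip_node G v)"
      with X(1) have "singleton_node H (Old_Node (tip_node G v))" by simp
      from singleton_emb[OF v this] good(2) show False by blast
    qed
    then show ?thesis ..
  qed
qed

end

section \<open>Suprema of sets of ordinals as ranks\<close>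

lemma rank_sup_le:
  assumes "A ~= {}" "!!a. a \<in> A ==> a \<le> b" shows "rank_sup A \<le> Ord b"
proof (cases "\<exists>m\<in>A. \<forall>a\<in>A. a \<le> m")
  case True
  then obtain m where m: "m \<in> A" "\<forall>a\<in>A. a \<le> m" by blast
  then have "(GREATEST m. m \<in> A) = m" by (intro Greatest_equality) auto
  then show ?thesis using True m assms(2) by (simp add: rank_sup_def)
next
  case False
  then have "\<forall>a\<in>A. a < b" using assms(2) by (metis order.not_eq_order_implies_strict)
  then have "(LEAST l. \<forall>a\<in>A. a < l) \<le> b" by (rule Least_le)
  then show ?thesis unfolding rank_sup_def if_not_P[OF False] by simp
qed

text \<open>The bound c guarantees that the \<open>LEAST\<close> in the unattained case exists;
  without a bound its value would be arbitrary.\<close>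

lemma rank_sup_upper:
  assumes "!!a. a \<in> A ==> a \<le> c" "a \<in> A"
  shows "Ord a \<le> rank_sup A" "rank_sup A = Arrow l ==> a < l"
proof -
  have "Ord a \<le> rank_sup A & (rank_sup A = Arrow l --> a < l)"
  proof (cases "\<exists>m\<in>A. \<forall>a\<in>A. a \<le> m")
    case True
    then obtain m where m: "m \<in> A" "\<forall>a\<in>A. a \<le> m" by blast
    then have "(GREATEST m. m \<in> A) = m" by (intro Greatest_equality) auto
    then show ?thesis using True m assms(2) by (simp add: rank_sup_def)
  next
    case False
    then have "\<forall>a\<in>A. a < c" using assms(1) by (metis order.not_eq_order_implies_strict)
    then have "\<forall>a\<in>A. a < (LEAST l. \<forall>a\<in>A. a < l)" by (rule LeastI)
    then show ?thesis using False assms(2) unfolding rank_sup_def by auto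
  qed
  then show "Ord a \<le> rank_sup A" "rank_sup A = Arrow l ==> a < l" by blast+
qed

lemma rank_sup_mono:
  assumes "A ~= {}" "A <= B" "!!b. b \<in> B ==> b \<le> c"
  shows "rank_sup A \<le> rank_sup B"
proof (cases "rank_sup B")
  case (Ord b)
  have "a \<le> b" if "a \<in> A" for a
  proof -
    have "Ord a \<le> rank_sup B" by (rule rank_sup_upper(1)[of B c]) (use assms(2,3) that in blast)+
    then show ?thesis unfolding Ord by simp
  qed
  then show ?thesis using rank_sup_le[OF assms(1)] Ord by metis
next
  case (Arrow l)
  have "a < l" if "a \<in> A" for a
    by (rule rank_sup_upper(2)[of B c]) (use assms(2,3) that Arrow in blast)+
  then have l: "\<forall>a\<in>A. a < l" by blast
  show ?thesis
  proof (cases "\<exists>m\<in>A. \<forall>a\<in>A. a \<le> m")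
    case True
    then obtain m where m: "m \<in> A" "\<forall>a\<in>A. a \<le> m" by blast
    then have "(GREATEST m. m \<in> A) = m" by (intro Greatest_equality) auto
    then show ?thesis using True m l Arrow by (simp add: rank_sup_def)
  next
    case False
    have "(LEAST l. \<forall>a\<in>A. a < l) \<le> l" using l by (rule Least_le)
    then show ?thesis unfolding rank_sup_def[of A] if_not_P[OF False] Arrow by simp
  qed
qed

text \<open>Minimise the underlying ordinal first. Among the two ranks with the same ordinal a,
  \<open>Arrow a\<close> precedes \<open>Ord a\<close>.\<close>

lemma ex_least_rank:
  assumes "R ~= {}" obtains r :: rank where "r \<in> R" "!!s. s \<in> R ==> r \<le> s"
proof -
  define key where "key r = (case r of Ord a \<Rightarrow> a | Arrow a \<Rightarrow> a)" for r
  define a where "a = (LEAST a. \<exists>r\<in>R. key r = a)"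
  obtain r0 where "r0 \<in> R" using assms by blast
  then have ex: "\<exists>a. \<exists>r\<in>R. key r = a" by blast
  have "\<exists>r\<in>R. key r = a" using LeastI_ex[OF ex] unfolding a_def .
  then obtain r where r: "r \<in> R" "key r = a" by blast
  have least: "a \<le> key s" if "s \<in> R" for s
    unfolding a_def by (rule Least_le) (rule bexI[OF refl that])
  show ?thesis
  proof (cases "Arrow a \<in> R")
    case True
    have "Arrow a \<le> s" if "s \<in> R" for s using least[OF that] by (cases s) (simp_all add: key_def)
    then show ?thesis by (rule that[OF True])
  next
    case False
    then have ra: "Ord a \<in> R" using r by (cases r) (auto simp: key_def)
    have "Ord a \<le> s" if s: "s \<in> R" for s
    proof (cases s)
      case (Ord b)
      then show ?thesis using least[OF s] by (simp add: key_def)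
    next
      case (Arrow b)
      then have "a ~= b" using False s by blast
      then show ?thesis using least[OF s] Arrow by (simp add: key_def)
    qed
    then show ?thesis by (rule that[OF ra])
  qed
qed

section \<open>Distances, radius and diameter\<close>

locale metric_graph = nu_graph G for G :: "('n, 'b) tgraph" +
  fixes M :: "'n set"
  assumes connected: "nu_connected G" and metrizable: "metrizable_set G M"
begin

text \<open>Larger than \<open>M\<close> in general: it also contains the singleton 0-nodes outside
  \<open>M\<close>. What counts is that all nodes in which condition (C) could fail to compare tips
  are excluded.\<close>

definition good :: "'n set" where
  "good = {m. maximal_node G m & (tip_singleton m --> m \<in> M)}"

sublocale cc_graph G good
proof
  interpret append_graph G "{x \<in> M. singleton_node G x}" ..
  have C: "condition_C H" using metrizable by (simp add: metrizable_set_def)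
  show "m \<in> good ==> maximal_node G m" for m by (simp add: good_def)
  show "maximal_node G m ==> ~ tip_singleton m ==> m \<in> good" for m by (simp add: good_def)
  show "mx (tip_node G w) = mx (tip_node G v)"
    if "is_ray G w" "is_ray G v" "path_rank w < graph_rank G" "path_rank v < graph_rank G"
      "mx (tip_node G w) \<in> good" "mx (tip_node G v) \<in> good" "!!i j. mnodes (tail i w) Int mnodes (tail j v) ~= {}" for w v
  proof (rule append_same_node[OF C that(1,3) that(2,4) _ _ that(7)])
    have "z \<in> {x \<in> M. singleton_node G x}" if "tip_singleton z" "mx z \<in> good" for z
    proof -
      have "singleton_node G z" using that(1) by (simp add: tip_singleton_def)
      moreover then have "mx z = z" by (simp add: singleton_node_def)
      ultimately show ?thesis using that by (simp add: good_def)
    qed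
    then show "tip_singleton (tip_node G w) ==> tip_node G w \<in> {x \<in> M. singleton_node G x}"
      "tip_singleton (tip_node G v) ==> tip_node G v \<in> {x \<in> M. singleton_node G x}"
      using that(5,6) by blast+
  qed
qed

lemma M_good: "m \<in> M ==> m \<in> good"
  using metrizable by (auto simp: metrizable_set_def good_def)

text \<open>A path of positive rank has a post reached by a tip, hence a constituent with an
  infinite end, to which induction applies.\<close>

lemma ex_zero_path_with_tip:
  "is_path G p ==> left_tip p \<or> right_tip p ==>
    \<exists>e x P. is_path G (Path (Fin 0) e x P) & e \<in> {Inward, Outward, Endless}"
proof (induction p rule: is_path.induct)
  case (zero e P x)
  have "is_path G (Path (Fin 0) e x P)" by (rule is_path.zero) (use zero in blast)+
  moreover have "e \<in> {Inward, Outward, Endless}" using zero.prems by auto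
  ultimately show ?case by blast
next
  case (succ e \<alpha> \<mu> x P)
  obtain i where "reached_by_tip e P \<mu> i" using succ.hyps by blast
  then obtain j where "j \<in> steps e" "left_tip (P j) \<or> right_tip (P j)" unfolding reached_by_tip_def by blast
  then show ?case using succ.IH by blast
next
  case (limit e x P)
  have "1 \<in> posts e \<or> - 1 \<in> posts e" using limit(1) by (auto simp: mem_posts)
  then obtain i where i: "i \<in> posts e" "i ~= 0" by (metis one_neq_zero neg_equal_0_iff_equal)
  have "reached_by_tip e P (node_rank G (x i)) i" using bspec[OF limit(5) i(1)] i(2) by (rule mp)
  then obtain j where "j \<in> steps e" "left_tip (P j) \<or> right_tip (P j)" unfolding reached_by_tip_def by blast
  then show ?case using limit.IH by blast
qed

text \<open>The graph has a node of positive rank with a tip, and inside a ray to it there is a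
  0-path with an infinite end. An interior 0-node of that path has two branches, so its maximal node
  is not a singleton and belongs to \<open>M\<close>.\<close>

lemma M_nonempty: "M ~= {}"
proof -
  obtain z where z: "z \<in> nodes G" "node_rank G z = graph_rank G" using ex_top_node by blast
  have "node_rank G z ~= Fin 0" using z(2) graph_rank_ge1 by auto
  then obtain w where w: "is_ray G w" using tips_in_nonempty[OF z(1)] z(2) graph_rank_not_Arrow unfolding tips_in_def by auto
  obtain e x P where p: "is_path G (Path (Fin 0) e x P)" and e: "e \<in> {Inward, Outward, Endless}"
    using ex_zero_path_with_tip[OF is_ray_path[OF w]] ray_tips(1)[OF w] by blast
  note Z = is_path_zeroD[OF p]
  obtain i where i: "i \<in> steps e" "i - 1 \<in> steps e"
  proof -
    have "1 \<in> steps e & 1 - 1 \<in> steps e \<or> - 1 \<in> steps e & - 1 - 1 \<in> steps e" using e by auto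
    then show ?thesis using that by blast
  qed
  obtain b where b: "b \<in> branches G" "ends G b = {x i, x (i + 1)}" using Z(2) i(1) by blast
  obtain c where c: "c \<in> branches G" "ends G c = {x (i - 1), x (i - 1 + 1)}" using Z(2) i(2) by blast
  have po: "i \<in> posts e" "i + 1 \<in> posts e" "i - 1 \<in> posts e" using i by (auto simp: mem_posts)
  have "x (i - 1) ~= x i" "x (i - 1) ~= x (i + 1)"
    using inj_onD[OF Z(3) _ po(3,1)] inj_onD[OF Z(3) _ po(3,2)] by fastforce+
  then have bc: "b ~= c" "x i \<in> ends G b" "x i \<in> ends G c" using b(2) c(2) by auto
  note xi = zero_posts[OF p po(1)]
  have "~ singleton_node G (mx (x i))"
  proof
    assume s: "singleton_node G (mx (x i))"
    then have "~ embraced G (x i) (mx (x i))" by (simp add: singleton_node_def)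
    then have e: "mx (x i) = x i" using mx(2)[OF xi(1)] by (simp add: embraces_def)
    have "\<exists>!b. b \<in> branches G & x i \<in> ends G b" using s xi(2) unfolding e singleton_node_def by simp
    then show False using b(1) c(1) bc by blast
  qed
  then have "mx (x i) \<in> M" using metrizable mx(1)[OF xi(1)] unfolding metrizable_set_def by blast
  then show ?thesis by blast
qed

lemma distance_path:
  assumes "a \<in> M" "b \<in> M" "a ~= b"
  obtains p where "proper p" "lend p = a" "rend p = b" "path_length p = distance G a b"
proof -
  have m: "maximal_node G a" "maximal_node G b" using M_good assms D_max by blast+
  obtain r where r: "proper r" "lend r = a" "rend r = b"
    using reach_all[OF connected M_good[OF assms(1)] M_good[OF assms(2)]] assms(3) unfolding reach_def by blast
  obtain r' where "two_ended_path_between G a b r'" using two_ended_same_length[OF r(1)] r(2,3) by metis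
  then have ex: "\<exists>l. \<exists>p. two_ended_path_between G a b p & path_length p = l" by blast
  have "\<exists>p. two_ended_path_between G a b p & path_length p = distance G a b"
    using LeastI_ex[OF ex] unfolding distance_def if_not_P[OF assms(3)] .
  then show ?thesis using two_ended_between_proper[OF _ m] that by blast
qed

lemma distance_le:
  assumes "proper p" shows "distance G (lend p) (rend p) \<le> path_length p"
proof -
  obtain p' where "two_ended_path_between G (lend p) (rend p) p'" "path_length p' = path_length p"
    using two_ended_same_length[OF assms] .
  moreover have "lend p ~= rend p" using assms by (simp add: proper_def)
  ultimately show ?thesis unfolding distance_def by (simp, intro Least_le) blast
qed

lemma distance_commute_le:
  assumes "a \<in> M" "b \<in> M" shows "distance G b a \<le> distance G a b"
proof (cases "a = b")
  case False
  obtain p where p: "proper p" "lend p = a" "rend p = b" "path_length p = distance G a b"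
    using distance_path[OF assms False] .
  then show ?thesis using distance_le[of "reverse p"] by simp
qed simp

lemma distance_triangle:
  assumes "a \<in> M" "b \<in> M" "c \<in> M"
  shows "distance G a c \<le> distance G a b \<oplus> distance G b c"
proof -
  consider "a = c" | "a = b" | "b = c" | "a ~= c" "a ~= b" "b ~= c" by blast
  then show ?thesis
  proof cases
    case 4
    obtain p where p: "proper p" "lend p = a" "rend p = b" "path_length p = distance G a b"
      using distance_path[OF assms(1,2) 4(2)] .
    obtain q where q: "proper q" "lend q = b" "rend q = c" "path_length q = distance G b c"
      using distance_path[OF assms(2,3) 4(3)] .
    have "\<exists>r. proper r & lend r = lend p & rend r = rend q & path_length r \<le> path_length p \<oplus> path_length q"
      by (rule triangle) (use p q 4(1) assms M_good in simp_all)
    then obtain r where r: "proper r" "lend r = lend p" "rend r = rend q"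
      "path_length r \<le> path_length p \<oplus> path_length q" by blast
    have "distance G (lend r) (rend r) \<le> path_length p \<oplus> path_length q"
      by (rule order.trans[OF distance_le[OF r(1)] r(4)])
    then show ?thesis unfolding r(2,3) p(2,4) q(3,4) .
  qed (simp_all add: distance_def)
qed

text \<open>Twice the length of a one-ended path of the highest rank bounds all distances, which
  makes the suprema in eccentricities and in the diameter well defined.\<close>

lemma distance_bound:
  assumes "a \<in> M" "b \<in> M" shows "distance G a b \<le> ray_length Omega \<odot> 2"
proof (cases "a = b")
  case False
  obtain p where p: "proper p" "path_length p = distance G a b" using distance_path[OF assms False] by metis
  have "path_length p \<le> ray_length (path_rank p) \<odot> 2" using path_length_bound[OF proper_path[OF p(1)]] by blast
  also have "\<dots> \<le> ray_length Omega \<odot> 2" by (rule nattimes_mono[OF ray_length_mono]) simp_all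
  finally show ?thesis unfolding p(2) .
qed (simp add: distance_def)

text \<open>Any two nodes are compared through x; the doubling is the natural one because the
  triangle inequality adds lengths by natural sums.\<close>

lemma diameter_le:
  assumes x: "x \<in> M" and le: "!!y. y \<in> M ==> distance G x y \<le> \<rho>"
  shows "diameter G M \<le> Ord (\<rho> \<odot> 2)"
  unfolding diameter_def
proof (rule rank_sup_le)
  show "{distance G x y | x y. x \<in> M & y \<in> M} ~= {}" using x by blast
  fix d assume "d \<in> {distance G x y | x y. x \<in> M & y \<in> M}"
  then obtain a b where d: "d = distance G a b" "a \<in> M" "b \<in> M" by blast
  have "distance G a b \<le> distance G a x \<oplus> distance G x b" by (rule distance_triangle[OF d(2) x d(3)])
  also have "\<dots> \<le> \<rho> \<oplus> \<rho>"
    by (rule natsum_mono) (use distance_commute_le[OF x d(2)] le[OF d(2)] le[OF d(3)] in auto)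
  finally show "d \<le> \<rho> \<odot> 2" unfolding d(1) by (simp add: numeral_2_eq_2)
qed

lemma radius_attained:
  obtains x where "x \<in> M" "radius G M = eccentricity G M x"
proof -
  obtain r where r: "r \<in> eccentricity G M ` M" "!!s. s \<in> eccentricity G M ` M ==> r \<le> s"
    using ex_least_rank[of "eccentricity G M ` M"] M_nonempty by blast
  then have "radius G M = r" unfolding radius_def by (intro Least_equality)
  then show ?thesis using r(1) that by blast
qed

lemma radius_diameter:
  "radius G M \<le> diameter G M"
  "radius G M = Ord \<rho> ==> diameter G M \<le> Ord (\<rho> \<odot> 2)"
  "radius G M = Arrow l ==> diameter G M \<le> Ord (l \<odot> 2)"
proof -
  obtain x where x: "x \<in> M" "radius G M = eccentricity G M x" by (rule radius_attained)
  have b: "d \<le> ray_length Omega \<odot> 2" if "d \<in> {distance G x y | y. y \<in> M}" for d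
    using that distance_bound x(1) by blast
  have mem: "distance G x y \<in> {distance G x y | y. y \<in> M}" if "y \<in> M" for y using that by blast
  show "radius G M \<le> diameter G M"
    unfolding x(2) eccentricity_def diameter_def
  proof (rule rank_sup_mono)
    show "{distance G x y | y. y \<in> M} ~= {}" using mem[OF x(1)] by (rule ex_in_conv[THEN iffD1, OF exI])
    show "{distance G x y | y. y \<in> M} <= {distance G x y | x y. x \<in> M & y \<in> M}" using x(1) by blast
    show "d \<le> ray_length Omega \<odot> 2" if "d \<in> {distance G x y | x y. x \<in> M & y \<in> M}" for d
      using that distance_bound by blast
  qed
  show "diameter G M \<le> Ord (\<rho> \<odot> 2)" if "radius G M = Ord \<rho>"
  proof (rule diameter_le[OF x(1)])
    fix y assume y: "y \<in> M"
    have "Ord (distance G x y) \<le> eccentricity G M x"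
      unfolding eccentricity_def by (rule rank_sup_upper(1)[where c = "ray_length Omega \<odot> 2", OF _ mem[OF y]]) (rule b)
    moreover have "eccentricity G M x = Ord \<rho>" using that x(2) by simp
    ultimately have "Ord (distance G x y) \<le> Ord \<rho>" by simp
    then show "distance G x y \<le> \<rho>" by simp
  qed
  show "diameter G M \<le> Ord (l \<odot> 2)" if "radius G M = Arrow l"
  proof (rule diameter_le[OF x(1)])
    fix y assume y: "y \<in> M"
    have e: "eccentricity G M x = Arrow l" using that x(2) by simp
    have "distance G x y < l"
      by (rule rank_sup_upper(2)[where c = "ray_length Omega \<odot> 2", OF _ mem[OF y] e[unfolded eccentricity_def]]) (rule b)
    then show "distance G x y \<le> l" by simp
  qed
qed

end

theorem theorem7p2:
  fixes G :: "('n, 'b) tgraph" and M :: "'n set"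
  assumes "transfinite_graph G"
    and "Fin 1 \<le> graph_rank G" and "graph_rank G \<noteq> Arrow_Omega"
    and "nu_connected G"
    and "condition_C G"
    and "metrizable_set G M"
  shows "(\<forall>\<rho>. radius G M = Ord \<rho> \<longrightarrow>
        radius G M \<le> diameter G M \<and> diameter G M \<le> Ord (\<rho> \<odot> 2)) \<and>
      (\<forall>l. radius G M = Arrow l \<longrightarrow>
        radius G M \<le> diameter G M \<and> diameter G M \<le> Ord (l \<odot> 2))"
proof -
  interpret metric_graph G M
    by unfold_locales (fact assms)+
  show ?thesis using radius_diameter by blast
qed

end
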